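(* Let $A$ be a left bialgebroid over $L$, written $\mathcal A_L=(A,L,s,t,\gamma,\pi)$, where $A$ and $L$ are algebras over a commutative ring $k$. A strong $*$-autonomous structure on the bialgebroid $A$ over $L$ in the sense of Day and Street (as spelled out in the context) is equivalent to a Hopf algebroid structure $(\mathcal A_L,S)$ (as defined in the context).
   Context: Unadorned $\otimes$ is $\otimes_k$. A left bialgebroid $(A,L,s,t,\gamma,\pi)$: $s:L\to A$, $t:L^{op}\to A$ are ($k$-algebra) homomorphisms with commuting images; $A$ is an $L$-$L$-bimodule via $l\cdot a\cdot l'=s(l)t(l')a$, and $A\otimes_LA$ is formed with it (so $t(l)a\otimes_L b=a\otimes_L s(l)b$); $(A,\gamma,\pi)$ is a comonoid in $L$-$L$-bimodules, and with $\gamma(a)=a_{(1)}\otimes a_{(2)}$: $a_{(1)}t(l)\otimes a_{(2)}=a_{(1)}\otimes a_{(2)}s(l)$, $\gamma(1)=1\otimes1$, $\gamma(ab)=\gamma(a)\gamma(b)$, $\pi(1)=1$, $\pi(as(\pi(b)))=\pi(ab)=\pi(at(\pi(b)))$. A Hopf algebroid is a pair $(\mathcal A_L,S)$ with $S$ an anti-automorphism of the ring ($k$-algebra) $A$ such that $S\circ t=s$ and, for all $a\in A$, in $A\otimes_LA$: $S^{-1}(a_{(2)})_{(1')}\otimes S^{-1}(a_{(2)})_{(2')}a_{(1)}=S^{-1}(a)\otimes1$ and $S(a_{(1)})_{(1')}a_{(2)}\otimes S(a_{(1)})_{(2')}=1\otimes S(a)$ (primed indices: a further application of $\gamma$). Bimodule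 calculus: 1-cells $P:C\to D$ between $k$-algebras are $D$-$C$-bimodules, composition is $Q\circ P=Q\otimes_DP$, 2-cells are bimodule maps; $\bullet$ is composition of 2-cells, and for a 2-cell $f$ and 1-cell $P$, $f\circ P$ and $P\circ f$ denote tensoring with the identity of $P$. Put $L^e=L\otimes L^{op}$ and $\eta:L^e\to A$, $\eta(l\otimes l')=s(l)t(l')$. Let $\eta_*={}_AA_{L^e}:L^e\to A$, $\eta^*={}_{L^e}A_A:A\to L^e$, and $\epsilon:\eta_*\circ\eta^*=A\otimes_{L^e}A\to A$ the map induced by multiplication. Further let - $M=A\otimes_LA:A\otimes A\to A$ with actions $a\cdot(x\otimes_Ly)\cdot(a_1\otimes a_2)=a_{(1)}xa_1\otimes_La_{(2)}ya_2$; - $m=L^e\otimes_LL^e:L^e\otimes L^e\to L^e$ with actions $(l\otimes l')\cdot((x\otimes x')\otimes_L(y\otimes y'))\cdot((l_1\otimes l_1')\otimes(l_2\otimes l_2'))=(lxl_1\otimes l_1'x')\otimes_L(yl_2\otimes l_2'y'l')$, products being taken in $L$; - $\psi:\eta_*\circ m\to M\circ(\eta_*\otimes\eta_* )$ the bimodule map $a\otimes((x\otimes x')\otimes_L(y\otimes y'))\mapsto a_{(1)}\eta(x\otimes x')\otimes_La_{(2)}\eta(y\otimes y')$ (so that $a\otimes((l\otimes1)\otimes_L(1\otimes l'))\mapsto a_{(1)}s(l)\otimes a_{(2)}t(l')$). A strong $*$-autonomous structure on $\mathcal A_L$ consists of: 1. a $*$-autonomous structure on $A$: an algebra isomorphism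 $\xi:A\to A^{op}$, which defines the right $A\otimes A$-module $\sigma$, equal to $A$ as a $k$-module with $x\cdot(a\otimes b)=\xi^{-1}(b)xa$, together with an isomorphism of right $A\otimes A\otimes A$-modules $\Gamma:\sigma\circ(M\otimes A)\to\sigma\circ(A\otimes M)$; 2. a "canonical" $*$-autonomous structure on $L^e$: an algebra automorphism $\theta:L\to L$, which defines the right $L^e\otimes L^e$-module $\sigma_0$, equal to $L^e$ with $(x\otimes x')\cdot((l_1\otimes l_1')\otimes(l_2\otimes l_2'))=\theta^{-1}(l_2')xl_1\otimes l_1'x'l_2$ (products in $L$), equipped with the isomorphism $\Gamma_0:\sigma_0\circ(m\otimes L^e)\to\sigma_0\circ(L^e\otimes m)$, $$(x\otimes x')\otimes[(l_1\otimes l_1')\otimes_L(l_2\otimes l_2')\otimes(l_3\otimes l_3')]\mapsto(1\otimes1)\otimes[(xl_1\otimes l_1')\otimes(l_2\otimes l_2'x')\otimes_L(l_3\otimes l_3')]$$ (allowing a non-trivial $\theta$ is a slight deviation from Day and Street's original definition); 3. a map of right $L^e\otimes L^e$-modules $\tau:\sigma_0\to\sigma\circ(\eta_*\otimes\eta_* )$ (the target is $A$ with the $A\otimes A$-action restricted along $\eta\otimes\eta$) such that $$[\Gamma\circ(\eta_*\otimes\eta_*\otimes\eta_* )]\bullet[\sigma\circ(\psi\otimes\eta_* )]\bullet[\tau\circ(m\otimes L^e)]=[\sigma\circ(\eta_*\otimes\psi)]\bullet[\tau\circ(L^e\otimes m)]\bullet\Gamma_0$$ and such that $\tau^l:=[\sigma\circ(\epsilon\otimes\eta_*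 )]\bullet[\tau\circ(\eta^*\otimes L^e)]:\sigma_0\circ(\eta^*\otimes L^e)\to\sigma\circ(A\otimes\eta_* )$ is an isomorphism. *)

theory Defs
  imports "HOL-Algebra.Free_Abelian_Groups" "HOL-Algebra.Module"
    "HOL-Algebra.Generated_Groups"
begin

section \<open>Algebras over a commutative ring\<close>

text \<open>
  The algebra locale of HOL-Algebra is commutative; here the product need not commute.
  The zero algebra is allowed.
\<close>

locale k_algebra = module K A + ring A for K (structure) and A (structure) +
  assumes smult_mult_left:
      "\<lbrakk>\<kappa> \<in> carrier K; x \<in> carrier A; y \<in> carrier A\<rbrakk>
        \<Longrightarrow> (\<kappa> \<odot>\<^bsub>A\<^esub> x) \<otimes>\<^bsub>A\<^esub> y = \<kappa> \<odot>\<^bsub>A\<^esub> (x \<otimes>\<^bsub>A\<^esub> y)"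
    and smult_mult_right:
      "\<lbrakk>\<kappa> \<in> carrier K; x \<in> carrier A; y \<in> carrier A\<rbrakk>
        \<Longrightarrow> x \<otimes>\<^bsub>A\<^esub> (\<kappa> \<odot>\<^bsub>A\<^esub> y) = \<kappa> \<odot>\<^bsub>A\<^esub> (x \<otimes>\<^bsub>A\<^esub> y)"

definition alg_hom ::
  "'k ring \<Rightarrow> ('k, 'a) module \<Rightarrow> ('k, 'b) module \<Rightarrow> ('a \<Rightarrow> 'b) set" where
  "alg_hom K A B = {f \<in> ring_hom A B.
     \<forall>\<kappa>\<in>carrier K. \<forall>x\<in>carrier A. f (\<kappa> \<odot>\<^bsub>A\<^esub> x) = \<kappa> \<odot>\<^bsub>B\<^esub> f x}"

definition alg_op :: "('k, 'a) module \<Rightarrow> ('k, 'a) module" where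
  "alg_op A = A\<lparr>mult := \<lambda>x y. y \<otimes>\<^bsub>A\<^esub> x\<rparr>"


section \<open>Tensor products\<close>

text \<open>
  The tensor product of a right \<open>R\<close>-module \<open>M\<close> and a left \<open>R\<close>-module \<open>N\<close> is the free abelian
  group on pairs modulo the usual relations; its elements are cosets.  Only the carrier set of \<open>R\<close>
  and the two actions \<open>\<rho>\<close>, \<open>\<mu>\<close> enter.
\<close>

type_synonym ('x, 'y) tens = "(('x \<times> 'y) \<Rightarrow>\<^sub>0 int) set"

definition tensor_rels ::
  "('k, 'm, 'e) module_scheme \<Rightarrow> 'r set \<Rightarrow> ('m \<Rightarrow> 'r \<Rightarrow> 'm) \<Rightarrow> ('r \<Rightarrow> 'n \<Rightarrow> 'n)
     \<Rightarrow> ('k, 'n, 'f) module_scheme \<Rightarrow> (('m \<times> 'n) \<Rightarrow>\<^sub>0 int) set" where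
  "tensor_rels M R \<rho> \<mu> N =
     {frag_of (x \<oplus>\<^bsub>M\<^esub> x', y) - frag_of (x, y) - frag_of (x', y) | x x' y.
        x \<in> carrier M \<and> x' \<in> carrier M \<and> y \<in> carrier N} \<union>
     {frag_of (x, y \<oplus>\<^bsub>N\<^esub> y') - frag_of (x, y) - frag_of (x, y') | x y y'.
        x \<in> carrier M \<and> y \<in> carrier N \<and> y' \<in> carrier N} \<union>
     {frag_of (\<rho> x r, y) - frag_of (x, \<mu> r y) | x r y.
        x \<in> carrier M \<and> r \<in> R \<and> y \<in> carrier N}"

definition tensor_group ::
  "('k, 'm, 'e) module_scheme \<Rightarrow> 'r set \<Rightarrow> ('m \<Rightarrow> 'r \<Rightarrow> 'm) \<Rightarrow> ('r \<Rightarrow> 'n \<Rightarrow> 'n)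
     \<Rightarrow> ('k, 'n, 'f) module_scheme \<Rightarrow> ('m, 'n) tens ring" where
  "tensor_group M R \<rho> \<mu> N =
     (let F = free_Abelian_group (carrier M \<times> carrier N);
          Q = F Mod (generate F (tensor_rels M R \<rho> \<mu> N))
      in \<lparr>carrier = carrier Q, monoid.mult = undefined, one = undefined,
          ring.zero = \<one>\<^bsub>Q\<^esub>, ring.add = (\<otimes>\<^bsub>Q\<^esub>)\<rparr>)"

text \<open>
  The class of the pair \<open>(x, y)\<close>: the zero of a tensor product is the subgroup of relations itself,
  so this is the coset of the generator.
\<close>

definition pure_tensor ::
  "(('m, 'n) tens, 'e) ring_scheme \<Rightarrow> 'm \<Rightarrow> 'n \<Rightarrow> ('m, 'n) tens" (infixl "\<boxtimes>\<index>" 71) where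
  "x \<boxtimes>\<^bsub>T\<^esub> y = \<zero>\<^bsub>T\<^esub> #>\<^bsub>free_Abelian_group UNIV\<^esub> frag_of (x, y)"

text \<open>
  The additive map into \<open>P\<close> sending the class of \<open>(x, y)\<close> to \<open>\<beta> x y\<close>.  It is evaluated on a chosen
  representative, hence meaningful for biadditive balanced \<open>\<beta>\<close> only.
\<close>

definition tlift ::
  "('p, 'e) ring_scheme \<Rightarrow> ('m \<Rightarrow> 'n \<Rightarrow> 'p) \<Rightarrow> ('m, 'n) tens \<Rightarrow> 'p" where
  "tlift P \<beta> X =
     (let c = (SOME c. c \<in> X)
      in \<Oplus>\<^bsub>P\<^esub>p\<in>Poly_Mapping.keys c. [Poly_Mapping.lookup c p] \<cdot>\<^bsub>P\<^esub> \<beta> (fst p) (snd p))"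

text \<open>\<open>f \<otimes> g\<close> with values in the tensor product \<open>T\<close>.\<close>

definition tmap ::
  "(('p, 'q) tens, 'e) ring_scheme \<Rightarrow> ('m \<Rightarrow> 'p) \<Rightarrow> ('n \<Rightarrow> 'q) \<Rightarrow> ('m, 'n) tens \<Rightarrow> ('p, 'q) tens" where
  "tmap T f g = tlift T (\<lambda>x y. f x \<boxtimes>\<^bsub>T\<^esub> g y)"

text \<open>\<open>(x \<otimes> y) \<otimes> z \<mapsto> x \<otimes> (y \<otimes> z)\<close>, where \<open>T\<close> is the target and \<open>U\<close> its right tensor factor.\<close>

definition tassoc ::
  "(('x, ('y, 'z) tens) tens, 'e) ring_scheme \<Rightarrow> (('y, 'z) tens, 'f) ring_scheme
     \<Rightarrow> (('x, 'y) tens, 'z) tens \<Rightarrow> ('x, ('y, 'z) tens) tens" where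
  "tassoc T U = tlift T (\<lambda>w z. tlift T (\<lambda>x y. x \<boxtimes>\<^bsub>T\<^esub> (y \<boxtimes>\<^bsub>U\<^esub> z)) w)"

definition tensor ::
  "('k, 'm, 'e) module_scheme \<Rightarrow> 'r set \<Rightarrow> ('m \<Rightarrow> 'r \<Rightarrow> 'm) \<Rightarrow> ('r \<Rightarrow> 'n \<Rightarrow> 'n)
     \<Rightarrow> ('k, 'n, 'f) module_scheme \<Rightarrow> ('k, ('m, 'n) tens) module" where
  "tensor M R \<rho> \<mu> N =
     (let G = tensor_group M R \<rho> \<mu> N
      in ring.extend G (module.fields (\<lambda>\<kappa>. tlift G (\<lambda>x y. (\<kappa> \<odot>\<^bsub>M\<^esub> x) \<boxtimes>\<^bsub>G\<^esub> y))))"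

definition ktensor ::
  "'k ring \<Rightarrow> ('k, 'm, 'e) module_scheme \<Rightarrow> ('k, 'n, 'f) module_scheme
     \<Rightarrow> ('k, ('m, 'n) tens) module" where
  "ktensor K M N = tensor M (carrier K) (\<lambda>x \<kappa>. \<kappa> \<odot>\<^bsub>M\<^esub> x) (\<lambda>\<kappa> y. \<kappa> \<odot>\<^bsub>N\<^esub> y) N"

definition alg_tensor ::
  "'k ring \<Rightarrow> ('k, 'a) module \<Rightarrow> ('k, 'b) module \<Rightarrow> ('k, ('a, 'b) tens) module" where
  "alg_tensor K A B =
     (let T = ktensor K A B
      in T\<lparr>mult := \<lambda>z w. tlift T (\<lambda>a b. tmap T (\<lambda>x. x \<otimes>\<^bsub>A\<^esub> a) (\<lambda>y. y \<otimes>\<^bsub>B\<^esub> b) z) w,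
           one := \<one>\<^bsub>A\<^esub> \<boxtimes>\<^bsub>T\<^esub> \<one>\<^bsub>B\<^esub>\<rparr>)"


section \<open>Bimodule calculus\<close>

text \<open>
  A 1-cell \<open>C \<rightarrow> D\<close> is a \<open>D\<close>-\<open>C\<close>-bimodule, with left action \<open>lact\<close> of \<open>D\<close> and right action \<open>ract\<close>
  of \<open>C\<close>.  As for the modules of HOL-Algebra, the inherited ring product and unit are irrelevant.
\<close>

record ('k, 'd, 'm, 'c) bimod = "('k, 'm) module" +
  lact :: "'d \<Rightarrow> 'm \<Rightarrow> 'm"
  ract :: "'m \<Rightarrow> 'c \<Rightarrow> 'm"

definition mk_bimod ::
  "('k, 'm, 'e) module_scheme \<Rightarrow> ('d \<Rightarrow> 'm \<Rightarrow> 'm) \<Rightarrow> ('m \<Rightarrow> 'c \<Rightarrow> 'm) \<Rightarrow> ('k, 'd, 'm, 'c) bimod" where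
  "mk_bimod M l r = module.extend (module.truncate M) (bimod.fields l r)"

definition id_cell :: "('k, 'a) module \<Rightarrow> ('k, 'a, 'a, 'a) bimod" where
  "id_cell A = mk_bimod A (\<lambda>a x. a \<otimes>\<^bsub>A\<^esub> x) (\<lambda>x a. x \<otimes>\<^bsub>A\<^esub> a)"

text \<open>The composite \<open>Q \<circ> P = Q \<otimes>\<^sub>D P\<close> of \<open>P : C \<rightarrow> D\<close> and \<open>Q : D \<rightarrow> E\<close>.\<close>

definition hcomp ::
  "('k, 'e, 'n, 'd) bimod \<Rightarrow> ('k, 'd) module \<Rightarrow> ('k, 'd, 'm, 'c) bimod
     \<Rightarrow> ('k, 'e, ('n, 'm) tens, 'c) bimod" where
  "hcomp Q D P =
     (let T = tensor Q (carrier D) (ract Q) (lact P) P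
      in mk_bimod T (\<lambda>e. tmap T (lact Q e) (\<lambda>p. p)) (\<lambda>z c. tmap T (\<lambda>q. q) (\<lambda>p. ract P p c) z))"

text \<open>The external product \<open>P \<otimes> P' : C \<otimes> C' \<rightarrow> D \<otimes> D'\<close>.\<close>

definition xtensor ::
  "'k ring \<Rightarrow> ('k, 'd, 'm, 'c) bimod \<Rightarrow> ('k, 'd2, 'm2, 'c2) bimod
     \<Rightarrow> ('k, ('d, 'd2) tens, ('m, 'm2) tens, ('c, 'c2) tens) bimod" where
  "xtensor K P P' =
     (let T = ktensor K P P'
      in mk_bimod T
           (\<lambda>w z. tlift T (\<lambda>d d'. tmap T (lact P d) (lact P' d') z) w)
           (\<lambda>z w. tlift T (\<lambda>c c'. tmap T (\<lambda>p. ract P p c) (\<lambda>p'. ract P' p' c') z) w))"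

text \<open>
  Restriction of the right action along an algebra map \<open>f : C' \<rightarrow> C\<close>.  Under the canonical
  isomorphism \<open>P \<otimes>\<^sub>C C \<cong> P\<close> this is the composite of \<open>P\<close> with the 1-cell \<open>C\<close>, regarded as a
  \<open>C\<close>-\<open>C'\<close>-bimodule via \<open>f\<close>.  This form is used below for all composites \<open>P \<circ> \<eta>\<^sub>*\<close>,
  \<open>P \<circ> (\<eta>\<^sub>* \<otimes> \<eta>\<^sub>*)\<close> and \<open>P \<circ> (\<eta>\<^sub>* \<otimes> \<eta>\<^sub>* \<otimes> \<eta>\<^sub>*)\<close>; accordingly the 2-cell \<open>g \<circ> (\<eta>\<^sub>* \<otimes> \<eta>\<^sub>* \<otimes> \<eta>\<^sub>*)\<close>
  is given by the same map as \<open>g\<close>.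
\<close>

definition restrict_right ::
  "('k, 'd, 'm, 'c) bimod \<Rightarrow> ('c2 \<Rightarrow> 'c) \<Rightarrow> ('k, 'd, 'm, 'c2) bimod" where
  "restrict_right P f = mk_bimod P (lact P) (\<lambda>p c. ract P p (f c))"

definition two_cell ::
  "('k, 'd) module \<Rightarrow> ('k, 'c) module \<Rightarrow> ('k, 'd, 'm, 'c) bimod \<Rightarrow> ('k, 'd, 'n, 'c) bimod
     \<Rightarrow> ('m \<Rightarrow> 'n) set" where
  "two_cell D C P Q = {f \<in> carrier P \<rightarrow> carrier Q.
     (\<forall>x\<in>carrier P. \<forall>y\<in>carrier P. f (x \<oplus>\<^bsub>P\<^esub> y) = f x \<oplus>\<^bsub>Q\<^esub> f y) \<and>
     (\<forall>d\<in>carrier D. \<forall>x\<in>carrier P. f (lact P d x) = lact Q d (f x)) \<and>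
     (\<forall>x\<in>carrier P. \<forall>c\<in>carrier C. f (ract P x c) = ract Q (f x) c)}"

definition two_cell_iso ::
  "('k, 'd) module \<Rightarrow> ('k, 'c) module \<Rightarrow> ('k, 'd, 'm, 'c) bimod \<Rightarrow> ('k, 'd, 'n, 'c) bimod
     \<Rightarrow> ('m \<Rightarrow> 'n) set" where
  "two_cell_iso D C P Q = {f \<in> two_cell D C P Q. bij_betw f (carrier P) (carrier Q)}"

text \<open>
  The ground ring as an algebra over itself.  Right \<open>C\<close>-modules are 1-cells \<open>C \<rightarrow> k\<close>.
\<close>

definition ground_alg :: "'k ring \<Rightarrow> ('k, 'k) module" where
  "ground_alg K = ring.extend K (module.fields (\<lambda>\<kappa> x. \<kappa> \<otimes>\<^bsub>K\<^esub> x))"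


section \<open>Left bialgebroids and Hopf algebroids\<close>

record ('k, 'a, 'l) bialgebroid =
  scalars :: "'k ring"
  total :: "('k, 'a) module"
  base :: "('k, 'l) module"
  src :: "'l \<Rightarrow> 'a"
  tgt :: "'l \<Rightarrow> 'a"
  cop :: "'a \<Rightarrow> ('a, 'a) tens"
  cou :: "'a \<Rightarrow> 'l"

text \<open>\<open>A\<close> as an \<open>L\<close>-\<open>L\<close>-bimodule, \<open>l \<cdot> a \<cdot> l' = s(l) t(l') a\<close>.\<close>

definition A_LL :: "('k, 'a, 'l) bialgebroid \<Rightarrow> ('k, 'l, 'a, 'l) bimod" where
  "A_LL B = mk_bimod (total B) (\<lambda>l a. src B l \<otimes>\<^bsub>total B\<^esub> a) (\<lambda>a l. tgt B l \<otimes>\<^bsub>total B\<^esub> a)"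

definition AA_L :: "('k, 'a, 'l) bialgebroid \<Rightarrow> ('k, 'l, ('a, 'a) tens, 'l) bimod" where
  "AA_L B = hcomp (A_LL B) (base B) (A_LL B)"

text \<open>\<open>(x \<otimes>\<^sub>L y) \<mapsto> xa \<otimes>\<^sub>L yb\<close> on \<open>A \<otimes>\<^sub>L A\<close>.\<close>

definition right_mult2 ::
  "('k, 'a, 'l) bialgebroid \<Rightarrow> ('a, 'a) tens \<Rightarrow> 'a \<Rightarrow> 'a \<Rightarrow> ('a, 'a) tens" where
  "right_mult2 B z a b = tmap (AA_L B) (\<lambda>x. x \<otimes>\<^bsub>total B\<^esub> a) (\<lambda>y. y \<otimes>\<^bsub>total B\<^esub> b) z"

text \<open>
  \<open>a \<cdot> (x \<otimes>\<^sub>L y) = a\<^sub>(\<^sub>1\<^sub>) x \<otimes>\<^sub>L a\<^sub>(\<^sub>2\<^sub>) y\<close>; in particular \<open>\<gamma>(a)\<gamma>(b)\<close> is \<open>a \<cdot> \<gamma>(b)\<close>.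
\<close>

definition diag_act ::
  "('k, 'a, 'l) bialgebroid \<Rightarrow> 'a \<Rightarrow> ('a, 'a) tens \<Rightarrow> ('a, 'a) tens" where
  "diag_act B a = tlift (AA_L B) (\<lambda>x y. right_mult2 B (cop B a) x y)"

definition left_bialgebroid :: "('k, 'a, 'l) bialgebroid \<Rightarrow> bool" where
  "left_bialgebroid B \<longleftrightarrow>
     (let K = scalars B; A = total B; L = base B; s = src B; t = tgt B; \<gamma> = cop B; \<pi> = cou B;
          T = AA_L B; T3 = hcomp (A_LL B) L (AA_L B); T3' = hcomp (AA_L B) L (A_LL B)
      in k_algebra K A \<and> k_algebra K L \<and>
         s \<in> alg_hom K L A \<and> t \<in> alg_hom K (alg_op L) A \<and>
         (\<forall>l\<in>carrier L. \<forall>l'\<in>carrier L. s l \<otimes>\<^bsub>A\<^esub> t l' = t l' \<otimes>\<^bsub>A\<^esub> s l) \<and>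
         \<comment> \<open>\<open>(A, \<gamma>, \<pi>)\<close> is a comonoid in \<open>L\<close>-\<open>L\<close>-bimodules\<close>
         \<gamma> \<in> two_cell L L (A_LL B) T \<and> \<pi> \<in> two_cell L L (A_LL B) (id_cell L) \<and>
         (\<forall>a\<in>carrier A. tassoc T3 T (tmap T3' \<gamma> (\<lambda>y. y) (\<gamma> a)) = tmap T3 (\<lambda>x. x) \<gamma> (\<gamma> a)) \<and>
         (\<forall>a\<in>carrier A. tlift A (\<lambda>x y. s (\<pi> x) \<otimes>\<^bsub>A\<^esub> y) (\<gamma> a) = a) \<and>
         (\<forall>a\<in>carrier A. tlift A (\<lambda>x y. t (\<pi> y) \<otimes>\<^bsub>A\<^esub> x) (\<gamma> a) = a) \<and>
         \<comment> \<open>compatibility with the product of \<open>A\<close>\<close>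
         (\<forall>a\<in>carrier A. \<forall>l\<in>carrier L.
            tmap T (\<lambda>x. x \<otimes>\<^bsub>A\<^esub> t l) (\<lambda>y. y) (\<gamma> a) = tmap T (\<lambda>x. x) (\<lambda>y. y \<otimes>\<^bsub>A\<^esub> s l) (\<gamma> a)) \<and>
         \<gamma> \<one>\<^bsub>A\<^esub> = \<one>\<^bsub>A\<^esub> \<boxtimes>\<^bsub>T\<^esub> \<one>\<^bsub>A\<^esub> \<and>
         (\<forall>a\<in>carrier A. \<forall>b\<in>carrier A. \<gamma> (a \<otimes>\<^bsub>A\<^esub> b) = diag_act B a (\<gamma> b)) \<and>
         \<pi> \<one>\<^bsub>A\<^esub> = \<one>\<^bsub>L\<^esub> \<and>
         (\<forall>a\<in>carrier A. \<forall>b\<in>carrier A.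
            \<pi> (a \<otimes>\<^bsub>A\<^esub> s (\<pi> b)) = \<pi> (a \<otimes>\<^bsub>A\<^esub> b) \<and> \<pi> (a \<otimes>\<^bsub>A\<^esub> b) = \<pi> (a \<otimes>\<^bsub>A\<^esub> t (\<pi> b))))"

definition hopf_algebroid :: "('k, 'a, 'l) bialgebroid \<Rightarrow> ('a \<Rightarrow> 'a) \<Rightarrow> bool" where
  "hopf_algebroid B S \<longleftrightarrow>
     (let K = scalars B; A = total B; L = base B; \<gamma> = cop B; T = AA_L B;
          Sinv = inv_into (carrier A) S
      in left_bialgebroid B \<and>
         S \<in> alg_hom K A (alg_op A) \<and> bij_betw S (carrier A) (carrier A) \<and>
         (\<forall>l\<in>carrier L. S (tgt B l) = src B l) \<and>
         (\<forall>a\<in>carrier A.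
            tlift T (\<lambda>a1 a2. tmap T (\<lambda>x. x) (\<lambda>y. y \<otimes>\<^bsub>A\<^esub> a1) (\<gamma> (Sinv a2))) (\<gamma> a)
              = Sinv a \<boxtimes>\<^bsub>T\<^esub> \<one>\<^bsub>A\<^esub>) \<and>
         (\<forall>a\<in>carrier A.
            tlift T (\<lambda>a1 a2. tmap T (\<lambda>x. x \<otimes>\<^bsub>A\<^esub> a2) (\<lambda>y. y) (\<gamma> (S a1))) (\<gamma> a)
              = \<one>\<^bsub>A\<^esub> \<boxtimes>\<^bsub>T\<^esub> S a))"


section \<open>The 1-cells and 2-cells attached to a bialgebroid\<close>

definition AxA :: "('k, 'a, 'l) bialgebroid \<Rightarrow> ('k, ('a, 'a) tens) module" where
  "AxA B = alg_tensor (scalars B) (total B) (total B)"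

definition Le :: "('k, 'a, 'l) bialgebroid \<Rightarrow> ('k, ('l, 'l) tens) module" where
  "Le B = alg_tensor (scalars B) (base B) (alg_op (base B))"

definition LexLe ::
  "('k, 'a, 'l) bialgebroid \<Rightarrow> ('k, (('l, 'l) tens, ('l, 'l) tens) tens) module" where
  "LexLe B = alg_tensor (scalars B) (Le B) (Le B)"

definition eta :: "('k, 'a, 'l) bialgebroid \<Rightarrow> ('l, 'l) tens \<Rightarrow> 'a" where
  "eta B = tlift (total B) (\<lambda>l l'. src B l \<otimes>\<^bsub>total B\<^esub> tgt B l')"

definition eta_eta ::
  "('k, 'a, 'l) bialgebroid \<Rightarrow> (('l, 'l) tens, ('l, 'l) tens) tens \<Rightarrow> ('a, 'a) tens" where
  "eta_eta B = tmap (AxA B) (eta B) (eta B)"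

definition eta_lower :: "('k, 'a, 'l) bialgebroid \<Rightarrow> ('k, 'a, 'a, ('l, 'l) tens) bimod" where
  "eta_lower B = restrict_right (id_cell (total B)) (eta B)"

definition eta_upper :: "('k, 'a, 'l) bialgebroid \<Rightarrow> ('k, ('l, 'l) tens, 'a, 'a) bimod" where
  "eta_upper B =
     mk_bimod (total B) (\<lambda>e a. eta B e \<otimes>\<^bsub>total B\<^esub> a) (\<lambda>a b. a \<otimes>\<^bsub>total B\<^esub> b)"

definition eps :: "('k, 'a, 'l) bialgebroid \<Rightarrow> ('a, 'a) tens \<Rightarrow> 'a" where
  "eps B = tlift (total B) (\<lambda>a b. a \<otimes>\<^bsub>total B\<^esub> b)"

definition M_cell ::
  "('k, 'a, 'l) bialgebroid \<Rightarrow> ('k, 'a, ('a, 'a) tens, ('a, 'a) tens) bimod" where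
  "M_cell B = mk_bimod (AA_L B) (diag_act B)
     (\<lambda>z w. tlift (AA_L B) (\<lambda>a b. right_mult2 B z a b) w)"

text \<open>
  \<open>L\<^sup>e \<otimes>\<^sub>L L\<^sup>e\<close> is formed by analogy with \<open>A \<otimes>\<^sub>L A\<close>, i.e.
  \<open>(1 \<otimes> l)u \<otimes>\<^sub>L v = u \<otimes>\<^sub>L (l \<otimes> 1)v\<close>.  The actions are written with the product of \<open>L\<^sup>e\<close>:
  \<open>(l \<otimes> 1)(x \<otimes> x') = lx \<otimes> x'\<close>, \<open>(1 \<otimes> l')(y \<otimes> y') = y \<otimes> y'l'\<close> and
  \<open>(x \<otimes> x')(l\<^sub>1 \<otimes> l\<^sub>1') = xl\<^sub>1 \<otimes> l\<^sub>1'x'\<close>.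
\<close>

definition m_tensor ::
  "('k, 'a, 'l) bialgebroid \<Rightarrow> ('k, (('l, 'l) tens, ('l, 'l) tens) tens) module" where
  "m_tensor B =
     tensor (Le B) (carrier (base B))
       (\<lambda>u l. (\<one>\<^bsub>base B\<^esub> \<boxtimes>\<^bsub>Le B\<^esub> l) \<otimes>\<^bsub>Le B\<^esub> u)
       (\<lambda>l v. (l \<boxtimes>\<^bsub>Le B\<^esub> \<one>\<^bsub>base B\<^esub>) \<otimes>\<^bsub>Le B\<^esub> v) (Le B)"

definition m_cell ::
  "('k, 'a, 'l) bialgebroid
     \<Rightarrow> ('k, ('l, 'l) tens, (('l, 'l) tens, ('l, 'l) tens) tens, (('l, 'l) tens, ('l, 'l) tens) tens) bimod"
  where
  "m_cell B = mk_bimod (m_tensor B)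
     (\<lambda>e z. tlift (m_tensor B)
        (\<lambda>l l'. tmap (m_tensor B)
           (\<lambda>u. (l \<boxtimes>\<^bsub>Le B\<^esub> \<one>\<^bsub>base B\<^esub>) \<otimes>\<^bsub>Le B\<^esub> u)
           (\<lambda>v. (\<one>\<^bsub>base B\<^esub> \<boxtimes>\<^bsub>Le B\<^esub> l') \<otimes>\<^bsub>Le B\<^esub> v) z) e)
     (\<lambda>z w. tlift (m_tensor B)
        (\<lambda>e1 e2. tmap (m_tensor B) (\<lambda>u. u \<otimes>\<^bsub>Le B\<^esub> e1) (\<lambda>v. v \<otimes>\<^bsub>Le B\<^esub> e2) z) w)"

text \<open>\<open>\<psi> : \<eta>\<^sub>* \<circ> m \<rightarrow> M \<circ> (\<eta>\<^sub>* \<otimes> \<eta>\<^sub>*)\<close>.\<close>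

definition psi ::
  "('k, 'a, 'l) bialgebroid \<Rightarrow> ('a, (('l, 'l) tens, ('l, 'l) tens) tens) tens \<Rightarrow> ('a, 'a) tens" where
  "psi B = tlift (AA_L B)
     (\<lambda>a z. tlift (AA_L B) (\<lambda>u v. right_mult2 B (cop B a) (eta B u) (eta B v)) z)"

definition M_res ::
  "('k, 'a, 'l) bialgebroid
     \<Rightarrow> ('k, 'a, ('a, 'a) tens, (('l, 'l) tens, ('l, 'l) tens) tens) bimod" where
  "M_res B = restrict_right (M_cell B) (eta_eta B)"


section \<open>Strong star-autonomous structures\<close>

text \<open>\<open>\<sigma>\<close> for a given \<open>\<xi>\<close>, and \<open>\<sigma> \<circ> (\<eta>\<^sub>* \<otimes> \<eta>\<^sub>*)\<close>.\<close>

definition sigma ::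
  "('k, 'a, 'l) bialgebroid \<Rightarrow> ('a \<Rightarrow> 'a) \<Rightarrow> ('k, 'k, 'a, ('a, 'a) tens) bimod" where
  "sigma B \<xi> = mk_bimod (total B) (\<lambda>\<kappa> x. \<kappa> \<odot>\<^bsub>total B\<^esub> x)
     (\<lambda>x w. tlift (total B)
        (\<lambda>a b. inv_into (carrier (total B)) \<xi> b \<otimes>\<^bsub>total B\<^esub> x \<otimes>\<^bsub>total B\<^esub> a) w)"

definition sigma_res ::
  "('k, 'a, 'l) bialgebroid \<Rightarrow> ('a \<Rightarrow> 'a)
     \<Rightarrow> ('k, 'k, 'a, (('l, 'l) tens, ('l, 'l) tens) tens) bimod" where
  "sigma_res B \<xi> = restrict_right (sigma B \<xi>) (eta_eta B)"

text \<open>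
  \<open>\<sigma>\<^sub>0\<close> for a given \<open>\<theta>\<close>.  In the product of \<open>L\<^sup>e\<close>, the action of \<open>u \<otimes> (l\<^sub>2 \<otimes> l\<^sub>2')\<close> is
  \<open>z \<mapsto> (\<theta>\<^sup>-\<^sup>1(l\<^sub>2') \<otimes> l\<^sub>2) z u\<close>, which for \<open>z = x \<otimes> x'\<close>, \<open>u = l\<^sub>1 \<otimes> l\<^sub>1'\<close> reads
  \<open>\<theta>\<^sup>-\<^sup>1(l\<^sub>2') x l\<^sub>1 \<otimes> l\<^sub>1' x' l\<^sub>2\<close>.
\<close>

definition sigma0 ::
  "('k, 'a, 'l) bialgebroid \<Rightarrow> ('l \<Rightarrow> 'l)
     \<Rightarrow> ('k, 'k, ('l, 'l) tens, (('l, 'l) tens, ('l, 'l) tens) tens) bimod" where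
  "sigma0 B \<theta> = mk_bimod (Le B) (\<lambda>\<kappa> x. \<kappa> \<odot>\<^bsub>Le B\<^esub> x)
     (\<lambda>z w. tlift (Le B)
        (\<lambda>u v. tlift (Le B)
           (\<lambda>l2 l2'. (inv_into (carrier (base B)) \<theta> l2' \<boxtimes>\<^bsub>Le B\<^esub> l2) \<otimes>\<^bsub>Le B\<^esub> z \<otimes>\<^bsub>Le B\<^esub> u) v) w)"

text \<open>
  The 1-cells \<open>\<sigma> \<circ> (M \<otimes> A)\<close>, \<open>\<sigma> \<circ> (A \<otimes> M)\<close>, \<open>\<sigma>\<^sub>0 \<circ> (m \<otimes> L\<^sup>e)\<close> and \<open>\<sigma>\<^sub>0 \<circ> (L\<^sup>e \<otimes> m)\<close>.
  The second one is a right module over \<open>A \<otimes> (A \<otimes> A)\<close>, regarded as one over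
  \<open>(A \<otimes> A) \<otimes> A\<close> along the associativity isomorphism.
\<close>

definition AAA :: "('k, 'a, 'l) bialgebroid \<Rightarrow> ('k, (('a, 'a) tens, 'a) tens) module" where
  "AAA B = alg_tensor (scalars B) (AxA B) (total B)"

definition sigma_MA ::
  "('k, 'a, 'l) bialgebroid \<Rightarrow> ('a \<Rightarrow> 'a)
     \<Rightarrow> ('k, 'k, ('a, (('a, 'a) tens, 'a) tens) tens, (('a, 'a) tens, 'a) tens) bimod" where
  "sigma_MA B \<xi> = hcomp (sigma B \<xi>) (AxA B) (xtensor (scalars B) (M_cell B) (id_cell (total B)))"

definition sigma_AM ::
  "('k, 'a, 'l) bialgebroid \<Rightarrow> ('a \<Rightarrow> 'a)
     \<Rightarrow> ('k, 'k, ('a, ('a, ('a, 'a) tens) tens) tens, (('a, 'a) tens, 'a) tens) bimod" where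
  "sigma_AM B \<xi> =
     restrict_right
       (hcomp (sigma B \<xi>) (AxA B) (xtensor (scalars B) (id_cell (total B)) (M_cell B)))
       (tassoc (alg_tensor (scalars B) (total B) (AxA B)) (AxA B))"

type_synonym 'l le = "('l, 'l) tens"

definition sigma0_mL ::
  "('k, 'a, 'l) bialgebroid \<Rightarrow> ('l \<Rightarrow> 'l)
     \<Rightarrow> ('k, 'k, ('l le, (('l le, 'l le) tens, 'l le) tens) tens, (('l le, 'l le) tens, 'l le) tens) bimod"
  where
  "sigma0_mL B \<theta> = hcomp (sigma0 B \<theta>) (LexLe B) (xtensor (scalars B) (m_cell B) (id_cell (Le B)))"

definition sigma0_Lm ::
  "('k, 'a, 'l) bialgebroid \<Rightarrow> ('l \<Rightarrow> 'l)
     \<Rightarrow> ('k, 'k, ('l le, ('l le, ('l le, 'l le) tens) tens) tens, ('l le, ('l le, 'l le) tens) tens) bimod"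
  where
  "sigma0_Lm B \<theta> = hcomp (sigma0 B \<theta>) (LexLe B) (xtensor (scalars B) (id_cell (Le B)) (m_cell B))"

text \<open>
  \<open>\<Gamma>\<^sub>0\<close>: note \<open>(x \<otimes> 1)(l\<^sub>1 \<otimes> l\<^sub>1') = xl\<^sub>1 \<otimes> l\<^sub>1'\<close> and \<open>(1 \<otimes> x')(l\<^sub>2 \<otimes> l\<^sub>2') = l\<^sub>2 \<otimes> l\<^sub>2'x'\<close> in \<open>L\<^sup>e\<close>.
\<close>

definition Gamma0 ::
  "('k, 'a, 'l) bialgebroid \<Rightarrow> ('l \<Rightarrow> 'l)
     \<Rightarrow> ('l le, (('l le, 'l le) tens, 'l le) tens) tens
     \<Rightarrow> ('l le, ('l le, ('l le, 'l le) tens) tens) tens" where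
  "Gamma0 B \<theta> =
     (let T = sigma0_Lm B \<theta>; U = xtensor (scalars B) (id_cell (Le B)) (m_cell B)
      in tlift T (\<lambda>z w. tlift T (\<lambda>n e3. tlift T (\<lambda>e1 e2. tlift T (\<lambda>x x'.
           \<one>\<^bsub>Le B\<^esub> \<boxtimes>\<^bsub>T\<^esub>
             (((x \<boxtimes>\<^bsub>Le B\<^esub> \<one>\<^bsub>base B\<^esub>) \<otimes>\<^bsub>Le B\<^esub> e1) \<boxtimes>\<^bsub>U\<^esub>
              (((\<one>\<^bsub>base B\<^esub> \<boxtimes>\<^bsub>Le B\<^esub> x') \<otimes>\<^bsub>Le B\<^esub> e2) \<boxtimes>\<^bsub>m_cell B\<^esub> e3))) z) n) w))"

text \<open>
  The canonical 2-cells
  \<open>(\<sigma> \<circ> (\<eta>\<^sub>* \<otimes> \<eta>\<^sub>*)) \<circ> (P \<otimes> L\<^sup>e) \<rightarrow> \<sigma> \<circ> ((\<eta>\<^sub>* \<circ> P) \<otimes> \<eta>\<^sub>*)\<close>, \<open>x \<otimes> (p \<otimes> e) \<mapsto> x \<otimes> ((1 \<otimes> p) \<otimes> \<eta>(e))\<close>, and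
  \<open>(\<sigma> \<circ> (\<eta>\<^sub>* \<otimes> \<eta>\<^sub>*)) \<circ> (L\<^sup>e \<otimes> P) \<rightarrow> \<sigma> \<circ> (\<eta>\<^sub>* \<otimes> (\<eta>\<^sub>* \<circ> P))\<close>, \<open>x \<otimes> (e \<otimes> p) \<mapsto> x \<otimes> (\<eta>(e) \<otimes> (1 \<otimes> p))\<close>,
  composed of associativity, interchange and \<open>\<eta>\<^sub>* \<circ> L\<^sup>e \<cong> \<eta>\<^sub>*\<close>.
\<close>

definition coh_left ::
  "('k, 'a, 'l) bialgebroid \<Rightarrow> ('a \<Rightarrow> 'a) \<Rightarrow> ('k, 'l le, 'p, 'c) bimod
     \<Rightarrow> ('a, ('p, 'l le) tens) tens \<Rightarrow> ('a, (('a, 'p) tens, 'a) tens) tens" where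
  "coh_left B \<xi> P =
     (let H = hcomp (eta_lower B) (Le B) P;
          U = xtensor (scalars B) H (eta_lower B);
          T = hcomp (sigma B \<xi>) (AxA B) U
      in tmap T (\<lambda>x. x) (tmap U (\<lambda>p. \<one>\<^bsub>total B\<^esub> \<boxtimes>\<^bsub>H\<^esub> p) (eta B)))"

definition coh_right ::
  "('k, 'a, 'l) bialgebroid \<Rightarrow> ('a \<Rightarrow> 'a) \<Rightarrow> ('k, 'l le, 'p, 'c) bimod
     \<Rightarrow> ('a, ('l le, 'p) tens) tens \<Rightarrow> ('a, ('a, ('a, 'p) tens) tens) tens" where
  "coh_right B \<xi> P =
     (let H = hcomp (eta_lower B) (Le B) P;
          U = xtensor (scalars B) (eta_lower B) H;
          T = hcomp (sigma B \<xi>) (AxA B) U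
      in tmap T (\<lambda>x. x) (tmap U (eta B) (\<lambda>p. \<one>\<^bsub>total B\<^esub> \<boxtimes>\<^bsub>H\<^esub> p)))"

record ('a, 'l) star_structure =
  xi :: "'a \<Rightarrow> 'a"
  Gam :: "('a, (('a, 'a) tens, 'a) tens) tens \<Rightarrow> ('a, ('a, ('a, 'a) tens) tens) tens"
  theta :: "'l \<Rightarrow> 'l"
  tau :: "'l le \<Rightarrow> 'a"

text \<open>\<open>\<tau> \<circ> P : \<sigma>\<^sub>0 \<circ> P \<rightarrow> (\<sigma> \<circ> (\<eta>\<^sub>* \<otimes> \<eta>\<^sub>*)) \<circ> P\<close> for \<open>P : C \<rightarrow> L\<^sup>e \<otimes> L\<^sup>e\<close>.\<close>

definition tau_whisker ::
  "('k, 'a, 'l) bialgebroid \<Rightarrow> ('a, 'l) star_structure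
     \<Rightarrow> ('k, ('l le, 'l le) tens, 'p, 'c) bimod \<Rightarrow> ('l le, 'p) tens \<Rightarrow> ('a, 'p) tens" where
  "tau_whisker B D P = tmap (hcomp (sigma_res B (xi D)) (LexLe B) P) (tau D) (\<lambda>p. p)"

text \<open>\<open>\<sigma> \<circ> f\<close>, for a 2-cell \<open>f\<close> with target \<open>Q : C \<rightarrow> A \<otimes> A\<close>.\<close>

definition sigma_whisker ::
  "('k, 'a, 'l) bialgebroid \<Rightarrow> ('a \<Rightarrow> 'a) \<Rightarrow> ('k, ('a, 'a) tens, 'q, 'c) bimod
     \<Rightarrow> ('p \<Rightarrow> 'q) \<Rightarrow> ('a, 'p) tens \<Rightarrow> ('a, 'q) tens" where
  "sigma_whisker B \<xi> Q f = tmap (hcomp (sigma B \<xi>) (AxA B) Q) (\<lambda>x. x) f"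

definition tau_l ::
  "('k, 'a, 'l) bialgebroid \<Rightarrow> ('a, 'l) star_structure
     \<Rightarrow> ('l le, ('a, 'l le) tens) tens \<Rightarrow> ('a, ('a, 'a) tens) tens" where
  "tau_l B D =
     (let K = scalars B; E = xtensor K (id_cell (total B)) (eta_lower B)
      in sigma_whisker B (xi D) E (tmap E (eps B) (\<lambda>a. a)) \<circ>
         coh_left B (xi D) (eta_upper B) \<circ>
         tau_whisker B D (xtensor K (eta_upper B) (id_cell (Le B))))"

definition strong_star_autonomous ::
  "('k, 'a, 'l) bialgebroid \<Rightarrow> ('a, 'l) star_structure \<Rightarrow> bool" where
  "strong_star_autonomous B D \<longleftrightarrow>
     (let K = scalars B; k = ground_alg K; A = total B; L = base B;
          \<xi> = xi D; \<Gamma> = Gam D; \<theta> = theta D; \<tau> = tau D;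
          MA = xtensor K (M_res B) (eta_lower B); AM = xtensor K (eta_lower B) (M_res B)
      in \<comment> \<open>star-autonomous structure on \<open>A\<close>\<close>
         \<xi> \<in> alg_hom K A (alg_op A) \<and> bij_betw \<xi> (carrier A) (carrier A) \<and>
         \<Gamma> \<in> two_cell_iso k (AAA B) (sigma_MA B \<xi>) (sigma_AM B \<xi>) \<and>
         \<comment> \<open>canonical star-autonomous structure on \<open>L\<^sup>e\<close>\<close>
         \<theta> \<in> alg_hom K L L \<and> bij_betw \<theta> (carrier L) (carrier L) \<and>
         \<comment> \<open>compatibility of the two\<close>
         \<tau> \<in> two_cell k (LexLe B) (sigma0 B \<theta>) (sigma_res B \<xi>) \<and>
         (\<forall>z\<in>carrier (sigma0_mL B \<theta>).
            (\<Gamma> \<circ> sigma_whisker B \<xi> MA (tmap MA (psi B) (\<lambda>a. a))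
               \<circ> coh_left B \<xi> (m_cell B)
               \<circ> tau_whisker B D (xtensor K (m_cell B) (id_cell (Le B)))) z =
            (sigma_whisker B \<xi> AM (tmap AM (\<lambda>a. a) (psi B))
               \<circ> coh_right B \<xi> (m_cell B)
               \<circ> tau_whisker B D (xtensor K (id_cell (Le B)) (m_cell B))
               \<circ> Gamma0 B \<theta>) z) \<and>
         tau_l B D \<in> two_cell_iso k (alg_tensor K A (Le B))
           (hcomp (sigma0 B \<theta>) (LexLe B) (xtensor K (eta_upper B) (id_cell (Le B))))
           (hcomp (sigma B \<xi>) (AxA B) (xtensor K (id_cell A) (eta_lower B))))"

text \<open>
  Two structures with the same \<open>\<theta>\<close> are isomorphic if some isomorphism \<open>f : \<sigma> \<rightarrow> \<sigma>'\<close> of right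
  \<open>A \<otimes> A\<close>-modules transports \<open>\<tau>\<close> to \<open>\<tau>'\<close> and \<open>\<Gamma>\<close> to \<open>\<Gamma>'\<close>.
\<close>

definition star_isomorphic ::
  "('k, 'a, 'l) bialgebroid \<Rightarrow> ('a, 'l) star_structure \<Rightarrow> ('a, 'l) star_structure \<Rightarrow> bool" where
  "star_isomorphic B D D' \<longleftrightarrow>
     (\<forall>l\<in>carrier (base B). theta D l = theta D' l) \<and>
     (\<exists>f \<in> two_cell_iso (ground_alg (scalars B)) (AxA B) (sigma B (xi D)) (sigma B (xi D')).
        (\<forall>e\<in>carrier (Le B). tau D' e = f (tau D e)) \<and>
        (\<forall>z\<in>carrier (sigma_MA B (xi D)).
           Gam D' (tmap (sigma_MA B (xi D')) f (\<lambda>n. n) z)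
             = tmap (sigma_AM B (xi D')) f (\<lambda>n. n) (Gam D z)))"


section \<open>Passage between the two kinds of structure\<close>

text \<open>\<open>S(a) = \<xi>(j a j\<^sup>-\<^sup>1)\<close> with \<open>j = \<tau>(1 \<otimes> 1)\<close>, which is invertible because \<open>\<tau>\<^sup>l\<close> is an isomorphism.\<close>

definition antipode_of ::
  "('k, 'a, 'l) bialgebroid \<Rightarrow> ('a, 'l) star_structure \<Rightarrow> 'a \<Rightarrow> 'a" where
  "antipode_of B D a =
     (let A = total B; j = tau D \<one>\<^bsub>Le B\<^esub> in xi D (j \<otimes>\<^bsub>A\<^esub> a \<otimes>\<^bsub>A\<^esub> inv\<^bsub>A\<^esub> j))"

text \<open>
  \<open>\<xi> = S\<close>, \<open>\<theta> = \<pi> \<circ> S \<circ> s\<close>, \<open>\<tau> = \<eta>\<close> and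
  \<open>\<Gamma>(x \<otimes> [(u \<otimes>\<^sub>L v) \<otimes> c]) = 1 \<otimes> [x\<^sub>(\<^sub>1\<^sub>)u \<otimes> (x\<^sub>(\<^sub>2\<^sub>)v \<otimes>\<^sub>L c)]\<close>.
\<close>

definition star_of ::
  "('k, 'a, 'l) bialgebroid \<Rightarrow> ('a \<Rightarrow> 'a) \<Rightarrow> ('a, 'l) star_structure" where
  "star_of B S =
     (let A = total B; T = sigma_AM B S; U = xtensor (scalars B) (id_cell A) (M_cell B)
      in \<lparr>xi = S,
          Gam = tlift T (\<lambda>x w. tlift T (\<lambda>n c.
                  tlift T (\<lambda>u v. \<one>\<^bsub>A\<^esub> \<boxtimes>\<^bsub>T\<^esub> (u \<boxtimes>\<^bsub>U\<^esub> (v \<boxtimes>\<^bsub>M_cell B\<^esub> c))) (diag_act B x n)) w),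
          theta = (\<lambda>l. cou B (S (src B l))),
          tau = eta B\<rparr>)"

end

theory Submission
  imports Defs
begin

text \<open>Two descriptions of \<open>h\<close> have to be brought together. Compatibility,
  evaluated on all its arguments and before any Hopf axiom is known, leads to
  \<open>q\<cdot>g(j\<^sup>-\<^sup>1\<cdot>n)\<close> (called \<open>G\<close> below). The
  expression \<open>q\<cdot>g(n)\<cdot>(1 \<otimes> q\<^sup>-\<^sup>1)\<close> comes instead from
  equivariance together with the one value at \<open>\<gamma>(j)\<close>. They agree because the
  second axiom at \<open>j\<^sup>-\<^sup>1\<close> turns a left action inside \<open>g\<close> into
  a right multiplication. The first axiom is not computed: the second makes the candidate inverse a
  right inverse of \<open>g\<close>, and the bijectivity of \<open>\<Gamma>\<close> makes
  \<open>g\<close> injective.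

  The conjugation by \<open>j\<close> in \<open>S\<close> is dictated by the base. Linearity of
  \<open>\<tau>\<close> only gives \<open>\<xi>\<^sup>-\<^sup>1(\<eta>(v)) j = j \<eta>(v')\<close>
  for a twisted \<open>v'\<close>, and conjugating by \<open>j\<close> removes the discrepancy,
  whence \<open>S(t(l)) = s(l)\<close>. Since \<open>\<Gamma>\<close> is forced by
  \<open>\<xi>\<close> and \<open>\<tau>\<close>, structures with the same antipode differ only by
  the left multiplication by \<open>j' j\<^sup>-\<^sup>1\<close>.

  The formal obstacle is that each composite of 1-cells is its own nested quotient, and that
  restricting an action gives a new record on the same group. Hence maps are characterised by
  additivity and values on pure tensors, and transported between records that share a group.\<close>

text \<open>
  Tensoring over \<open>A \<otimes> A\<close> with \<open>\<sigma>\<close> is trivial: \<open>\<sigma> \<circ> (M \<otimes> A)\<close> and \<open>\<sigma> \<circ> (A \<otimes> M)\<close> are both copies of \<open>M\<close>, and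
  the source and target of \<open>\<tau>\<^sup>l\<close> are copies of \<open>A\<close>.  In these coordinates \<open>\<tau> = j \<eta>(-)\<close> with
  \<open>j = \<tau>(1 \<otimes> 1)\<close> and \<open>\<tau>\<^sup>l\<close> is left multiplication by \<open>j\<close>, so that \<open>j\<close> is a unit, and \<open>\<Gamma>\<close> is a
  bijection \<open>h\<close> of \<open>M\<close> with \<open>h(\<xi>\<^sup>-\<^sup>1(c)\<cdot>n\<cdot>(a \<otimes> b)) = \<xi>(a)\<cdot>h(n)\<cdot>(b \<otimes> c)\<close>.  Compatibility at \<open>1\<close> says
  \<open>h(\<gamma>(j)) = \<gamma>(\<xi>(j))\<close>, which forces \<open>h(n) = q\<cdot>g(n)\<cdot>(1 \<otimes> q\<^sup>-\<^sup>1)\<close> for \<open>q = \<xi>(j)\<close>, \<open>S(a) = \<xi>(jaj\<^sup>-\<^sup>1)\<close> and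
  the Galois map \<open>g(u \<otimes> v) = \<gamma>(S(u))(v \<otimes> 1)\<close>.  The second Hopf axiom is the equivariance of \<open>h\<close>
  evaluated at \<open>\<gamma>(a)\<close>, and the first one says that \<open>g\<close> has inverse \<open>u \<otimes> v \<mapsto> \<gamma>(S\<^sup>-\<^sup>1(v))(1 \<otimes> u)\<close>.
  Conversely these two axioms give back the equivariance and the bijectivity of \<open>h\<close>.
\<close>

section \<open>Additive maps and tensor products of abelian groups\<close>

text \<open>Only carriers and additions enter, so membership is insensitive to all other record
  fields. This lets one map be read between a bimodule, its restrictions and the bare tensor product
  that carries it.\<close>

definition add_map ::
  "('m, 'e) ring_scheme \<Rightarrow> ('p, 'f) ring_scheme \<Rightarrow> ('m \<Rightarrow> 'p) set" where
  "add_map M P = {f \<in> carrier M \<rightarrow> carrier P.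
     \<forall>x\<in>carrier M. \<forall>y\<in>carrier M. f (x \<oplus>\<^bsub>M\<^esub> y) = f x \<oplus>\<^bsub>P\<^esub> f y}"

definition biadd_map ::
  "('m, 'e) ring_scheme \<Rightarrow> ('n, 'f) ring_scheme \<Rightarrow> ('p, 'g) ring_scheme
     \<Rightarrow> ('m \<Rightarrow> 'n \<Rightarrow> 'p) set" where
  "biadd_map M N P = {\<beta>. (\<forall>x\<in>carrier M. \<beta> x \<in> add_map N P) \<and>
     (\<forall>y\<in>carrier N. (\<lambda>x. \<beta> x y) \<in> add_map M P)}"

lemma add_mapI:
  assumes "\<And>x. x \<in> carrier M \<Longrightarrow> f x \<in> carrier P"
    and "\<And>x y. \<lbrakk>x \<in> carrier M; y \<in> carrier M\<rbrakk> \<Longrightarrow> f (x \<oplus>\<^bsub>M\<^esub> y) = f x \<oplus>\<^bsub>P\<^esub> f y"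
  shows "f \<in> add_map M P"
  using assms by (auto simp: add_map_def)

lemma add_map_closed: "\<lbrakk>f \<in> add_map M P; x \<in> carrier M\<rbrakk> \<Longrightarrow> f x \<in> carrier P"
  by (auto simp: add_map_def)

lemma add_map_add:
  "\<lbrakk>f \<in> add_map M P; x \<in> carrier M; y \<in> carrier M\<rbrakk> \<Longrightarrow> f (x \<oplus>\<^bsub>M\<^esub> y) = f x \<oplus>\<^bsub>P\<^esub> f y"
  by (auto simp: add_map_def)

lemma add_map_comp: "\<lbrakk>f \<in> add_map M N; g \<in> add_map N P\<rbrakk> \<Longrightarrow> (\<lambda>x. g (f x)) \<in> add_map M P"
  by (auto simp: add_map_def Pi_iff)

lemma add_map_ident: "(\<lambda>x. x) \<in> add_map M M"
  by (auto simp: add_map_def)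

lemma add_map_group_cong:
  assumes "carrier M = carrier M'" "carrier P = carrier P'"
    and "(\<oplus>\<^bsub>M\<^esub>) = (\<oplus>\<^bsub>M'\<^esub>)" "(\<oplus>\<^bsub>P\<^esub>) = (\<oplus>\<^bsub>P'\<^esub>)"
  shows "add_map M P = add_map M' P'"
  using assms by (auto simp: add_map_def)

lemma abelian_group_cong:
  assumes "abelian_group M" "carrier M' = carrier M" "(\<oplus>\<^bsub>M'\<^esub>) = (\<oplus>\<^bsub>M\<^esub>)" "\<zero>\<^bsub>M'\<^esub> = \<zero>\<^bsub>M\<^esub>"
  shows "abelian_group M'"
  using abelian_groupE[OF assms(1)] by (intro abelian_groupI) (auto simp: assms(2-4))

lemma add_map_zero:
  assumes "abelian_group M" "abelian_group P" "f \<in> add_map M P"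
  shows "f \<zero>\<^bsub>M\<^esub> = \<zero>\<^bsub>P\<^esub>"
proof -
  interpret M: abelian_group M by fact
  interpret P: abelian_group P by fact
  have "f \<zero>\<^bsub>M\<^esub> \<oplus>\<^bsub>P\<^esub> f \<zero>\<^bsub>M\<^esub> = f \<zero>\<^bsub>M\<^esub>"
    using add_map_add[OF assms(3), of "\<zero>\<^bsub>M\<^esub>" "\<zero>\<^bsub>M\<^esub>"] by simp
  then show ?thesis
    using add_map_closed[OF assms(3)] by (metis M.zero_closed P.add.r_cancel_one)
qed

lemma add_map_minus:
  assumes "abelian_group M" "abelian_group P" "f \<in> add_map M P" "x \<in> carrier M"
  shows "f (\<ominus>\<^bsub>M\<^esub> x) = \<ominus>\<^bsub>P\<^esub> f x"
proof -
  interpret M: abelian_group M by fact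
  interpret P: abelian_group P by fact
  have "f (\<ominus>\<^bsub>M\<^esub> x) \<oplus>\<^bsub>P\<^esub> f x = \<zero>\<^bsub>P\<^esub>"
    using add_map_add[OF assms(3), of "\<ominus>\<^bsub>M\<^esub> x" x] assms add_map_zero[OF assms(1-3)]
    by (simp add: M.l_neg)
  then show ?thesis
    using add_map_closed[OF assms(3)] assms(4) by (simp add: P.minus_equality)
qed

lemma biadd_mapI:
  assumes "\<And>x. x \<in> carrier M \<Longrightarrow> \<beta> x \<in> add_map N P"
    and "\<And>y. y \<in> carrier N \<Longrightarrow> (\<lambda>x. \<beta> x y) \<in> add_map M P"
  shows "\<beta> \<in> biadd_map M N P"
  using assms by (auto simp: biadd_map_def)

lemma biadd_map_closed:
  "\<lbrakk>\<beta> \<in> biadd_map M N P; x \<in> carrier M; y \<in> carrier N\<rbrakk> \<Longrightarrow> \<beta> x y \<in> carrier P"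
  by (auto simp: biadd_map_def add_map_def)

lemma biadd_map_left: "\<lbrakk>\<beta> \<in> biadd_map M N P; y \<in> carrier N\<rbrakk> \<Longrightarrow> (\<lambda>x. \<beta> x y) \<in> add_map M P"
  by (auto simp: biadd_map_def)

lemma biadd_map_right: "\<lbrakk>\<beta> \<in> biadd_map M N P; x \<in> carrier M\<rbrakk> \<Longrightarrow> \<beta> x \<in> add_map N P"
  by (auto simp: biadd_map_def)

section \<open>Evaluation of formal sums in an abelian group\<close>

definition free_eval :: "('p, 'e) ring_scheme \<Rightarrow> ('s \<Rightarrow> 'p) \<Rightarrow> ('s \<Rightarrow>\<^sub>0 int) \<Rightarrow> 'p" where
  "free_eval P f c = (\<Oplus>\<^bsub>P\<^esub>p\<in>Poly_Mapping.keys c. [Poly_Mapping.lookup c p] \<cdot>\<^bsub>P\<^esub> f p)"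

context abelian_group
begin

text \<open>Outside the support the coefficients vanish, so several formal sums can be evaluated
  over one common finite index set. Additivity rests on this.\<close>

lemma free_eval_superset:
  assumes "finite S" "Poly_Mapping.keys c \<subseteq> S" "f \<in> S \<rightarrow> carrier G"
  shows "free_eval G f c = (\<Oplus>p\<in>S. [Poly_Mapping.lookup c p] \<cdot> f p)"
  unfolding free_eval_def
proof -
  have "\<forall>i\<in>S - Poly_Mapping.keys c. [Poly_Mapping.lookup c i] \<cdot> f i = \<zero>"
    by (auto simp: in_keys_iff add_pow_def)
  then show "(\<Oplus>p\<in>Poly_Mapping.keys c. [Poly_Mapping.lookup c p] \<cdot> f p)
      = (\<Oplus>p\<in>S. [Poly_Mapping.lookup c p] \<cdot> f p)"
    using assms by (intro add.finprod_mono_neutral_cong_left) auto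
qed

lemma free_eval_closed:
  assumes "f \<in> S \<rightarrow> carrier G" "Poly_Mapping.keys c \<subseteq> S"
  shows "free_eval G f c \<in> carrier G"
  unfolding free_eval_def using assms by (intro finsum_closed) auto

lemma free_eval_zero: "free_eval G f 0 = \<zero>"
  by (simp add: free_eval_def)

lemma free_eval_add:
  assumes f: "f \<in> S \<rightarrow> carrier G" and c: "Poly_Mapping.keys c \<subseteq> S" "Poly_Mapping.keys d \<subseteq> S"
  shows "free_eval G f (c + d) = free_eval G f c \<oplus> free_eval G f d"
proof -
  let ?U = "Poly_Mapping.keys c \<union> Poly_Mapping.keys d"
  have U: "finite ?U" "f \<in> ?U \<rightarrow> carrier G" using f c by auto
  have "free_eval G f (c + d) = (\<Oplus>p\<in>?U. [Poly_Mapping.lookup (c + d) p] \<cdot> f p)"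
    by (rule free_eval_superset) (use U keys_add[of c d] in auto)
  also have "\<dots> = (\<Oplus>p\<in>?U. [Poly_Mapping.lookup c p] \<cdot> f p \<oplus> [Poly_Mapping.lookup d p] \<cdot> f p)"
    by (rule finsum_cong') (use U in \<open>auto simp: lookup_add add.int_pow_mult Pi_iff\<close>)
  also have "\<dots> = (\<Oplus>p\<in>?U. [Poly_Mapping.lookup c p] \<cdot> f p) \<oplus> (\<Oplus>p\<in>?U. [Poly_Mapping.lookup d p] \<cdot> f p)"
    by (rule finsum_addf) (use U in auto)
  also have "\<dots> = free_eval G f c \<oplus> free_eval G f d"
    using U by (simp add: free_eval_superset[of ?U])
  finally show ?thesis .
qed

lemma free_eval_diff:
  assumes f: "f \<in> S \<rightarrow> carrier G" and c: "Poly_Mapping.keys c \<subseteq> S" "Poly_Mapping.keys d \<subseteq> S"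
  shows "free_eval G f (c - d) = free_eval G f c \<ominus> free_eval G f d"
proof -
  have k: "Poly_Mapping.keys (c - d) \<subseteq> S" using c keys_diff[of c d] by auto
  have "free_eval G f (c - d) \<oplus> free_eval G f d = free_eval G f c"
    using free_eval_add[OF f k c(2)] by simp
  then show ?thesis
    using free_eval_closed[OF f] k c by (metis add.inv_solve_right minus_eq)
qed

lemma free_eval_frag_of:
  assumes "f p \<in> carrier G"
  shows "free_eval G f (frag_of p) = f p"
  using assms by (simp add: free_eval_def)

end

section \<open>The universal property of the tensor product\<close>

text \<open>\<open>T\<close> is any record whose additive group is the tensor group, rather than
  that group itself. The same facts thus serve \<open>ktensor\<close>, \<open>hcomp\<close>,
  \<open>xtensor\<close>, \<open>alg_tensor\<close> and restrictions of these.\<close>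

locale tensor_product =
  fixes M :: "('k, 'm, 'e) module_scheme" and N :: "('k, 'n, 'f) module_scheme"
    and R :: "'r set" and \<rho> :: "'m \<Rightarrow> 'r \<Rightarrow> 'm" and \<mu> :: "'r \<Rightarrow> 'n \<Rightarrow> 'n"
    and T :: "(('m, 'n) tens, 'h) ring_scheme"
  assumes abM: "abelian_group M" and abN: "abelian_group N"
    and rho_closed: "\<And>x r. \<lbrakk>x \<in> carrier M; r \<in> R\<rbrakk> \<Longrightarrow> \<rho> x r \<in> carrier M"
    and mu_closed: "\<And>r y. \<lbrakk>r \<in> R; y \<in> carrier N\<rbrakk> \<Longrightarrow> \<mu> r y \<in> carrier N"
    and carrier_T: "carrier T = carrier (tensor_group M R \<rho> \<mu> N)"
    and add_T: "(\<oplus>\<^bsub>T\<^esub>) = (\<oplus>\<^bsub>tensor_group M R \<rho> \<mu> N\<^esub>)"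
    and zero_T: "\<zero>\<^bsub>T\<^esub> = \<zero>\<^bsub>tensor_group M R \<rho> \<mu> N\<^esub>"
begin

abbreviation (input) "F \<equiv> free_Abelian_group (carrier M \<times> carrier N)"
abbreviation (input) "I \<equiv> generate F (tensor_rels M R \<rho> \<mu> N)"

lemma rels_subset: "tensor_rels M R \<rho> \<mu> N \<subseteq> carrier F"
proof -
  have k: "Poly_Mapping.keys (frag_of p - frag_of q - frag_of r) \<subseteq> {p, q, r}"
    "Poly_Mapping.keys (frag_of p - frag_of q) \<subseteq> {p, q}" for p q r :: "'m \<times> 'n"
    using keys_diff[of "frag_of p - frag_of q" "frag_of r"] keys_diff[of "frag_of p" "frag_of q"]
    by auto
  show ?thesis
    unfolding tensor_rels_def
    using abelian_groupE(1)[OF abM] abelian_groupE(1)[OF abN] rho_closed mu_closed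
    by (auto dest!: subsetD[OF k(1)] subsetD[OF k(2)])
qed

lemma normal_I: "I \<lhd> F"
proof -
  interpret F: comm_group F by (rule abelian_free_Abelian_group)
  show ?thesis
    using F.generate_is_subgroup[OF rels_subset] by (simp add: F.subgroup_imp_normal)
qed

lemma T_eq: "carrier T = carrier (F Mod I)" "(\<oplus>\<^bsub>T\<^esub>) = (\<otimes>\<^bsub>F Mod I\<^esub>)" "\<zero>\<^bsub>T\<^esub> = I"
  by (simp_all add: carrier_T add_T zero_T tensor_group_def Let_def)

definition proj :: "('m \<times> 'n \<Rightarrow>\<^sub>0 int) \<Rightarrow> ('m, 'n) tens" where
  "proj c = I #>\<^bsub>F\<^esub> c"

lemma carrier_proj: "X \<in> carrier T \<longleftrightarrow> (\<exists>c\<in>carrier F. X = proj c)"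
  by (auto simp: T_eq carrier_FactGroup proj_def)

lemma proj_closed: "c \<in> carrier F \<Longrightarrow> proj c \<in> carrier T"
  using carrier_proj by blast

lemma proj_add: "\<lbrakk>c \<in> carrier F; d \<in> carrier F\<rbrakk> \<Longrightarrow> proj (c + d) = proj c \<oplus>\<^bsub>T\<^esub> proj d"
  using normal.rcos_sum[OF normal_I, of c d] by (simp add: T_eq proj_def)

text \<open>\<open>pure_tensor\<close> forms its coset in the free group on all pairs, whose
  operation agrees with that of \<open>F\<close>; the subgroup of relations is supplied by the zero
  of \<open>T\<close>.\<close>

lemma pure_proj: "x \<boxtimes>\<^bsub>T\<^esub> y = proj (frag_of (x, y))"
  by (simp add: pure_tensor_def proj_def T_eq r_coset_def)

lemma ab: "abelian_group T"
proof -
  interpret F: comm_group F by (rule abelian_free_Abelian_group)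
  have s: "subgroup I F" by (rule F.generate_is_subgroup[OF rels_subset])
  interpret Q: comm_group "F Mod I" by (rule F.abelian_FactGroup[OF s])
  show ?thesis
  proof (rule abelian_groupI)
    show "\<zero>\<^bsub>T\<^esub> \<in> carrier T" using Q.one_closed by (simp add: T_eq)
    show "\<exists>y\<in>carrier T. y \<oplus>\<^bsub>T\<^esub> x = \<zero>\<^bsub>T\<^esub>" if "x \<in> carrier T" for x
      using that Q.l_inv[of x] Q.inv_closed[of x] unfolding T_eq by auto
  qed (use Q.m_closed Q.m_assoc Q.m_comm Q.l_one in \<open>auto simp: T_eq\<close>)
qed

sublocale T: abelian_group T by (rule ab)

lemma pure_closed [simp, intro]: "\<lbrakk>x \<in> carrier M; y \<in> carrier N\<rbrakk> \<Longrightarrow> x \<boxtimes>\<^bsub>T\<^esub> y \<in> carrier T"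
  by (simp add: pure_proj proj_closed)

lemma proj_zero: "proj 0 = \<zero>\<^bsub>T\<^esub>"
  using proj_add[of 0 0] proj_closed[of 0] by simp

lemma proj_minus: "c \<in> carrier F \<Longrightarrow> proj (- c) = \<ominus>\<^bsub>T\<^esub> proj c"
  using proj_add[of "-c" c] proj_closed[of "-c"] proj_closed[of c]
  by (simp add: proj_zero) (metis T.minus_equality)

lemma proj_diff: "\<lbrakk>c \<in> carrier F; d \<in> carrier F\<rbrakk> \<Longrightarrow> proj (c - d) = proj c \<ominus>\<^bsub>T\<^esub> proj d"
  using proj_add[of c "-d"] proj_minus[of d] by (simp add: T.minus_eq)

lemma proj_eq_iff: "c \<in> carrier F \<Longrightarrow> proj c = \<zero>\<^bsub>T\<^esub> \<longleftrightarrow> c \<in> I"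
proof -
  interpret F: comm_group F by (rule abelian_free_Abelian_group)
  have s: "subgroup I F" by (rule F.generate_is_subgroup[OF rels_subset])
  assume "c \<in> carrier F"
  then show ?thesis
    using F.coset_join1[of I c] F.coset_join2[of c I] s subgroup.subset[OF s]
    by (auto simp: proj_def T_eq)
qed

lemma proj_rel:
  assumes "a - b \<in> tensor_rels M R \<rho> \<mu> N" "a \<in> carrier F" "b \<in> carrier F"
  shows "proj a = proj b"
proof -
  have "a - b \<in> I" using assms(1) by (rule generate.incl)
  then have "proj (a - b) = \<zero>\<^bsub>T\<^esub>"
    using proj_eq_iff[of "a - b"] rels_subset assms(1) by blast
  moreover have "a - b \<in> carrier F"
    using rels_subset assms(1) by blast
  ultimately show ?thesis
    using proj_add[of "a - b" b] assms proj_closed[of b] by simp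
qed

lemma pure_add_left:
  assumes "x \<in> carrier M" "x' \<in> carrier M" "y \<in> carrier N"
  shows "(x \<oplus>\<^bsub>M\<^esub> x') \<boxtimes>\<^bsub>T\<^esub> y = x \<boxtimes>\<^bsub>T\<^esub> y \<oplus>\<^bsub>T\<^esub> x' \<boxtimes>\<^bsub>T\<^esub> y"
proof -
  have "proj (frag_of (x \<oplus>\<^bsub>M\<^esub> x', y)) = proj (frag_of (x, y) + frag_of (x', y))"
  proof (rule proj_rel)
    show "frag_of (x \<oplus>\<^bsub>M\<^esub> x', y) - (frag_of (x, y) + frag_of (x', y)) \<in> tensor_rels M R \<rho> \<mu> N"
      unfolding tensor_rels_def diff_diff_eq[symmetric] by (rule UnI1, rule UnI1, rule CollectI, intro exI conjI, rule refl) (use assms in auto)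
    show "frag_of (x, y) + frag_of (x', y) \<in> carrier F"
      using assms by (simp add: keys_add[THEN order_trans])
  qed (use assms abelian_groupE(1)[OF abM] in auto)
  then show ?thesis
    using assms proj_add[of "frag_of (x, y)" "frag_of (x', y)"] by (simp add: pure_proj)
qed

lemma pure_add_right:
  assumes "x \<in> carrier M" "y \<in> carrier N" "y' \<in> carrier N"
  shows "x \<boxtimes>\<^bsub>T\<^esub> (y \<oplus>\<^bsub>N\<^esub> y') = x \<boxtimes>\<^bsub>T\<^esub> y \<oplus>\<^bsub>T\<^esub> x \<boxtimes>\<^bsub>T\<^esub> y'"
proof -
  have "proj (frag_of (x, y \<oplus>\<^bsub>N\<^esub> y')) = proj (frag_of (x, y) + frag_of (x, y'))"
  proof (rule proj_rel)
    show "frag_of (x, y \<oplus>\<^bsub>N\<^esub> y') - (frag_of (x, y) + frag_of (x, y')) \<in> tensor_rels M R \<rho> \<mu> N"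
      unfolding tensor_rels_def diff_diff_eq[symmetric] by (rule UnI1, rule UnI2, rule CollectI, intro exI conjI, rule refl) (use assms in auto)
    show "frag_of (x, y) + frag_of (x, y') \<in> carrier F"
      using assms by (simp add: keys_add[THEN order_trans])
  qed (use assms abelian_groupE(1)[OF abN] in auto)
  then show ?thesis
    using assms proj_add[of "frag_of (x, y)" "frag_of (x, y')"] by (simp add: pure_proj)
qed

lemma pure_balanced:
  assumes "x \<in> carrier M" "r \<in> R" "y \<in> carrier N"
  shows "\<rho> x r \<boxtimes>\<^bsub>T\<^esub> y = x \<boxtimes>\<^bsub>T\<^esub> \<mu> r y"
  unfolding pure_proj
proof (rule proj_rel)
  show "frag_of (\<rho> x r, y) - frag_of (x, \<mu> r y) \<in> tensor_rels M R \<rho> \<mu> N"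
    unfolding tensor_rels_def
    by (rule UnI2, rule CollectI, intro exI conjI, rule refl) (use assms in auto)
qed (use assms rho_closed mu_closed in auto)

lemma pure_left: "y \<in> carrier N \<Longrightarrow> (\<lambda>x. x \<boxtimes>\<^bsub>T\<^esub> y) \<in> add_map M T"
  by (auto intro: add_mapI simp: pure_add_left)

lemma pure_right: "x \<in> carrier M \<Longrightarrow> (\<lambda>y. x \<boxtimes>\<^bsub>T\<^esub> y) \<in> add_map N T"
  by (auto intro: add_mapI simp: pure_add_right)

text \<open>The negative of a pure tensor is again pure, \<open>(\<ominus> x) \<boxtimes> y\<close>,
  so sums of pure tensors already exhaust \<open>T\<close> and no case for negatives arises.\<close>

lemma tensor_induct [consumes 1, case_names pure add]:
  assumes "X \<in> carrier T"
    and p: "\<And>x y. \<lbrakk>x \<in> carrier M; y \<in> carrier N\<rbrakk> \<Longrightarrow> Q (x \<boxtimes>\<^bsub>T\<^esub> y)"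
    and a: "\<And>X Y. \<lbrakk>X \<in> carrier T; Y \<in> carrier T; Q X; Q Y\<rbrakk> \<Longrightarrow> Q (X \<oplus>\<^bsub>T\<^esub> Y)"
  shows "Q X"
proof -
  interpret M: abelian_group M by (rule abM)
  interpret N: abelian_group N by (rule abN)
  obtain c where c: "c \<in> carrier F" "X = proj c" using assms(1) carrier_proj by blast
  have z: "\<zero>\<^bsub>M\<^esub> \<boxtimes>\<^bsub>T\<^esub> y = \<zero>\<^bsub>T\<^esub>" if "y \<in> carrier N" for y
    using add_map_zero[OF abM ab pure_left[OF that]] .
  have m: "(\<ominus>\<^bsub>M\<^esub> x) \<boxtimes>\<^bsub>T\<^esub> y = \<ominus>\<^bsub>T\<^esub> (x \<boxtimes>\<^bsub>T\<^esub> y)" if "x \<in> carrier M" "y \<in> carrier N" for x y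
    using add_map_minus[OF abM ab pure_left[OF that(2)] that(1)] .
  have Q0: "Q \<zero>\<^bsub>T\<^esub>" using p[of "\<zero>\<^bsub>M\<^esub>" "\<zero>\<^bsub>N\<^esub>"] z by simp
  have m0: "\<ominus>\<^bsub>T\<^esub> \<zero>\<^bsub>T\<^esub> = \<zero>\<^bsub>T\<^esub>"
    by (metis T.r_zero T.l_neg T.zero_closed T.a_inv_closed)
  \<comment> \<open>Induction on the free group has a case for differences, so the claim is
    strengthened to cover an element together with its negative.\<close>
  have "Q (proj c) \<and> Q (\<ominus>\<^bsub>T\<^esub> proj c)"
    using c(1)[simplified]
  proof (induction c rule: free_Abelian_group_induct[consumes 1, case_names zero diff frag])
    case zero
    then show ?case using Q0 by (simp add: proj_zero m0)
  next
    case (diff c d)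
    then have k: "proj c \<in> carrier T" "proj d \<in> carrier T"
      by (auto intro: proj_closed)
    have e: "\<ominus>\<^bsub>T\<^esub> proj (c - d) = proj d \<oplus>\<^bsub>T\<^esub> \<ominus>\<^bsub>T\<^esub> proj c"
      using diff k by (simp add: proj_diff T.minus_eq T.minus_add T.a_comm)
    show ?case
      unfolding e using diff k by (auto simp: proj_diff T.minus_eq intro: a)
  next
    case (frag s)
    then obtain x y where "s = (x, y)" "x \<in> carrier M" "y \<in> carrier N" by auto
    then show ?case
      using p[of x y] p[of "\<ominus>\<^bsub>M\<^esub> x" y] m[of x y] by (simp add: pure_proj)
  qed
  then show ?thesis using c by simp
qed

text \<open>These two facts about the chosen representative are the only access to
  \<open>tlift\<close>: it evaluates a formal sum of admissible pairs that lies over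
  \<open>X\<close>.\<close>

lemma
  assumes "X \<in> carrier T"
  shows some_rep_keys: "Poly_Mapping.keys (SOME c. c \<in> X) \<subseteq> carrier M \<times> carrier N"
    and some_rep_proj: "proj (SOME c. c \<in> X) = X"
proof -
  interpret F: comm_group F by (rule abelian_free_Abelian_group)
  have s: "subgroup I F" by (rule F.generate_is_subgroup[OF rels_subset])
  obtain d where d: "d \<in> carrier F" "X = I #>\<^bsub>F\<^esub> d" using assms carrier_proj by (auto simp: proj_def)
  let ?c = "SOME c. c \<in> X"
  have "d \<in> X" using d F.rcos_self[OF _ s] by auto
  then have c: "?c \<in> X" by (rule someI)
  have cF: "?c \<in> carrier F"
    using c d F.r_coset_subset_G[OF subgroup.subset[OF s]] by blast
  show "Poly_Mapping.keys ?c \<subseteq> carrier M \<times> carrier N" using cF by simp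
  show "proj ?c = X"
    using F.repr_independence[OF _ _ s, of ?c d] c d by (simp add: proj_def)
qed

lemma tlift_eval: "tlift P \<beta> X = free_eval P (\<lambda>p. \<beta> (fst p) (snd p)) (SOME c. c \<in> X)"
  by (simp add: tlift_def free_eval_def Let_def)

lemma tlift_closed:
  assumes "abelian_group P" "X \<in> carrier T"
    and "\<And>x y. \<lbrakk>x \<in> carrier M; y \<in> carrier N\<rbrakk> \<Longrightarrow> \<beta> x y \<in> carrier P"
  shows "tlift P \<beta> X \<in> carrier P"
proof -
  interpret P: abelian_group P by fact
  show ?thesis
    unfolding tlift_eval
    by (rule P.free_eval_closed[OF _ some_rep_keys[OF assms(2)]]) (use assms(3) in auto)
qed

lemma tlift_cong:
  assumes "abelian_group P" "X \<in> carrier T"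
    and "\<And>x y. \<lbrakk>x \<in> carrier M; y \<in> carrier N\<rbrakk> \<Longrightarrow> \<beta> x y = \<beta>' x y"
    and "\<And>x y. \<lbrakk>x \<in> carrier M; y \<in> carrier N\<rbrakk> \<Longrightarrow> \<beta> x y \<in> carrier P"
  shows "tlift P \<beta> X = tlift P \<beta>' X"
proof -
  interpret P: abelian_group P by fact
  show ?thesis
    unfolding tlift_eval free_eval_def
    by (rule P.finsum_cong')
      (use assms(3,4) some_rep_keys[OF assms(2)] in \<open>auto simp: subset_iff intro!: P.add.int_pow_closed\<close>)
qed

text \<open>
  No well-definedness of \<open>\<beta>\<close> is required here: the representative on which \<open>tlift\<close> is evaluated
  expands \<open>X\<close> into pure tensors, and \<open>g\<close> sees only that expansion.
\<close>

lemma tlift_fuse: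
  assumes P: "abelian_group P" and Q: "abelian_group Q"
    and F: "h \<in> add_map P Q" and G: "g \<in> add_map T Q"
    and \<beta>: "\<And>x y. \<lbrakk>x \<in> carrier M; y \<in> carrier N\<rbrakk> \<Longrightarrow> \<beta> x y \<in> carrier P"
    and eq: "\<And>x y. \<lbrakk>x \<in> carrier M; y \<in> carrier N\<rbrakk> \<Longrightarrow> h (\<beta> x y) = g (x \<boxtimes>\<^bsub>T\<^esub> y)"
    and X: "X \<in> carrier T"
  shows "h (tlift P \<beta> X) = g X"
proof -
  interpret P: abelian_group P by fact
  interpret Q: abelian_group Q by fact
  let ?b = "\<lambda>p. \<beta> (fst p) (snd p)"
  have b: "?b \<in> carrier M \<times> carrier N \<rightarrow> carrier P" using \<beta> by auto
  obtain c where c: "Poly_Mapping.keys c \<subseteq> carrier M \<times> carrier N" "X = proj c"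
    "tlift P \<beta> X = free_eval P ?b c"
    by (rule that[OF some_rep_keys[OF X] some_rep_proj[OF X, symmetric] tlift_eval])
  have "h (free_eval P ?b c) = g (proj c)"
    using c(1)
  proof (induction c rule: free_Abelian_group_induct[consumes 1, case_names zero diff frag])
    case zero
    then show ?case
      by (simp add: P.free_eval_zero proj_zero add_map_zero[OF P Q F] add_map_zero[OF ab Q G])
  next
    case (diff c d)
    have k: "free_eval P ?b c \<in> carrier P" "free_eval P ?b d \<in> carrier P"
      using P.free_eval_closed[OF b] diff by auto
    have k2: "proj c \<in> carrier T" "proj d \<in> carrier T" using diff by (auto intro: proj_closed)
    show ?case
      using diff k k2
      by (simp add: P.free_eval_diff[OF b] proj_diff P.minus_eq T.minus_eq
          add_map_add[OF F] add_map_add[OF G] add_map_minus[OF P Q F] add_map_minus[OF ab Q G])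
  next
    case (frag s)
    then show ?case
      using \<beta> eq by (auto simp: P.free_eval_frag_of pure_proj)
  qed
  then show ?thesis using c by simp
qed

text \<open>When an additive \<open>g\<close> with the right values is already at hand, balancedness
  of \<open>\<beta>\<close> is inherited from it. Nested lifts are simplified in this way, from the
  inside out.\<close>

lemma tlift_eqI:
  assumes P: "abelian_group P" and G: "g \<in> add_map T P"
    and eq: "\<And>x y. \<lbrakk>x \<in> carrier M; y \<in> carrier N\<rbrakk> \<Longrightarrow> \<beta> x y = g (x \<boxtimes>\<^bsub>T\<^esub> y)"
    and X: "X \<in> carrier T"
  shows "tlift P \<beta> X = g X"
  using tlift_fuse[OF P P add_map_ident G _ eq X] eq G add_map_closed by fastforce

text \<open>A biadditive balanced \<open>\<beta>\<close> evaluates each of the three kinds of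
  relations to zero, hence the whole subgroup they generate; the choice of representative made by
  \<open>tlift\<close> then has no influence.\<close>

lemma
  assumes P: "abelian_group P" and \<beta>: "\<beta> \<in> biadd_map M N P"
    and bal: "\<And>x r y. \<lbrakk>x \<in> carrier M; r \<in> R; y \<in> carrier N\<rbrakk> \<Longrightarrow> \<beta> (\<rho> x r) y = \<beta> x (\<mu> r y)"
  shows tlift_add_map: "tlift P \<beta> \<in> add_map T P"
    and tlift_pure: "\<lbrakk>x \<in> carrier M; y \<in> carrier N\<rbrakk> \<Longrightarrow> tlift P \<beta> (x \<boxtimes>\<^bsub>T\<^esub> y) = \<beta> x y"
proof -
  interpret P: abelian_group P by fact
  interpret Mg: abelian_group M by (rule abM)
  interpret Ng: abelian_group N by (rule abN)
  let ?b = "\<lambda>p. \<beta> (fst p) (snd p)"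
  let ?e = "free_eval P ?b"
  have b: "?b \<in> carrier M \<times> carrier N \<rightarrow> carrier P" using biadd_map_closed[OF \<beta>] by auto
  note clos = P.free_eval_closed[OF b] 
  have pp: "Poly_Mapping.keys (frag_of (x, y)) \<subseteq> carrier M \<times> carrier N"
    if "x \<in> carrier M" "y \<in> carrier N" for x y using that by auto
  have ep: "?e (frag_of (x, y)) = \<beta> x y" if "x \<in> carrier M" "y \<in> carrier N" for x y
    using that biadd_map_closed[OF \<beta>] by (simp add: P.free_eval_frag_of)
  have rel: "?e r = \<zero>\<^bsub>P\<^esub>" if r: "r \<in> tensor_rels M R \<rho> \<mu> N" for r
  proof -
    have k2: "?e (frag_of p - frag_of q) = ?e (frag_of p) \<ominus>\<^bsub>P\<^esub> ?e (frag_of q)"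
      if "p \<in> carrier M \<times> carrier N" "q \<in> carrier M \<times> carrier N" for p q
      using that by (auto simp: P.free_eval_diff[OF b])
    have k3: "?e (frag_of p - frag_of q - frag_of s)
        = ?e (frag_of p) \<ominus>\<^bsub>P\<^esub> ?e (frag_of q) \<ominus>\<^bsub>P\<^esub> ?e (frag_of s)"
      if "p \<in> carrier M \<times> carrier N" "q \<in> carrier M \<times> carrier N" "s \<in> carrier M \<times> carrier N" for p q s
    proof -
      have "Poly_Mapping.keys (frag_of p - frag_of q) \<subseteq> carrier M \<times> carrier N"
        using that keys_diff[of "frag_of p" "frag_of q"] by auto
      then show ?thesis
        using that by (simp add: P.free_eval_diff[OF b] k2)
    qed
    have cancel: "(u \<oplus>\<^bsub>P\<^esub> v) \<ominus>\<^bsub>P\<^esub> u \<ominus>\<^bsub>P\<^esub> v = \<zero>\<^bsub>P\<^esub>" if "u \<in> carrier P" "v \<in> carrier P" for u v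
      using that P.r_neg[of "u \<oplus>\<^bsub>P\<^esub> v"] by (simp add: P.minus_eq P.minus_add P.a_assoc)
    show ?thesis
      using r unfolding tensor_rels_def
    proof (elim UnE CollectE exE conjE)
      fix x x' y assume *: "r = frag_of (x \<oplus>\<^bsub>M\<^esub> x', y) - frag_of (x, y) - frag_of (x', y)"
        "x \<in> carrier M" "x' \<in> carrier M" "y \<in> carrier N"
      then show ?thesis
        using biadd_map_closed[OF \<beta>] cancel
        by (simp add: k3 ep add_map_add[OF biadd_map_left[OF \<beta>]])
    next
      fix x y y' assume *: "r = frag_of (x, y \<oplus>\<^bsub>N\<^esub> y') - frag_of (x, y) - frag_of (x, y')"
        "x \<in> carrier M" "y \<in> carrier N" "y' \<in> carrier N"
      then show ?thesis
        using biadd_map_closed[OF \<beta>] cancel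
        by (simp add: k3 ep add_map_add[OF biadd_map_right[OF \<beta>]])
    next
      fix x t y assume *: "r = frag_of (\<rho> x t, y) - frag_of (x, \<mu> t y)"
        "x \<in> carrier M" "t \<in> R" "y \<in> carrier N"
      then show ?thesis
        using biadd_map_closed[OF \<beta>] rho_closed mu_closed
        by (simp add: k2 ep bal P.minus_eq P.r_neg)
    qed
  qed
  have relF: "r \<in> tensor_rels M R \<rho> \<mu> N \<Longrightarrow> Poly_Mapping.keys r \<subseteq> carrier M \<times> carrier N" for r
    using subsetD[OF rels_subset, of r] by simp
  \<comment> \<open>The support is carried along because evaluation is known to be additive only on
    formal sums supported on pairs of elements.\<close>
  have I0: "?e r = \<zero>\<^bsub>P\<^esub> \<and> Poly_Mapping.keys r \<subseteq> carrier M \<times> carrier N" if "r \<in> I" for r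
    using that
  proof (induction rule: generate.induct)
    case one then show ?case by (simp add: P.free_eval_zero)
  next
    case (incl h) then show ?case using rel relF by auto
  next
    case (inv h)
    have "?e (0 - h) = \<zero>\<^bsub>P\<^esub>"
      using P.free_eval_diff[OF b, of 0 h] relF[OF inv] rel[OF inv] by (simp add: P.free_eval_zero P.minus_eq)
    then show ?case using relF[OF inv] by simp
  next
    case (eng h1 h2)
    then show ?case
      using keys_add[of h1 h2] by (auto simp: P.free_eval_add[OF b])
  qed
  have e_eq: "?e c = ?e d" if "proj c = proj d" "c \<in> carrier F" "d \<in> carrier F" for c d
  proof -
    have k: "Poly_Mapping.keys (c - d) \<subseteq> carrier M \<times> carrier N" using that keys_diff[of c d] by auto
    have "proj (c - d) = \<zero>\<^bsub>T\<^esub>" using that proj_diff proj_closed by (simp add: T.r_neg T.minus_eq)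
    then have "?e (c - d) = \<zero>\<^bsub>P\<^esub>" using proj_eq_iff[of "c - d"] k I0 by auto
    then show ?thesis
      using P.free_eval_add[OF b, of "c - d" d] that k clos[of d] by simp
  qed
  have tl: "tlift P \<beta> (proj c) = ?e c" if "c \<in> carrier F" for c
  proof -
    note X = proj_closed[OF that]
    obtain d where d: "Poly_Mapping.keys d \<subseteq> carrier M \<times> carrier N" "proj c = proj d"
      "tlift P \<beta> (proj c) = ?e d"
        by (rule that[OF some_rep_keys[OF X] some_rep_proj[OF X, symmetric] tlift_eval])
    then show ?thesis using e_eq[of c d] that by auto
  qed
  show "tlift P \<beta> \<in> add_map T P"
  proof (rule add_mapI)
    fix X Y assume "X \<in> carrier T" "Y \<in> carrier T"
    then obtain c d where cd: "c \<in> carrier F" "d \<in> carrier F" "X = proj c" "Y = proj d"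
      using carrier_proj by metis
    have "tlift P \<beta> (proj (c + d)) = ?e (c + d)"
      by (rule tl) (use cd keys_add[of c d] in auto)
    then show "tlift P \<beta> (X \<oplus>\<^bsub>T\<^esub> Y) = tlift P \<beta> X \<oplus>\<^bsub>P\<^esub> tlift P \<beta> Y"
      using cd by (simp add: tl proj_add P.free_eval_add[OF b])
  qed (use tlift_closed[OF P] biadd_map_closed[OF \<beta>] in blast)
  show "tlift P \<beta> (x \<boxtimes>\<^bsub>T\<^esub> y) = \<beta> x y" if "x \<in> carrier M" "y \<in> carrier N"
    using that by (simp add: pure_proj tl ep)
qed

end

lemma pure_tensor_cong: "\<zero>\<^bsub>T\<^esub> = \<zero>\<^bsub>T'\<^esub> \<Longrightarrow> x \<boxtimes>\<^bsub>T\<^esub> y = x \<boxtimes>\<^bsub>T'\<^esub> y"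
  by (simp add: pure_tensor_def)

text \<open>The two tensor products may be taken over different rings. Compatibility is stated as
  the one identity in the target that makes \<open>f \<otimes> g\<close> balanced, which covers
  linear and semilinear pairs alike.\<close>

locale tensor_map = S: tensor_product M N R \<rho> \<mu> T + T': tensor_product M' N' R' \<rho>' \<mu>' T'
  for M N R \<rho> \<mu> T M' N' R' \<rho>' \<mu>' T' +
  fixes f g
  assumes f: "f \<in> add_map M M'" and g: "g \<in> add_map N N'"
    and bal: "\<And>x r y. \<lbrakk>x \<in> carrier M; r \<in> R; y \<in> carrier N\<rbrakk> \<Longrightarrow> f (\<rho> x r) \<boxtimes>\<^bsub>T'\<^esub> g y = f x \<boxtimes>\<^bsub>T'\<^esub> g (\<mu> r y)"
begin

lemma biadd: "(\<lambda>x y. f x \<boxtimes>\<^bsub>T'\<^esub> g y) \<in> biadd_map M N T'"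
  by (intro biadd_mapI)
    (auto intro!: add_map_comp[OF g] add_map_comp[OF f] T'.pure_left T'.pure_right
      add_map_closed[OF f] add_map_closed[OF g])

lemma add_map: "tmap T' f g \<in> add_map T T'"
  unfolding tmap_def by (rule S.tlift_add_map[OF T'.ab biadd bal])

lemma pure: "\<lbrakk>x \<in> carrier M; y \<in> carrier N\<rbrakk> \<Longrightarrow> tmap T' f g (x \<boxtimes>\<^bsub>T\<^esub> y) = f x \<boxtimes>\<^bsub>T'\<^esub> g y"
  unfolding tmap_def by (rule S.tlift_pure[OF T'.ab biadd bal])

end

section \<open>Bimodules\<close>

lemma mk_bimod_simps [simp]:
  "carrier (mk_bimod M l r) = carrier M" "\<zero>\<^bsub>mk_bimod M l r\<^esub> = \<zero>\<^bsub>M\<^esub>"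
  "x \<oplus>\<^bsub>mk_bimod M l r\<^esub> y = x \<oplus>\<^bsub>M\<^esub> y" "\<kappa> \<odot>\<^bsub>mk_bimod M l r\<^esub> x = \<kappa> \<odot>\<^bsub>M\<^esub> x"
  "lact (mk_bimod M l r) = l" "ract (mk_bimod M l r) = r"
  "pure_tensor (mk_bimod T l' r') = pure_tensor T"
  by (simp_all add: mk_bimod_def module.extend_def module.truncate_def bimod.fields_def
      pure_tensor_def fun_eq_iff)

lemma mk_bimod_add [simp]: "(\<oplus>\<^bsub>mk_bimod M l r\<^esub>) = (\<oplus>\<^bsub>M\<^esub>)"
  by (simp add: fun_eq_iff)

lemma module_mk_bimod:
  assumes "module K M" shows "module K (mk_bimod M l r)"
proof -
  interpret module K M by fact
  show ?thesis
    by (rule moduleI)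
      (auto simp: smult_l_distr smult_r_distr smult_assoc1 R.is_cring
        intro: abelian_group_cong[OF M.abelian_group_axioms])
qed

lemma tensor_simps:
  "carrier (tensor M R \<rho> \<mu> N) = carrier (tensor_group M R \<rho> \<mu> N)"
  "\<zero>\<^bsub>tensor M R \<rho> \<mu> N\<^esub> = \<zero>\<^bsub>tensor_group M R \<rho> \<mu> N\<^esub>"
  "(\<oplus>\<^bsub>tensor M R \<rho> \<mu> N\<^esub>) = (\<oplus>\<^bsub>tensor_group M R \<rho> \<mu> N\<^esub>)"
  "\<kappa> \<odot>\<^bsub>tensor M R \<rho> \<mu> N\<^esub> z
     = tlift (tensor_group M R \<rho> \<mu> N) (\<lambda>x y. (\<kappa> \<odot>\<^bsub>M\<^esub> x) \<boxtimes>\<^bsub>tensor_group M R \<rho> \<mu> N\<^esub> y) z"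
  by (simp_all add: tensor_def Let_def ring.extend_def module.fields_def tensor_group_def)

lemma add_map_module:
  assumes "module K M" "\<kappa> \<in> carrier K"
  shows "(\<lambda>x. \<kappa> \<odot>\<^bsub>M\<^esub> x) \<in> add_map M M"
proof -
  interpret module K M by fact
  show ?thesis using assms(2) by (auto intro: add_mapI smult_r_distr)
qed

lemma
  fixes K :: "'k ring" and T :: "('k, ('m, 'n) tens, 'x) module_scheme"
  assumes tp: "tensor_product M N R \<rho> \<mu> T"
    and mM: "module K M"
    and sm: "\<And>\<kappa> z. \<kappa> \<odot>\<^bsub>T\<^esub> z = \<kappa> \<odot>\<^bsub>tensor M R \<rho> \<mu> N\<^esub> z"
    and lin: "\<And>\<kappa> x r. \<lbrakk>\<kappa> \<in> carrier K; x \<in> carrier M; r \<in> R\<rbrakk> \<Longrightarrow> \<rho> (\<kappa> \<odot>\<^bsub>M\<^esub> x) r = \<kappa> \<odot>\<^bsub>M\<^esub> \<rho> x r"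
  shows module_tensor: "module K T"
    and tensor_smult_pure: "\<And>\<kappa> x y. \<lbrakk>\<kappa> \<in> carrier K; x \<in> carrier M; y \<in> carrier N\<rbrakk>
      \<Longrightarrow> \<kappa> \<odot>\<^bsub>T\<^esub> (x \<boxtimes>\<^bsub>T\<^esub> y) = (\<kappa> \<odot>\<^bsub>M\<^esub> x) \<boxtimes>\<^bsub>T\<^esub> y"
proof -
  interpret T: tensor_product M N R \<rho> \<mu> T by fact
  interpret M: module K M by fact
  \<comment> \<open>\<open>tensor\<close> defines its scalar action with values in the bare group
    \<open>?G\<close>. The action is first recognised as a map from \<open>T\<close> to
    \<open>?G\<close> and then read back in \<open>T\<close>, which has the same elements and
    sums.\<close>
  let ?G = "tensor_group M R \<rho> \<mu> N"
  interpret G: tensor_product M N R \<rho> \<mu> ?G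
    by (intro tensor_product.intro T.abM T.abN T.rho_closed T.mu_closed refl)
  have pt: "x \<boxtimes>\<^bsub>?G\<^esub> y = x \<boxtimes>\<^bsub>T\<^esub> y" for x y
    by (rule pure_tensor_cong) (simp add: T.zero_T)
  have sm': "\<kappa> \<odot>\<^bsub>T\<^esub> z = tmap ?G (\<lambda>x. \<kappa> \<odot>\<^bsub>M\<^esub> x) (\<lambda>y. y) z" for \<kappa> z
    by (simp add: sm tensor_simps tmap_def)
  have tm: "tensor_map M N R \<rho> \<mu> T M N R \<rho> \<mu> ?G (\<lambda>x. \<kappa> \<odot>\<^bsub>M\<^esub> x) (\<lambda>y. y)" if "\<kappa> \<in> carrier K" for \<kappa>
  proof (intro tensor_map.intro tp tensor_map_axioms.intro add_map_module[OF mM] add_map_ident that)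
    show "tensor_product M N R \<rho> \<mu> ?G" ..
    show "(\<kappa> \<odot>\<^bsub>M\<^esub> \<rho> x r) \<boxtimes>\<^bsub>?G\<^esub> y = (\<kappa> \<odot>\<^bsub>M\<^esub> x) \<boxtimes>\<^bsub>?G\<^esub> \<mu> r y"
      if "x \<in> carrier M" "r \<in> R" "y \<in> carrier N" for x r y
      using that \<open>\<kappa> \<in> carrier K\<close> by (simp add: lin[symmetric] G.pure_balanced)
  qed
  have add: "(\<lambda>z. \<kappa> \<odot>\<^bsub>T\<^esub> z) \<in> add_map T T" if "\<kappa> \<in> carrier K" for \<kappa>
    using tensor_map.add_map[OF tm[OF that]] by (simp add: sm' add_map_def T.carrier_T T.add_T)
  show pure: "\<kappa> \<odot>\<^bsub>T\<^esub> (x \<boxtimes>\<^bsub>T\<^esub> y) = (\<kappa> \<odot>\<^bsub>M\<^esub> x) \<boxtimes>\<^bsub>T\<^esub> y"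
    if "\<kappa> \<in> carrier K" "x \<in> carrier M" "y \<in> carrier N" for \<kappa> x y
    using tensor_map.pure[OF tm[OF that(1)] that(2,3)] by (simp add: sm' pt)
  note closed = add_map_closed[OF add]
  note dist = add_map_add[OF add]
  show "module K T"
  proof (rule moduleI)
    show "cring K" ..
    show "(a \<oplus>\<^bsub>K\<^esub> b) \<odot>\<^bsub>T\<^esub> x = a \<odot>\<^bsub>T\<^esub> x \<oplus>\<^bsub>T\<^esub> b \<odot>\<^bsub>T\<^esub> x"
      if "a \<in> carrier K" "b \<in> carrier K" "x \<in> carrier T" for a b x
      using that(3)
      by (induction rule: T.tensor_induct)
        (use that(1,2) in \<open>simp_all add: pure M.smult_l_distr T.pure_add_left dist closed T.T.a_ac\<close>)
    show "(a \<otimes>\<^bsub>K\<^esub> b) \<odot>\<^bsub>T\<^esub> x = a \<odot>\<^bsub>T\<^esub> (b \<odot>\<^bsub>T\<^esub> x)"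
      if "a \<in> carrier K" "b \<in> carrier K" "x \<in> carrier T" for a b x
      using that(3)
      by (induction rule: T.tensor_induct)
        (use that(1,2) in \<open>simp_all add: pure M.smult_assoc1 dist closed\<close>)
    show "\<one>\<^bsub>K\<^esub> \<odot>\<^bsub>T\<^esub> x = x" if "x \<in> carrier T" for x
      using that by (induction rule: T.tensor_induct) (simp_all add: pure dist)
  qed (use closed dist T.ab in auto)
qed

lemma tensor_product_ktensor:
  assumes "module K M" "module K N"
    and "carrier T = carrier (ktensor K M N)" "(\<oplus>\<^bsub>T\<^esub>) = (\<oplus>\<^bsub>ktensor K M N\<^esub>)"
      "\<zero>\<^bsub>T\<^esub> = \<zero>\<^bsub>ktensor K M N\<^esub>"
  shows "tensor_product M N (carrier K) (\<lambda>x \<kappa>. \<kappa> \<odot>\<^bsub>M\<^esub> x) (\<lambda>\<kappa> y. \<kappa> \<odot>\<^bsub>N\<^esub> y) T"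
proof -
  interpret M: module K M by fact
  interpret N: module K N by fact
  show ?thesis
    by (intro tensor_product.intro M.abelian_group_axioms N.abelian_group_axioms)
      (simp_all add: assms(3-5) ktensor_def tensor_simps)
qed

lemma k_algebra_module: "k_algebra K A \<Longrightarrow> module K A"
  by (simp add: k_algebra_def)

text \<open>
  The common pattern behind the two actions on an external product and the product of a tensor
  product of algebras.
\<close>

locale tensor_action =
  T: tensor_product P P' R \<rho> \<mu> T +
  W: tensor_product C C' "carrier K" "\<lambda>x \<kappa>. \<kappa> \<odot>\<^bsub>C\<^esub> x" "\<lambda>\<kappa> y. \<kappa> \<odot>\<^bsub>C'\<^esub> y" W
  for P P' R \<rho> \<mu> T and K :: "'k ring" and C C' W +
  fixes r r'
  assumes r: "r \<in> biadd_map C P P" and r': "r' \<in> biadd_map C' P' P'"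
    and r_bal: "\<And>c c' x a y. \<lbrakk>c \<in> carrier C; c' \<in> carrier C'; x \<in> carrier P; a \<in> R; y \<in> carrier P'\<rbrakk>
      \<Longrightarrow> r c (\<rho> x a) \<boxtimes>\<^bsub>T\<^esub> r' c' y = r c x \<boxtimes>\<^bsub>T\<^esub> r' c' (\<mu> a y)"
    and r_smult: "\<And>\<kappa> c c' x y. \<lbrakk>\<kappa> \<in> carrier K; c \<in> carrier C; c' \<in> carrier C'; x \<in> carrier P; y \<in> carrier P'\<rbrakk>
      \<Longrightarrow> r (\<kappa> \<odot>\<^bsub>C\<^esub> c) x \<boxtimes>\<^bsub>T\<^esub> r' c' y = r c x \<boxtimes>\<^bsub>T\<^esub> r' (\<kappa> \<odot>\<^bsub>C'\<^esub> c') y"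
begin

text \<open>The acting element comes first also for right actions, so that left actions, right
  actions and right multiplication in a tensor product of algebras are instances of one
  definition.\<close>

definition "act w z = tlift T (\<lambda>c c'. tmap T (r c) (r' c') z) w"

lemma tm:
  assumes "c \<in> carrier C" "c' \<in> carrier C'"
  shows "tensor_map P P' R \<rho> \<mu> T P P' R \<rho> \<mu> T (r c) (r' c')"
  using assms biadd_map_right[OF r] biadd_map_right[OF r'] biadd_map_closed[OF r] biadd_map_closed[OF r']
  by (intro tensor_map.intro tensor_map_axioms.intro T.tensor_product_axioms)
    (simp_all add: r_bal)

lemmas tm_add = tensor_map.add_map[OF tm]
lemmas tm_pure = tensor_map.pure[OF tm]
lemmas rc = biadd_map_closed[OF r] biadd_map_closed[OF r']
  add_map_add[OF biadd_map_left[OF r]] add_map_add[OF biadd_map_left[OF r']]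

lemma inner_biadd:
  assumes "z \<in> carrier T"
  shows "(\<lambda>c c'. tmap T (r c) (r' c') z) \<in> biadd_map C C' T"
proof (intro biadd_mapI add_mapI)
  interpret C: abelian_group C by (rule W.abM)
  interpret C': abelian_group C' by (rule W.abN)
  show "tmap T (r c) (r' c') z \<in> carrier T" if "c \<in> carrier C" "c' \<in> carrier C'" for c c'
    using add_map_closed[OF tm_add[OF that] assms] .
  then show "tmap T (r c) (r' c') z \<in> carrier T" if "c' \<in> carrier C'" "c \<in> carrier C" for c c'
    using that by blast
  show "tmap T (r c) (r' (c' \<oplus>\<^bsub>C'\<^esub> d')) z = tmap T (r c) (r' c') z \<oplus>\<^bsub>T\<^esub> tmap T (r c) (r' d') z"
    if "c \<in> carrier C" "c' \<in> carrier C'" "d' \<in> carrier C'" for c c' d'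
    using assms
    by (induction rule: T.tensor_induct)
      (use that in \<open>simp_all add: tm_pure rc T.pure_add_right add_map_add[OF tm_add]
          add_map_closed[OF tm_add] T.T.a_ac\<close>)
  show "tmap T (r (c \<oplus>\<^bsub>C\<^esub> d)) (r' c') z = tmap T (r c) (r' c') z \<oplus>\<^bsub>T\<^esub> tmap T (r d) (r' c') z"
    if "c' \<in> carrier C'" "c \<in> carrier C" "d \<in> carrier C" for c c' d
    using assms
    by (induction rule: T.tensor_induct)
      (use that in \<open>simp_all add: tm_pure rc T.pure_add_left add_map_add[OF tm_add]
          add_map_closed[OF tm_add] T.T.a_ac\<close>)
qed

lemma inner_bal:
  assumes "z \<in> carrier T" "c \<in> carrier C" "\<kappa> \<in> carrier K" "c' \<in> carrier C'"
  shows "tmap T (r (\<kappa> \<odot>\<^bsub>C\<^esub> c)) (r' c') z = tmap T (r c) (r' (\<kappa> \<odot>\<^bsub>C'\<^esub> c')) z"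
proof -
  note [simp] = W.rho_closed W.mu_closed
  show ?thesis
    using assms(1)
    by (induction rule: T.tensor_induct)
      (use assms(2-4) in \<open>simp_all add: tm_pure rc r_smult add_map_add[OF tm_add]\<close>)
qed

lemma act_pure_left:
  assumes "z \<in> carrier T" "c \<in> carrier C" "c' \<in> carrier C'"
  shows "act (c \<boxtimes>\<^bsub>W\<^esub> c') z = tmap T (r c) (r' c') z"
  unfolding act_def by (rule W.tlift_pure[OF T.ab inner_biadd inner_bal]) (use assms in auto)

lemma act_pure:
  "\<lbrakk>c \<in> carrier C; c' \<in> carrier C'; p \<in> carrier P; p' \<in> carrier P'\<rbrakk>
    \<Longrightarrow> act (c \<boxtimes>\<^bsub>W\<^esub> c') (p \<boxtimes>\<^bsub>T\<^esub> p') = r c p \<boxtimes>\<^bsub>T\<^esub> r' c' p'"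
  by (simp add: act_pure_left tm_pure)

lemma act_left: "z \<in> carrier T \<Longrightarrow> (\<lambda>w. act w z) \<in> add_map W T"
  unfolding act_def using W.tlift_add_map[OF T.ab inner_biadd inner_bal] by blast

lemma act_biadd: "act \<in> biadd_map W T T"
proof (rule biadd_mapI)
  have cl: "act w z \<in> carrier T" if "w \<in> carrier W" "z \<in> carrier T" for w z
    using act_left add_map_closed that by fast
  show "act w \<in> add_map T T" if w: "w \<in> carrier W" for w
  proof (rule add_mapI)
    show "act w (x \<oplus>\<^bsub>T\<^esub> y) = act w x \<oplus>\<^bsub>T\<^esub> act w y"
      if xy: "x \<in> carrier T" "y \<in> carrier T" for x y
      using w
    proof (induction rule: W.tensor_induct)
      case (pure c c')
      then show ?case using xy by (simp add: act_pure_left add_map_add[OF tm_add])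
    next
      case (add v w)
      then show ?case
        using xy cl by (simp add: add_map_add[OF act_left] T.T.a_ac)
    qed
  qed (use cl w in auto)
qed (rule act_left)

end

section \<open>Tensor products of algebras\<close>

lemma alg_tensor_simps:
  "carrier (alg_tensor K A B) = carrier (ktensor K A B)"
  "(\<oplus>\<^bsub>alg_tensor K A B\<^esub>) = (\<oplus>\<^bsub>ktensor K A B\<^esub>)"
  "\<zero>\<^bsub>alg_tensor K A B\<^esub> = \<zero>\<^bsub>ktensor K A B\<^esub>"
  "\<kappa> \<odot>\<^bsub>alg_tensor K A B\<^esub> z = \<kappa> \<odot>\<^bsub>ktensor K A B\<^esub> z"
  "pure_tensor (alg_tensor K A B) = pure_tensor (ktensor K A B)"
  "\<one>\<^bsub>alg_tensor K A B\<^esub> = \<one>\<^bsub>A\<^esub> \<boxtimes>\<^bsub>ktensor K A B\<^esub> \<one>\<^bsub>B\<^esub>"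
  "z \<otimes>\<^bsub>alg_tensor K A B\<^esub> w = tlift (ktensor K A B) (\<lambda>a b. tmap (ktensor K A B)
     (\<lambda>x. x \<otimes>\<^bsub>A\<^esub> a) (\<lambda>y. y \<otimes>\<^bsub>B\<^esub> b) z) w"
  by (simp_all add: alg_tensor_def Let_def pure_tensor_def fun_eq_iff)

locale algebra_pair =
  fixes K :: "'k ring" and A :: "('k, 'a) module" and B :: "('k, 'b) module"
  assumes alg_A: "k_algebra K A" and alg_B: "k_algebra K B"
begin

sublocale A: k_algebra K A by (rule alg_A)
sublocale B: k_algebra K B by (rule alg_B)

sublocale tensor_product A B "carrier K" "\<lambda>x \<kappa>. \<kappa> \<odot>\<^bsub>A\<^esub> x" "\<lambda>\<kappa> y. \<kappa> \<odot>\<^bsub>B\<^esub> y" "alg_tensor K A B"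
  by (rule tensor_product_ktensor) (simp_all add: alg_tensor_simps k_algebra_module alg_A alg_B)

lemma mod: "module K (alg_tensor K A B)"
  by (rule module_tensor[OF tensor_product_axioms])
    (auto simp: alg_tensor_simps ktensor_def k_algebra_module alg_A A.smult_assoc1[symmetric] A.R.m_comm)

lemma smult_pure:
  "\<lbrakk>\<kappa> \<in> carrier K; x \<in> carrier A; y \<in> carrier B\<rbrakk>
    \<Longrightarrow> \<kappa> \<odot>\<^bsub>alg_tensor K A B\<^esub> (x \<boxtimes>\<^bsub>alg_tensor K A B\<^esub> y) = (\<kappa> \<odot>\<^bsub>A\<^esub> x) \<boxtimes>\<^bsub>alg_tensor K A B\<^esub> y"
  by (rule tensor_smult_pure[OF tensor_product_axioms])
    (auto simp: alg_tensor_simps ktensor_def k_algebra_module alg_A A.smult_assoc1[symmetric] A.R.m_comm)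

text \<open>A tensor product of algebras acts on itself by right multiplication in both factors, and
  its product is this action. The space acted upon is \<open>ktensor\<close> because the product is
  defined with values there.\<close>

lemma act: "tensor_action A B (carrier K) (\<lambda>x \<kappa>. \<kappa> \<odot>\<^bsub>A\<^esub> x) (\<lambda>\<kappa> y. \<kappa> \<odot>\<^bsub>B\<^esub> y) (ktensor K A B)
    K A B (alg_tensor K A B) (\<lambda>c p. p \<otimes>\<^bsub>A\<^esub> c) (\<lambda>c p. p \<otimes>\<^bsub>B\<^esub> c)"
proof -
  interpret T: tensor_product A B "carrier K" "\<lambda>x \<kappa>. \<kappa> \<odot>\<^bsub>A\<^esub> x" "\<lambda>\<kappa> y. \<kappa> \<odot>\<^bsub>B\<^esub> y" "ktensor K A B"
    by (rule tensor_product_ktensor) (simp_all add: k_algebra_module alg_A alg_B)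
  show ?thesis
    by (intro tensor_action.intro tensor_product_axioms T.tensor_product_axioms tensor_action_axioms.intro)
      (auto intro!: biadd_mapI add_mapI
        simp: A.r_distr B.r_distr A.l_distr B.l_distr A.smult_mult_left A.smult_mult_right
          B.smult_mult_left B.smult_mult_right T.pure_balanced)
qed

lemma mult_act: "z \<otimes>\<^bsub>alg_tensor K A B\<^esub> w
    = tensor_action.act (ktensor K A B) (\<lambda>c p. p \<otimes>\<^bsub>A\<^esub> c) (\<lambda>c p. p \<otimes>\<^bsub>B\<^esub> c) w z"
  by (simp add: tensor_action.act_def[OF act] alg_tensor_simps)

lemma mult_pure:
  "\<lbrakk>a \<in> carrier A; b \<in> carrier B; a' \<in> carrier A; b' \<in> carrier B\<rbrakk>
    \<Longrightarrow> (a \<boxtimes>\<^bsub>alg_tensor K A B\<^esub> b) \<otimes>\<^bsub>alg_tensor K A B\<^esub> (a' \<boxtimes>\<^bsub>alg_tensor K A B\<^esub> b')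
      = (a \<otimes>\<^bsub>A\<^esub> a') \<boxtimes>\<^bsub>alg_tensor K A B\<^esub> (b \<otimes>\<^bsub>B\<^esub> b')"
  using tensor_action.act_pure[OF act, of a' b' a b] unfolding mult_act by (simp add: alg_tensor_simps)

lemma mult_biadd:
  "(\<lambda>w z. z \<otimes>\<^bsub>alg_tensor K A B\<^esub> w) \<in> biadd_map (alg_tensor K A B) (alg_tensor K A B) (alg_tensor K A B)"
  using tensor_action.act_biadd[OF act]
  unfolding mult_act by (simp add: biadd_map_def add_map_def alg_tensor_simps)

lemma one_pure: "\<one>\<^bsub>alg_tensor K A B\<^esub> = \<one>\<^bsub>A\<^esub> \<boxtimes>\<^bsub>alg_tensor K A B\<^esub> \<one>\<^bsub>B\<^esub>"
  by (simp add: alg_tensor_simps)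

lemma alg: "k_algebra K (alg_tensor K A B)"
proof -
  let ?T = "alg_tensor K A B"
  interpret m: module K ?T by (rule mod)
  note mc = biadd_map_closed[OF mult_biadd, simp]
  note md = add_map_add[OF biadd_map_left[OF mult_biadd]] add_map_add[OF biadd_map_right[OF mult_biadd]]
  note ind = tensor_induct
  have one: "\<one>\<^bsub>?T\<^esub> \<in> carrier ?T" by (auto simp: one_pure)
  have assoc: "x \<otimes>\<^bsub>?T\<^esub> y \<otimes>\<^bsub>?T\<^esub> z = x \<otimes>\<^bsub>?T\<^esub> (y \<otimes>\<^bsub>?T\<^esub> z)"
    if x: "x \<in> carrier ?T" and y: "y \<in> carrier ?T" and z: "z \<in> carrier ?T" for x y z
    using x
  proof (induction rule: ind)
    case (pure a b)
    note ab = pure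
    show ?case
      using y
    proof (induction rule: ind)
      case (pure a' b')
      note ab' = pure
      show ?case
        using z
        by (induction rule: ind)
          (use ab ab' in \<open>simp_all add: mult_pure A.m_assoc B.m_assoc md\<close>)
    qed (use ab z in \<open>simp add: md\<close>)
  qed (use y z in \<open>simp add: md\<close>)
  have l1: "\<one>\<^bsub>?T\<^esub> \<otimes>\<^bsub>?T\<^esub> x = x" "x \<otimes>\<^bsub>?T\<^esub> \<one>\<^bsub>?T\<^esub> = x" if "x \<in> carrier ?T" for x
    using that by (induction rule: ind) (use one in \<open>simp_all add: md\<close>, simp_all add: one_pure mult_pure)
  have sm: "(\<kappa> \<odot>\<^bsub>?T\<^esub> x) \<otimes>\<^bsub>?T\<^esub> y = \<kappa> \<odot>\<^bsub>?T\<^esub> (x \<otimes>\<^bsub>?T\<^esub> y) \<and> x \<otimes>\<^bsub>?T\<^esub> (\<kappa> \<odot>\<^bsub>?T\<^esub> y) = \<kappa> \<odot>\<^bsub>?T\<^esub> (x \<otimes>\<^bsub>?T\<^esub> y)"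
    if x: "x \<in> carrier ?T" and y: "y \<in> carrier ?T" and k: "\<kappa> \<in> carrier K" for \<kappa> x y
    using x
  proof (induction rule: ind)
    case (pure a b)
    note ab = pure
    show ?case
      using y
      by (induction rule: ind)
        (use ab k in \<open>simp_all add: smult_pure mult_pure A.smult_mult_left A.smult_mult_right md m.smult_r_distr\<close>)
  qed (use y k in \<open>simp add: md m.smult_r_distr\<close>)
  have "ring ?T"
    by (rule ringI[OF ab]) (auto intro!: monoidI simp: one assoc l1 md)
  then show ?thesis
    using sm by (intro k_algebra.intro mod k_algebra_axioms.intro) auto
qed

end

section \<open>Bimodules over k-algebras\<close>

locale kbimod =
  fixes K :: "'k ring" and D :: "('k, 'd) module" and C :: "('k, 'c) module"
    and P :: "('k, 'd, 'm, 'c) bimod"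
  assumes alg_D: "k_algebra K D" and alg_C: "k_algebra K C" and mod: "module K P"
    and lact_biadd: "lact P \<in> biadd_map D P P"
    and lact_one: "\<And>p. p \<in> carrier P \<Longrightarrow> lact P \<one>\<^bsub>D\<^esub> p = p"
    and lact_mult: "\<And>d d' p. \<lbrakk>d \<in> carrier D; d' \<in> carrier D; p \<in> carrier P\<rbrakk>
      \<Longrightarrow> lact P (d \<otimes>\<^bsub>D\<^esub> d') p = lact P d (lact P d' p)"
    and lact_smult: "\<And>\<kappa> d p. \<lbrakk>\<kappa> \<in> carrier K; d \<in> carrier D; p \<in> carrier P\<rbrakk>
      \<Longrightarrow> lact P (\<kappa> \<odot>\<^bsub>D\<^esub> d) p = \<kappa> \<odot>\<^bsub>P\<^esub> lact P d p"
    and ract_biadd: "(\<lambda>c p. ract P p c) \<in> biadd_map C P P"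
    and ract_one: "\<And>p. p \<in> carrier P \<Longrightarrow> ract P p \<one>\<^bsub>C\<^esub> = p"
    and ract_mult: "\<And>c c' p. \<lbrakk>c \<in> carrier C; c' \<in> carrier C; p \<in> carrier P\<rbrakk>
      \<Longrightarrow> ract P p (c \<otimes>\<^bsub>C\<^esub> c') = ract P (ract P p c) c'"
    and ract_smult: "\<And>\<kappa> c p. \<lbrakk>\<kappa> \<in> carrier K; c \<in> carrier C; p \<in> carrier P\<rbrakk>
      \<Longrightarrow> ract P p (\<kappa> \<odot>\<^bsub>C\<^esub> c) = \<kappa> \<odot>\<^bsub>P\<^esub> ract P p c"
    and lract: "\<And>d p c. \<lbrakk>d \<in> carrier D; p \<in> carrier P; c \<in> carrier C\<rbrakk>
      \<Longrightarrow> lact P d (ract P p c) = ract P (lact P d p) c"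
begin

lemma ab: "abelian_group P" using mod by (simp add: module_def)

lemma lact_closed: "\<lbrakk>d \<in> carrier D; p \<in> carrier P\<rbrakk> \<Longrightarrow> lact P d p \<in> carrier P"
  by (rule biadd_map_closed[OF lact_biadd])

lemma ract_closed: "\<lbrakk>p \<in> carrier P; c \<in> carrier C\<rbrakk> \<Longrightarrow> ract P p c \<in> carrier P"
  using biadd_map_closed[OF ract_biadd] by blast

lemmas lact_add = add_map_add[OF biadd_map_right[OF lact_biadd]]
lemmas lact_add_left = add_map_add[OF biadd_map_left[OF lact_biadd]]
lemmas ract_add = add_map_add[OF biadd_map_right[OF ract_biadd]]
lemmas ract_add_right = add_map_add[OF biadd_map_left[OF ract_biadd]]

text \<open>A scalar acts on \<open>P\<close> as the element \<open>\<kappa> \<odot> 1\<close> of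
  \<open>D\<close>, which commutes with every \<open>d\<close>. Linearity in the algebra variable
  thus gives linearity in the module variable.\<close>

lemma lact_smult_right:
  assumes "\<kappa> \<in> carrier K" "d \<in> carrier D" "p \<in> carrier P"
  shows "lact P d (\<kappa> \<odot>\<^bsub>P\<^esub> p) = \<kappa> \<odot>\<^bsub>P\<^esub> lact P d p"
proof -
  interpret D: k_algebra K D by (rule alg_D)
  have "lact P d (\<kappa> \<odot>\<^bsub>P\<^esub> p) = lact P d (lact P (\<kappa> \<odot>\<^bsub>D\<^esub> \<one>\<^bsub>D\<^esub>) p)"
    using assms by (simp add: lact_smult lact_one)
  also have "\<dots> = lact P (\<kappa> \<odot>\<^bsub>D\<^esub> d) p"
    using assms by (simp add: lact_mult[symmetric] D.smult_mult_right)
  finally show ?thesis using assms by (simp add: lact_smult)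
qed

lemma ract_smult_left:
  assumes "\<kappa> \<in> carrier K" "c \<in> carrier C" "p \<in> carrier P"
  shows "ract P (\<kappa> \<odot>\<^bsub>P\<^esub> p) c = \<kappa> \<odot>\<^bsub>P\<^esub> ract P p c"
proof -
  interpret C: k_algebra K C by (rule alg_C)
  have "ract P (\<kappa> \<odot>\<^bsub>P\<^esub> p) c = ract P (ract P p (\<kappa> \<odot>\<^bsub>C\<^esub> \<one>\<^bsub>C\<^esub>)) c"
    using assms by (simp add: ract_smult ract_one)
  also have "\<dots> = ract P p (\<kappa> \<odot>\<^bsub>C\<^esub> c)"
    using assms by (simp add: ract_mult[symmetric] C.smult_mult_left)
  finally show ?thesis using assms by (simp add: ract_smult)
qed

end

lemma kbimod_id_cell:
  assumes "k_algebra K A"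
  shows "kbimod K A A (id_cell A)"
proof -
  interpret k_algebra K A by fact
  show ?thesis
  proof (intro kbimod.intro assms)
    show "module K (id_cell A)"
      by (simp add: id_cell_def module_mk_bimod module_axioms)
    show "lact (id_cell A) \<in> biadd_map A (id_cell A) (id_cell A)"
      by (intro biadd_mapI add_mapI) (auto simp: id_cell_def l_distr r_distr)
    show "(\<lambda>c p. ract (id_cell A) p c) \<in> biadd_map A (id_cell A) (id_cell A)"
      by (intro biadd_mapI add_mapI) (auto simp: id_cell_def l_distr r_distr)
  qed (auto simp: id_cell_def m_assoc smult_mult_left smult_mult_right)
qed


lemma kbimod_restrict_right:
  assumes "kbimod K D C P" "k_algebra K C'" "f \<in> alg_hom K C' C"
  shows "kbimod K D C' (restrict_right P f)"
proof -
  interpret kbimod K D C P by fact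
  interpret C': k_algebra K C' by fact
  have f: "f x \<in> carrier C" "f (x \<oplus>\<^bsub>C'\<^esub> y) = f x \<oplus>\<^bsub>C\<^esub> f y" "f (x \<otimes>\<^bsub>C'\<^esub> y) = f x \<otimes>\<^bsub>C\<^esub> f y"
    "\<kappa> \<in> carrier K \<Longrightarrow> f (\<kappa> \<odot>\<^bsub>C'\<^esub> x) = \<kappa> \<odot>\<^bsub>C\<^esub> f x"
    if "x \<in> carrier C'" "y \<in> carrier C'" for x y \<kappa>
    using assms(3) that by (auto simp: alg_hom_def ring_hom_def)
  have f_one: "f \<one>\<^bsub>C'\<^esub> = \<one>\<^bsub>C\<^esub>"
    using assms(3) by (auto simp: alg_hom_def ring_hom_def)
  show ?thesis
  proof (intro kbimod.intro alg_D assms(2))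
    show "module K (restrict_right P f)"
      by (simp add: restrict_right_def module_mk_bimod mod)
    show "lact (restrict_right P f) \<in> biadd_map D (restrict_right P f) (restrict_right P f)"
      using lact_biadd by (simp add: restrict_right_def biadd_map_def add_map_def)
    show "(\<lambda>c p. ract (restrict_right P f) p c) \<in> biadd_map C' (restrict_right P f) (restrict_right P f)"
      by (intro biadd_mapI add_mapI) (auto simp: restrict_right_def f ract_closed ract_add ract_add_right)
  qed (auto simp: restrict_right_def lact_one lact_mult lact_smult ract_one f_one f
      ract_mult ract_smult lract)
qed

section \<open>Composites and external products of bimodules\<close>

locale hcomp_pair = Q: kbimod K E D Q + P: kbimod K D C P for K E D C Q P
begin

sublocale tensor_product Q P "carrier D" "ract Q" "lact P" "hcomp Q D P"
  by (intro tensor_product.intro Q.ab P.ab Q.ract_closed P.lact_closed)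
    (simp_all add: hcomp_def Let_def tensor_simps)

lemma mod: "module K (hcomp Q D P)"
  by (rule module_tensor[OF tensor_product_axioms Q.mod])
    (simp_all add: hcomp_def Let_def Q.ract_smult_left)

lemma smult_pure:
  "\<lbrakk>\<kappa> \<in> carrier K; x \<in> carrier Q; y \<in> carrier P\<rbrakk>
    \<Longrightarrow> \<kappa> \<odot>\<^bsub>hcomp Q D P\<^esub> (x \<boxtimes>\<^bsub>hcomp Q D P\<^esub> y) = (\<kappa> \<odot>\<^bsub>Q\<^esub> x) \<boxtimes>\<^bsub>hcomp Q D P\<^esub> y"
  by (rule tensor_smult_pure[OF tensor_product_axioms Q.mod])
    (simp_all add: hcomp_def Let_def Q.ract_smult_left)

text \<open>The actions on a composite are defined by \<open>tmap\<close> into the bare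
  \<open>tensor\<close>, so the maps are constructed with that target and then transported to
  \<open>hcomp\<close>.\<close>

lemma tensor_product_tensor:
  "tensor_product Q P (carrier D) (ract Q) (lact P) (tensor Q (carrier D) (ract Q) (lact P) P)"
  by (intro tensor_product.intro Q.ab P.ab Q.ract_closed P.lact_closed)
    (simp_all add: tensor_simps)

lemma pure_tensor_hcomp:
  "pure_tensor (tensor Q (carrier D) (ract Q) (lact P) P) = pure_tensor (hcomp Q D P)"
  by (simp add: hcomp_def Let_def)

lemma add_map_tensor:
  "add_map (hcomp Q D P) (tensor Q (carrier D) (ract Q) (lact P) P) = add_map (hcomp Q D P) (hcomp Q D P)"
  by (rule add_map_group_cong) (simp_all add: hcomp_def Let_def)

lemma lact_map:
  assumes "e \<in> carrier E"
  shows "tensor_map Q P (carrier D) (ract Q) (lact P) (hcomp Q D P)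
    Q P (carrier D) (ract Q) (lact P) (tensor Q (carrier D) (ract Q) (lact P) P) (lact Q e) (\<lambda>p. p)"
  by (intro tensor_map.intro tensor_product_axioms tensor_product_tensor tensor_map_axioms.intro
      add_map_ident biadd_map_right[OF Q.lact_biadd])
    (simp_all add: assms Q.lract pure_tensor_hcomp pure_balanced Q.lact_closed)

lemma ract_map:
  assumes "c \<in> carrier C"
  shows "tensor_map Q P (carrier D) (ract Q) (lact P) (hcomp Q D P)
    Q P (carrier D) (ract Q) (lact P) (tensor Q (carrier D) (ract Q) (lact P) P) (\<lambda>q. q) (\<lambda>p. ract P p c)"
  by (intro tensor_map.intro tensor_product_axioms tensor_product_tensor tensor_map_axioms.intro
      add_map_ident biadd_map_right[OF P.ract_biadd])
    (simp_all add: assms P.lract[symmetric] pure_tensor_hcomp pure_balanced P.ract_closed)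

lemma lact_add_map: "e \<in> carrier E \<Longrightarrow> lact (hcomp Q D P) e \<in> add_map (hcomp Q D P) (hcomp Q D P)"
  using tensor_map.add_map[OF lact_map, of e] unfolding add_map_tensor by (simp add: hcomp_def Let_def)

lemma ract_add_map:
  "c \<in> carrier C \<Longrightarrow> (\<lambda>z. ract (hcomp Q D P) z c) \<in> add_map (hcomp Q D P) (hcomp Q D P)"
  using tensor_map.add_map[OF ract_map, of c] unfolding add_map_tensor by (simp add: hcomp_def Let_def)

lemma lact_pure:
  "\<lbrakk>e \<in> carrier E; q \<in> carrier Q; p \<in> carrier P\<rbrakk>
    \<Longrightarrow> lact (hcomp Q D P) e (q \<boxtimes>\<^bsub>hcomp Q D P\<^esub> p) = lact Q e q \<boxtimes>\<^bsub>hcomp Q D P\<^esub> p"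
  using tensor_map.pure[OF lact_map, of e q p] by (simp add: hcomp_def Let_def)

lemma ract_pure:
  "\<lbrakk>q \<in> carrier Q; p \<in> carrier P; c \<in> carrier C\<rbrakk>
    \<Longrightarrow> ract (hcomp Q D P) (q \<boxtimes>\<^bsub>hcomp Q D P\<^esub> p) c = q \<boxtimes>\<^bsub>hcomp Q D P\<^esub> ract P p c"
  using tensor_map.pure[OF ract_map, of c q p] by (simp add: hcomp_def Let_def)

lemma kb: "kbimod K E C (hcomp Q D P)"
proof -
  let ?H = "hcomp Q D P"
  interpret m: module K ?H by (rule mod)
  interpret E: k_algebra K E by (rule Q.alg_D)
  interpret C: k_algebra K C by (rule P.alg_C)
  note cl = add_map_closed[OF lact_add_map] add_map_closed[OF ract_add_map]
  note ad = add_map_add[OF lact_add_map] add_map_add[OF ract_add_map]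
  note pu = lact_pure ract_pure Q.lact_closed P.ract_closed smult_pure m.smult_r_distr
  \<comment> \<open>Scalars act on the left factor, but \<open>C\<close> acts on the right one. The
    scalar crosses the tensor sign as the element \<open>\<kappa> \<odot> 1\<close> of the middle
    algebra \<open>D\<close>.\<close>
  have mid: "\<kappa> \<odot>\<^bsub>?H\<^esub> (q \<boxtimes>\<^bsub>?H\<^esub> p) = q \<boxtimes>\<^bsub>?H\<^esub> (\<kappa> \<odot>\<^bsub>P\<^esub> p)"
    if "\<kappa> \<in> carrier K" "q \<in> carrier Q" "p \<in> carrier P" for \<kappa> q p
  proof -
    interpret D: k_algebra K D by (rule Q.alg_C)
    have "\<kappa> \<odot>\<^bsub>?H\<^esub> (q \<boxtimes>\<^bsub>?H\<^esub> p) = ract Q q (\<kappa> \<odot>\<^bsub>D\<^esub> \<one>\<^bsub>D\<^esub>) \<boxtimes>\<^bsub>?H\<^esub> p"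
      using that by (simp add: smult_pure Q.ract_smult Q.ract_one)
    also have "\<dots> = q \<boxtimes>\<^bsub>?H\<^esub> (\<kappa> \<odot>\<^bsub>P\<^esub> p)"
      using that by (simp add: pure_balanced P.lact_smult P.lact_one)
    finally show ?thesis .
  qed
  show ?thesis
  proof (intro kbimod.intro Q.alg_D P.alg_C mod biadd_mapI lact_add_map ract_add_map)
    show "(\<lambda>e. lact ?H e z) \<in> add_map E ?H" if z: "z \<in> carrier ?H" for z
    proof (rule add_mapI)
      show "lact ?H (d \<oplus>\<^bsub>E\<^esub> e) z = lact ?H d z \<oplus>\<^bsub>?H\<^esub> lact ?H e z" if "d \<in> carrier E" "e \<in> carrier E" for d e
        using z by (induction rule: tensor_induct)
          (use that in \<open>simp_all add: pu ad cl Q.lact_add_left pure_add_left T.a_ac\<close>)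
    qed (use cl z in auto)
    show "(\<lambda>c. ract ?H z c) \<in> add_map C ?H" if z: "z \<in> carrier ?H" for z
    proof (rule add_mapI)
      show "ract ?H z (d \<oplus>\<^bsub>C\<^esub> e) = ract ?H z d \<oplus>\<^bsub>?H\<^esub> ract ?H z e" if "d \<in> carrier C" "e \<in> carrier C" for d e
        using z by (induction rule: tensor_induct)
          (use that in \<open>simp_all add: pu ad cl P.ract_add_right pure_add_right T.a_ac\<close>)
    qed (use cl z in auto)
    show "lact ?H \<one>\<^bsub>E\<^esub> z = z" if "z \<in> carrier ?H" for z
      using that by (induction rule: tensor_induct) (simp_all add: pu ad Q.lact_one)
    show "ract ?H z \<one>\<^bsub>C\<^esub> = z" if "z \<in> carrier ?H" for z
      using that by (induction rule: tensor_induct) (simp_all add: pu ad P.ract_one)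
    show "lact ?H (d \<otimes>\<^bsub>E\<^esub> e) z = lact ?H d (lact ?H e z)"
      if "d \<in> carrier E" "e \<in> carrier E" "z \<in> carrier ?H" for d e z
      using that(3) by (induction rule: tensor_induct)
        (use that(1,2) in \<open>simp_all add: pu ad cl Q.lact_mult\<close>)
    show "ract ?H z (d \<otimes>\<^bsub>C\<^esub> e) = ract ?H (ract ?H z d) e"
      if "d \<in> carrier C" "e \<in> carrier C" "z \<in> carrier ?H" for d e z
      using that(3) by (induction rule: tensor_induct)
        (use that(1,2) in \<open>simp_all add: pu ad cl P.ract_mult\<close>)
    show "lact ?H (\<kappa> \<odot>\<^bsub>E\<^esub> d) z = \<kappa> \<odot>\<^bsub>?H\<^esub> lact ?H d z"
      if "\<kappa> \<in> carrier K" "d \<in> carrier E" "z \<in> carrier ?H" for \<kappa> d z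
      using that(3) by (induction rule: tensor_induct)
        (use that(1,2) in \<open>simp_all add: pu ad cl Q.lact_smult\<close>)
    show "ract ?H z (\<kappa> \<odot>\<^bsub>C\<^esub> d) = \<kappa> \<odot>\<^bsub>?H\<^esub> ract ?H z d"
      if "\<kappa> \<in> carrier K" "d \<in> carrier C" "z \<in> carrier ?H" for \<kappa> d z
      using that(3)
    proof (induction rule: tensor_induct)
      case (pure q p)
      then show ?case using that(1,2) by (simp add: ract_pure P.ract_smult mid P.ract_closed)
    qed (use that(1,2) in \<open>simp add: ad cl m.smult_r_distr\<close>)
    show "lact ?H d (ract ?H z c) = ract ?H (lact ?H d z) c"
      if "d \<in> carrier E" "z \<in> carrier ?H" "c \<in> carrier C" for d z c
      using that(2) by (induction rule: tensor_induct)
        (use that(1,3) in \<open>simp_all add: pu ad cl\<close>)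
  qed
qed

end

locale xtensor_pair = P: kbimod K D C P + P': kbimod K D' C' P' for K D C D' C' P P'
begin

sublocale D: algebra_pair K D D' by (intro algebra_pair.intro P.alg_D P'.alg_D)
sublocale C: algebra_pair K C C' by (intro algebra_pair.intro P.alg_C P'.alg_C)

sublocale tensor_product P P' "carrier K" "\<lambda>x \<kappa>. \<kappa> \<odot>\<^bsub>P\<^esub> x" "\<lambda>\<kappa> y. \<kappa> \<odot>\<^bsub>P'\<^esub> y" "xtensor K P P'"
  by (rule tensor_product_ktensor[OF P.mod P'.mod]) (simp_all add: xtensor_def Let_def)

lemma smult_commute:
  assumes "\<kappa> \<in> carrier K" "\<kappa>' \<in> carrier K" "p \<in> carrier P"
  shows "\<kappa> \<odot>\<^bsub>P\<^esub> (\<kappa>' \<odot>\<^bsub>P\<^esub> p) = \<kappa>' \<odot>\<^bsub>P\<^esub> (\<kappa> \<odot>\<^bsub>P\<^esub> p)"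
proof -
  interpret m: module K P by (rule P.mod)
  show ?thesis using assms by (simp add: m.smult_assoc1[symmetric] D.A.R.m_comm)
qed

lemma mod: "module K (xtensor K P P')"
  by (rule module_tensor[OF tensor_product_axioms P.mod])
    (simp_all add: xtensor_def Let_def ktensor_def smult_commute)

lemma smult_pure:
  "\<lbrakk>\<kappa> \<in> carrier K; x \<in> carrier P; y \<in> carrier P'\<rbrakk>
    \<Longrightarrow> \<kappa> \<odot>\<^bsub>xtensor K P P'\<^esub> (x \<boxtimes>\<^bsub>xtensor K P P'\<^esub> y) = (\<kappa> \<odot>\<^bsub>P\<^esub> x) \<boxtimes>\<^bsub>xtensor K P P'\<^esub> y"
  by (rule tensor_smult_pure[OF tensor_product_axioms P.mod])
    (simp_all add: xtensor_def Let_def ktensor_def smult_commute)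

lemma pure_tensor_xtensor: "pure_tensor (ktensor K P P') = pure_tensor (xtensor K P P')"
  by (simp add: xtensor_def Let_def)

lemma tensor_product_ktens:
  "tensor_product P P' (carrier K) (\<lambda>x \<kappa>. \<kappa> \<odot>\<^bsub>P\<^esub> x) (\<lambda>\<kappa> y. \<kappa> \<odot>\<^bsub>P'\<^esub> y) (ktensor K P P')"
  by (intro tensor_product_ktensor P.mod P'.mod refl)

lemma lact_action: "tensor_action P P' (carrier K) (\<lambda>x \<kappa>. \<kappa> \<odot>\<^bsub>P\<^esub> x) (\<lambda>\<kappa> y. \<kappa> \<odot>\<^bsub>P'\<^esub> y) (ktensor K P P')
    K D D' (alg_tensor K D D') (lact P) (lact P')"
  by (intro tensor_action.intro tensor_product_ktens D.tensor_product_axioms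
      tensor_action_axioms.intro P.lact_biadd P'.lact_biadd)
    (simp_all add: P.lact_smult P'.lact_smult P.lact_smult_right P'.lact_smult_right
      P.lact_closed P'.lact_closed tensor_product.pure_balanced[OF tensor_product_ktens])

lemma ract_action: "tensor_action P P' (carrier K) (\<lambda>x \<kappa>. \<kappa> \<odot>\<^bsub>P\<^esub> x) (\<lambda>\<kappa> y. \<kappa> \<odot>\<^bsub>P'\<^esub> y) (ktensor K P P')
    K C C' (alg_tensor K C C') (\<lambda>c p. ract P p c) (\<lambda>c p. ract P' p c)"
  by (intro tensor_action.intro tensor_product_ktens C.tensor_product_axioms
      tensor_action_axioms.intro P.ract_biadd P'.ract_biadd)
    (simp_all add: P.ract_smult P'.ract_smult P.ract_smult_left P'.ract_smult_left
      P.ract_closed P'.ract_closed tensor_product.pure_balanced[OF tensor_product_ktens])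

lemma lact_act: "lact (xtensor K P P') w z = tensor_action.act (ktensor K P P') (lact P) (lact P') w z"
  by (simp add: tensor_action.act_def[OF lact_action] xtensor_def Let_def)

lemma ract_act: "ract (xtensor K P P') z w
    = tensor_action.act (ktensor K P P') (\<lambda>c p. ract P p c) (\<lambda>c p. ract P' p c) w z"
  by (simp add: tensor_action.act_def[OF ract_action] xtensor_def Let_def)

lemma biadd_map_ktensor:
  "biadd_map W (ktensor K P P') (ktensor K P P') = biadd_map W (xtensor K P P') (xtensor K P P')"
  by (simp add: biadd_map_def add_map_def xtensor_def Let_def)

lemma lact_biadd: "lact (xtensor K P P') \<in> biadd_map (alg_tensor K D D') (xtensor K P P') (xtensor K P P')"
  using tensor_action.act_biadd[OF lact_action] unfolding biadd_map_ktensor lact_act[abs_def] .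

lemma ract_biadd:
  "(\<lambda>c p. ract (xtensor K P P') p c) \<in> biadd_map (alg_tensor K C C') (xtensor K P P') (xtensor K P P')"
  using tensor_action.act_biadd[OF ract_action] unfolding biadd_map_ktensor ract_act[abs_def] .

lemma lact_pure:
  "\<lbrakk>d \<in> carrier D; d' \<in> carrier D'; p \<in> carrier P; p' \<in> carrier P'\<rbrakk>
    \<Longrightarrow> lact (xtensor K P P') (d \<boxtimes>\<^bsub>alg_tensor K D D'\<^esub> d') (p \<boxtimes>\<^bsub>xtensor K P P'\<^esub> p')
      = lact P d p \<boxtimes>\<^bsub>xtensor K P P'\<^esub> lact P' d' p'"
  using tensor_action.act_pure[OF lact_action, of d d' p p'] by (simp add: lact_act pure_tensor_xtensor)

lemma ract_pure:
  "\<lbrakk>p \<in> carrier P; p' \<in> carrier P'; c \<in> carrier C; c' \<in> carrier C'\<rbrakk>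
    \<Longrightarrow> ract (xtensor K P P') (p \<boxtimes>\<^bsub>xtensor K P P'\<^esub> p') (c \<boxtimes>\<^bsub>alg_tensor K C C'\<^esub> c')
      = ract P p c \<boxtimes>\<^bsub>xtensor K P P'\<^esub> ract P' p' c'"
  using tensor_action.act_pure[OF ract_action, of c c' p p'] by (simp add: ract_act pure_tensor_xtensor)

lemma kb: "kbimod K (alg_tensor K D D') (alg_tensor K C C') (xtensor K P P')"
proof -
  let ?X = "xtensor K P P'" and ?D = "alg_tensor K D D'" and ?C = "alg_tensor K C C'"
  interpret m: module K ?X by (rule mod)
  interpret DD: k_algebra K ?D by (rule D.alg)
  interpret CC: k_algebra K ?C by (rule C.alg)
  have lcl: "lact ?X w z \<in> carrier ?X" if "w \<in> carrier ?D" "z \<in> carrier ?X" for w z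
    using biadd_map_closed[OF lact_biadd that] .
  have rcl: "ract ?X z w \<in> carrier ?X" if "w \<in> carrier ?C" "z \<in> carrier ?X" for w z
    using biadd_map_closed[OF ract_biadd that] .
  note cl = lcl rcl P.lact_closed P'.lact_closed P.ract_closed P'.ract_closed
  note ad = add_map_add[OF biadd_map_left[OF lact_biadd]] add_map_add[OF biadd_map_right[OF lact_biadd]]
    add_map_add[OF biadd_map_left[OF ract_biadd]] add_map_add[OF biadd_map_right[OF ract_biadd]]
  note pu = lact_pure ract_pure smult_pure D.smult_pure C.smult_pure D.mult_pure C.mult_pure
    m.smult_r_distr
  show ?thesis
  proof (intro kbimod.intro D.alg C.alg mod lact_biadd ract_biadd)
    show "lact ?X \<one>\<^bsub>?D\<^esub> z = z" if "z \<in> carrier ?X" for z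
      using that by (induction rule: tensor_induct)
        (simp_all only: ad DD.one_closed, simp_all add: D.one_pure lact_pure P.lact_one P'.lact_one)
    show "ract ?X z \<one>\<^bsub>?C\<^esub> = z" if "z \<in> carrier ?X" for z
      using that by (induction rule: tensor_induct)
        (simp_all only: ad CC.one_closed, simp_all add: C.one_pure ract_pure P.ract_one P'.ract_one)
    show "lact ?X (w \<otimes>\<^bsub>?D\<^esub> w') z = lact ?X w (lact ?X w' z)"
      if w: "w \<in> carrier ?D" "w' \<in> carrier ?D" "z \<in> carrier ?X" for w w' z
      using w(1)
    proof (induction rule: D.tensor_induct)
      case (pure a b)
      note ab = pure
      show ?case
        using w(2)
      proof (induction rule: D.tensor_induct)
        case (pure a' b')
        note ab' = pure
        show ?case
          using w(3) by (induction rule: tensor_induct)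
            (use ab ab' in \<open>simp_all add: pu ad cl P.lact_mult P'.lact_mult\<close>)
      qed (use ab w in \<open>simp add: ad cl DD.r_distr\<close>)
    qed (use w in \<open>simp add: ad cl DD.l_distr\<close>)
    show "ract ?X z (w \<otimes>\<^bsub>?C\<^esub> w') = ract ?X (ract ?X z w) w'"
      if w: "w \<in> carrier ?C" "w' \<in> carrier ?C" "z \<in> carrier ?X" for w w' z
      using w(1)
    proof (induction rule: C.tensor_induct)
      case (pure a b)
      note ab = pure
      show ?case
        using w(2)
      proof (induction rule: C.tensor_induct)
        case (pure a' b')
        note ab' = pure
        show ?case
          using w(3) by (induction rule: tensor_induct)
            (use ab ab' in \<open>simp_all add: pu ad cl P.ract_mult P'.ract_mult\<close>)
      qed (use ab w in \<open>simp add: ad cl CC.r_distr\<close>)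
    qed (use w in \<open>simp add: ad cl CC.l_distr\<close>)
    show "lact ?X (\<kappa> \<odot>\<^bsub>?D\<^esub> w) z = \<kappa> \<odot>\<^bsub>?X\<^esub> lact ?X w z"
      if w: "\<kappa> \<in> carrier K" "w \<in> carrier ?D" "z \<in> carrier ?X" for \<kappa> w z
      using w(2)
    proof (induction rule: D.tensor_induct)
      case (pure a b)
      note ab = pure
      show ?case
        using w(3) by (induction rule: tensor_induct)
          (use ab w(1) in \<open>simp_all add: pu ad cl P.lact_smult\<close>)
    qed (use w in \<open>simp add: ad cl m.smult_r_distr DD.smult_r_distr\<close>)
    show "ract ?X z (\<kappa> \<odot>\<^bsub>?C\<^esub> w) = \<kappa> \<odot>\<^bsub>?X\<^esub> ract ?X z w"
      if w: "\<kappa> \<in> carrier K" "w \<in> carrier ?C" "z \<in> carrier ?X" for \<kappa> w z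
      using w(2)
    proof (induction rule: C.tensor_induct)
      case (pure a b)
      note ab = pure
      show ?case
        using w(3) by (induction rule: tensor_induct)
          (use ab w(1) in \<open>simp_all add: pu ad cl P.ract_smult\<close>)
    qed (use w in \<open>simp add: ad cl m.smult_r_distr CC.smult_r_distr\<close>)
    show "lact ?X w (ract ?X z w') = ract ?X (lact ?X w z) w'"
      if w: "w \<in> carrier ?D" "z \<in> carrier ?X" "w' \<in> carrier ?C" for w w' z
      using w(1)
    proof (induction rule: D.tensor_induct)
      case (pure a b)
      note ab = pure
      show ?case
        using w(3)
      proof (induction rule: C.tensor_induct)
        case (pure a' b')
        note ab' = pure
        show ?case
          using w(2) by (induction rule: tensor_induct)
            (use ab ab' in \<open>simp_all add: pu ad cl P.lract P'.lract\<close>)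
      qed (use ab w in \<open>simp add: ad cl\<close>)
    qed (use w in \<open>simp add: ad cl\<close>)
  qed
qed

end

section \<open>Right modules over the ground ring, whiskering, opposite algebras,
  associativity\<close>

lemma k_algebra_ground: "cring K \<Longrightarrow> k_algebra K (ground_alg K)"
proof -
  assume "cring K"
  then interpret cring K .
  have [simp]: "carrier (ground_alg K) = carrier K" "(\<oplus>\<^bsub>ground_alg K\<^esub>) = (\<oplus>\<^bsub>K\<^esub>)"
    "\<zero>\<^bsub>ground_alg K\<^esub> = \<zero>\<^bsub>K\<^esub>" "\<one>\<^bsub>ground_alg K\<^esub> = \<one>\<^bsub>K\<^esub>" "(\<otimes>\<^bsub>ground_alg K\<^esub>) = (\<otimes>\<^bsub>K\<^esub>)"
    "(\<odot>\<^bsub>ground_alg K\<^esub>) = (\<otimes>\<^bsub>K\<^esub>)"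
    by (simp_all add: ground_alg_def ring.extend_def module.fields_def)
  have ag: "abelian_group (ground_alg K)" by (rule abelian_group_cong[OF abelian_group_axioms]) simp_all
  show ?thesis
    by (intro k_algebra.intro moduleI ringI monoidI k_algebra_axioms.intro ag is_cring)
      (auto simp: m_assoc l_distr r_distr m_lcomm)
qed

lemma lact_ground:
  assumes "kbimod K (ground_alg K) C P" "\<kappa> \<in> carrier K" "p \<in> carrier P"
  shows "lact P \<kappa> p = ract P p (\<kappa> \<odot>\<^bsub>C\<^esub> \<one>\<^bsub>C\<^esub>)"
proof -
  interpret kbimod K "ground_alg K" C P by fact
  let ?D = "ground_alg K"
  interpret D: k_algebra K ?D by (rule alg_D)
  interpret C: k_algebra K C by (rule alg_C)
  have g: "\<kappa> \<odot>\<^bsub>?D\<^esub> \<one>\<^bsub>?D\<^esub> = \<kappa>"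
    using assms(2) by (simp add: ground_alg_def ring.extend_def module.fields_def)
  have "lact P (\<kappa> \<odot>\<^bsub>?D\<^esub> \<one>\<^bsub>?D\<^esub>) p = ract P p (\<kappa> \<odot>\<^bsub>C\<^esub> \<one>\<^bsub>C\<^esub>)"
    using assms by (simp add: lact_smult lact_one ract_smult ract_one)
  then show ?thesis by (simp add: g)
qed

text \<open>By \<open>lact_ground\<close> a scalar acts from the left as
  \<open>\<kappa> \<odot> 1\<close> acts from the right, so for right modules linearity over the
  ground ring is a consequence of right linearity.\<close>

lemma two_cell_groundI:
  assumes P: "kbimod K (ground_alg K) C P" and Q: "kbimod K (ground_alg K) C Q"
    and f: "f \<in> add_map P Q"
    and eq: "\<And>p c. \<lbrakk>p \<in> carrier P; c \<in> carrier C\<rbrakk> \<Longrightarrow> f (ract P p c) = ract Q (f p) c"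
  shows "f \<in> two_cell (ground_alg K) C P Q"
proof -
  interpret P: kbimod K "ground_alg K" C P by fact
  interpret Q: kbimod K "ground_alg K" C Q by fact
  interpret C: k_algebra K C by (rule P.alg_C)
  have g: "carrier (ground_alg K) = carrier K"
    by (simp add: ground_alg_def ring.extend_def module.fields_def)
  show ?thesis
    using f by (auto simp: two_cell_def g add_map_def eq lact_ground[OF P] lact_ground[OF Q] Pi_iff)
qed

text \<open>Scalars act through \<open>\<kappa> \<odot> 1\<close> in \<open>D\<close>, so a
  \<open>D\<close>-linear map is automatically linear over the ground ring.\<close>

lemma left_linear_smult:
  assumes P: "kbimod K D C P" and P': "kbimod K D C' P'" and g: "g \<in> add_map P P'"
    and lin: "\<And>d p. \<lbrakk>d \<in> carrier D; p \<in> carrier P\<rbrakk> \<Longrightarrow> g (lact P d p) = lact P' d (g p)"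
    and "\<kappa> \<in> carrier K" "p \<in> carrier P"
  shows "g (\<kappa> \<odot>\<^bsub>P\<^esub> p) = \<kappa> \<odot>\<^bsub>P'\<^esub> g p"
proof -
  interpret P: kbimod K D C P by fact
  interpret P': kbimod K D C' P' by fact
  interpret D: k_algebra K D by (rule P.alg_D)
  have "g (lact P (\<kappa> \<odot>\<^bsub>D\<^esub> \<one>\<^bsub>D\<^esub>) p) = lact P' (\<kappa> \<odot>\<^bsub>D\<^esub> \<one>\<^bsub>D\<^esub>) (g p)"
    using assms by (intro lin) auto
  then show ?thesis
    using assms add_map_closed[OF g] by (simp add: P.lact_smult P'.lact_smult P.lact_one P'.lact_one)
qed

text \<open>The middle algebra may change along \<open>h\<close>. With \<open>h\<close> the identity
  this is whiskering by a 2-cell; with \<open>eta_eta\<close> it yields the coherence maps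
  \<open>coh_left\<close> and \<open>coh_right\<close>.\<close>

lemma whisker_map:
  assumes S: "hcomp_pair K E D C Q P" and T: "hcomp_pair K E D' C' Q' P'"
    and f: "f \<in> add_map Q Q'" and g: "g \<in> add_map P P'"
    and h: "\<And>d. d \<in> carrier D \<Longrightarrow> h d \<in> carrier D'"
    and flin: "\<And>q d. \<lbrakk>q \<in> carrier Q; d \<in> carrier D\<rbrakk> \<Longrightarrow> f (ract Q q d) = ract Q' (f q) (h d)"
    and glin: "\<And>d p. \<lbrakk>d \<in> carrier D; p \<in> carrier P\<rbrakk> \<Longrightarrow> g (lact P d p) = lact P' (h d) (g p)"
  shows "tensor_map Q P (carrier D) (ract Q) (lact P) (hcomp Q D P)
    Q' P' (carrier D') (ract Q') (lact P') (hcomp Q' D' P') f g"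
proof -
  interpret S: hcomp_pair K E D C Q P by fact
  interpret T: hcomp_pair K E D' C' Q' P' by fact
  show ?thesis
    by (intro tensor_map.intro S.tensor_product_axioms T.tensor_product_axioms tensor_map_axioms.intro f g)
      (simp add: flin glin T.pure_balanced add_map_closed[OF f] add_map_closed[OF g] h)
qed

lemma alg_op_simps [simp]:
  "carrier (alg_op A) = carrier A" "(\<oplus>\<^bsub>alg_op A\<^esub>) = (\<oplus>\<^bsub>A\<^esub>)" "\<zero>\<^bsub>alg_op A\<^esub> = \<zero>\<^bsub>A\<^esub>"
  "\<one>\<^bsub>alg_op A\<^esub> = \<one>\<^bsub>A\<^esub>" "x \<otimes>\<^bsub>alg_op A\<^esub> y = y \<otimes>\<^bsub>A\<^esub> x" "(\<odot>\<^bsub>alg_op A\<^esub>) = (\<odot>\<^bsub>A\<^esub>)"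
  by (simp_all add: alg_op_def)

lemma k_algebra_alg_op:
  assumes "k_algebra K A" shows "k_algebra K (alg_op A)"
proof -
  interpret k_algebra K A by fact
  have ag: "abelian_group (alg_op A)" by (rule abelian_group_cong[OF M.abelian_group_axioms]) simp_all
  show ?thesis
    by (intro k_algebra.intro moduleI ringI monoidI k_algebra_axioms.intro ag R.is_cring)
      (auto simp: m_assoc l_distr r_distr smult_l_distr smult_r_distr smult_assoc1
        smult_mult_left smult_mult_right)
qed

lemma alg_homD:
  assumes "f \<in> alg_hom K A B"
  shows "\<And>x. x \<in> carrier A \<Longrightarrow> f x \<in> carrier B"
    and "\<And>x y. \<lbrakk>x \<in> carrier A; y \<in> carrier A\<rbrakk> \<Longrightarrow> f (x \<oplus>\<^bsub>A\<^esub> y) = f x \<oplus>\<^bsub>B\<^esub> f y"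
    and "\<And>x y. \<lbrakk>x \<in> carrier A; y \<in> carrier A\<rbrakk> \<Longrightarrow> f (x \<otimes>\<^bsub>A\<^esub> y) = f x \<otimes>\<^bsub>B\<^esub> f y"
    and "f \<one>\<^bsub>A\<^esub> = \<one>\<^bsub>B\<^esub>"
    and "\<And>\<kappa> x. \<lbrakk>\<kappa> \<in> carrier K; x \<in> carrier A\<rbrakk> \<Longrightarrow> f (\<kappa> \<odot>\<^bsub>A\<^esub> x) = \<kappa> \<odot>\<^bsub>B\<^esub> f x"
    and "f \<in> add_map A B"
  using assms by (auto simp: alg_hom_def ring_hom_def add_map_def)

lemma alg_homI:
  assumes "f \<in> add_map A B"
    and "\<And>x y. \<lbrakk>x \<in> carrier A; y \<in> carrier A\<rbrakk> \<Longrightarrow> f (x \<otimes>\<^bsub>A\<^esub> y) = f x \<otimes>\<^bsub>B\<^esub> f y"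
    and "f \<one>\<^bsub>A\<^esub> = \<one>\<^bsub>B\<^esub>"
    and "\<And>\<kappa> x. \<lbrakk>\<kappa> \<in> carrier K; x \<in> carrier A\<rbrakk> \<Longrightarrow> f (\<kappa> \<odot>\<^bsub>A\<^esub> x) = \<kappa> \<odot>\<^bsub>B\<^esub> f x"
  shows "f \<in> alg_hom K A B"
  using assms by (auto simp: alg_hom_def ring_hom_def add_map_def)

lemma alg_hom_inv_into:
  assumes A: "k_algebra K A" and f: "f \<in> alg_hom K A B" and b: "bij_betw f (carrier A) (carrier B)"
  shows "inv_into (carrier A) f \<in> alg_hom K B A"
proof -
  interpret k_algebra K A by fact
  have im: "f ` carrier A = carrier B" and inj: "inj_on f (carrier A)"
    using b by (auto simp: bij_betw_def)
  let ?g = "inv_into (carrier A) f"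
  have c: "?g y \<in> carrier A" "f (?g y) = y" if "y \<in> carrier B" for y
    using that im by (auto simp: inv_into_into f_inv_into_f)
  have i: "?g y = x" if "x \<in> carrier A" "f x = y" for x y
    using inj that by auto
  show ?thesis
    by (intro alg_homI add_mapI i) (auto simp: c alg_homD[OF f])
qed

lemma tassoc_alg_hom:
  assumes A: "k_algebra K A" and B: "k_algebra K B" and C: "k_algebra K C"
  shows "tassoc (alg_tensor K A (alg_tensor K B C)) (alg_tensor K B C)
      \<in> alg_hom K (alg_tensor K (alg_tensor K A B) C) (alg_tensor K A (alg_tensor K B C))"
    (is "?f \<in> alg_hom K ?L ?R")
    and "\<And>a b c. \<lbrakk>a \<in> carrier A; b \<in> carrier B; c \<in> carrier C\<rbrakk> \<Longrightarrow>
      tassoc (alg_tensor K A (alg_tensor K B C)) (alg_tensor K B C)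
        ((a \<boxtimes>\<^bsub>alg_tensor K A B\<^esub> b) \<boxtimes>\<^bsub>alg_tensor K (alg_tensor K A B) C\<^esub> c)
      = a \<boxtimes>\<^bsub>alg_tensor K A (alg_tensor K B C)\<^esub> (b \<boxtimes>\<^bsub>alg_tensor K B C\<^esub> c)"
proof -
  interpret AB: algebra_pair K A B by (intro algebra_pair.intro A B)
  interpret BC: algebra_pair K B C by (intro algebra_pair.intro B C)
  interpret L: algebra_pair K "alg_tensor K A B" C by (intro algebra_pair.intro AB.alg C)
  interpret R: algebra_pair K A "alg_tensor K B C" by (intro algebra_pair.intro A BC.alg)
  interpret Ra: k_algebra K ?R by (rule R.alg)
  interpret La: k_algebra K ?L by (rule L.alg)
  let ?AB = "alg_tensor K A B" and ?BC = "alg_tensor K B C"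
  have inner: "(\<lambda>x y. x \<boxtimes>\<^bsub>?R\<^esub> (y \<boxtimes>\<^bsub>?BC\<^esub> z)) \<in> biadd_map A B ?R" if "z \<in> carrier C" for z
    by (intro biadd_mapI)
      (use that in \<open>auto intro!: add_map_comp[OF BC.pure_left R.pure_right] R.pure_left\<close>)
  have ibal: "(\<kappa> \<odot>\<^bsub>A\<^esub> x) \<boxtimes>\<^bsub>?R\<^esub> (y \<boxtimes>\<^bsub>?BC\<^esub> z) = x \<boxtimes>\<^bsub>?R\<^esub> ((\<kappa> \<odot>\<^bsub>B\<^esub> y) \<boxtimes>\<^bsub>?BC\<^esub> z)"
    if "\<kappa> \<in> carrier K" "x \<in> carrier A" "y \<in> carrier B" "z \<in> carrier C" for \<kappa> x y z
    using that by (simp add: R.pure_balanced BC.smult_pure)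
  let ?g = "\<lambda>w z. tlift ?R (\<lambda>x y. x \<boxtimes>\<^bsub>?R\<^esub> (y \<boxtimes>\<^bsub>?BC\<^esub> z)) w"
  have g1: "(\<lambda>w. ?g w z) \<in> add_map ?AB ?R" if "z \<in> carrier C" for z
    using AB.tlift_add_map[OF R.ab inner[OF that]] ibal that by blast
  have g1p: "?g (x \<boxtimes>\<^bsub>?AB\<^esub> y) z = x \<boxtimes>\<^bsub>?R\<^esub> (y \<boxtimes>\<^bsub>?BC\<^esub> z)"
    if "x \<in> carrier A" "y \<in> carrier B" "z \<in> carrier C" for x y z
    by (rule AB.tlift_pure[OF R.ab inner]) (use that ibal in auto)
  note g1c = add_map_closed[OF g1]
  note g1a = add_map_add[OF g1]
  have bi: "?g \<in> biadd_map ?AB C ?R"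
  proof (intro biadd_mapI g1 add_mapI)
    show "?g w (y \<oplus>\<^bsub>C\<^esub> z) = ?g w y \<oplus>\<^bsub>?R\<^esub> ?g w z"
      if w: "w \<in> carrier ?AB" and yz: "y \<in> carrier C" "z \<in> carrier C" for w y z
      using w by (induction rule: AB.tensor_induct)
        (use yz in \<open>simp_all add: g1p g1a g1c BC.pure_add_right R.pure_add_right R.T.a_ac\<close>)
  qed (rule g1c)
  have bal: "?g (\<kappa> \<odot>\<^bsub>?AB\<^esub> w) z = ?g w (\<kappa> \<odot>\<^bsub>C\<^esub> z)"
    if w: "w \<in> carrier ?AB" and "\<kappa> \<in> carrier K" "z \<in> carrier C" for \<kappa> w z
    using w by (induction rule: AB.tensor_induct)
      (use that in \<open>simp_all add: AB.smult_pure g1p ibal BC.pure_balanced g1a L.A.smult_r_distr\<close>)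
  have fa: "?f \<in> add_map ?L ?R"
    unfolding tassoc_def by (rule L.tlift_add_map[OF R.ab bi bal])
  show fp: "?f ((x \<boxtimes>\<^bsub>?AB\<^esub> y) \<boxtimes>\<^bsub>?L\<^esub> z) = x \<boxtimes>\<^bsub>?R\<^esub> (y \<boxtimes>\<^bsub>?BC\<^esub> z)"
    if "x \<in> carrier A" "y \<in> carrier B" "z \<in> carrier C" for x y z
    unfolding tassoc_def using L.tlift_pure[OF R.ab bi bal, of "x \<boxtimes>\<^bsub>?AB\<^esub> y" z] that by (simp add: g1p)
  note fc = add_map_closed[OF fa]
  note fad = add_map_add[OF fa]
  have ind: "Q w" if "w \<in> carrier ?L"
    "\<And>x y z. \<lbrakk>x \<in> carrier A; y \<in> carrier B; z \<in> carrier C\<rbrakk> \<Longrightarrow> Q ((x \<boxtimes>\<^bsub>?AB\<^esub> y) \<boxtimes>\<^bsub>?L\<^esub> z)"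
    "\<And>X Y. \<lbrakk>X \<in> carrier ?L; Y \<in> carrier ?L; Q X; Q Y\<rbrakk> \<Longrightarrow> Q (X \<oplus>\<^bsub>?L\<^esub> Y)" for Q w
    using that(1)
  proof (induction rule: L.tensor_induct)
    case (pure u z)
    show ?case
      using pure(1) by (induction rule: AB.tensor_induct)
        (use pure that(2,3) in \<open>auto simp: L.pure_add_left\<close>)
  qed (rule that(3))
  have mult: "?f (v \<otimes>\<^bsub>?L\<^esub> w) = ?f v \<otimes>\<^bsub>?R\<^esub> ?f w" if "v \<in> carrier ?L" "w \<in> carrier ?L" for v w
  proof (rule ind[OF that(1)])
    fix x y z assume xyz: "x \<in> carrier A" "y \<in> carrier B" "z \<in> carrier C"
    show "?f ((x \<boxtimes>\<^bsub>?AB\<^esub> y) \<boxtimes>\<^bsub>?L\<^esub> z \<otimes>\<^bsub>?L\<^esub> w) = ?f ((x \<boxtimes>\<^bsub>?AB\<^esub> y) \<boxtimes>\<^bsub>?L\<^esub> z) \<otimes>\<^bsub>?R\<^esub> ?f w"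
      by (rule ind[OF that(2)])
        (use xyz in \<open>simp_all add: L.mult_pure AB.mult_pure R.mult_pure BC.mult_pure fp
            La.r_distr Ra.r_distr fad fc\<close>)
  qed (use that in \<open>simp add: La.l_distr Ra.l_distr fad fc\<close>)
  show "?f \<in> alg_hom K ?L ?R"
  proof (rule alg_homI[OF fa mult])
    show "?f \<one>\<^bsub>?L\<^esub> = \<one>\<^bsub>?R\<^esub>" by (simp add: L.one_pure AB.one_pure R.one_pure BC.one_pure fp)
    show "?f (\<kappa> \<odot>\<^bsub>?L\<^esub> w) = \<kappa> \<odot>\<^bsub>?R\<^esub> ?f w" if "\<kappa> \<in> carrier K" "w \<in> carrier ?L" for \<kappa> w
      by (rule ind[OF that(2)])
        (use that(1) in \<open>simp_all add: L.smult_pure AB.smult_pure R.smult_pure fp fad fc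
          La.smult_r_distr Ra.smult_r_distr\<close>)
  qed auto
qed

section \<open>Twisted regular bimodules\<close>

text \<open>Both \<open>\<sigma>\<close> (with \<open>\<phi> = \<xi>\<^sup>-\<^sup>1\<close>) and \<open>\<sigma>\<^sub>0\<close> (with \<open>\<phi>(l \<otimes> l') = \<theta>\<^sup>-\<^sup>1(l') \<otimes> l\<close>) are of this form.\<close>

locale twisted = algebra_pair K C C for K :: "'k ring" and C :: "('k, 'c) module" +
  fixes \<phi> and \<sigma> :: "('k, 'k, 'c, ('c, 'c) tens) bimod"
  assumes phi: "\<phi> \<in> alg_hom K C (alg_op C)"
    and sig: "carrier \<sigma> = carrier C" "(\<oplus>\<^bsub>\<sigma>\<^esub>) = (\<oplus>\<^bsub>C\<^esub>)" "\<zero>\<^bsub>\<sigma>\<^esub> = \<zero>\<^bsub>C\<^esub>" "(\<odot>\<^bsub>\<sigma>\<^esub>) = (\<odot>\<^bsub>C\<^esub>)"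
    and lact_sig: "lact \<sigma> = (\<lambda>\<kappa> x. \<kappa> \<odot>\<^bsub>C\<^esub> x)"
    and ract_sig: "\<And>x. x \<in> carrier C \<Longrightarrow> ract \<sigma> x \<in> add_map (alg_tensor K C C) C"
    and ract_sig_pure: "\<And>x a b. \<lbrakk>x \<in> carrier C; a \<in> carrier C; b \<in> carrier C\<rbrakk>
      \<Longrightarrow> ract \<sigma> x (a \<boxtimes>\<^bsub>alg_tensor K C C\<^esub> b) = \<phi> b \<otimes>\<^bsub>C\<^esub> x \<otimes>\<^bsub>C\<^esub> a"
begin

lemmas phi_simps = alg_homD[OF phi, simplified]

lemma ab_sig: "abelian_group \<sigma>"
  by (rule abelian_group_cong[OF abM]) (simp_all add: sig)

lemma mod_sig: "module K \<sigma>"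
  by (rule moduleI[OF A.R.is_cring ab_sig])
    (auto simp: sig A.smult_l_distr A.smult_r_distr A.smult_assoc1)

text \<open>Since \<open>\<phi>\<close> reverses products, left multiplication by
  \<open>\<phi>(b)\<close> is a right action of \<open>b\<close>; it commutes with right
  multiplication by \<open>a\<close>.\<close>

lemma kb_sig: "kbimod K (ground_alg K) (alg_tensor K C C) \<sigma>"
proof -
  let ?T = "alg_tensor K C C"
  interpret T: k_algebra K ?T by (rule alg)
  have g: "carrier (ground_alg K) = carrier K" "(\<oplus>\<^bsub>ground_alg K\<^esub>) = (\<oplus>\<^bsub>K\<^esub>)"
    "\<one>\<^bsub>ground_alg K\<^esub> = \<one>\<^bsub>K\<^esub>" "(\<otimes>\<^bsub>ground_alg K\<^esub>) = (\<otimes>\<^bsub>K\<^esub>)" "(\<odot>\<^bsub>ground_alg K\<^esub>) = (\<otimes>\<^bsub>K\<^esub>)"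
    by (simp_all add: ground_alg_def ring.extend_def module.fields_def)
  note rc = add_map_closed[OF ract_sig]
  note ra = add_map_add[OF ract_sig]
  have rl: "ract \<sigma> (x \<oplus>\<^bsub>C\<^esub> y) w = ract \<sigma> x w \<oplus>\<^bsub>C\<^esub> ract \<sigma> y w"
    if "x \<in> carrier C" "y \<in> carrier C" "w \<in> carrier ?T" for x y w
    using that(3) by (induction rule: tensor_induct)
      (use that(1,2) in \<open>simp_all add: ract_sig_pure ra rc phi_simps A.l_distr A.r_distr A.M.a_ac\<close>)
  show ?thesis
  proof (intro kbimod.intro k_algebra_ground alg mod_sig A.R.is_cring biadd_mapI add_mapI)
    show "ract \<sigma> z (w \<otimes>\<^bsub>?T\<^esub> w') = ract \<sigma> (ract \<sigma> z w) w'"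
      if w: "w \<in> carrier ?T" "w' \<in> carrier ?T" "z \<in> carrier \<sigma>" for w w' z
      using w(1)
    proof (induction rule: tensor_induct)
      case (pure a b)
      note ab = pure
      show ?case
        using w(2)
        by (induction rule: tensor_induct)
          (use ab w(3) in \<open>simp_all add: sig mult_pure ract_sig_pure phi_simps A.m_assoc ra rc T.r_distr\<close>)
    qed (use w in \<open>simp add: ra rc rl sig T.l_distr\<close>)
    show "ract \<sigma> z (\<kappa> \<odot>\<^bsub>?T\<^esub> w) = \<kappa> \<odot>\<^bsub>\<sigma>\<^esub> ract \<sigma> z w"
      if w: "\<kappa> \<in> carrier K" "w \<in> carrier ?T" "z \<in> carrier \<sigma>" for \<kappa> w z
      using w(2) by (induction rule: tensor_induct)
        (use w(1,3) in \<open>simp_all add: sig smult_pure ract_sig_pure phi_simps A.smult_mult_right ra rc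
            T.smult_r_distr A.smult_r_distr\<close>)
    show "lact \<sigma> d (ract \<sigma> p c) = ract \<sigma> (lact \<sigma> d p) c"
      if w: "d \<in> carrier (ground_alg K)" "p \<in> carrier \<sigma>" "c \<in> carrier ?T" for d p c
      using w(3) by (induction rule: tensor_induct)
        (use w(1,2) in \<open>simp_all add: g sig lact_sig ract_sig_pure phi_simps A.smult_mult_right
            A.smult_mult_left ra rc A.smult_r_distr\<close>)
  qed (auto simp: g sig lact_sig A.smult_r_distr A.smult_l_distr A.smult_assoc1 rc ra rl one_pure
      ract_sig_pure phi_simps)
qed

end

text \<open>\<open>\<sigma> \<circ> (P \<otimes> C) \<cong> P\<close> by \<open>x \<otimes> (p \<otimes> c) \<mapsto> \<phi>(c)x \<cdot> p\<close>.\<close>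

locale collapse_left = twisted K C \<phi> \<sigma> + X: xtensor_pair K C C1 C C2 P Y
  for K :: "'k ring" and C :: "('k, 'c) module" and \<phi> \<sigma> C1 C2 P and Y :: "('k, 'c, 'c, 'y) bimod" +
  assumes Y: "carrier Y = carrier C" "(\<oplus>\<^bsub>Y\<^esub>) = (\<oplus>\<^bsub>C\<^esub>)" "(\<odot>\<^bsub>Y\<^esub>) = (\<odot>\<^bsub>C\<^esub>)"
    and lact_Y: "\<And>a y. \<lbrakk>a \<in> carrier C; y \<in> carrier C\<rbrakk> \<Longrightarrow> lact Y a y = a \<otimes>\<^bsub>C\<^esub> y"
begin

sublocale H: hcomp_pair K "ground_alg K" "alg_tensor K C C" "alg_tensor K C1 C2" \<sigma> "xtensor K P Y"
  by (intro hcomp_pair.intro kb_sig X.kb)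

definition coll where
  "coll = tlift P (\<lambda>x w. tlift P (\<lambda>p c. lact P (\<phi> c \<otimes>\<^bsub>C\<^esub> x) p) w)"

abbreviation (input) "inner x w \<equiv> tlift P (\<lambda>p c. lact P (\<phi> c \<otimes>\<^bsub>C\<^esub> x) p) w"

lemma inner:
  assumes x: "x \<in> carrier C"
  shows inner_add: "inner x \<in> add_map (xtensor K P Y) P"
    and inner_pure: "\<And>p c. \<lbrakk>p \<in> carrier P; c \<in> carrier C\<rbrakk>
      \<Longrightarrow> inner x (p \<boxtimes>\<^bsub>xtensor K P Y\<^esub> c) = lact P (\<phi> c \<otimes>\<^bsub>C\<^esub> x) p"
proof -
  note s = phi_simps X.P.lact_closed X.P.lact_add X.P.lact_add_left A.l_distr Y
  have bi: "(\<lambda>p c. lact P (\<phi> c \<otimes>\<^bsub>C\<^esub> x) p) \<in> biadd_map P Y P"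
    by (intro biadd_mapI add_mapI) (use x in \<open>simp_all add: s\<close>)
  have bal: "lact P (\<phi> c \<otimes>\<^bsub>C\<^esub> x) (\<kappa> \<odot>\<^bsub>P\<^esub> p) = lact P (\<phi> (\<kappa> \<odot>\<^bsub>Y\<^esub> c) \<otimes>\<^bsub>C\<^esub> x) p"
    if "p \<in> carrier P" "\<kappa> \<in> carrier K" "c \<in> carrier Y" for p \<kappa> c
    using that x by (simp add: s A.smult_mult_left X.P.lact_smult X.P.lact_smult_right)
  show "inner x \<in> add_map (xtensor K P Y) P"
    by (rule X.tlift_add_map[OF X.P.ab bi bal])
  show "inner x (p \<boxtimes>\<^bsub>xtensor K P Y\<^esub> c) = lact P (\<phi> c \<otimes>\<^bsub>C\<^esub> x) p"
    if "p \<in> carrier P" "c \<in> carrier C" for p c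
    using that X.tlift_pure[OF X.P.ab bi bal, of p c] by (simp add: Y)
qed

lemma
  shows coll_add: "coll \<in> add_map (hcomp \<sigma> (alg_tensor K C C) (xtensor K P Y)) P"
    and coll_pure: "\<And>x p c. \<lbrakk>x \<in> carrier C; p \<in> carrier P; c \<in> carrier C\<rbrakk>
      \<Longrightarrow> coll (x \<boxtimes>\<^bsub>hcomp \<sigma> (alg_tensor K C C) (xtensor K P Y)\<^esub> (p \<boxtimes>\<^bsub>xtensor K P Y\<^esub> c))
        = lact P (\<phi> c \<otimes>\<^bsub>C\<^esub> x) p"
proof -
  let ?X = "xtensor K P Y" and ?H = "hcomp \<sigma> (alg_tensor K C C) (xtensor K P Y)" and ?T = "alg_tensor K C C"
  interpret P: abelian_group P by (rule X.P.ab)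
  interpret T: k_algebra K ?T by (rule alg)
  note ic = add_map_closed[OF inner_add]
  note ia = add_map_add[OF inner_add]
  note Xl = X.kb[THEN kbimod.lact_closed] X.kb[THEN kbimod.lact_add] X.kb[THEN kbimod.lact_add_left]
  have il: "inner (x \<oplus>\<^bsub>C\<^esub> y) w = inner x w \<oplus>\<^bsub>P\<^esub> inner y w"
    if "x \<in> carrier C" "y \<in> carrier C" "w \<in> carrier ?X" for x y w
    using that(3) by (induction rule: X.tensor_induct)
      (use that(1,2) in \<open>simp_all add: Y inner_pure ia ic A.r_distr X.P.lact_add_left phi_simps P.a_ac
          X.P.lact_closed\<close>)
  have bi: "inner \<in> biadd_map \<sigma> ?X P"
    by (intro biadd_mapI add_mapI) (simp_all add: sig ic ia il)
  \<comment> \<open>On pure tensors both sides are \<open>\<phi>(bc) x a \<cdot> p\<close>, because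
    \<open>\<phi>(c) \<phi>(b) = \<phi>(bc)\<close>.\<close>
  have bal: "inner (ract \<sigma> x d) w = inner x (lact ?X d w)"
    if x: "x \<in> carrier \<sigma>" and d: "d \<in> carrier ?T" and w: "w \<in> carrier ?X" for x d w
    using d
  proof (induction rule: tensor_induct)
    case (pure a b)
    note ab = pure
    show ?case
      using w
    proof (induction rule: X.tensor_induct)
      case (pure p c)
      then show ?case
        using ab x by (simp add: sig Y ract_sig_pure X.lact_pure[OF ab] inner_pure X.P.lact_closed
            lact_Y phi_simps X.P.lact_mult[symmetric] A.m_assoc)
    next
      case (add u v)
      then show ?case
        using ab x by (simp add: sig ract_sig_pure phi_simps ia ic Xl)
    qed
  next
    case (add d e)
    then show ?case
      using x w add_map_closed[OF ract_sig] add_map_add[OF ract_sig] by (simp add: sig il ia ic Xl)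
  qed
  show "coll \<in> add_map ?H P"
    unfolding coll_def by (rule H.tlift_add_map[OF X.P.ab bi bal])
  show "coll (x \<boxtimes>\<^bsub>?H\<^esub> (p \<boxtimes>\<^bsub>?X\<^esub> c)) = lact P (\<phi> c \<otimes>\<^bsub>C\<^esub> x) p"
    if "x \<in> carrier C" "p \<in> carrier P" "c \<in> carrier C" for x p c
    unfolding coll_def using that H.tlift_pure[OF X.P.ab bi bal, of x "p \<boxtimes>\<^bsub>?X\<^esub> c"]
    by (simp add: sig Y inner_pure)
qed

abbreviation (input) "Hc \<equiv> hcomp \<sigma> (alg_tensor K C C) (xtensor K P Y)"
abbreviation (input) "Xc \<equiv> xtensor K P Y"

definition expand where "expand p = \<one>\<^bsub>C\<^esub> \<boxtimes>\<^bsub>Hc\<^esub> (p \<boxtimes>\<^bsub>Xc\<^esub> \<one>\<^bsub>C\<^esub>)"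

lemma expand_add: "expand \<in> add_map P Hc"
  unfolding expand_def
  by (rule add_map_comp[OF X.pure_left H.pure_right]) (simp_all add: sig Y)

text \<open>Moving \<open>c\<close> across the tensor sign into \<open>\<sigma>\<close> produces
  \<open>y = \<phi>(c) x\<close>. This equals \<open>1 \<cdot> (y \<otimes> 1)\<close>, so
  \<open>y\<close> can be moved back, now onto \<open>p\<close>.\<close>

lemma pure_expand:
  assumes "x \<in> carrier C" "p \<in> carrier P" "c \<in> carrier C"
  shows "x \<boxtimes>\<^bsub>Hc\<^esub> (p \<boxtimes>\<^bsub>Xc\<^esub> c) = expand (lact P (\<phi> c \<otimes>\<^bsub>C\<^esub> x) p)"
proof -
  let ?T = "alg_tensor K C C"
  have one: "\<one>\<^bsub>C\<^esub> \<in> carrier \<sigma>" "p \<boxtimes>\<^bsub>Xc\<^esub> \<one>\<^bsub>C\<^esub> \<in> carrier Xc" using assms by (auto simp: sig Y)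
  have "x \<boxtimes>\<^bsub>Hc\<^esub> (p \<boxtimes>\<^bsub>Xc\<^esub> c) = x \<boxtimes>\<^bsub>Hc\<^esub> lact Xc (\<one>\<^bsub>C\<^esub> \<boxtimes>\<^bsub>?T\<^esub> c) (p \<boxtimes>\<^bsub>Xc\<^esub> \<one>\<^bsub>C\<^esub>)"
    using assms by (simp add: X.lact_pure Y lact_Y X.P.lact_one)
  also have "\<dots> = (\<phi> c \<otimes>\<^bsub>C\<^esub> x) \<boxtimes>\<^bsub>Hc\<^esub> (p \<boxtimes>\<^bsub>Xc\<^esub> \<one>\<^bsub>C\<^esub>)"
    using assms one by (subst H.pure_balanced[symmetric]) (simp_all add: sig ract_sig_pure phi_simps)
  also have "\<dots> = ract \<sigma> \<one>\<^bsub>C\<^esub> ((\<phi> c \<otimes>\<^bsub>C\<^esub> x) \<boxtimes>\<^bsub>?T\<^esub> \<one>\<^bsub>C\<^esub>) \<boxtimes>\<^bsub>Hc\<^esub> (p \<boxtimes>\<^bsub>Xc\<^esub> \<one>\<^bsub>C\<^esub>)"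
    using assms by (simp add: ract_sig_pure phi_simps)
  also have "\<dots> = expand (lact P (\<phi> c \<otimes>\<^bsub>C\<^esub> x) p)"
    using assms one by (subst H.pure_balanced)
      (simp_all add: phi_simps expand_def X.lact_pure Y lact_Y)
  finally show ?thesis .
qed

lemma coll_expand: "p \<in> carrier P \<Longrightarrow> coll (expand p) = p"
  by (simp add: expand_def coll_pure phi_simps X.P.lact_one)

lemma expand_coll:
  assumes "z \<in> carrier Hc" shows "expand (coll z) = z"
  using assms
proof (induction rule: H.tensor_induct)
  case (pure x w)
  note x = pure(1)
  show ?case
    using pure(2)
  proof (induction rule: X.tensor_induct)
    case (pure p c)
    then show ?case using x by (simp add: sig Y pure_expand coll_expand phi_simps X.P.lact_closed)
  next
    case (add v w)
    then show ?case
      using x by (simp add: H.pure_add_right add_map_add[OF coll_add] add_map_add[OF expand_add]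
          add_map_closed[OF coll_add])
  qed
qed (simp add: add_map_add[OF coll_add] add_map_add[OF expand_add] add_map_closed[OF coll_add])

lemma coll_bij: "bij_betw coll (carrier Hc) (carrier P)"
  by (rule bij_betw_byWitness[where f' = expand])
    (auto simp: coll_expand expand_coll intro: add_map_closed[OF coll_add] add_map_closed[OF expand_add])

end

text \<open>\<open>\<sigma> \<circ> (C \<otimes> P) \<cong> P\<close> by \<open>x \<otimes> (c \<otimes> p) \<mapsto> \<xi>(xc) \<cdot> p\<close>, where \<open>\<xi> = \<phi>\<^sup>-\<^sup>1\<close>.\<close>

locale collapse_right = twisted K C \<phi> \<sigma> + X: xtensor_pair K C C2 C C1 Y P
  for K :: "'k ring" and C :: "('k, 'c) module" and \<phi> \<sigma> C1 C2 P and Y :: "('k, 'c, 'c, 'y) bimod" +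
  fixes \<xi>
  assumes Y: "carrier Y = carrier C" "(\<oplus>\<^bsub>Y\<^esub>) = (\<oplus>\<^bsub>C\<^esub>)" "(\<odot>\<^bsub>Y\<^esub>) = (\<odot>\<^bsub>C\<^esub>)"
    and lact_Y: "\<And>a y. \<lbrakk>a \<in> carrier C; y \<in> carrier C\<rbrakk> \<Longrightarrow> lact Y a y = a \<otimes>\<^bsub>C\<^esub> y"
    and xi: "\<xi> \<in> alg_hom K C (alg_op C)"
    and xi_phi: "\<And>a. a \<in> carrier C \<Longrightarrow> \<xi> (\<phi> a) = a" "\<And>a. a \<in> carrier C \<Longrightarrow> \<phi> (\<xi> a) = a"
begin

lemmas xi_simps = alg_homD[OF xi, simplified]

sublocale H: hcomp_pair K "ground_alg K" "alg_tensor K C C" "alg_tensor K C2 C1" \<sigma> "xtensor K Y P"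
  by (intro hcomp_pair.intro kb_sig X.kb)

definition coll where
  "coll = tlift P (\<lambda>x w. tlift P (\<lambda>c p. lact P (\<xi> (x \<otimes>\<^bsub>C\<^esub> c)) p) w)"

abbreviation (input) "inner x w \<equiv> tlift P (\<lambda>c p. lact P (\<xi> (x \<otimes>\<^bsub>C\<^esub> c)) p) w"

lemma inner:
  assumes x: "x \<in> carrier C"
  shows inner_add: "inner x \<in> add_map (xtensor K Y P) P"
    and inner_pure: "\<And>p c. \<lbrakk>p \<in> carrier P; c \<in> carrier C\<rbrakk>
      \<Longrightarrow> inner x (c \<boxtimes>\<^bsub>xtensor K Y P\<^esub> p) = lact P (\<xi> (x \<otimes>\<^bsub>C\<^esub> c)) p"
proof -
  note s = xi_simps X.P'.lact_closed X.P'.lact_add X.P'.lact_add_left A.l_distr A.r_distr Y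
  have bi: "(\<lambda>c p. lact P (\<xi> (x \<otimes>\<^bsub>C\<^esub> c)) p) \<in> biadd_map Y P P"
    by (intro biadd_mapI add_mapI) (use x in \<open>simp_all add: s\<close>)
  have bal: "lact P (\<xi> (x \<otimes>\<^bsub>C\<^esub> (\<kappa> \<odot>\<^bsub>Y\<^esub> c))) p = lact P (\<xi> (x \<otimes>\<^bsub>C\<^esub> c)) (\<kappa> \<odot>\<^bsub>P\<^esub> p)"
    if "c \<in> carrier Y" "\<kappa> \<in> carrier K" "p \<in> carrier P" for p \<kappa> c
    using that x by (simp add: s A.smult_mult_left A.smult_mult_right X.P'.lact_smult X.P'.lact_smult_right)
  show "inner x \<in> add_map (xtensor K Y P) P"
    by (rule X.tlift_add_map[OF X.P'.ab bi bal])
  show "inner x (c \<boxtimes>\<^bsub>xtensor K Y P\<^esub> p) = lact P (\<xi> (x \<otimes>\<^bsub>C\<^esub> c)) p"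
    if "p \<in> carrier P" "c \<in> carrier C" for p c
    using that X.tlift_pure[OF X.P'.ab bi bal, of c p] by (simp add: Y)
qed

abbreviation (input) "Hc \<equiv> hcomp \<sigma> (alg_tensor K C C) (xtensor K Y P)"
abbreviation (input) "Xc \<equiv> xtensor K Y P"

lemma
  shows coll_add: "coll \<in> add_map Hc P"
    and coll_pure: "\<And>x p c. \<lbrakk>x \<in> carrier C; p \<in> carrier P; c \<in> carrier C\<rbrakk>
      \<Longrightarrow> coll (x \<boxtimes>\<^bsub>Hc\<^esub> (c \<boxtimes>\<^bsub>Xc\<^esub> p)) = lact P (\<xi> (x \<otimes>\<^bsub>C\<^esub> c)) p"
proof -
  let ?X = "xtensor K Y P" and ?T = "alg_tensor K C C"
  interpret P: abelian_group P by (rule X.P'.ab)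
  interpret T: k_algebra K ?T by (rule alg)
  note ic = add_map_closed[OF inner_add]
  note ia = add_map_add[OF inner_add]
  note Xl = X.kb[THEN kbimod.lact_closed] X.kb[THEN kbimod.lact_add] X.kb[THEN kbimod.lact_add_left]
  have il: "inner (x \<oplus>\<^bsub>C\<^esub> y) w = inner x w \<oplus>\<^bsub>P\<^esub> inner y w"
    if "x \<in> carrier C" "y \<in> carrier C" "w \<in> carrier ?X" for x y w
    using that(3) by (induction rule: X.tensor_induct)
      (use that(1,2) in \<open>simp_all add: Y inner_pure ia ic A.l_distr A.r_distr X.P'.lact_add_left xi_simps P.a_ac
          X.P'.lact_closed\<close>)
  have bi: "inner \<in> biadd_map \<sigma> ?X P"
    by (intro biadd_mapI add_mapI) (simp_all add: sig ic ia il)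
  have bal: "inner (ract \<sigma> x d) w = inner x (lact ?X d w)"
    if x: "x \<in> carrier \<sigma>" and d: "d \<in> carrier ?T" and w: "w \<in> carrier ?X" for x d w
    using d
  proof (induction rule: tensor_induct)
    case (pure a b)
    note ab = pure
    show ?case
      using w
    proof (induction rule: X.tensor_induct)
      case (pure c p)
      then show ?case
        using ab x by (simp add: sig Y ract_sig_pure X.lact_pure[OF ab] inner_pure X.P'.lact_closed
            lact_Y phi_simps xi_simps xi_phi X.P'.lact_mult[symmetric] A.m_assoc)
    next
      case (add u v)
      then show ?case
        using ab x by (simp add: sig ract_sig_pure phi_simps ia ic Xl)
    qed
  next
    case (add d e)
    then show ?case
      using x w add_map_closed[OF ract_sig] add_map_add[OF ract_sig] by (simp add: sig il ia ic Xl)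
  qed
  show "coll \<in> add_map Hc P"
    unfolding coll_def by (rule H.tlift_add_map[OF X.P'.ab bi bal])
  show "coll (x \<boxtimes>\<^bsub>Hc\<^esub> (c \<boxtimes>\<^bsub>?X\<^esub> p)) = lact P (\<xi> (x \<otimes>\<^bsub>C\<^esub> c)) p"
    if "x \<in> carrier C" "p \<in> carrier P" "c \<in> carrier C" for x p c
    unfolding coll_def using that H.tlift_pure[OF X.P'.ab bi bal, of x "c \<boxtimes>\<^bsub>?X\<^esub> p"]
    by (simp add: sig Y inner_pure)
qed

definition expand where "expand p = \<one>\<^bsub>C\<^esub> \<boxtimes>\<^bsub>Hc\<^esub> (\<one>\<^bsub>C\<^esub> \<boxtimes>\<^bsub>Xc\<^esub> p)"

lemma expand_add: "expand \<in> add_map P Hc"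
  unfolding expand_def
  by (rule add_map_comp[OF X.pure_right H.pure_right]) (simp_all add: sig Y)

text \<open>Moving \<open>c\<close> into \<open>\<sigma>\<close> produces \<open>y = xc\<close>.
  This time it is written as \<open>1 \<cdot> (1 \<otimes> \<xi>(y))\<close>, using
  \<open>\<phi>(\<xi>(y)) = y\<close>, and \<open>\<xi>(y)\<close> is moved back onto
  \<open>p\<close>.\<close>

lemma pure_expand:
  assumes "x \<in> carrier C" "p \<in> carrier P" "c \<in> carrier C"
  shows "x \<boxtimes>\<^bsub>Hc\<^esub> (c \<boxtimes>\<^bsub>Xc\<^esub> p) = expand (lact P (\<xi> (x \<otimes>\<^bsub>C\<^esub> c)) p)"
proof -
  let ?T = "alg_tensor K C C"
  have one: "\<one>\<^bsub>C\<^esub> \<in> carrier \<sigma>" "\<one>\<^bsub>C\<^esub> \<boxtimes>\<^bsub>Xc\<^esub> p \<in> carrier Xc" using assms by (auto simp: sig Y)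
  have "x \<boxtimes>\<^bsub>Hc\<^esub> (c \<boxtimes>\<^bsub>Xc\<^esub> p) = x \<boxtimes>\<^bsub>Hc\<^esub> lact Xc (c \<boxtimes>\<^bsub>?T\<^esub> \<one>\<^bsub>C\<^esub>) (\<one>\<^bsub>C\<^esub> \<boxtimes>\<^bsub>Xc\<^esub> p)"
    using assms by (simp add: X.lact_pure Y lact_Y X.P'.lact_one)
  also have "\<dots> = (x \<otimes>\<^bsub>C\<^esub> c) \<boxtimes>\<^bsub>Hc\<^esub> (\<one>\<^bsub>C\<^esub> \<boxtimes>\<^bsub>Xc\<^esub> p)"
    using assms one by (subst H.pure_balanced[symmetric]) (simp_all add: sig ract_sig_pure phi_simps)
  also have "\<dots> = ract \<sigma> \<one>\<^bsub>C\<^esub> (\<one>\<^bsub>C\<^esub> \<boxtimes>\<^bsub>?T\<^esub> \<xi> (x \<otimes>\<^bsub>C\<^esub> c)) \<boxtimes>\<^bsub>Hc\<^esub> (\<one>\<^bsub>C\<^esub> \<boxtimes>\<^bsub>Xc\<^esub> p)"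
    using assms by (simp add: ract_sig_pure xi_phi xi_simps del: xi_simps(3))
  also have "\<dots> = expand (lact P (\<xi> (x \<otimes>\<^bsub>C\<^esub> c)) p)"
    using assms one by (subst H.pure_balanced)
      (simp_all add: xi_simps expand_def X.lact_pure Y lact_Y)
  finally show ?thesis .
qed

lemma coll_expand: "p \<in> carrier P \<Longrightarrow> coll (expand p) = p"
  by (simp add: expand_def coll_pure xi_simps X.P'.lact_one)

lemma expand_coll:
  assumes "z \<in> carrier Hc" shows "expand (coll z) = z"
  using assms
proof (induction rule: H.tensor_induct)
  case (pure x w)
  note x = pure(1)
  show ?case
    using pure(2)
  proof (induction rule: X.tensor_induct)
    case (pure c p)
    then show ?case using x by (simp add: sig Y pure_expand coll_expand xi_simps X.P'.lact_closed)
  next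
    case (add v w)
    then show ?case
      using x by (simp add: H.pure_add_right add_map_add[OF coll_add] add_map_add[OF expand_add]
          add_map_closed[OF coll_add])
  qed
qed (simp add: add_map_add[OF coll_add] add_map_add[OF expand_add] add_map_closed[OF coll_add])

lemma expand_bij: "bij_betw expand (carrier P) (carrier Hc)"
  by (rule bij_betw_byWitness[where f' = coll])
    (auto simp: coll_expand expand_coll intro: add_map_closed[OF coll_add] add_map_closed[OF expand_add])

end

section \<open>Bialgebroids\<close>

lemma
  assumes A: "algebra_pair K A B" and A': "algebra_pair K A' B'"
    and f: "f \<in> alg_hom K A A'" and g: "g \<in> alg_hom K B B'"
  shows tmap_alg_hom: "tmap (alg_tensor K A' B') f g \<in> alg_hom K (alg_tensor K A B) (alg_tensor K A' B')"
    and tmap_alg_hom_pure: "\<lbrakk>x \<in> carrier A; y \<in> carrier B\<rbrakk>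
      \<Longrightarrow> tmap (alg_tensor K A' B') f g (x \<boxtimes>\<^bsub>alg_tensor K A B\<^esub> y) = f x \<boxtimes>\<^bsub>alg_tensor K A' B'\<^esub> g y"
proof -
  interpret S: algebra_pair K A B by fact
  interpret T: algebra_pair K A' B' by fact
  interpret Sa: k_algebra K "alg_tensor K A B" by (rule S.alg)
  interpret Ta: k_algebra K "alg_tensor K A' B'" by (rule T.alg)
  let ?S = "alg_tensor K A B" and ?T = "alg_tensor K A' B'"
  interpret tm: tensor_map A B "carrier K" "\<lambda>x \<kappa>. \<kappa> \<odot>\<^bsub>A\<^esub> x" "\<lambda>\<kappa> y. \<kappa> \<odot>\<^bsub>B\<^esub> y" ?S
    A' B' "carrier K" "\<lambda>x \<kappa>. \<kappa> \<odot>\<^bsub>A'\<^esub> x" "\<lambda>\<kappa> y. \<kappa> \<odot>\<^bsub>B'\<^esub> y" ?T f g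
    by (intro tensor_map.intro S.tensor_product_axioms T.tensor_product_axioms tensor_map_axioms.intro
        alg_homD(6)[OF f] alg_homD(6)[OF g])
      (simp add: alg_homD[OF f] alg_homD[OF g] T.pure_balanced)
  note ac = add_map_closed[OF tm.add_map] and aa = add_map_add[OF tm.add_map]
  have m: "tmap ?T f g (v \<otimes>\<^bsub>?S\<^esub> w) = tmap ?T f g v \<otimes>\<^bsub>?T\<^esub> tmap ?T f g w"
    if "v \<in> carrier ?S" "w \<in> carrier ?S" for v w
    using that(1)
  proof (induction rule: S.tensor_induct)
    case (pure a b)
    note ab = pure
    show ?case
      using that(2) by (induction rule: S.tensor_induct)
        (use ab in \<open>simp_all add: S.mult_pure T.mult_pure tm.pure alg_homD[OF f] alg_homD[OF g]
            Sa.r_distr Ta.r_distr aa ac\<close>)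
  qed (use that(2) in \<open>simp add: Sa.l_distr Ta.l_distr aa ac\<close>)
  show "tmap ?T f g \<in> alg_hom K ?S ?T"
  proof (rule alg_homI[OF tm.add_map m])
    show "tmap ?T f g \<one>\<^bsub>?S\<^esub> = \<one>\<^bsub>?T\<^esub>"
      by (simp add: S.one_pure T.one_pure tm.pure alg_homD[OF f] alg_homD[OF g])
    show "tmap ?T f g (\<kappa> \<odot>\<^bsub>?S\<^esub> w) = \<kappa> \<odot>\<^bsub>?T\<^esub> tmap ?T f g w" if "\<kappa> \<in> carrier K" "w \<in> carrier ?S" for \<kappa> w
      using that(2) by (induction rule: S.tensor_induct)
        (use that(1) in \<open>simp_all add: S.smult_pure T.smult_pure tm.pure alg_homD[OF f] alg_homD[OF g]
            aa ac Sa.smult_r_distr Ta.smult_r_distr\<close>)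
  qed auto
  show "tmap ?T f g (x \<boxtimes>\<^bsub>?S\<^esub> y) = f x \<boxtimes>\<^bsub>?T\<^esub> g y" if "x \<in> carrier A" "y \<in> carrier B"
    using tm.pure[OF that] .
qed

locale left_bialgebroid_loc =
  fixes B :: "('k, 'a, 'l) bialgebroid"
  assumes bialgebroid: "left_bialgebroid B"
begin

abbreviation "K \<equiv> scalars B"
abbreviation "A \<equiv> total B"
abbreviation "L \<equiv> base B"
abbreviation "s \<equiv> src B"
abbreviation "t \<equiv> tgt B"
abbreviation "\<gamma> \<equiv> cop B"
abbreviation "\<pi> \<equiv> cou B"
abbreviation "M \<equiv> AA_L B"

lemma alg_A: "k_algebra K A" and alg_L: "k_algebra K L"
  and s_hom: "s \<in> alg_hom K L A" and t_hom: "t \<in> alg_hom K (alg_op L) A"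
  and s_t: "\<And>l l'. \<lbrakk>l \<in> carrier L; l' \<in> carrier L\<rbrakk> \<Longrightarrow> s l \<otimes>\<^bsub>A\<^esub> t l' = t l' \<otimes>\<^bsub>A\<^esub> s l"
  and cop_cell: "\<gamma> \<in> two_cell L L (A_LL B) M" and cou_cell: "\<pi> \<in> two_cell L L (A_LL B) (id_cell L)"
  and counit_left: "\<And>a. a \<in> carrier A \<Longrightarrow> tlift A (\<lambda>x y. s (\<pi> x) \<otimes>\<^bsub>A\<^esub> y) (\<gamma> a) = a"
  and counit_right: "\<And>a. a \<in> carrier A \<Longrightarrow> tlift A (\<lambda>x y. t (\<pi> y) \<otimes>\<^bsub>A\<^esub> x) (\<gamma> a) = a"
  and takeuchi: "\<And>a l. \<lbrakk>a \<in> carrier A; l \<in> carrier L\<rbrakk> \<Longrightarrow>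
      tmap M (\<lambda>x. x \<otimes>\<^bsub>A\<^esub> t l) (\<lambda>y. y) (\<gamma> a) = tmap M (\<lambda>x. x) (\<lambda>y. y \<otimes>\<^bsub>A\<^esub> s l) (\<gamma> a)"
  and cop_one: "\<gamma> \<one>\<^bsub>A\<^esub> = \<one>\<^bsub>A\<^esub> \<boxtimes>\<^bsub>M\<^esub> \<one>\<^bsub>A\<^esub>"
  and cop_mult: "\<And>a b. \<lbrakk>a \<in> carrier A; b \<in> carrier A\<rbrakk> \<Longrightarrow> \<gamma> (a \<otimes>\<^bsub>A\<^esub> b) = diag_act B a (\<gamma> b)"
  and cou_one: "\<pi> \<one>\<^bsub>A\<^esub> = \<one>\<^bsub>L\<^esub>"
  using bialgebroid unfolding left_bialgebroid_def Let_def by blast+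

sublocale A: k_algebra K A by (rule alg_A)
sublocale L: k_algebra K L by (rule alg_L)

lemmas s_simps [simp] = alg_homD(1,4)[OF s_hom]
lemmas s_add = alg_homD(2)[OF s_hom]
lemmas s_mult = alg_homD(3)[OF s_hom]
lemmas s_smult = alg_homD(5)[OF s_hom]
lemmas t_simps [simp] = alg_homD(1,4)[OF t_hom, simplified]
lemmas t_add = alg_homD(2)[OF t_hom, simplified]
lemmas t_mult = alg_homD(3)[OF t_hom, simplified]
lemmas t_smult = alg_homD(5)[OF t_hom, simplified]

lemma A_LL_simps [simp]:
  "carrier (A_LL B) = carrier A" "(\<oplus>\<^bsub>A_LL B\<^esub>) = (\<oplus>\<^bsub>A\<^esub>)" "\<zero>\<^bsub>A_LL B\<^esub> = \<zero>\<^bsub>A\<^esub>"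
  "\<kappa> \<odot>\<^bsub>A_LL B\<^esub> x = \<kappa> \<odot>\<^bsub>A\<^esub> x" "lact (A_LL B) l x = s l \<otimes>\<^bsub>A\<^esub> x" "ract (A_LL B) x l = t l \<otimes>\<^bsub>A\<^esub> x"
  by (simp_all add: A_LL_def)

lemma kb_A_LL: "kbimod K L L (A_LL B)"
proof (intro kbimod.intro alg_L)
  show "module K (A_LL B)" by (simp add: A_LL_def module_mk_bimod A.module_axioms)
  show "lact (A_LL B) \<in> biadd_map L (A_LL B) (A_LL B)"
    by (intro biadd_mapI add_mapI) (auto simp: s_add A.l_distr A.r_distr)
  show "(\<lambda>c p. ract (A_LL B) p c) \<in> biadd_map L (A_LL B) (A_LL B)"
    by (intro biadd_mapI add_mapI) (auto simp: t_add A.l_distr A.r_distr)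
  show "lact (A_LL B) d (ract (A_LL B) p c) = ract (A_LL B) (lact (A_LL B) d p) c"
    if "d \<in> carrier L" "p \<in> carrier (A_LL B)" "c \<in> carrier L" for d p c
    using that by (simp add: A.m_assoc[symmetric] s_t)
qed (auto simp: s_mult t_mult s_smult t_smult A.m_assoc A.smult_mult_left)

sublocale MM: hcomp_pair K L L L "A_LL B" "A_LL B"
  by (intro hcomp_pair.intro kb_A_LL)

text \<open>The actions in \<open>A_LL\<close> are left multiplications by \<open>t(l)\<close> and
  \<open>s(l)\<close>, so the defining relations can be written in \<open>A\<close> itself.
  Computations in \<open>M\<close> then stay in the algebra and avoid the bimodule record.\<close>

sublocale M: tensor_product A A "carrier L" "\<lambda>x l. t l \<otimes>\<^bsub>A\<^esub> x" "\<lambda>l y. s l \<otimes>\<^bsub>A\<^esub> y" "AA_L B"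
proof (intro tensor_product.intro A.M.abelian_group_axioms)
  have rels: "tensor_rels (A_LL B) (carrier L) (ract (A_LL B)) (lact (A_LL B)) (A_LL B)
      = tensor_rels A (carrier L) (\<lambda>x l. t l \<otimes>\<^bsub>A\<^esub> x) (\<lambda>l y. s l \<otimes>\<^bsub>A\<^esub> y) A"
    by (simp add: tensor_rels_def)
  show "carrier (AA_L B) = carrier (tensor_group A (carrier L) (\<lambda>x l. t l \<otimes>\<^bsub>A\<^esub> x) (\<lambda>l y. s l \<otimes>\<^bsub>A\<^esub> y) A)"
    "(\<oplus>\<^bsub>AA_L B\<^esub>) = (\<oplus>\<^bsub>tensor_group A (carrier L) (\<lambda>x l. t l \<otimes>\<^bsub>A\<^esub> x) (\<lambda>l y. s l \<otimes>\<^bsub>A\<^esub> y) A\<^esub>)"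
    "\<zero>\<^bsub>AA_L B\<^esub> = \<zero>\<^bsub>tensor_group A (carrier L) (\<lambda>x l. t l \<otimes>\<^bsub>A\<^esub> x) (\<lambda>l y. s l \<otimes>\<^bsub>A\<^esub> y) A\<^esub>"
    by (simp_all add: AA_L_def MM.carrier_T MM.add_T MM.zero_T tensor_group_def rels)
qed auto

lemma kb_M_LL: "kbimod K L L M"
  unfolding AA_L_def by (rule MM.kb)

sublocale Mm: module K M
  using MM.mod by (simp add: AA_L_def)

lemma smult_pure:
  "\<lbrakk>\<kappa> \<in> carrier K; x \<in> carrier A; y \<in> carrier A\<rbrakk> \<Longrightarrow> \<kappa> \<odot>\<^bsub>M\<^esub> (x \<boxtimes>\<^bsub>M\<^esub> y) = (\<kappa> \<odot>\<^bsub>A\<^esub> x) \<boxtimes>\<^bsub>M\<^esub> y"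
  using MM.smult_pure[of \<kappa> x y] by (simp add: AA_L_def)

lemma M_lact: "\<lbrakk>l \<in> carrier L; x \<in> carrier A; y \<in> carrier A\<rbrakk> \<Longrightarrow> lact M l (x \<boxtimes>\<^bsub>M\<^esub> y) = (s l \<otimes>\<^bsub>A\<^esub> x) \<boxtimes>\<^bsub>M\<^esub> y"
  using MM.lact_pure[of l x y] by (simp add: AA_L_def)

lemma M_ract: "\<lbrakk>l \<in> carrier L; x \<in> carrier A; y \<in> carrier A\<rbrakk> \<Longrightarrow> ract M (x \<boxtimes>\<^bsub>M\<^esub> y) l = x \<boxtimes>\<^bsub>M\<^esub> (t l \<otimes>\<^bsub>A\<^esub> y)"
  using MM.ract_pure[of x y l] by (simp add: AA_L_def)

lemma cop_add_map: "\<gamma> \<in> add_map A M"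
  using cop_cell by (auto simp: two_cell_def add_map_def)

lemmas cop_closed [simp] = add_map_closed[OF cop_add_map]
lemmas cop_add = add_map_add[OF cop_add_map]

lemma cop_smult: "\<lbrakk>\<kappa> \<in> carrier K; a \<in> carrier A\<rbrakk> \<Longrightarrow> \<gamma> (\<kappa> \<odot>\<^bsub>A\<^esub> a) = \<kappa> \<odot>\<^bsub>M\<^esub> \<gamma> a"
  using left_linear_smult[OF kb_A_LL kb_M_LL, of \<gamma> \<kappa> a] cop_cell
  by (auto simp: two_cell_def add_map_def)

lemma cop_s_mult: "\<lbrakk>l \<in> carrier L; a \<in> carrier A\<rbrakk> \<Longrightarrow> \<gamma> (s l \<otimes>\<^bsub>A\<^esub> a) = lact M l (\<gamma> a)"
  and cop_t_mult: "\<lbrakk>l \<in> carrier L; a \<in> carrier A\<rbrakk> \<Longrightarrow> \<gamma> (t l \<otimes>\<^bsub>A\<^esub> a) = ract M (\<gamma> a) l"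
  using cop_cell by (simp_all add: two_cell_def)

lemma cop_s: "l \<in> carrier L \<Longrightarrow> \<gamma> (s l) = s l \<boxtimes>\<^bsub>M\<^esub> \<one>\<^bsub>A\<^esub>"
  using cop_s_mult[of l "\<one>\<^bsub>A\<^esub>"] by (simp add: cop_one M_lact)

lemma cop_t: "l \<in> carrier L \<Longrightarrow> \<gamma> (t l) = \<one>\<^bsub>A\<^esub> \<boxtimes>\<^bsub>M\<^esub> t l"
  using cop_t_mult[of l "\<one>\<^bsub>A\<^esub>"] by (simp add: cop_one M_ract)

lemma cou_closed [simp]: "a \<in> carrier A \<Longrightarrow> \<pi> a \<in> carrier L"
  using cou_cell by (auto simp: two_cell_def id_cell_def)

lemma cou_add_map: "\<pi> \<in> add_map A L"
  using cou_cell by (auto simp: two_cell_def add_map_def id_cell_def)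

lemma cou_s_mult: "\<lbrakk>l \<in> carrier L; a \<in> carrier A\<rbrakk> \<Longrightarrow> \<pi> (s l \<otimes>\<^bsub>A\<^esub> a) = l \<otimes>\<^bsub>L\<^esub> \<pi> a"
  and cou_t_mult: "\<lbrakk>l \<in> carrier L; a \<in> carrier A\<rbrakk> \<Longrightarrow> \<pi> (t l \<otimes>\<^bsub>A\<^esub> a) = \<pi> a \<otimes>\<^bsub>L\<^esub> l"
  using cou_cell by (auto simp: two_cell_def id_cell_def)

lemma cou_s: "l \<in> carrier L \<Longrightarrow> \<pi> (s l) = l"
  using cou_s_mult[of l "\<one>\<^bsub>A\<^esub>"] by (simp add: cou_one)

lemma cou_t: "l \<in> carrier L \<Longrightarrow> \<pi> (t l) = l"
  using cou_t_mult[of l "\<one>\<^bsub>A\<^esub>"] by (simp add: cou_one)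

text \<open>The counit axiom for an element with pure coproduct. With \<open>y = 1\<close> it shows
  that \<open>\<gamma>(a) = a \<otimes> 1\<close> forces \<open>a = s(\<pi>(a))\<close>; with its
  companion, \<open>\<gamma>(a) = 1 \<otimes> a\<close> forces
  \<open>a = t(\<pi>(a))\<close>.\<close>

lemma counit_left_eq:
  assumes "a \<in> carrier A" "x \<in> carrier A" "y \<in> carrier A" "\<gamma> a = x \<boxtimes>\<^bsub>M\<^esub> y"
  shows "s (\<pi> x) \<otimes>\<^bsub>A\<^esub> y = a"
proof -
  have "tlift A (\<lambda>x y. s (\<pi> x) \<otimes>\<^bsub>A\<^esub> y) (x \<boxtimes>\<^bsub>M\<^esub> y) = s (\<pi> x) \<otimes>\<^bsub>A\<^esub> y"
    by (rule M.tlift_pure[OF A.M.abelian_group_axioms])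
      (auto intro!: biadd_mapI add_mapI simp: assms add_map_add[OF cou_add_map] s_add A.l_distr A.r_distr
        cou_t_mult s_mult A.m_assoc)
  then show ?thesis using counit_left[OF assms(1)] assms(4) by simp
qed

lemma counit_right_eq:
  assumes "a \<in> carrier A" "x \<in> carrier A" "y \<in> carrier A" "\<gamma> a = x \<boxtimes>\<^bsub>M\<^esub> y"
  shows "t (\<pi> y) \<otimes>\<^bsub>A\<^esub> x = a"
proof -
  have "tlift A (\<lambda>x y. t (\<pi> y) \<otimes>\<^bsub>A\<^esub> x) (x \<boxtimes>\<^bsub>M\<^esub> y) = t (\<pi> y) \<otimes>\<^bsub>A\<^esub> x"
    by (rule M.tlift_pure[OF A.M.abelian_group_axioms])
      (auto intro!: biadd_mapI add_mapI simp: assms add_map_add[OF cou_add_map] t_add A.l_distr A.r_distr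
        cou_s_mult t_mult A.m_assoc)
  then show ?thesis using counit_right[OF assms(1)] assms(4) by simp
qed

sublocale AA: algebra_pair K A A by (intro algebra_pair.intro alg_A)

subsection \<open>The two actions on the tensor square\<close>

abbreviation rmult :: "('a, 'a) tens \<Rightarrow> 'a \<Rightarrow> 'a \<Rightarrow> ('a, 'a) tens" where "rmult \<equiv> right_mult2 B"
abbreviation dact :: "'a \<Rightarrow> ('a, 'a) tens \<Rightarrow> ('a, 'a) tens" where "dact \<equiv> diag_act B"

lemma rmult_action: "tensor_action A A (carrier L) (\<lambda>x l. t l \<otimes>\<^bsub>A\<^esub> x) (\<lambda>l y. s l \<otimes>\<^bsub>A\<^esub> y) M
    K A A (alg_tensor K A A) (\<lambda>c p. p \<otimes>\<^bsub>A\<^esub> c) (\<lambda>c p. p \<otimes>\<^bsub>A\<^esub> c)"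
proof (intro tensor_action.intro M.tensor_product_axioms AA.tensor_product_axioms tensor_action_axioms.intro)
  show "(x \<otimes>\<^bsub>A\<^esub> (\<kappa> \<odot>\<^bsub>A\<^esub> c)) \<boxtimes>\<^bsub>M\<^esub> (y \<otimes>\<^bsub>A\<^esub> c') = (x \<otimes>\<^bsub>A\<^esub> c) \<boxtimes>\<^bsub>M\<^esub> (y \<otimes>\<^bsub>A\<^esub> (\<kappa> \<odot>\<^bsub>A\<^esub> c'))"
    if "\<kappa> \<in> carrier K" "c \<in> carrier A" "c' \<in> carrier A" "x \<in> carrier A" "y \<in> carrier A" for \<kappa> c c' x y
  proof -
    \<comment> \<open>Scalars act through the base by \<open>s\<close> as well as by
      \<open>t\<close>, so a tensor over \<open>L\<close> is also balanced over the ground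
      ring.\<close>
    have e: "\<kappa> \<odot>\<^bsub>A\<^esub> z = t (\<kappa> \<odot>\<^bsub>L\<^esub> \<one>\<^bsub>L\<^esub>) \<otimes>\<^bsub>A\<^esub> z" "\<kappa> \<odot>\<^bsub>A\<^esub> z = s (\<kappa> \<odot>\<^bsub>L\<^esub> \<one>\<^bsub>L\<^esub>) \<otimes>\<^bsub>A\<^esub> z" if "z \<in> carrier A" for z
      using that \<open>\<kappa> \<in> carrier K\<close> by (simp_all add: s_smult t_smult A.smult_mult_left)
    have "(x \<otimes>\<^bsub>A\<^esub> (\<kappa> \<odot>\<^bsub>A\<^esub> c)) \<boxtimes>\<^bsub>M\<^esub> (y \<otimes>\<^bsub>A\<^esub> c') = (t (\<kappa> \<odot>\<^bsub>L\<^esub> \<one>\<^bsub>L\<^esub>) \<otimes>\<^bsub>A\<^esub> (x \<otimes>\<^bsub>A\<^esub> c)) \<boxtimes>\<^bsub>M\<^esub> (y \<otimes>\<^bsub>A\<^esub> c')"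
      using that by (simp add: A.smult_mult_right e(1)[symmetric])
    also have "\<dots> = (x \<otimes>\<^bsub>A\<^esub> c) \<boxtimes>\<^bsub>M\<^esub> (s (\<kappa> \<odot>\<^bsub>L\<^esub> \<one>\<^bsub>L\<^esub>) \<otimes>\<^bsub>A\<^esub> (y \<otimes>\<^bsub>A\<^esub> c'))"
      using that by (intro M.pure_balanced) auto
    finally show ?thesis using that by (simp add: A.smult_mult_right e(2)[symmetric])
  qed
qed (auto intro!: biadd_mapI add_mapI simp: A.l_distr A.r_distr A.m_assoc M.pure_balanced)

sublocale R: tensor_action A A "carrier L" "\<lambda>x l. t l \<otimes>\<^bsub>A\<^esub> x" "\<lambda>l y. s l \<otimes>\<^bsub>A\<^esub> y" M
    K A A "alg_tensor K A A" "\<lambda>c p. p \<otimes>\<^bsub>A\<^esub> c" "\<lambda>c p. p \<otimes>\<^bsub>A\<^esub> c"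
  by (rule rmult_action)

lemma rmult_act: "\<lbrakk>z \<in> carrier M; a \<in> carrier A; b \<in> carrier A\<rbrakk> \<Longrightarrow> rmult z a b = R.act (a \<boxtimes>\<^bsub>alg_tensor K A A\<^esub> b) z"
  by (simp add: R.act_pure_left right_mult2_def)

lemma rmult_add_map: "\<lbrakk>a \<in> carrier A; b \<in> carrier A\<rbrakk> \<Longrightarrow> (\<lambda>z. rmult z a b) \<in> add_map M M"
  unfolding right_mult2_def by (rule R.tm_add)

lemma rmult_pure: "\<lbrakk>x \<in> carrier A; y \<in> carrier A; a \<in> carrier A; b \<in> carrier A\<rbrakk>
    \<Longrightarrow> rmult (x \<boxtimes>\<^bsub>M\<^esub> y) a b = (x \<otimes>\<^bsub>A\<^esub> a) \<boxtimes>\<^bsub>M\<^esub> (y \<otimes>\<^bsub>A\<^esub> b)"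
  unfolding right_mult2_def by (rule R.tm_pure)

lemma rmult_biadd: "z \<in> carrier M \<Longrightarrow> rmult z \<in> biadd_map A A M"
  unfolding right_mult2_def by (rule R.inner_biadd)

lemmas rmult_closed [simp] = add_map_closed[OF rmult_add_map]
lemmas rmult_add = add_map_add[OF rmult_add_map]
lemmas rmult_add1 = add_map_add[OF biadd_map_left[OF rmult_biadd]]
lemmas rmult_add2 = add_map_add[OF biadd_map_right[OF rmult_biadd]]

lemma rmult_rmult:
  assumes "z \<in> carrier M" "a \<in> carrier A" "b \<in> carrier A" "c \<in> carrier A" "d \<in> carrier A"
  shows "rmult (rmult z a b) c d = rmult z (a \<otimes>\<^bsub>A\<^esub> c) (b \<otimes>\<^bsub>A\<^esub> d)"
  using assms(1) by (induction rule: M.tensor_induct)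
    (use assms(2-) in \<open>simp_all add: rmult_pure rmult_add A.m_assoc\<close>)

lemma rmult_one: "z \<in> carrier M \<Longrightarrow> rmult z \<one>\<^bsub>A\<^esub> \<one>\<^bsub>A\<^esub> = z"
  by (induction rule: M.tensor_induct) (simp_all add: rmult_pure rmult_add)

lemma rmult_smult:
  assumes "\<kappa> \<in> carrier K" "z \<in> carrier M" "a \<in> carrier A" "b \<in> carrier A"
  shows "rmult (\<kappa> \<odot>\<^bsub>M\<^esub> z) a b = \<kappa> \<odot>\<^bsub>M\<^esub> rmult z a b" "rmult z (\<kappa> \<odot>\<^bsub>A\<^esub> a) b = \<kappa> \<odot>\<^bsub>M\<^esub> rmult z a b"
    "rmult z a (\<kappa> \<odot>\<^bsub>A\<^esub> b) = \<kappa> \<odot>\<^bsub>M\<^esub> rmult z a b"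
proof -
  show "rmult (\<kappa> \<odot>\<^bsub>M\<^esub> z) a b = \<kappa> \<odot>\<^bsub>M\<^esub> rmult z a b"
    using assms(2) by (induction rule: M.tensor_induct)
      (use assms in \<open>simp_all add: rmult_pure rmult_add smult_pure A.smult_mult_left Mm.smult_r_distr\<close>)
  show 1: "rmult z (\<kappa> \<odot>\<^bsub>A\<^esub> a) b = \<kappa> \<odot>\<^bsub>M\<^esub> rmult z a b"
    using assms(2) by (induction rule: M.tensor_induct)
      (use assms in \<open>simp_all add: rmult_pure rmult_add smult_pure A.smult_mult_right Mm.smult_r_distr\<close>)
  show "rmult z a (\<kappa> \<odot>\<^bsub>A\<^esub> b) = \<kappa> \<odot>\<^bsub>M\<^esub> rmult z a b"
    using R.inner_bal[of z a \<kappa> b] assms 1 by (simp add: right_mult2_def)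
qed

text \<open>The Takeuchi condition \<open>\<gamma>(a)(t(l) \<otimes> 1) = \<gamma>(a)(1 \<otimes>
  s(l))\<close>, followed by right multiplication. It is what makes
  \<open>a \<cdot> (x \<otimes> y) = \<gamma>(a)(x \<otimes> y)\<close> balanced over
  \<open>L\<close>.\<close>

lemma rmult_takeuchi:
  assumes "a \<in> carrier A" "l \<in> carrier L" "x \<in> carrier A" "y \<in> carrier A"
  shows "rmult (\<gamma> a) (t l \<otimes>\<^bsub>A\<^esub> x) y = rmult (\<gamma> a) x (s l \<otimes>\<^bsub>A\<^esub> y)"
proof -
  have 1: "tmap M (\<lambda>x. x \<otimes>\<^bsub>A\<^esub> c) (\<lambda>y. y) z = rmult z c \<one>\<^bsub>A\<^esub>" "tmap M (\<lambda>x. x) (\<lambda>y. y \<otimes>\<^bsub>A\<^esub> c) z = rmult z \<one>\<^bsub>A\<^esub> c"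
    if "z \<in> carrier M" "c \<in> carrier A" for z c
    unfolding right_mult2_def tmap_def
    using that by (intro M.tlift_cong[OF M.ab]; simp)+
  have "rmult (rmult (\<gamma> a) (t l) \<one>\<^bsub>A\<^esub>) x y = rmult (rmult (\<gamma> a) \<one>\<^bsub>A\<^esub> (s l)) x y"
    using takeuchi[OF assms(1,2)] assms by (simp add: 1)
  then show ?thesis using assms by (simp add: rmult_rmult)
qed

lemma dact_add_map: "a \<in> carrier A \<Longrightarrow> dact a \<in> add_map M M"
  and dact_pure: "\<lbrakk>a \<in> carrier A; x \<in> carrier A; y \<in> carrier A\<rbrakk> \<Longrightarrow> dact a (x \<boxtimes>\<^bsub>M\<^esub> y) = rmult (\<gamma> a) x y"
  unfolding diag_act_def
  by (rule M.tlift_add_map[OF M.ab rmult_biadd]; simp add: rmult_takeuchi)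
    (rule M.tlift_pure[OF M.ab rmult_biadd]; simp add: rmult_takeuchi)

lemmas dact_closed [simp] = add_map_closed[OF dact_add_map]
lemmas dact_add = add_map_add[OF dact_add_map]

lemma dact_rmult:
  assumes "z \<in> carrier M" "a \<in> carrier A" "x \<in> carrier A" "y \<in> carrier A"
  shows "dact a (rmult z x y) = rmult (dact a z) x y"
  using assms(1) by (induction rule: M.tensor_induct)
    (use assms(2-) in \<open>simp_all add: rmult_pure rmult_add dact_pure dact_add rmult_rmult\<close>)

lemma dact_mult:
  assumes "z \<in> carrier M" "a \<in> carrier A" "b \<in> carrier A"
  shows "dact (a \<otimes>\<^bsub>A\<^esub> b) z = dact a (dact b z)"
  using assms(1) by (induction rule: M.tensor_induct)
    (use assms(2-) in \<open>simp_all add: dact_pure dact_add cop_mult dact_rmult\<close>)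

lemma dact_one: "z \<in> carrier M \<Longrightarrow> dact \<one>\<^bsub>A\<^esub> z = z"
  by (induction rule: M.tensor_induct) (simp_all add: dact_pure dact_add cop_one rmult_pure)

lemma dact_add_left:
  assumes "z \<in> carrier M" "a \<in> carrier A" "b \<in> carrier A"
  shows "dact (a \<oplus>\<^bsub>A\<^esub> b) z = dact a z \<oplus>\<^bsub>M\<^esub> dact b z"
  using assms(1) by (induction rule: M.tensor_induct)
    (use assms(2-) in \<open>simp_all add: dact_pure dact_add cop_add rmult_add M.T.a_ac\<close>)

lemma dact_smult:
  assumes "z \<in> carrier M" "a \<in> carrier A" "\<kappa> \<in> carrier K"
  shows "dact (\<kappa> \<odot>\<^bsub>A\<^esub> a) z = \<kappa> \<odot>\<^bsub>M\<^esub> dact a z"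
  using assms(1) by (induction rule: M.tensor_induct)
    (use assms(2-) in \<open>simp_all add: dact_pure dact_add cop_smult rmult_smult Mm.smult_r_distr\<close>)

lemma dact_cop: "a \<in> carrier A \<Longrightarrow> dact a (\<one>\<^bsub>A\<^esub> \<boxtimes>\<^bsub>M\<^esub> \<one>\<^bsub>A\<^esub>) = \<gamma> a"
  by (simp add: dact_pure rmult_one)

lemma dact_s: "\<lbrakk>l \<in> carrier L; x \<in> carrier A; y \<in> carrier A\<rbrakk> \<Longrightarrow> dact (s l) (x \<boxtimes>\<^bsub>M\<^esub> y) = (s l \<otimes>\<^bsub>A\<^esub> x) \<boxtimes>\<^bsub>M\<^esub> y"
  by (simp add: dact_pure cop_s rmult_pure)

lemma dact_t: "\<lbrakk>l \<in> carrier L; x \<in> carrier A; y \<in> carrier A\<rbrakk> \<Longrightarrow> dact (t l) (x \<boxtimes>\<^bsub>M\<^esub> y) = x \<boxtimes>\<^bsub>M\<^esub> (t l \<otimes>\<^bsub>A\<^esub> y)"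
  by (simp add: dact_pure cop_t rmult_pure)

lemma M_cell_simps [simp]:
  "carrier (M_cell B) = carrier M" "(\<oplus>\<^bsub>M_cell B\<^esub>) = (\<oplus>\<^bsub>M\<^esub>)" "\<zero>\<^bsub>M_cell B\<^esub> = \<zero>\<^bsub>M\<^esub>"
  "\<kappa> \<odot>\<^bsub>M_cell B\<^esub> z = \<kappa> \<odot>\<^bsub>M\<^esub> z" "pure_tensor (M_cell B) = pure_tensor M" "lact (M_cell B) = dact"
  by (simp_all add: M_cell_def)

lemma ract_M_act: "ract (M_cell B) z w = R.act w z"
  by (simp add: M_cell_def R.act_def right_mult2_def)

lemma ract_M: "\<lbrakk>z \<in> carrier M; a \<in> carrier A; b \<in> carrier A\<rbrakk>
    \<Longrightarrow> ract (M_cell B) z (a \<boxtimes>\<^bsub>alg_tensor K A A\<^esub> b) = rmult z a b"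
  by (simp add: ract_M_act rmult_act)

lemma kb_M: "kbimod K A (AxA B) (M_cell B)"
proof -
  let ?T = "alg_tensor K A A"
  interpret T: k_algebra K ?T by (rule AA.alg)
  have ra: "(\<lambda>c p. ract (M_cell B) p c) \<in> biadd_map ?T M M"
    unfolding ract_M_act[abs_def] by (rule R.act_biadd)
  note rc [simp] = biadd_map_closed[OF ra]
  note rd = add_map_add[OF biadd_map_left[OF ra]] add_map_add[OF biadd_map_right[OF ra]]
  show ?thesis
    unfolding AxA_def
  proof (intro kbimod.intro alg_A AA.alg)
    show "module K (M_cell B)" by (simp add: M_cell_def module_mk_bimod Mm.module_axioms)
    show "lact (M_cell B) \<in> biadd_map A (M_cell B) (M_cell B)"
      by (intro biadd_mapI add_mapI) (simp_all add: dact_add dact_add_left)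
    show "(\<lambda>c p. ract (M_cell B) p c) \<in> biadd_map ?T (M_cell B) (M_cell B)"
      using ra by (simp add: biadd_map_def add_map_def)
    show "ract (M_cell B) z (w \<otimes>\<^bsub>?T\<^esub> w') = ract (M_cell B) (ract (M_cell B) z w) w'"
      if w: "w \<in> carrier ?T" "w' \<in> carrier ?T" "z \<in> carrier (M_cell B)" for w w' z
      using w(1)
    proof (induction rule: AA.tensor_induct)
      case (pure a b)
      note ab = pure
      show ?case
        using w(2)
        by (induction rule: AA.tensor_induct)
          (use ab w(3) in \<open>simp_all add: AA.mult_pure ract_M rmult_rmult rd T.r_distr\<close>)
    qed (use w in \<open>simp add: rd T.l_distr\<close>)
    show "ract (M_cell B) z (\<kappa> \<odot>\<^bsub>?T\<^esub> w) = \<kappa> \<odot>\<^bsub>M_cell B\<^esub> ract (M_cell B) z w"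
      if w: "\<kappa> \<in> carrier K" "w \<in> carrier ?T" "z \<in> carrier (M_cell B)" for \<kappa> w z
      using w(2) by (induction rule: AA.tensor_induct)
        (use w(1,3) in \<open>simp_all add: AA.smult_pure ract_M rmult_smult rd T.smult_r_distr Mm.smult_r_distr\<close>)
    show "lact (M_cell B) d (ract (M_cell B) p c) = ract (M_cell B) (lact (M_cell B) d p) c"
      if w: "d \<in> carrier A" "p \<in> carrier (M_cell B)" "c \<in> carrier ?T" for d p c
      using w(3) by (induction rule: AA.tensor_induct)
        (use w(1,2) in \<open>simp_all add: ract_M dact_rmult rd dact_add\<close>)
  qed (simp_all add: dact_one dact_mult dact_smult AA.one_pure ract_M rmult_one)
qed

lemma kb_A: "kbimod K A A (id_cell A)"
  by (rule kbimod_id_cell[OF alg_A])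

end

context left_bialgebroid_loc
begin

subsection \<open>The enveloping algebra of the base\<close>

lemma alg_Lop: "k_algebra K (alg_op L)"
  by (rule k_algebra_alg_op[OF alg_L])

sublocale E: algebra_pair K L "alg_op L"
  rewrites "alg_tensor (scalars B) (base B) (alg_op (base B)) = Le B"
  by (intro algebra_pair.intro alg_L alg_Lop) (simp add: Le_def)

sublocale Ea: k_algebra K "Le B"
  by (rule E.alg)

sublocale EE: algebra_pair K "Le B" "Le B"
  by (intro algebra_pair.intro E.alg)

abbreviation "\<eta> \<equiv> eta B"

lemma
  shows eta_add_map: "\<eta> \<in> add_map (Le B) A"
    and eta_pure: "\<lbrakk>l \<in> carrier L; l' \<in> carrier L\<rbrakk> \<Longrightarrow> \<eta> (l \<boxtimes>\<^bsub>Le B\<^esub> l') = s l \<otimes>\<^bsub>A\<^esub> t l'"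
proof -
  have bi: "(\<lambda>l l'. s l \<otimes>\<^bsub>A\<^esub> t l') \<in> biadd_map L (alg_op L) A"
    by (intro biadd_mapI add_mapI) (simp_all add: s_add t_add A.l_distr A.r_distr)
  have bal: "s (\<kappa> \<odot>\<^bsub>L\<^esub> l) \<otimes>\<^bsub>A\<^esub> t l' = s l \<otimes>\<^bsub>A\<^esub> t (\<kappa> \<odot>\<^bsub>alg_op L\<^esub> l')"
    if "l \<in> carrier L" "\<kappa> \<in> carrier K" "l' \<in> carrier (alg_op L)" for \<kappa> l l'
    using that by (simp add: s_smult t_smult A.smult_mult_left A.smult_mult_right)
  show "\<eta> \<in> add_map (Le B) A"
    unfolding eta_def by (rule E.tlift_add_map[OF A.M.abelian_group_axioms bi bal])
  show "\<eta> (l \<boxtimes>\<^bsub>Le B\<^esub> l') = s l \<otimes>\<^bsub>A\<^esub> t l'" if "l \<in> carrier L" "l' \<in> carrier L"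
    unfolding eta_def by (rule E.tlift_pure[OF A.M.abelian_group_axioms bi bal]) (use that in auto)
qed

lemma t_s: "\<lbrakk>l \<in> carrier L; l' \<in> carrier L; x \<in> carrier A\<rbrakk> \<Longrightarrow> t l' \<otimes>\<^bsub>A\<^esub> (s l \<otimes>\<^bsub>A\<^esub> x) = s l \<otimes>\<^bsub>A\<^esub> (t l' \<otimes>\<^bsub>A\<^esub> x)"
  by (simp add: A.m_assoc[symmetric] s_t)

text \<open>\<open>s\<close> is multiplicative, \<open>t\<close> is multiplicative on the opposite
  algebra, and \<open>t_s\<close> lets the two images pass each other.\<close>

lemma eta_hom: "\<eta> \<in> alg_hom K (Le B) A"
proof (rule alg_homI[OF eta_add_map])
  note ec = add_map_closed[OF eta_add_map] and ea = add_map_add[OF eta_add_map]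
  show "\<eta> (v \<otimes>\<^bsub>Le B\<^esub> w) = \<eta> v \<otimes>\<^bsub>A\<^esub> \<eta> w" if "v \<in> carrier (Le B)" "w \<in> carrier (Le B)" for v w
    using that(1)
  proof (induction rule: E.tensor_induct)
    case (pure a b)
    note ab = pure
    show ?case
      using that(2) by (induction rule: E.tensor_induct)
        (use ab in \<open>simp_all add: E.mult_pure eta_pure s_mult t_mult A.m_assoc t_s
            Ea.r_distr A.r_distr ea ec\<close>)
  qed (use that(2) in \<open>simp add: Ea.l_distr A.l_distr ea ec\<close>)
  show "\<eta> \<one>\<^bsub>Le B\<^esub> = \<one>\<^bsub>A\<^esub>" by (simp add: E.one_pure eta_pure)
  show "\<eta> (\<kappa> \<odot>\<^bsub>Le B\<^esub> w) = \<kappa> \<odot>\<^bsub>A\<^esub> \<eta> w" if "\<kappa> \<in> carrier K" "w \<in> carrier (Le B)" for \<kappa> w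
    using that(2) by (induction rule: E.tensor_induct)
      (use that(1) in \<open>simp_all add: E.smult_pure eta_pure s_smult A.smult_mult_left ea ec
          Ea.smult_r_distr A.smult_r_distr\<close>)
qed

lemmas eta_simps [simp] = alg_homD(1,4)[OF eta_hom]
lemmas eta_add = alg_homD(2)[OF eta_hom]
lemmas eta_mult = alg_homD(3)[OF eta_hom]
lemmas eta_smult = alg_homD(5)[OF eta_hom]

lemma eta_eta_hom: "eta_eta B \<in> alg_hom K (alg_tensor K (Le B) (Le B)) (alg_tensor K A A)"
  and eta_eta_pure: "\<lbrakk>u \<in> carrier (Le B); v \<in> carrier (Le B)\<rbrakk>
    \<Longrightarrow> eta_eta B (u \<boxtimes>\<^bsub>alg_tensor K (Le B) (Le B)\<^esub> v) = \<eta> u \<boxtimes>\<^bsub>alg_tensor K A A\<^esub> \<eta> v"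
  unfolding eta_eta_def AxA_def
  by (rule tmap_alg_hom[OF EE.algebra_pair_axioms AA.algebra_pair_axioms eta_hom eta_hom])
    (rule tmap_alg_hom_pure[OF EE.algebra_pair_axioms AA.algebra_pair_axioms eta_hom eta_hom])

lemma id_cell_simps [simp]:
  "carrier (id_cell C) = carrier C" "(\<oplus>\<^bsub>id_cell C\<^esub>) = (\<oplus>\<^bsub>C\<^esub>)" "\<zero>\<^bsub>id_cell C\<^esub> = \<zero>\<^bsub>C\<^esub>"
  "\<kappa> \<odot>\<^bsub>id_cell C\<^esub> z = \<kappa> \<odot>\<^bsub>C\<^esub> z" "lact (id_cell C) a x = a \<otimes>\<^bsub>C\<^esub> x" "ract (id_cell C) x a = x \<otimes>\<^bsub>C\<^esub> a"
  by (simp_all add: id_cell_def)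

lemma eta_lower_simps [simp]:
  "carrier (eta_lower B) = carrier A" "(\<oplus>\<^bsub>eta_lower B\<^esub>) = (\<oplus>\<^bsub>A\<^esub>)" "\<zero>\<^bsub>eta_lower B\<^esub> = \<zero>\<^bsub>A\<^esub>"
  "\<kappa> \<odot>\<^bsub>eta_lower B\<^esub> z = \<kappa> \<odot>\<^bsub>A\<^esub> z" "lact (eta_lower B) a x = a \<otimes>\<^bsub>A\<^esub> x"
  "ract (eta_lower B) x e = x \<otimes>\<^bsub>A\<^esub> \<eta> e"
  by (simp_all add: eta_lower_def restrict_right_def)

lemma eta_upper_simps [simp]:
  "carrier (eta_upper B) = carrier A" "(\<oplus>\<^bsub>eta_upper B\<^esub>) = (\<oplus>\<^bsub>A\<^esub>)" "\<zero>\<^bsub>eta_upper B\<^esub> = \<zero>\<^bsub>A\<^esub>"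
  "\<kappa> \<odot>\<^bsub>eta_upper B\<^esub> z = \<kappa> \<odot>\<^bsub>A\<^esub> z" "lact (eta_upper B) e x = \<eta> e \<otimes>\<^bsub>A\<^esub> x"
  "ract (eta_upper B) x a = x \<otimes>\<^bsub>A\<^esub> a"
  by (simp_all add: eta_upper_def)

lemma M_res_simps [simp]:
  "carrier (M_res B) = carrier M" "(\<oplus>\<^bsub>M_res B\<^esub>) = (\<oplus>\<^bsub>M\<^esub>)" "\<zero>\<^bsub>M_res B\<^esub> = \<zero>\<^bsub>M\<^esub>"
  "\<kappa> \<odot>\<^bsub>M_res B\<^esub> z = \<kappa> \<odot>\<^bsub>M\<^esub> z" "pure_tensor (M_res B) = pure_tensor M" "lact (M_res B) = dact"
  by (simp_all add: M_res_def restrict_right_def)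

lemma kb_eta_lower: "kbimod K A (Le B) (eta_lower B)"
  unfolding eta_lower_def by (rule kbimod_restrict_right[OF kb_A E.alg eta_hom])

lemma kb_eta_upper: "kbimod K (Le B) A (eta_upper B)"
proof (intro kbimod.intro alg_A E.alg)
  show "module K (eta_upper B)" by (simp add: eta_upper_def module_mk_bimod A.module_axioms)
  show "lact (eta_upper B) \<in> biadd_map (Le B) (eta_upper B) (eta_upper B)"
    by (intro biadd_mapI add_mapI) (simp_all add: eta_add A.l_distr A.r_distr)
  show "(\<lambda>c p. ract (eta_upper B) p c) \<in> biadd_map A (eta_upper B) (eta_upper B)"
    by (intro biadd_mapI add_mapI) (simp_all add: A.l_distr A.r_distr)
qed (simp_all add: eta_mult eta_smult A.m_assoc A.smult_mult_left A.smult_mult_right)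

lemma kb_Le: "kbimod K (Le B) (Le B) (id_cell (Le B))"
  by (rule kbimod_id_cell[OF E.alg])

lemma kb_M_res: "kbimod K A (alg_tensor K (Le B) (Le B)) (M_res B)"
  unfolding M_res_def
  using kbimod_restrict_right[OF kb_M[unfolded AxA_def] EE.alg eta_eta_hom] .

subsection \<open>The bimodule \<open>m\<close>\<close>

abbreviation inl :: "'l \<Rightarrow> ('l, 'l) tens" where "inl l \<equiv> l \<boxtimes>\<^bsub>Le B\<^esub> \<one>\<^bsub>L\<^esub>"
abbreviation inr :: "'l \<Rightarrow> ('l, 'l) tens" where "inr l \<equiv> \<one>\<^bsub>L\<^esub> \<boxtimes>\<^bsub>Le B\<^esub> l"

lemma E_mult_pure: "\<lbrakk>a \<in> carrier L; b \<in> carrier L; a' \<in> carrier L; b' \<in> carrier L\<rbrakk>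
    \<Longrightarrow> (a \<boxtimes>\<^bsub>Le B\<^esub> b) \<otimes>\<^bsub>Le B\<^esub> (a' \<boxtimes>\<^bsub>Le B\<^esub> b') = (a \<otimes>\<^bsub>L\<^esub> a') \<boxtimes>\<^bsub>Le B\<^esub> (b' \<otimes>\<^bsub>L\<^esub> b)"
  using E.mult_pure[of a b a' b'] by simp

lemma inl_add: "\<lbrakk>a \<in> carrier L; b \<in> carrier L\<rbrakk> \<Longrightarrow> inl (a \<oplus>\<^bsub>L\<^esub> b) = inl a \<oplus>\<^bsub>Le B\<^esub> inl b"
  and inr_add: "\<lbrakk>a \<in> carrier L; b \<in> carrier L\<rbrakk> \<Longrightarrow> inr (a \<oplus>\<^bsub>L\<^esub> b) = inr a \<oplus>\<^bsub>Le B\<^esub> inr b"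
  using E.pure_add_left[of a b "\<one>\<^bsub>L\<^esub>"] E.pure_add_right[of "\<one>\<^bsub>L\<^esub>" a b] by simp_all

lemma inl_smult: "\<lbrakk>\<kappa> \<in> carrier K; l \<in> carrier L\<rbrakk> \<Longrightarrow> inl (\<kappa> \<odot>\<^bsub>L\<^esub> l) = \<kappa> \<odot>\<^bsub>Le B\<^esub> inl l"
  and inr_smult: "\<lbrakk>\<kappa> \<in> carrier K; l \<in> carrier L\<rbrakk> \<Longrightarrow> inr (\<kappa> \<odot>\<^bsub>L\<^esub> l) = \<kappa> \<odot>\<^bsub>Le B\<^esub> inr l"
  using E.smult_pure[of \<kappa> l "\<one>\<^bsub>L\<^esub>"] E.smult_pure[of \<kappa> "\<one>\<^bsub>L\<^esub>" l] E.pure_balanced[of "\<one>\<^bsub>L\<^esub>" \<kappa> l] by simp_all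

lemma eta_inl: "l \<in> carrier L \<Longrightarrow> \<eta> (inl l) = s l"
  and eta_inr: "l \<in> carrier L \<Longrightarrow> \<eta> (inr l) = t l"
  by (simp_all add: eta_pure)

lemma inl_inr: "\<lbrakk>a \<in> carrier L; b \<in> carrier L; x \<in> carrier (Le B)\<rbrakk>
    \<Longrightarrow> inr b \<otimes>\<^bsub>Le B\<^esub> (inl a \<otimes>\<^bsub>Le B\<^esub> x) = inl a \<otimes>\<^bsub>Le B\<^esub> (inr b \<otimes>\<^bsub>Le B\<^esub> x)"
  by (simp add: Ea.m_assoc[symmetric] E_mult_pure)

sublocale m: tensor_product "Le B" "Le B" "carrier L"
    "\<lambda>u l. inr l \<otimes>\<^bsub>Le B\<^esub> u" "\<lambda>l v. inl l \<otimes>\<^bsub>Le B\<^esub> v" "m_tensor B"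
  by (intro tensor_product.intro E.ab)
    (simp_all add: m_tensor_def tensor_simps)

lemma mod_m: "module K (m_tensor B)"
  and m_smult_pure: "\<lbrakk>\<kappa> \<in> carrier K; x \<in> carrier (Le B); y \<in> carrier (Le B)\<rbrakk>
    \<Longrightarrow> \<kappa> \<odot>\<^bsub>m_tensor B\<^esub> (x \<boxtimes>\<^bsub>m_tensor B\<^esub> y) = (\<kappa> \<odot>\<^bsub>Le B\<^esub> x) \<boxtimes>\<^bsub>m_tensor B\<^esub> y"
  by (rule module_tensor[OF m.tensor_product_axioms] tensor_smult_pure[OF m.tensor_product_axioms];
      simp add: m_tensor_def k_algebra_module[OF E.alg] Ea.smult_mult_right)+

sublocale mm: module K "m_tensor B"
  by (rule mod_m)

lemma m_smult_mid:
  assumes "\<kappa> \<in> carrier K" "x \<in> carrier (Le B)" "y \<in> carrier (Le B)"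
  shows "(\<kappa> \<odot>\<^bsub>Le B\<^esub> x) \<boxtimes>\<^bsub>m_tensor B\<^esub> y = x \<boxtimes>\<^bsub>m_tensor B\<^esub> (\<kappa> \<odot>\<^bsub>Le B\<^esub> y)"
  using m.pure_balanced[of x "\<kappa> \<odot>\<^bsub>L\<^esub> \<one>\<^bsub>L\<^esub>" y] assms
  by (simp add: inl_smult inr_smult Ea.smult_mult_left E.one_pure[simplified, symmetric])

lemma m_lact_action: "tensor_action (Le B) (Le B) (carrier L) (\<lambda>u l. inr l \<otimes>\<^bsub>Le B\<^esub> u) (\<lambda>l v. inl l \<otimes>\<^bsub>Le B\<^esub> v)
    (m_tensor B) K L (alg_op L) (Le B) (\<lambda>l u. inl l \<otimes>\<^bsub>Le B\<^esub> u) (\<lambda>l v. inr l \<otimes>\<^bsub>Le B\<^esub> v)"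
  by (intro tensor_action.intro m.tensor_product_axioms E.tensor_product_axioms tensor_action_axioms.intro
      biadd_mapI add_mapI)
    (simp_all add: Ea.l_distr Ea.r_distr inl_add inr_add inl_inr m.pure_balanced[symmetric]
      inl_smult inr_smult Ea.smult_mult_left m_smult_mid)

lemma m_ract_action: "tensor_action (Le B) (Le B) (carrier L) (\<lambda>u l. inr l \<otimes>\<^bsub>Le B\<^esub> u) (\<lambda>l v. inl l \<otimes>\<^bsub>Le B\<^esub> v)
    (m_tensor B) K (Le B) (Le B) (alg_tensor K (Le B) (Le B)) (\<lambda>c p. p \<otimes>\<^bsub>Le B\<^esub> c) (\<lambda>c p. p \<otimes>\<^bsub>Le B\<^esub> c)"
  by (intro tensor_action.intro m.tensor_product_axioms EE.tensor_product_axioms tensor_action_axioms.intro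
      biadd_mapI add_mapI)
    (simp_all add: Ea.l_distr Ea.r_distr Ea.m_assoc m.pure_balanced Ea.smult_mult_right m_smult_mid)

sublocale ml: tensor_action "Le B" "Le B" "carrier L" "\<lambda>u l. inr l \<otimes>\<^bsub>Le B\<^esub> u" "\<lambda>l v. inl l \<otimes>\<^bsub>Le B\<^esub> v"
    "m_tensor B" K L "alg_op L" "Le B" "\<lambda>l u. inl l \<otimes>\<^bsub>Le B\<^esub> u" "\<lambda>l v. inr l \<otimes>\<^bsub>Le B\<^esub> v"
  by (rule m_lact_action)

sublocale mr: tensor_action "Le B" "Le B" "carrier L" "\<lambda>u l. inr l \<otimes>\<^bsub>Le B\<^esub> u" "\<lambda>l v. inl l \<otimes>\<^bsub>Le B\<^esub> v"
    "m_tensor B" K "Le B" "Le B" "alg_tensor K (Le B) (Le B)" "\<lambda>c p. p \<otimes>\<^bsub>Le B\<^esub> c" "\<lambda>c p. p \<otimes>\<^bsub>Le B\<^esub> c"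
  by (rule m_ract_action)

lemma m_cell_simps [simp]:
  "carrier (m_cell B) = carrier (m_tensor B)" "(\<oplus>\<^bsub>m_cell B\<^esub>) = (\<oplus>\<^bsub>m_tensor B\<^esub>)"
  "\<zero>\<^bsub>m_cell B\<^esub> = \<zero>\<^bsub>m_tensor B\<^esub>" "\<kappa> \<odot>\<^bsub>m_cell B\<^esub> z = \<kappa> \<odot>\<^bsub>m_tensor B\<^esub> z"
  "pure_tensor (m_cell B) = pure_tensor (m_tensor B)"
  by (simp_all add: m_cell_def)

lemma m_lact: "lact (m_cell B) = ml.act" and m_ract: "ract (m_cell B) z w = mr.act w z"
  by (simp_all add: m_cell_def ml.act_def mr.act_def fun_eq_iff)

lemma ml_pure: "\<lbrakk>l \<in> carrier L; l' \<in> carrier L; u \<in> carrier (Le B); v \<in> carrier (Le B)\<rbrakk>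
    \<Longrightarrow> ml.act (l \<boxtimes>\<^bsub>Le B\<^esub> l') (u \<boxtimes>\<^bsub>m_tensor B\<^esub> v)
      = (inl l \<otimes>\<^bsub>Le B\<^esub> u) \<boxtimes>\<^bsub>m_tensor B\<^esub> (inr l' \<otimes>\<^bsub>Le B\<^esub> v)"
  by (rule ml.act_pure) simp_all

lemma kb_m: "kbimod K (Le B) (alg_tensor K (Le B) (Le B)) (m_cell B)"
proof -
  let ?T = "alg_tensor K (Le B) (Le B)"
  interpret T: k_algebra K ?T by (rule EE.alg)
  note lc [simp] = biadd_map_closed[OF ml.act_biadd] biadd_map_closed[OF mr.act_biadd]
  note ld = add_map_add[OF biadd_map_left[OF ml.act_biadd]] add_map_add[OF biadd_map_right[OF ml.act_biadd]]
    add_map_add[OF biadd_map_left[OF mr.act_biadd]] add_map_add[OF biadd_map_right[OF mr.act_biadd]]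
  show ?thesis
  proof (intro kbimod.intro E.alg EE.alg)
    show "module K (m_cell B)" by (simp add: m_cell_def module_mk_bimod mod_m)
    show "lact (m_cell B) \<in> biadd_map (Le B) (m_cell B) (m_cell B)"
      using ml.act_biadd by (simp add: m_lact biadd_map_def add_map_def)
    show "(\<lambda>c p. ract (m_cell B) p c) \<in> biadd_map ?T (m_cell B) (m_cell B)"
      using mr.act_biadd by (simp add: m_ract biadd_map_def add_map_def)
    show "lact (m_cell B) \<one>\<^bsub>Le B\<^esub> p = p" if "p \<in> carrier (m_cell B)" for p
      using that[unfolded m_cell_simps]
    proof (induction rule: m.tensor_induct)
      case (pure u v)
      have "inl \<one>\<^bsub>L\<^esub> = \<one>\<^bsub>Le B\<^esub>" by (simp add: E.one_pure)
      then show ?case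
        using pure ml_pure[of "\<one>\<^bsub>L\<^esub>" "\<one>\<^bsub>L\<^esub>" u v] by (simp add: m_lact)
    qed (simp add: ld m_lact)
    show "ract (m_cell B) p \<one>\<^bsub>?T\<^esub> = p" if "p \<in> carrier (m_cell B)" for p
      using that[unfolded m_cell_simps]
    proof (induction rule: m.tensor_induct)
      case (pure u v)
      then show ?case by (simp add: m_ract EE.one_pure mr.act_pure)
    qed (simp add: ld m_ract)
    show "lact (m_cell B) (w \<otimes>\<^bsub>Le B\<^esub> w') z = lact (m_cell B) w (lact (m_cell B) w' z)"
      if w: "w \<in> carrier (Le B)" "w' \<in> carrier (Le B)" "z \<in> carrier (m_cell B)" for w w' z
      using w(1)
    proof (induction rule: E.tensor_induct)
      case (pure a b)
      note ab = pure
      show ?case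
        using w(2)
      proof (induction rule: E.tensor_induct)
        case (pure a' b')
        note ab' = pure
        have p: "inl (a \<otimes>\<^bsub>L\<^esub> a') = inl a \<otimes>\<^bsub>Le B\<^esub> inl a'" "inr (b' \<otimes>\<^bsub>L\<^esub> b) = inr b \<otimes>\<^bsub>Le B\<^esub> inr b'"
          using ab ab' by (simp_all add: E_mult_pure)
        show ?case
          using w(3)[unfolded m_cell_simps] by (induction rule: m.tensor_induct)
            (use ab ab' in \<open>simp_all add: m_lact E_mult_pure[of a b a' b'] ml_pure p Ea.m_assoc ld\<close>)
      qed (use ab w in \<open>simp add: m_lact ld Ea.r_distr\<close>)
    qed (use w in \<open>simp add: m_lact ld Ea.l_distr\<close>)
    show "ract (m_cell B) z (w \<otimes>\<^bsub>?T\<^esub> w') = ract (m_cell B) (ract (m_cell B) z w) w'"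
      if w: "w \<in> carrier ?T" "w' \<in> carrier ?T" "z \<in> carrier (m_cell B)" for w w' z
      using w(1)
    proof (induction rule: EE.tensor_induct)
      case (pure a b)
      note ab = pure
      show ?case
        using w(2)
      proof (induction rule: EE.tensor_induct)
        case (pure a' b')
        note ab' = pure
        show ?case
          using w(3)[unfolded m_cell_simps] by (induction rule: m.tensor_induct)
            (use ab ab' in \<open>simp_all add: m_ract EE.mult_pure mr.act_pure Ea.m_assoc ld\<close>)
      qed (use ab w in \<open>simp add: m_ract ld T.r_distr\<close>)
    qed (use w in \<open>simp add: m_ract ld T.l_distr\<close>)
    show "lact (m_cell B) (\<kappa> \<odot>\<^bsub>Le B\<^esub> w) z = \<kappa> \<odot>\<^bsub>m_cell B\<^esub> lact (m_cell B) w z"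
      if w: "\<kappa> \<in> carrier K" "w \<in> carrier (Le B)" "z \<in> carrier (m_cell B)" for \<kappa> w z
      using w(2)
    proof (induction rule: E.tensor_induct)
      case (pure a b)
      note ab = pure[simplified]
      have p: "\<kappa> \<odot>\<^bsub>Le B\<^esub> (a \<boxtimes>\<^bsub>Le B\<^esub> b) = (\<kappa> \<odot>\<^bsub>L\<^esub> a) \<boxtimes>\<^bsub>Le B\<^esub> b"
        using E.smult_pure[of \<kappa> a b] ab w(1) by simp
      show ?case
        using w(3)[unfolded m_cell_simps] by (induction rule: m.tensor_induct)
          (use ab w(1) in \<open>simp_all add: m_lact p ml_pure inl_smult Ea.smult_mult_left m_smult_pure ld
              mm.smult_r_distr\<close>)
    qed (use w in \<open>simp add: m_lact ld Ea.smult_r_distr mm.smult_r_distr\<close>)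
    show "ract (m_cell B) z (\<kappa> \<odot>\<^bsub>?T\<^esub> w) = \<kappa> \<odot>\<^bsub>m_cell B\<^esub> ract (m_cell B) z w"
      if w: "\<kappa> \<in> carrier K" "w \<in> carrier ?T" "z \<in> carrier (m_cell B)" for \<kappa> w z
      using w(2)
    proof (induction rule: EE.tensor_induct)
      case (pure a b)
      note ab = pure
      show ?case
        using w(3)[unfolded m_cell_simps] by (induction rule: m.tensor_induct)
          (use ab w(1) in \<open>simp_all add: m_ract EE.smult_pure mr.act_pure Ea.smult_mult_right m_smult_pure ld
              mm.smult_r_distr\<close>)
    qed (use w in \<open>simp add: m_ract ld T.smult_r_distr mm.smult_r_distr\<close>)
    show "lact (m_cell B) w (ract (m_cell B) z w') = ract (m_cell B) (lact (m_cell B) w z) w'"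
      if w: "w \<in> carrier (Le B)" "z \<in> carrier (m_cell B)" "w' \<in> carrier ?T" for w w' z
      using w(1)
    proof (induction rule: E.tensor_induct)
      case (pure a b)
      note ab = pure
      show ?case
        using w(3)
      proof (induction rule: EE.tensor_induct)
        case (pure a' b')
        note ab' = pure
        show ?case
          using w(2)[unfolded m_cell_simps] by (induction rule: m.tensor_induct)
            (use ab ab' in \<open>simp_all add: m_lact m_ract ml_pure mr.act_pure Ea.m_assoc ld\<close>)
      qed (use ab w in \<open>simp add: m_lact m_ract ld\<close>)
    qed (use w in \<open>simp add: m_lact m_ract ld\<close>)
  qed
qed

text \<open>The value of \<open>psi\<close> at \<open>1 \<boxtimes> n\<close>; the general value is
  \<open>a\<close> acting on it (\<open>psi_pure\<close>).\<close>

definition etam :: "(('l, 'l) tens, ('l, 'l) tens) tens \<Rightarrow> ('a, 'a) tens" where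
  "etam = tmap M \<eta> \<eta>"

lemma etam_map: "tensor_map (Le B) (Le B) (carrier L) (\<lambda>u l. inr l \<otimes>\<^bsub>Le B\<^esub> u) (\<lambda>l v. inl l \<otimes>\<^bsub>Le B\<^esub> v) (m_tensor B)
    A A (carrier L) (\<lambda>x l. t l \<otimes>\<^bsub>A\<^esub> x) (\<lambda>l y. s l \<otimes>\<^bsub>A\<^esub> y) M \<eta> \<eta>"
  by (intro tensor_map.intro m.tensor_product_axioms M.tensor_product_axioms tensor_map_axioms.intro
      eta_add_map) (simp add: eta_mult eta_inl eta_inr M.pure_balanced)

lemma etam_add_map: "etam \<in> add_map (m_tensor B) M"
  unfolding etam_def by (rule tensor_map.add_map[OF etam_map])

lemma etam_pure: "\<lbrakk>u \<in> carrier (Le B); v \<in> carrier (Le B)\<rbrakk> \<Longrightarrow> etam (u \<boxtimes>\<^bsub>m_tensor B\<^esub> v) = \<eta> u \<boxtimes>\<^bsub>M\<^esub> \<eta> v"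
  unfolding etam_def by (rule tensor_map.pure[OF etam_map])

lemmas etam_closed [simp] = add_map_closed[OF etam_add_map]
lemmas etam_add = add_map_add[OF etam_add_map]

text \<open>Both actions of the enveloping algebra reduce to
  \<open>\<gamma>(s(l)) = s(l) \<otimes> 1\<close> and
  \<open>\<gamma>(t(l)) = 1 \<otimes> t(l)\<close>. This semilinearity is the balancedness of
  \<open>psi\<close>.\<close>

lemma etam_lact:
  assumes "e \<in> carrier (Le B)" "n \<in> carrier (m_tensor B)"
  shows "etam (lact (m_cell B) e n) = dact (\<eta> e) (etam n)"
proof -
  note lc [simp] = biadd_map_closed[OF ml.act_biadd]
  note ld = add_map_add[OF biadd_map_left[OF ml.act_biadd]] add_map_add[OF biadd_map_right[OF ml.act_biadd]]
  show ?thesis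
    using assms(1)
  proof (induction rule: E.tensor_induct)
    case (pure a b)
    note ab = pure[simplified]
    show ?case
      using assms(2)
    proof (induction rule: m.tensor_induct)
      case (pure u v)
      then show ?case
        using ab by (simp add: m_lact ml_pure etam_pure eta_mult eta_inl eta_inr eta_pure dact_mult dact_t dact_s)
    qed (use ab in \<open>simp add: m_lact ld etam_add dact_add eta_pure\<close>)
  qed (use assms(2) in \<open>simp add: m_lact ld etam_add eta_add dact_add_left\<close>)
qed

abbreviation "Hm \<equiv> hcomp (eta_lower B) (Le B) (m_cell B)"

sublocale Hm: hcomp_pair K A "Le B" "alg_tensor K (Le B) (Le B)" "eta_lower B" "m_cell B"
  by (intro hcomp_pair.intro kb_eta_lower kb_m)

lemma psi_add_map: "psi B \<in> add_map Hm M"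
  and psi_pure: "\<lbrakk>a \<in> carrier A; n \<in> carrier (m_tensor B)\<rbrakk> \<Longrightarrow> psi B (a \<boxtimes>\<^bsub>Hm\<^esub> n) = dact a (etam n)"
proof -
  let ?b = "\<lambda>a z. tlift M (\<lambda>u v. rmult (\<gamma> a) (\<eta> u) (\<eta> v)) z"
  have b: "?b a z = dact a (etam z)" if "a \<in> carrier A" "z \<in> carrier (m_tensor B)" for a z
    by (rule m.tlift_eqI[OF M.ab add_map_comp[OF etam_add_map dact_add_map]])
      (use that in \<open>simp_all add: etam_pure dact_pure\<close>)
  have bi: "?b \<in> biadd_map (eta_lower B) (m_cell B) M"
    by (intro biadd_mapI add_mapI) (simp_all add: b etam_add dact_add dact_add_left)
  have bal: "?b (ract (eta_lower B) x e) z = ?b x (lact (m_cell B) e z)"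
    if "x \<in> carrier (eta_lower B)" "e \<in> carrier (Le B)" "z \<in> carrier (m_cell B)" for x e z
    using that kbimod.lact_closed[OF kb_m that(2,3)] by (simp add: b etam_lact dact_mult)
  show "psi B \<in> add_map Hm M"
    unfolding psi_def by (rule Hm.tlift_add_map[OF M.ab bi bal])
  show "psi B (a \<boxtimes>\<^bsub>Hm\<^esub> n) = dact a (etam n)" if "a \<in> carrier A" "n \<in> carrier (m_tensor B)"
    unfolding psi_def using Hm.tlift_pure[OF M.ab bi bal, of a n] that by (simp add: b)
qed

lemma psi_lact:
  assumes "a \<in> carrier A" "h \<in> carrier Hm"
  shows "psi B (lact Hm a h) = dact a (psi B h)"
  using assms(2)
  by (induction rule: Hm.tensor_induct)
    (use assms(1) add_map_closed[OF Hm.lact_add_map, of a] in \<open>simp_all add: Hm.lact_pure psi_pure dact_mult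
      add_map_add[OF Hm.lact_add_map] add_map_add[OF psi_add_map] add_map_closed[OF psi_add_map] dact_add\<close>)

abbreviation "Hu \<equiv> hcomp (eta_lower B) (Le B) (eta_upper B)"

sublocale Hu: hcomp_pair K A "Le B" A "eta_lower B" "eta_upper B"
  by (intro hcomp_pair.intro kb_eta_lower kb_eta_upper)

lemma eps_add_map: "eps B \<in> add_map Hu A"
  and eps_pure: "\<lbrakk>a \<in> carrier A; b \<in> carrier A\<rbrakk> \<Longrightarrow> eps B (a \<boxtimes>\<^bsub>Hu\<^esub> b) = a \<otimes>\<^bsub>A\<^esub> b"
proof -
  have bi: "(\<lambda>a b. a \<otimes>\<^bsub>A\<^esub> b) \<in> biadd_map (eta_lower B) (eta_upper B) A"
    by (intro biadd_mapI add_mapI) (simp_all add: A.l_distr A.r_distr)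
  have bal: "ract (eta_lower B) x e \<otimes>\<^bsub>A\<^esub> y = x \<otimes>\<^bsub>A\<^esub> lact (eta_upper B) e y"
    if "x \<in> carrier (eta_lower B)" "e \<in> carrier (Le B)" "y \<in> carrier (eta_upper B)" for x e y
    using that by (simp add: A.m_assoc)
  show "eps B \<in> add_map Hu A"
    unfolding eps_def by (rule Hu.tlift_add_map[OF A.M.abelian_group_axioms bi bal])
  show "eps B (a \<boxtimes>\<^bsub>Hu\<^esub> b) = a \<otimes>\<^bsub>A\<^esub> b" if "a \<in> carrier A" "b \<in> carrier A"
    unfolding eps_def using Hu.tlift_pure[OF A.M.abelian_group_axioms bi bal, of a b] that by simp
qed

lemma eps_lact:
  assumes "a \<in> carrier A" "h \<in> carrier Hu"
  shows "eps B (lact Hu a h) = a \<otimes>\<^bsub>A\<^esub> eps B h"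
  using assms(2)
  by (induction rule: Hu.tensor_induct)
    (use assms(1) add_map_closed[OF Hu.lact_add_map, of a] in \<open>simp_all add: Hu.lact_pure eps_pure A.m_assoc
      add_map_add[OF Hu.lact_add_map] add_map_add[OF eps_add_map] add_map_closed[OF eps_add_map] A.r_distr\<close>)

end

section \<open>Tensor products of records with the same underlying data\<close>

lemma tensor_cong:
  assumes "carrier M = carrier M'" "(\<oplus>\<^bsub>M\<^esub>) = (\<oplus>\<^bsub>M'\<^esub>)" "(\<odot>\<^bsub>M\<^esub>) = (\<odot>\<^bsub>M'\<^esub>)"
    and "carrier N = carrier N'" "(\<oplus>\<^bsub>N\<^esub>) = (\<oplus>\<^bsub>N'\<^esub>)"
  shows "tensor M R \<rho> \<mu> N = tensor M' R \<rho> \<mu> N'"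
  using assms by (simp add: tensor_def tensor_group_def tensor_rels_def)

lemma ktensor_cong:
  assumes "carrier M = carrier M'" "(\<oplus>\<^bsub>M\<^esub>) = (\<oplus>\<^bsub>M'\<^esub>)" "(\<odot>\<^bsub>M\<^esub>) = (\<odot>\<^bsub>M'\<^esub>)"
    and "carrier N = carrier N'" "(\<oplus>\<^bsub>N\<^esub>) = (\<oplus>\<^bsub>N'\<^esub>)" "(\<odot>\<^bsub>N\<^esub>) = (\<odot>\<^bsub>N'\<^esub>)"
  shows "ktensor K M N = ktensor K M' N'"
  using assms tensor_cong[of M M' N N'] by (simp add: ktensor_def)

text \<open>The second factor of a composite may be restricted on the right without changing the underlying group.\<close>

lemma hcomp_group_cong:
  assumes "carrier P = carrier P'" "(\<oplus>\<^bsub>P\<^esub>) = (\<oplus>\<^bsub>P'\<^esub>)" "lact P = lact P'"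
  shows "carrier (hcomp Q D P) = carrier (hcomp Q D P')"
    and "(\<oplus>\<^bsub>hcomp Q D P\<^esub>) = (\<oplus>\<^bsub>hcomp Q D P'\<^esub>)"
    and "pure_tensor (hcomp Q D P) = pure_tensor (hcomp Q D P')"
  using tensor_cong[of Q Q P P' "carrier D" "ract Q" "lact P'"] assms by (simp_all add: hcomp_def Let_def)

lemma xtensor_cong:
  assumes "carrier P = carrier Q" "(\<oplus>\<^bsub>P\<^esub>) = (\<oplus>\<^bsub>Q\<^esub>)" "(\<odot>\<^bsub>P\<^esub>) = (\<odot>\<^bsub>Q\<^esub>)" "lact P = lact Q"
    and "carrier P' = carrier Q'" "(\<oplus>\<^bsub>P'\<^esub>) = (\<oplus>\<^bsub>Q'\<^esub>)" "(\<odot>\<^bsub>P'\<^esub>) = (\<odot>\<^bsub>Q'\<^esub>)" "lact P' = lact Q'"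
  shows "carrier (xtensor K P P') = carrier (xtensor K Q Q')"
    and "(\<oplus>\<^bsub>xtensor K P P'\<^esub>) = (\<oplus>\<^bsub>xtensor K Q Q'\<^esub>)"
    and "lact (xtensor K P P') = lact (xtensor K Q Q')"
    and "pure_tensor (xtensor K P P') = pure_tensor (xtensor K Q Q')"
  using ktensor_cong[of P Q P' Q' K] assms by (simp_all add: xtensor_def Let_def)

subsection \<open>The one-dimensional module of an anti-automorphism\<close>

locale anti_auto = left_bialgebroid_loc B for B :: "('k, 'a, 'l) bialgebroid" +
  fixes \<xi> :: "'a \<Rightarrow> 'a"
  assumes xi_hom: "\<xi> \<in> alg_hom K A (alg_op A)" and xi_bij: "bij_betw \<xi> (carrier A) (carrier A)"
begin

abbreviation "\<phi> \<equiv> inv_into (carrier A) \<xi>"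

lemma xi_phi [simp]: "a \<in> carrier A \<Longrightarrow> \<xi> (\<phi> a) = a" "a \<in> carrier A \<Longrightarrow> \<phi> (\<xi> a) = a"
  using xi_bij by (auto simp: bij_betw_inv_into_left bij_betw_inv_into_right)

lemma phi_hom: "\<phi> \<in> alg_hom K A (alg_op A)"
proof -
  have "\<phi> \<in> alg_hom K (alg_op A) A"
    by (rule alg_hom_inv_into[OF alg_A xi_hom]) (use xi_bij in simp)
  then show ?thesis by (auto simp: alg_hom_def ring_hom_def)
qed

lemmas xi_simps [simp] = alg_homD(1,4)[OF xi_hom, simplified]
lemmas xi_add = alg_homD(2)[OF xi_hom, simplified]
lemmas xi_mult = alg_homD(3)[OF xi_hom, simplified]
lemmas xi_smult = alg_homD(5)[OF xi_hom, simplified]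
lemmas phi_simps' [simp] = alg_homD(1,4)[OF phi_hom, simplified]
lemmas phi_add = alg_homD(2)[OF phi_hom, simplified]
lemmas phi_mult = alg_homD(3)[OF phi_hom, simplified]
lemmas phi_smult = alg_homD(5)[OF phi_hom, simplified]

lemma sigma_simps [simp]:
  "carrier (sigma B \<xi>) = carrier A" "(\<oplus>\<^bsub>sigma B \<xi>\<^esub>) = (\<oplus>\<^bsub>A\<^esub>)" "\<zero>\<^bsub>sigma B \<xi>\<^esub> = \<zero>\<^bsub>A\<^esub>"
  "(\<odot>\<^bsub>sigma B \<xi>\<^esub>) = (\<odot>\<^bsub>A\<^esub>)"
  by (simp_all add: sigma_def fun_eq_iff)

lemma ract_sigma:
  assumes x: "x \<in> carrier A"
  shows "ract (sigma B \<xi>) x \<in> add_map (alg_tensor K A A) A"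
    and "\<And>a b. \<lbrakk>a \<in> carrier A; b \<in> carrier A\<rbrakk> \<Longrightarrow>
      ract (sigma B \<xi>) x (a \<boxtimes>\<^bsub>alg_tensor K A A\<^esub> b) = \<phi> b \<otimes>\<^bsub>A\<^esub> x \<otimes>\<^bsub>A\<^esub> a"
proof -
  have bi: "(\<lambda>a b. \<phi> b \<otimes>\<^bsub>A\<^esub> x \<otimes>\<^bsub>A\<^esub> a) \<in> biadd_map A A A"
    by (intro biadd_mapI add_mapI) (simp_all add: x phi_add A.l_distr A.r_distr)
  have bal: "\<phi> b \<otimes>\<^bsub>A\<^esub> x \<otimes>\<^bsub>A\<^esub> (\<kappa> \<odot>\<^bsub>A\<^esub> a) = \<phi> (\<kappa> \<odot>\<^bsub>A\<^esub> b) \<otimes>\<^bsub>A\<^esub> x \<otimes>\<^bsub>A\<^esub> a"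
    if "a \<in> carrier A" "\<kappa> \<in> carrier K" "b \<in> carrier A" for a \<kappa> b
    using that x by (simp add: phi_smult A.smult_mult_left A.smult_mult_right)
  show "ract (sigma B \<xi>) x \<in> add_map (alg_tensor K A A) A"
    using AA.tlift_add_map[OF A.M.abelian_group_axioms bi bal] by (simp add: sigma_def)
  show "ract (sigma B \<xi>) x (a \<boxtimes>\<^bsub>alg_tensor K A A\<^esub> b) = \<phi> b \<otimes>\<^bsub>A\<^esub> x \<otimes>\<^bsub>A\<^esub> a"
    if "a \<in> carrier A" "b \<in> carrier A" for a b
    using AA.tlift_pure[OF A.M.abelian_group_axioms bi bal that] by (simp add: sigma_def)
qed

sublocale Sg: twisted K A \<phi> "sigma B \<xi>"
  by (intro twisted.intro AA.algebra_pair_axioms twisted_axioms.intro phi_hom)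
    (simp_all add: ract_sigma, simp add: sigma_def)

text \<open>The coordinate systems of the proof: \<open>CL\<close> on \<open>sigma_MA\<close> and
  \<open>CR\<close> on \<open>sigma_AM\<close> take values in \<open>M\<close>, while
  \<open>CT\<close> describes the target of \<open>tau_l\<close> as a copy of
  \<open>A\<close>.\<close>

sublocale CL: collapse_left K A \<phi> "sigma B \<xi>" "alg_tensor K A A" A "M_cell B" "id_cell A"
  by (intro collapse_left.intro Sg.twisted_axioms xtensor_pair.intro collapse_left_axioms.intro
      kb_M[unfolded AxA_def] kb_A) (simp_all add: fun_eq_iff)

sublocale CR: collapse_right K A \<phi> "sigma B \<xi>" "alg_tensor K A A" A "M_cell B" "id_cell A" \<xi>
  by (intro collapse_right.intro Sg.twisted_axioms xtensor_pair.intro collapse_right_axioms.intro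
      kb_M[unfolded AxA_def] kb_A xi_hom) (simp_all add: fun_eq_iff)

sublocale CT: collapse_left K A \<phi> "sigma B \<xi>" A "Le B" "id_cell A" "eta_lower B"
  by (intro collapse_left.intro Sg.twisted_axioms xtensor_pair.intro collapse_left_axioms.intro
      kb_eta_lower kb_A) (simp_all add: fun_eq_iff)

abbreviation "sMA \<equiv> sigma_MA B \<xi>"
abbreviation "sAM \<equiv> sigma_AM B \<xi>"

lemma sMA_eq: "sMA = hcomp (sigma B \<xi>) (alg_tensor K A A) (xtensor K (M_cell B) (id_cell A))"
  by (simp add: sigma_MA_def AxA_def)

lemma sAM_simps:
  "carrier sAM = carrier (hcomp (sigma B \<xi>) (alg_tensor K A A) (xtensor K (id_cell A) (M_cell B)))"
  "(\<oplus>\<^bsub>sAM\<^esub>) = (\<oplus>\<^bsub>hcomp (sigma B \<xi>) (alg_tensor K A A) (xtensor K (id_cell A) (M_cell B))\<^esub>)"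
  "pure_tensor sAM = pure_tensor (hcomp (sigma B \<xi>) (alg_tensor K A A) (xtensor K (id_cell A) (M_cell B)))"
  by (simp_all add: sigma_AM_def AxA_def restrict_right_def)

lemma kb_sMA: "kbimod K (ground_alg K) (AAA B) sMA"
  unfolding sMA_eq AAA_def AxA_def by (rule CL.H.kb)

lemma alg_AAA: "k_algebra K (AAA B)"
  by (rule kbimod.alg_C[OF kb_sMA])

lemma kb_sAM: "kbimod K (ground_alg K) (AAA B) sAM"
  unfolding sigma_AM_def AxA_def
  by (rule kbimod_restrict_right[OF CR.H.kb alg_AAA])
    (simp add: AAA_def AxA_def tassoc_alg_hom alg_A)

text \<open>The first two factors act on \<open>M\<close> itself. The third acts on the adjacent
  copy of \<open>A\<close>, is absorbed by \<open>\<sigma>\<close>, and returns as the left action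
  of \<open>\<phi>(c)\<close>.\<close>

lemma ract_sMA:
  assumes "n \<in> carrier M" "a \<in> carrier A" "b \<in> carrier A" "c \<in> carrier A"
  shows "ract sMA (CL.expand n) ((a \<boxtimes>\<^bsub>AxA B\<^esub> b) \<boxtimes>\<^bsub>AAA B\<^esub> c) = CL.expand (dact (\<phi> c) (rmult n a b))"
proof -
  have "ract sMA (CL.expand n) ((a \<boxtimes>\<^bsub>AxA B\<^esub> b) \<boxtimes>\<^bsub>AAA B\<^esub> c)
      = \<one>\<^bsub>A\<^esub> \<boxtimes>\<^bsub>sMA\<^esub> (rmult n a b \<boxtimes>\<^bsub>xtensor K (M_cell B) (id_cell A)\<^esub> c)"
    using assms by (simp add: sMA_eq CL.expand_def AAA_def AxA_def CL.H.ract_pure CL.X.ract_pure ract_M)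
  then show ?thesis using assms by (simp add: sMA_eq CL.pure_expand)
qed

text \<open>Here it is the first factor that \<open>\<sigma>\<close> absorbs, and it returns as the
  left action of \<open>\<xi>(a)\<close>. Comparison with \<open>ract_sMA\<close> gives the
  equivariance required of an endomap of \<open>M\<close>.\<close>

lemma ract_sAM:
  assumes "n \<in> carrier M" "a \<in> carrier A" "b \<in> carrier A" "c \<in> carrier A"
  shows "ract sAM (CR.expand n) ((a \<boxtimes>\<^bsub>AxA B\<^esub> b) \<boxtimes>\<^bsub>AAA B\<^esub> c) = CR.expand (dact (\<xi> a) (rmult n b c))"
proof -
  have "ract sAM (CR.expand n) ((a \<boxtimes>\<^bsub>AxA B\<^esub> b) \<boxtimes>\<^bsub>AAA B\<^esub> c)
      = \<one>\<^bsub>A\<^esub> \<boxtimes>\<^bsub>sAM\<^esub> (a \<boxtimes>\<^bsub>xtensor K (id_cell A) (M_cell B)\<^esub> rmult n b c)"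
    using assms by (simp add: sigma_AM_def restrict_right_def CR.expand_def AAA_def AxA_def tassoc_alg_hom alg_A
        CR.H.ract_pure CR.X.ract_pure ract_M)
  then show ?thesis using assms by (simp add: sAM_simps CR.pure_expand)
qed

lemma AAA_induct [consumes 1, case_names pure add]:
  assumes "w \<in> carrier (AAA B)"
    and p: "\<And>x y z. \<lbrakk>x \<in> carrier A; y \<in> carrier A; z \<in> carrier A\<rbrakk> \<Longrightarrow> Q ((x \<boxtimes>\<^bsub>AxA B\<^esub> y) \<boxtimes>\<^bsub>AAA B\<^esub> z)"
    and a: "\<And>X Y. \<lbrakk>X \<in> carrier (AAA B); Y \<in> carrier (AAA B); Q X; Q Y\<rbrakk> \<Longrightarrow> Q (X \<oplus>\<^bsub>AAA B\<^esub> Y)"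
  shows "Q w"
proof -
  interpret T: algebra_pair K "AxA B" A by (simp add: algebra_pair_def AxA_def AA.alg alg_A)
  show ?thesis
    using assms(1) unfolding AAA_def
  proof (induction rule: T.tensor_induct)
    case (pure u z)
    have "u \<in> carrier (alg_tensor K A A)" using pure by (simp add: AxA_def)
    then show ?case
      by (induction rule: AA.tensor_induct)
        (use pure p a in \<open>auto simp: AxA_def[symmetric] AAA_def[symmetric]
          T.pure_add_left[folded AAA_def] T.pure_closed[folded AAA_def] T.pure_closed AA.pure_closed[folded AxA_def]\<close>)
  qed (use a in \<open>simp add: AAA_def[symmetric]\<close>)
qed

text \<open>
  The map \<open>\<sigma> \<circ> (M \<otimes> A) \<rightarrow> \<sigma> \<circ> (A \<otimes> M)\<close> corresponding to an endomap \<open>g\<close> of \<open>M\<close>.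
\<close>

definition "conj_coll g z = CR.expand (g (CL.coll z))"

lemma conj_coll_add_map: "g \<in> add_map M M \<Longrightarrow> conj_coll g \<in> add_map sMA sAM"
  unfolding conj_coll_def
  using add_map_comp[OF add_map_comp[OF CL.coll_add, of g "M_cell B"] CR.expand_add]
  by (simp add: sMA_eq sAM_simps add_map_def)

text \<open>The assumption \<open>eq\<close> is right linearity over the triple tensor product of
  \<open>A\<close>, read in the coordinates \<open>CL\<close> and \<open>CR\<close> on pure
  elements.\<close>

lemma conj_coll_two_cell_iso:
  assumes g: "g \<in> add_map M M" "bij_betw g (carrier M) (carrier M)"
    and eq: "\<And>n a b c. \<lbrakk>n \<in> carrier M; a \<in> carrier A; b \<in> carrier A; c \<in> carrier A\<rbrakk>
      \<Longrightarrow> g (dact (\<phi> c) (rmult n a b)) = dact (\<xi> a) (rmult (g n) b c)"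
  shows "conj_coll g \<in> two_cell_iso (ground_alg K) (AAA B) sMA sAM"
proof -
  interpret s: kbimod K "ground_alg K" "AAA B" sMA by (rule kb_sMA)
  interpret s': kbimod K "ground_alg K" "AAA B" sAM by (rule kb_sAM)
  note ga = conj_coll_add_map[OF g(1)]
  have "conj_coll g \<in> two_cell (ground_alg K) (AAA B) sMA sAM"
  proof (rule two_cell_groundI[OF kb_sMA kb_sAM ga])
    fix z w assume z: "z \<in> carrier sMA" and "w \<in> carrier (AAA B)"
    from this(2) show "conj_coll g (ract sMA z w) = ract sAM (conj_coll g z) w"
    proof (induction rule: AAA_induct)
      case (pure a b c)
      define n where "n = CL.coll z"
      have n: "n \<in> carrier M" "z = CL.expand n"
        using z add_map_closed[OF CL.coll_add] CL.expand_coll by (simp_all add: n_def sMA_eq)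
      show ?case
        using pure n(1) add_map_closed[OF g(1)] unfolding n(2)
        by (simp add: ract_sMA ract_sAM conj_coll_def CL.coll_expand eq)
    qed (use z ga in \<open>simp add: s.ract_add_right s'.ract_add_right add_map_add add_map_closed
        s.ract_closed\<close>)
  qed
  moreover have "bij_betw (conj_coll g) (carrier sMA) (carrier sAM)"
    using bij_betw_trans[OF bij_betw_trans[OF CL.coll_bij[simplified] g(2)] CR.expand_bij[simplified]]
    unfolding sMA_eq sAM_simps conj_coll_def[abs_def] by (simp add: o_def)
  ultimately show ?thesis by (simp add: two_cell_iso_def)
qed

end

subsection \<open>The Galois maps of an anti-automorphism\<close>

locale antipode_like = anti_auto B S for B :: "('k, 'a, 'l) bialgebroid" and S :: "'a \<Rightarrow> 'a" +
  assumes S_t: "\<And>l. l \<in> carrier L \<Longrightarrow> S (t l) = s l"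
begin

text \<open>At \<open>\<gamma>(a)\<close> this map takes the left side of the second Hopf axiom as
  its value, and \<open>gal'\<close> that of the first one; see
  \<open>hopf_algebroid_iff\<close>.\<close>

definition "gal = tlift M (\<lambda>u v. rmult (\<gamma> (S u)) v \<one>\<^bsub>A\<^esub>)"
definition "gal' = tlift M (\<lambda>u v. rmult (\<gamma> (\<phi> v)) \<one>\<^bsub>A\<^esub> u)"

lemma phi_s: "l \<in> carrier L \<Longrightarrow> \<phi> (s l) = t l"
  using xi_phi(2)[of "t l"] by (simp add: S_t)

text \<open>Balanced because \<open>S(t(l) u) = S(u) s(l)\<close> and
  \<open>\<gamma>(s(l)) = s(l) \<otimes> 1\<close>, which places \<open>s(l)\<close> in front of
  \<open>v\<close>.\<close>

lemma gal_add_map: "gal \<in> add_map M M"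
  and gal_pure: "\<lbrakk>u \<in> carrier A; v \<in> carrier A\<rbrakk> \<Longrightarrow> gal (u \<boxtimes>\<^bsub>M\<^esub> v) = rmult (\<gamma> (S u)) v \<one>\<^bsub>A\<^esub>"
proof -
  have bi: "(\<lambda>u v. rmult (\<gamma> (S u)) v \<one>\<^bsub>A\<^esub>) \<in> biadd_map A A M"
    by (intro biadd_mapI add_mapI) (simp_all add: xi_add cop_add rmult_add rmult_add1)
  have bal: "rmult (\<gamma> (S (t l \<otimes>\<^bsub>A\<^esub> u))) v \<one>\<^bsub>A\<^esub> = rmult (\<gamma> (S u)) (s l \<otimes>\<^bsub>A\<^esub> v) \<one>\<^bsub>A\<^esub>"
    if "u \<in> carrier A" "l \<in> carrier L" "v \<in> carrier A" for u l v
    using that by (simp add: xi_mult S_t cop_mult dact_rmult[symmetric] cop_s rmult_pure)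
      (simp add: dact_pure)
  show "gal \<in> add_map M M" unfolding gal_def by (rule M.tlift_add_map[OF M.ab bi bal])
  show "gal (u \<boxtimes>\<^bsub>M\<^esub> v) = rmult (\<gamma> (S u)) v \<one>\<^bsub>A\<^esub>" if "u \<in> carrier A" "v \<in> carrier A"
    unfolding gal_def by (rule M.tlift_pure[OF M.ab bi bal that])
qed

text \<open>Balanced because \<open>\<phi>(s(l) v) = \<phi>(v) t(l)\<close> and
  \<open>\<gamma>(t(l)) = 1 \<otimes> t(l)\<close>, which places \<open>t(l)\<close> in front of
  \<open>u\<close>.\<close>

lemma gal'_add_map: "gal' \<in> add_map M M"
  and gal'_pure: "\<lbrakk>u \<in> carrier A; v \<in> carrier A\<rbrakk> \<Longrightarrow> gal' (u \<boxtimes>\<^bsub>M\<^esub> v) = rmult (\<gamma> (\<phi> v)) \<one>\<^bsub>A\<^esub> u"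
proof -
  have bi: "(\<lambda>u v. rmult (\<gamma> (\<phi> v)) \<one>\<^bsub>A\<^esub> u) \<in> biadd_map A A M"
    by (intro biadd_mapI add_mapI) (simp_all add: phi_add cop_add rmult_add rmult_add2)
  have bal: "rmult (\<gamma> (\<phi> v)) \<one>\<^bsub>A\<^esub> (t l \<otimes>\<^bsub>A\<^esub> u) = rmult (\<gamma> (\<phi> (s l \<otimes>\<^bsub>A\<^esub> v))) \<one>\<^bsub>A\<^esub> u"
    if "u \<in> carrier A" "l \<in> carrier L" "v \<in> carrier A" for u l v
    using that by (simp add: phi_mult phi_s cop_mult dact_rmult[symmetric] cop_t rmult_pure)
      (simp add: dact_pure)
  show "gal' \<in> add_map M M" unfolding gal'_def by (rule M.tlift_add_map[OF M.ab bi bal])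
  show "gal' (u \<boxtimes>\<^bsub>M\<^esub> v) = rmult (\<gamma> (\<phi> v)) \<one>\<^bsub>A\<^esub> u" if "u \<in> carrier A" "v \<in> carrier A"
    unfolding gal'_def by (rule M.tlift_pure[OF M.ab bi bal that])
qed

lemmas gal_closed [simp] = add_map_closed[OF gal_add_map] add_map_closed[OF gal'_add_map]
lemmas gal_add = add_map_add[OF gal_add_map] add_map_add[OF gal'_add_map]

text \<open>\<open>S\<close> reverses products, so a right factor \<open>x\<close> in the first slot
  leaves \<open>gal\<close> as the diagonal action of \<open>S(x)\<close> on the left.\<close>

lemma gal_rmult:
  assumes "w \<in> carrier M" "x \<in> carrier A" "y \<in> carrier A"
  shows "gal (rmult w x y) = dact (S x) (rmult (gal w) y \<one>\<^bsub>A\<^esub>)"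
  using assms(1) by (induction rule: M.tensor_induct)
    (use assms(2,3) in \<open>simp_all add: rmult_pure gal_pure xi_mult cop_mult rmult_rmult dact_rmult
      rmult_add gal_add dact_add\<close>)

lemma gal'_rmult:
  assumes "w \<in> carrier M" "x \<in> carrier A" "y \<in> carrier A"
  shows "gal' (rmult w x y) = dact (\<phi> y) (rmult (gal' w) \<one>\<^bsub>A\<^esub> x)"
  using assms(1) by (induction rule: M.tensor_induct)
    (use assms(2,3) in \<open>simp_all add: rmult_pure gal'_pure phi_mult cop_mult rmult_rmult dact_rmult
      rmult_add gal_add dact_add\<close>)

text \<open>From the Hopf axiom at one element \<open>c\<close>, the left action of \<open>c\<close>
  becomes right multiplication by \<open>1 \<otimes> S(c)\<close>. The axiom is assumed at this
  \<open>c\<close> alone so that elements of the image of \<open>eta\<close> can be treated before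
  the axiom is known in general.\<close>

lemma gal_dact:
  assumes "m \<in> carrier M" "c \<in> carrier A" and c: "gal (\<gamma> c) = \<one>\<^bsub>A\<^esub> \<boxtimes>\<^bsub>M\<^esub> S c"
  shows "gal (dact c m) = rmult (gal m) \<one>\<^bsub>A\<^esub> (S c)"
  using assms(1) by (induction rule: M.tensor_induct)
    (use assms(2) in \<open>simp_all add: dact_pure gal_rmult c rmult_pure gal_pure rmult_rmult
      dact_add gal_add rmult_add\<close>)

lemma hopf_algebroid_iff:
  "hopf_algebroid B S \<longleftrightarrow>
    (\<forall>a\<in>carrier A. gal' (\<gamma> a) = \<phi> a \<boxtimes>\<^bsub>M\<^esub> \<one>\<^bsub>A\<^esub>) \<and> (\<forall>a\<in>carrier A. gal (\<gamma> a) = \<one>\<^bsub>A\<^esub> \<boxtimes>\<^bsub>M\<^esub> S a)"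
proof -
  have 1: "tmap M (\<lambda>x. x \<otimes>\<^bsub>A\<^esub> c) (\<lambda>y. y) z = rmult z c \<one>\<^bsub>A\<^esub>"
    "tmap M (\<lambda>x. x) (\<lambda>y. y \<otimes>\<^bsub>A\<^esub> c) z = rmult z \<one>\<^bsub>A\<^esub> c"
    if "z \<in> carrier M" "c \<in> carrier A" for z c
    unfolding right_mult2_def tmap_def
    using that by (intro M.tlift_cong[OF M.ab]; simp)+
  have "tlift M (\<lambda>a1 a2. tmap M (\<lambda>x. x) (\<lambda>y. y \<otimes>\<^bsub>A\<^esub> a1) (\<gamma> (\<phi> a2))) z = gal' z"
    "tlift M (\<lambda>a1 a2. tmap M (\<lambda>x. x \<otimes>\<^bsub>A\<^esub> a2) (\<lambda>y. y) (\<gamma> (S a1))) z = gal z" if "z \<in> carrier M" for z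
    unfolding gal_def gal'_def using that by (intro M.tlift_cong[OF M.ab]; simp add: 1)+
  then show ?thesis
    using bialgebroid xi_hom xi_bij S_t by (simp add: hopf_algebroid_def Let_def cong: ball_cong)
qed

end

text \<open>\<open>hh\<close> stands for \<open>h \<otimes> h'\<close>, given only through
  additivity and its values on pure tensors. Both \<open>eta_eta\<close> and the identity can
  therefore take its place.\<close>

lemma
  assumes P: "kbimod K D C P" and P': "kbimod K D' C' P'" and Q: "kbimod K E F Q" and Q': "kbimod K E' F' Q'"
    and f: "f \<in> add_map P Q" and g: "g \<in> add_map P' Q'"
    and fk: "\<And>\<kappa> p. \<lbrakk>\<kappa> \<in> carrier K; p \<in> carrier P\<rbrakk> \<Longrightarrow> f (\<kappa> \<odot>\<^bsub>P\<^esub> p) = \<kappa> \<odot>\<^bsub>Q\<^esub> f p"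
    and gk: "\<And>\<kappa> p. \<lbrakk>\<kappa> \<in> carrier K; p \<in> carrier P'\<rbrakk> \<Longrightarrow> g (\<kappa> \<odot>\<^bsub>P'\<^esub> p) = \<kappa> \<odot>\<^bsub>Q'\<^esub> g p"
    and h: "\<And>d. d \<in> carrier D \<Longrightarrow> h d \<in> carrier E" and h': "\<And>d. d \<in> carrier D' \<Longrightarrow> h' d \<in> carrier E'"
    and hh: "hh \<in> add_map (alg_tensor K D D') (alg_tensor K E E')"
      "\<And>d d'. \<lbrakk>d \<in> carrier D; d' \<in> carrier D'\<rbrakk>
        \<Longrightarrow> hh (d \<boxtimes>\<^bsub>alg_tensor K D D'\<^esub> d') = h d \<boxtimes>\<^bsub>alg_tensor K E E'\<^esub> h' d'"
    and flin: "\<And>d p. \<lbrakk>d \<in> carrier D; p \<in> carrier P\<rbrakk> \<Longrightarrow> f (lact P d p) = lact Q (h d) (f p)"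
    and glin: "\<And>d p. \<lbrakk>d \<in> carrier D'; p \<in> carrier P'\<rbrakk> \<Longrightarrow> g (lact P' d p) = lact Q' (h' d) (g p)"
  shows xtensor_semilinear_add: "tmap (xtensor K Q Q') f g \<in> add_map (xtensor K P P') (xtensor K Q Q')"
    and xtensor_semilinear_pure: "\<And>x y. \<lbrakk>x \<in> carrier P; y \<in> carrier P'\<rbrakk> \<Longrightarrow>
      tmap (xtensor K Q Q') f g (x \<boxtimes>\<^bsub>xtensor K P P'\<^esub> y) = f x \<boxtimes>\<^bsub>xtensor K Q Q'\<^esub> g y"
    and xtensor_semilinear_lact: "\<And>w z. \<lbrakk>w \<in> carrier (alg_tensor K D D'); z \<in> carrier (xtensor K P P')\<rbrakk> \<Longrightarrow>
      tmap (xtensor K Q Q') f g (lact (xtensor K P P') w z)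
        = lact (xtensor K Q Q') (hh w) (tmap (xtensor K Q Q') f g z)"
proof -
  interpret X: xtensor_pair K D C D' C' P P' by (intro xtensor_pair.intro P P')
  interpret Y: xtensor_pair K E F E' F' Q Q' by (intro xtensor_pair.intro Q Q')
  have tm: "tensor_map P P' (carrier K) (\<lambda>x \<kappa>. \<kappa> \<odot>\<^bsub>P\<^esub> x) (\<lambda>\<kappa> y. \<kappa> \<odot>\<^bsub>P'\<^esub> y) (xtensor K P P')
    Q Q' (carrier K) (\<lambda>x \<kappa>. \<kappa> \<odot>\<^bsub>Q\<^esub> x) (\<lambda>\<kappa> y. \<kappa> \<odot>\<^bsub>Q'\<^esub> y) (xtensor K Q Q') f g"
    by (intro tensor_map.intro X.tensor_product_axioms Y.tensor_product_axioms tensor_map_axioms.intro f g)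
      (simp add: fk gk Y.pure_balanced add_map_closed[OF f] add_map_closed[OF g])
  show add: "tmap (xtensor K Q Q') f g \<in> add_map (xtensor K P P') (xtensor K Q Q')"
    by (rule tensor_map.add_map[OF tm])
  show "tmap (xtensor K Q Q') f g (x \<boxtimes>\<^bsub>xtensor K P P'\<^esub> y) = f x \<boxtimes>\<^bsub>xtensor K Q Q'\<^esub> g y"
    if "x \<in> carrier P" "y \<in> carrier P'" for x y
    by (rule tensor_map.pure[OF tm that])
  note xl = X.kb[THEN kbimod.lact_closed] X.kb[THEN kbimod.lact_add] X.kb[THEN kbimod.lact_add_left]
    Y.kb[THEN kbimod.lact_closed] Y.kb[THEN kbimod.lact_add] Y.kb[THEN kbimod.lact_add_left]
  note a = add_map_closed[OF add] add_map_add[OF add] add_map_closed[OF hh(1)] add_map_add[OF hh(1)]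
  show "tmap (xtensor K Q Q') f g (lact (xtensor K P P') w z)
        = lact (xtensor K Q Q') (hh w) (tmap (xtensor K Q Q') f g z)"
    if w: "w \<in> carrier (alg_tensor K D D')" and z: "z \<in> carrier (xtensor K P P')" for w z
    using w
  proof (induction rule: X.D.tensor_induct)
    case (pure u v)
    note uv = pure
    then have uv': "h u \<boxtimes>\<^bsub>alg_tensor K E E'\<^esub> h' v \<in> carrier (alg_tensor K E E')"
      using h h' by (intro Y.D.pure_closed)
    show ?case
      using z
    proof (induction rule: X.tensor_induct)
      case (pure p p')
      then show ?case
        using uv add_map_closed[OF f] add_map_closed[OF g]
        by (simp add: X.lact_pure Y.lact_pure tensor_map.pure[OF tm] flin glin X.P.lact_closed
            X.P'.lact_closed hh(2) h h')
    qed (use uv uv' in \<open>simp add: xl a hh(2)\<close>)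
  qed (use z in \<open>simp add: xl a\<close>)
qed

lemmas xtensor_semilinear = xtensor_semilinear_add xtensor_semilinear_pure xtensor_semilinear_lact

lemma
  assumes P: "kbimod K D C P" and Q: "kbimod K D F Q" and P': "kbimod K D' C' P'" and Q': "kbimod K D' F' Q'"
    and f: "f \<in> add_map P Q" and g: "g \<in> add_map P' Q'"
    and flin: "\<And>d p. \<lbrakk>d \<in> carrier D; p \<in> carrier P\<rbrakk> \<Longrightarrow> f (lact P d p) = lact Q d (f p)"
    and glin: "\<And>d p. \<lbrakk>d \<in> carrier D'; p \<in> carrier P'\<rbrakk> \<Longrightarrow> g (lact P' d p) = lact Q' d (g p)"
  shows xtensor_linear_add: "tmap (xtensor K Q Q') f g \<in> add_map (xtensor K P P') (xtensor K Q Q')"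
    and xtensor_linear_pure: "\<And>x y. \<lbrakk>x \<in> carrier P; y \<in> carrier P'\<rbrakk> \<Longrightarrow>
      tmap (xtensor K Q Q') f g (x \<boxtimes>\<^bsub>xtensor K P P'\<^esub> y) = f x \<boxtimes>\<^bsub>xtensor K Q Q'\<^esub> g y"
    and xtensor_linear_lact: "\<And>w z. \<lbrakk>w \<in> carrier (alg_tensor K D D'); z \<in> carrier (xtensor K P P')\<rbrakk> \<Longrightarrow>
      tmap (xtensor K Q Q') f g (lact (xtensor K P P') w z)
        = lact (xtensor K Q Q') w (tmap (xtensor K Q Q') f g z)"
proof -
  note fk = left_linear_smult[OF P Q f flin] and gk = left_linear_smult[OF P' Q' g glin]
  note l = xtensor_semilinear[OF P P' Q Q' f g fk gk _ _ add_map_ident _ flin glin]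
  show "tmap (xtensor K Q Q') f g \<in> add_map (xtensor K P P') (xtensor K Q Q')"
    by (rule l(1)) simp_all
  show "tmap (xtensor K Q Q') f g (x \<boxtimes>\<^bsub>xtensor K P P'\<^esub> y) = f x \<boxtimes>\<^bsub>xtensor K Q Q'\<^esub> g y"
    if "x \<in> carrier P" "y \<in> carrier P'" for x y
    by (rule l(2)) (simp_all add: that)
  show "tmap (xtensor K Q Q') f g (lact (xtensor K P P') w z)
        = lact (xtensor K Q Q') w (tmap (xtensor K Q Q') f g z)"
    if "w \<in> carrier (alg_tensor K D D')" "z \<in> carrier (xtensor K P P')" for w z
    by (rule l(3)) (simp_all add: that)
qed

lemmas xtensor_linear = xtensor_linear_add xtensor_linear_pure xtensor_linear_lact

subsection \<open>The one-dimensional module of the enveloping algebra\<close>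

locale base_auto = left_bialgebroid_loc B for B :: "('k, 'a, 'l) bialgebroid" +
  fixes \<theta> :: "'l \<Rightarrow> 'l"
  assumes theta_hom: "\<theta> \<in> alg_hom K L L" and theta_bij: "bij_betw \<theta> (carrier L) (carrier L)"
begin

abbreviation "th' \<equiv> inv_into (carrier L) \<theta>"

lemma theta_inv [simp]: "l \<in> carrier L \<Longrightarrow> \<theta> (th' l) = l" "l \<in> carrier L \<Longrightarrow> th' (\<theta> l) = l"
  using theta_bij by (auto simp: bij_betw_inv_into_left bij_betw_inv_into_right)

lemma th'_hom: "th' \<in> alg_hom K L L"
  by (rule alg_hom_inv_into[OF alg_L theta_hom theta_bij])

lemmas th'_simps [simp] = alg_homD(1,4)[OF th'_hom]
lemmas th'_add = alg_homD(2)[OF th'_hom]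
lemmas th'_mult = alg_homD(3)[OF th'_hom]
lemmas th'_smult = alg_homD(5)[OF th'_hom]
lemmas theta_simps [simp] = alg_homD(1,4)[OF theta_hom]

definition "Th = tlift (Le B) (\<lambda>l2 l2'. th' l2' \<boxtimes>\<^bsub>Le B\<^esub> l2)"

lemma E_pure_add:
  "\<lbrakk>a \<in> carrier L; b \<in> carrier L; c \<in> carrier L\<rbrakk> \<Longrightarrow> (a \<oplus>\<^bsub>L\<^esub> b) \<boxtimes>\<^bsub>Le B\<^esub> c = a \<boxtimes>\<^bsub>Le B\<^esub> c \<oplus>\<^bsub>Le B\<^esub> b \<boxtimes>\<^bsub>Le B\<^esub> c"
  "\<lbrakk>a \<in> carrier L; b \<in> carrier L; c \<in> carrier L\<rbrakk> \<Longrightarrow> c \<boxtimes>\<^bsub>Le B\<^esub> (a \<oplus>\<^bsub>L\<^esub> b) = c \<boxtimes>\<^bsub>Le B\<^esub> a \<oplus>\<^bsub>Le B\<^esub> c \<boxtimes>\<^bsub>Le B\<^esub> b"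
  using E.pure_add_left[of a b c] E.pure_add_right[of c a b] by simp_all

lemma E_smult_pure:
  "\<lbrakk>\<kappa> \<in> carrier K; a \<in> carrier L; c \<in> carrier L\<rbrakk> \<Longrightarrow> (\<kappa> \<odot>\<^bsub>L\<^esub> a) \<boxtimes>\<^bsub>Le B\<^esub> c = \<kappa> \<odot>\<^bsub>Le B\<^esub> (a \<boxtimes>\<^bsub>Le B\<^esub> c)"
  "\<lbrakk>\<kappa> \<in> carrier K; a \<in> carrier L; c \<in> carrier L\<rbrakk> \<Longrightarrow> a \<boxtimes>\<^bsub>Le B\<^esub> (\<kappa> \<odot>\<^bsub>L\<^esub> c) = \<kappa> \<odot>\<^bsub>Le B\<^esub> (a \<boxtimes>\<^bsub>Le B\<^esub> c)"
  using E.smult_pure[of \<kappa> a c] E.pure_balanced[of a \<kappa> c] by simp_all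

lemma Th_add_map: "Th \<in> add_map (Le B) (Le B)"
  and Th_pure: "\<lbrakk>l \<in> carrier L; l' \<in> carrier L\<rbrakk> \<Longrightarrow> Th (l \<boxtimes>\<^bsub>Le B\<^esub> l') = th' l' \<boxtimes>\<^bsub>Le B\<^esub> l"
proof -
  have bi: "(\<lambda>l2 l2'. th' l2' \<boxtimes>\<^bsub>Le B\<^esub> l2) \<in> biadd_map L (alg_op L) (Le B)"
    by (intro biadd_mapI add_mapI) (simp_all add: th'_add E_pure_add)
  have bal: "th' l' \<boxtimes>\<^bsub>Le B\<^esub> (\<kappa> \<odot>\<^bsub>L\<^esub> l) = th' (\<kappa> \<odot>\<^bsub>alg_op L\<^esub> l') \<boxtimes>\<^bsub>Le B\<^esub> l"
    if "l \<in> carrier L" "\<kappa> \<in> carrier K" "l' \<in> carrier (alg_op L)" for \<kappa> l l'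
    using that by (simp add: th'_smult E_smult_pure)
  show "Th \<in> add_map (Le B) (Le B)"
    unfolding Th_def by (rule E.tlift_add_map[OF E.ab bi bal])
  show "Th (l \<boxtimes>\<^bsub>Le B\<^esub> l') = th' l' \<boxtimes>\<^bsub>Le B\<^esub> l" if "l \<in> carrier L" "l' \<in> carrier L"
    unfolding Th_def by (rule E.tlift_pure[OF E.ab bi bal]) (use that in simp_all)
qed

text \<open>Products are reversed because \<open>\<theta>\<close> is multiplicative while the second
  slot of the enveloping algebra multiplies in opposite order, and \<open>Th\<close> interchanges
  the slots.\<close>

lemma Th_hom: "Th \<in> alg_hom K (Le B) (alg_op (Le B))"
proof (rule alg_homI)
  note ec = add_map_closed[OF Th_add_map] and ea = add_map_add[OF Th_add_map]
  show "Th \<in> add_map (Le B) (alg_op (Le B))" using Th_add_map by (simp add: add_map_def)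
  show "Th (v \<otimes>\<^bsub>Le B\<^esub> w) = Th v \<otimes>\<^bsub>alg_op (Le B)\<^esub> Th w" if "v \<in> carrier (Le B)" "w \<in> carrier (Le B)" for v w
    using that(1)
  proof (induction rule: E.tensor_induct)
    case (pure a b)
    note ab = pure
    show ?case
      using that(2) by (induction rule: E.tensor_induct)
        (use ab in \<open>simp_all add: E_mult_pure Th_pure th'_mult Ea.r_distr Ea.l_distr ea ec\<close>)
  qed (use that(2) in \<open>simp add: Ea.l_distr Ea.r_distr ea ec\<close>)
  show "Th \<one>\<^bsub>Le B\<^esub> = \<one>\<^bsub>alg_op (Le B)\<^esub>" by (simp add: E.one_pure Th_pure)
  show "Th (\<kappa> \<odot>\<^bsub>Le B\<^esub> w) = \<kappa> \<odot>\<^bsub>alg_op (Le B)\<^esub> Th w" if "\<kappa> \<in> carrier K" "w \<in> carrier (Le B)" for \<kappa> w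
    using that(2) by (induction rule: E.tensor_induct)
      (use that(1) in \<open>simp_all add: E_smult_pure[symmetric] Th_pure ea ec Ea.smult_r_distr\<close>,
       simp add: E_smult_pure)
qed

lemmas Th_simps [simp] = alg_homD(1,4)[OF Th_hom, simplified]

lemma ract_sigma0:
  assumes z: "z \<in> carrier (Le B)"
  shows "ract (sigma0 B \<theta>) z \<in> add_map (alg_tensor K (Le B) (Le B)) (Le B)"
    and "\<And>u v. \<lbrakk>u \<in> carrier (Le B); v \<in> carrier (Le B)\<rbrakk> \<Longrightarrow>
      ract (sigma0 B \<theta>) z (u \<boxtimes>\<^bsub>alg_tensor K (Le B) (Le B)\<^esub> v) = Th v \<otimes>\<^bsub>Le B\<^esub> z \<otimes>\<^bsub>Le B\<^esub> u"
proof -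
  let ?b = "\<lambda>u v. tlift (Le B) (\<lambda>l2 l2'. (th' l2' \<boxtimes>\<^bsub>Le B\<^esub> l2) \<otimes>\<^bsub>Le B\<^esub> z \<otimes>\<^bsub>Le B\<^esub> u) v"
  have b: "?b u v = Th v \<otimes>\<^bsub>Le B\<^esub> z \<otimes>\<^bsub>Le B\<^esub> u" if "u \<in> carrier (Le B)" "v \<in> carrier (Le B)" for u v
    by (rule E.tlift_eqI[OF E.ab, where g = "\<lambda>v. Th v \<otimes>\<^bsub>Le B\<^esub> z \<otimes>\<^bsub>Le B\<^esub> u"])
      (use that z in \<open>auto intro!: add_mapI simp: Th_pure add_map_add[OF Th_add_map] Ea.l_distr\<close>)
  have bi: "?b \<in> biadd_map (Le B) (Le B) (Le B)"
    by (intro biadd_mapI add_mapI) (simp_all add: b z add_map_add[OF Th_add_map] Ea.l_distr Ea.r_distr)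
  have bal: "?b (\<kappa> \<odot>\<^bsub>Le B\<^esub> u) v = ?b u (\<kappa> \<odot>\<^bsub>Le B\<^esub> v)"
    if "u \<in> carrier (Le B)" "\<kappa> \<in> carrier K" "v \<in> carrier (Le B)" for u \<kappa> v
    using that z by (simp add: b alg_homD(5)[OF Th_hom, simplified] Ea.smult_mult_left Ea.smult_mult_right)
  show "ract (sigma0 B \<theta>) z \<in> add_map (alg_tensor K (Le B) (Le B)) (Le B)"
    using EE.tlift_add_map[OF E.ab bi bal] by (simp add: sigma0_def)
  show "ract (sigma0 B \<theta>) z (u \<boxtimes>\<^bsub>alg_tensor K (Le B) (Le B)\<^esub> v) = Th v \<otimes>\<^bsub>Le B\<^esub> z \<otimes>\<^bsub>Le B\<^esub> u"
    if "u \<in> carrier (Le B)" "v \<in> carrier (Le B)" for u v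
    using EE.tlift_pure[OF E.ab bi bal that] that by (simp add: sigma0_def b)
qed

lemma sigma0_simps [simp]:
  "carrier (sigma0 B \<theta>) = carrier (Le B)" "(\<oplus>\<^bsub>sigma0 B \<theta>\<^esub>) = (\<oplus>\<^bsub>Le B\<^esub>)" "\<zero>\<^bsub>sigma0 B \<theta>\<^esub> = \<zero>\<^bsub>Le B\<^esub>"
  "(\<odot>\<^bsub>sigma0 B \<theta>\<^esub>) = (\<odot>\<^bsub>Le B\<^esub>)"
  by (simp_all add: sigma0_def fun_eq_iff)

sublocale S0: twisted K "Le B" Th "sigma0 B \<theta>"
  by (intro twisted.intro EE.algebra_pair_axioms twisted_axioms.intro Th_hom)
    (simp_all add: ract_sigma0, simp add: sigma0_def)

sublocale C0: collapse_left K "Le B" Th "sigma0 B \<theta>" A "Le B" "eta_upper B" "id_cell (Le B)"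
  by (intro collapse_left.intro S0.twisted_axioms xtensor_pair.intro collapse_left_axioms.intro
      kb_eta_upper kb_Le) (simp_all add: fun_eq_iff)

sublocale mL: xtensor_pair K "Le B" "alg_tensor K (Le B) (Le B)" "Le B" "Le B" "m_cell B" "id_cell (Le B)"
  by (intro xtensor_pair.intro kb_m kb_Le)

sublocale Lm: xtensor_pair K "Le B" "Le B" "Le B" "alg_tensor K (Le B) (Le B)" "id_cell (Le B)" "m_cell B"
  by (intro xtensor_pair.intro kb_m kb_Le)

end

subsection \<open>The compatibility of the two structures\<close>

locale tau_data = left_bialgebroid_loc B for B :: "('k, 'a, 'l) bialgebroid" +
  fixes D :: "('a, 'l) star_structure"
  assumes xi_D: "xi D \<in> alg_hom K A (alg_op A)" "bij_betw (xi D) (carrier A) (carrier A)"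
    and theta_D: "theta D \<in> alg_hom K L L" "bij_betw (theta D) (carrier L) (carrier L)"
    and tau_cell: "tau D \<in> two_cell (ground_alg K) (LexLe B) (sigma0 B (theta D)) (sigma_res B (xi D))"
begin

abbreviation "\<xi> \<equiv> xi D"
abbreviation "\<theta> \<equiv> theta D"
abbreviation "\<tau> \<equiv> tau D"

sublocale anti_auto B \<xi> by unfold_locales (rule xi_D)+
sublocale base_auto B \<theta> by unfold_locales (rule theta_D)+

definition "j = \<tau> \<one>\<^bsub>Le B\<^esub>"

lemma sigma_res_simps [simp]:
  "carrier (sigma_res B \<xi>) = carrier A" "(\<oplus>\<^bsub>sigma_res B \<xi>\<^esub>) = (\<oplus>\<^bsub>A\<^esub>)"
  "ract (sigma_res B \<xi>) x w = ract (sigma B \<xi>) x (eta_eta B w)"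
  by (simp_all add: sigma_res_def restrict_right_def)

lemma kb_sigma_res: "kbimod K (ground_alg K) (alg_tensor K (Le B) (Le B)) (sigma_res B \<xi>)"
  unfolding sigma_res_def by (rule kbimod_restrict_right[OF Sg.kb_sig EE.alg eta_eta_hom])

lemma tau_add_map: "\<tau> \<in> add_map (Le B) A"
  using tau_cell by (simp add: two_cell_def add_map_def)

lemmas tau_closed [simp] = add_map_closed[OF tau_add_map]

lemma j_closed [simp]: "j \<in> carrier A" by (simp add: j_def)

lemma tau_ract: "\<lbrakk>z \<in> carrier (Le B); w \<in> carrier (alg_tensor K (Le B) (Le B))\<rbrakk>
    \<Longrightarrow> \<tau> (ract (sigma0 B \<theta>) z w) = ract (sigma_res B \<xi>) (\<tau> z) w"
  using tau_cell by (simp add: two_cell_def LexLe_def)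

lemma tau_twist: "\<lbrakk>z \<in> carrier (Le B); u \<in> carrier (Le B); v \<in> carrier (Le B)\<rbrakk>
    \<Longrightarrow> \<tau> (Th v \<otimes>\<^bsub>Le B\<^esub> z \<otimes>\<^bsub>Le B\<^esub> u) = \<phi> (\<eta> v) \<otimes>\<^bsub>A\<^esub> \<tau> z \<otimes>\<^bsub>A\<^esub> \<eta> u"
  using tau_ract[of z "u \<boxtimes>\<^bsub>alg_tensor K (Le B) (Le B)\<^esub> v"]
  by (simp add: ract_sigma0 eta_eta_pure ract_sigma)

lemma tau_eta: "u \<in> carrier (Le B) \<Longrightarrow> \<tau> u = j \<otimes>\<^bsub>A\<^esub> \<eta> u"
  using tau_twist[of "\<one>\<^bsub>Le B\<^esub>" u "\<one>\<^bsub>Le B\<^esub>"] by (simp add: j_def)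

text \<open>\<open>\<tau>(Th(v))\<close> is computed twice: as the value at
  \<open>1 \<cdot> (1 \<otimes> v)\<close>, and as \<open>j \<eta>(Th(v))\<close>. This relation
  between \<open>\<xi>\<close> and the base is the source of \<open>S(t(l)) = s(l)\<close>.\<close>

lemma phi_eta_j: "v \<in> carrier (Le B) \<Longrightarrow> \<phi> (\<eta> v) \<otimes>\<^bsub>A\<^esub> j = j \<otimes>\<^bsub>A\<^esub> \<eta> (Th v)"
  using tau_twist[of "\<one>\<^bsub>Le B\<^esub>" "\<one>\<^bsub>Le B\<^esub>" v] tau_eta[of "Th v"] by (simp add: j_def)

lemma tau_whisker:
  assumes "kbimod K (alg_tensor K (Le B) (Le B)) C P"
  shows tau_whisker_add: "tau_whisker B D P
      \<in> add_map (hcomp (sigma0 B \<theta>) (LexLe B) P) (hcomp (sigma_res B \<xi>) (LexLe B) P)"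
    and tau_whisker_pure: "\<And>z p. \<lbrakk>z \<in> carrier (Le B); p \<in> carrier P\<rbrakk> \<Longrightarrow>
      tau_whisker B D P (z \<boxtimes>\<^bsub>hcomp (sigma0 B \<theta>) (LexLe B) P\<^esub> p) = \<tau> z \<boxtimes>\<^bsub>hcomp (sigma_res B \<xi>) (LexLe B) P\<^esub> p"
proof -
  have *: "tensor_map (sigma0 B \<theta>) P (carrier (LexLe B)) (ract (sigma0 B \<theta>)) (lact P) (hcomp (sigma0 B \<theta>) (LexLe B) P)
    (sigma_res B \<xi>) P (carrier (LexLe B)) (ract (sigma_res B \<xi>)) (lact P) (hcomp (sigma_res B \<xi>) (LexLe B) P) \<tau> (\<lambda>p. p)"
    unfolding LexLe_def
    by (rule whisker_map[where K = K and h = "\<lambda>d. d", OF hcomp_pair.intro[OF S0.kb_sig assms] hcomp_pair.intro[OF kb_sigma_res assms]])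
      (use tau_add_map tau_ract in \<open>simp_all add: add_map_def\<close>)
  show "tau_whisker B D P \<in> add_map (hcomp (sigma0 B \<theta>) (LexLe B) P) (hcomp (sigma_res B \<xi>) (LexLe B) P)"
    unfolding tau_whisker_def by (rule tensor_map.add_map[OF *])
  show "tau_whisker B D P (z \<boxtimes>\<^bsub>hcomp (sigma0 B \<theta>) (LexLe B) P\<^esub> p) = \<tau> z \<boxtimes>\<^bsub>hcomp (sigma_res B \<xi>) (LexLe B) P\<^esub> p"
    if "z \<in> carrier (Le B)" "p \<in> carrier P" for z p
    unfolding tau_whisker_def by (rule tensor_map.pure[OF *]) (use that in simp_all)
qed

text \<open>The insertion of \<open>1\<close> is the nontrivial ingredient of
  \<open>coh_left\<close> and \<open>coh_right\<close>. It is semilinear along \<open>eta\<close>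
  because \<open>\<eta>(e)\<close> slides across the tensor sign and becomes part of the left
  factor.\<close>

lemma unit_pure:
  assumes P: "kbimod K (Le B) C P"
  defines "H \<equiv> hcomp (eta_lower B) (Le B) P"
  shows "kbimod K A C H" "(\<lambda>p. \<one>\<^bsub>A\<^esub> \<boxtimes>\<^bsub>H\<^esub> p) \<in> add_map P H"
    and "\<And>e p. \<lbrakk>e \<in> carrier (Le B); p \<in> carrier P\<rbrakk> \<Longrightarrow> \<one>\<^bsub>A\<^esub> \<boxtimes>\<^bsub>H\<^esub> lact P e p = lact H (\<eta> e) (\<one>\<^bsub>A\<^esub> \<boxtimes>\<^bsub>H\<^esub> p)"
    and "\<And>\<kappa> p. \<lbrakk>\<kappa> \<in> carrier K; p \<in> carrier P\<rbrakk> \<Longrightarrow> \<one>\<^bsub>A\<^esub> \<boxtimes>\<^bsub>H\<^esub> (\<kappa> \<odot>\<^bsub>P\<^esub> p) = \<kappa> \<odot>\<^bsub>H\<^esub> (\<one>\<^bsub>A\<^esub> \<boxtimes>\<^bsub>H\<^esub> p)"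
    and "\<And>a p. \<lbrakk>a \<in> carrier A; p \<in> carrier P\<rbrakk> \<Longrightarrow> a \<boxtimes>\<^bsub>H\<^esub> p \<in> carrier H"
proof -
  interpret H: hcomp_pair K A "Le B" C "eta_lower B" P by (intro hcomp_pair.intro kb_eta_lower P)
  show "kbimod K A C H" unfolding H_def by (rule H.kb)
  show "(\<lambda>p. \<one>\<^bsub>A\<^esub> \<boxtimes>\<^bsub>H\<^esub> p) \<in> add_map P H" unfolding H_def by (rule H.pure_right) simp
  show e: "\<one>\<^bsub>A\<^esub> \<boxtimes>\<^bsub>H\<^esub> lact P e p = lact H (\<eta> e) (\<one>\<^bsub>A\<^esub> \<boxtimes>\<^bsub>H\<^esub> p)"
    if "e \<in> carrier (Le B)" "p \<in> carrier P" for e p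
    using that H.pure_balanced[of "\<one>\<^bsub>A\<^esub>" e p] by (simp add: H_def H.lact_pure)
  show "\<one>\<^bsub>A\<^esub> \<boxtimes>\<^bsub>H\<^esub> (\<kappa> \<odot>\<^bsub>P\<^esub> p) = \<kappa> \<odot>\<^bsub>H\<^esub> (\<one>\<^bsub>A\<^esub> \<boxtimes>\<^bsub>H\<^esub> p)" if "\<kappa> \<in> carrier K" "p \<in> carrier P" for \<kappa> p
    using e[of "\<kappa> \<odot>\<^bsub>Le B\<^esub> \<one>\<^bsub>Le B\<^esub>" p] that
    by (simp add: H_def H.P.lact_smult H.P.lact_one eta_smult kbimod.lact_smult[OF H.kb] kbimod.lact_one[OF H.kb])
  show "a \<boxtimes>\<^bsub>H\<^esub> p \<in> carrier H" if "a \<in> carrier A" "p \<in> carrier P" for a p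
    unfolding H_def using that by (intro H.pure_closed) simp_all
qed

lemma eta_lower_map: "\<eta> \<in> add_map (id_cell (Le B)) (eta_lower B)"
  using eta_add_map by (simp add: add_map_def)

text \<open>An instance of \<open>whisker_map\<close> in which the middle algebra changes along
  \<open>\<eta> \<otimes> \<eta>\<close>: both the restricted \<open>\<sigma>\<close> and the
  insertion of \<open>1\<close> are semilinear along it.\<close>

lemma coh_left:
  assumes P: "kbimod K (Le B) C P"
  defines "X \<equiv> xtensor K P (id_cell (Le B))" and "H \<equiv> hcomp (eta_lower B) (Le B) P"
    and "U \<equiv> xtensor K (hcomp (eta_lower B) (Le B) P) (eta_lower B)"
  shows coh_left_add: "coh_left B \<xi> P \<in> add_map (hcomp (sigma_res B \<xi>) (LexLe B) X) (hcomp (sigma B \<xi>) (AxA B) U)"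
    and coh_left_pure: "\<And>x p e. \<lbrakk>x \<in> carrier A; p \<in> carrier P; e \<in> carrier (Le B)\<rbrakk> \<Longrightarrow>
      coh_left B \<xi> P (x \<boxtimes>\<^bsub>hcomp (sigma_res B \<xi>) (LexLe B) X\<^esub> (p \<boxtimes>\<^bsub>X\<^esub> e))
        = x \<boxtimes>\<^bsub>hcomp (sigma B \<xi>) (AxA B) U\<^esub> ((\<one>\<^bsub>A\<^esub> \<boxtimes>\<^bsub>H\<^esub> p) \<boxtimes>\<^bsub>U\<^esub> \<eta> e)"
proof -
  note up = unit_pure[OF P, folded H_def]
  have U: "U = xtensor K H (eta_lower B)" by (simp add: U_def H_def)
  interpret X: xtensor_pair K "Le B" C "Le B" "Le B" P "id_cell (Le B)"
    by (intro xtensor_pair.intro P kb_Le)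
  interpret U: xtensor_pair K A C A "Le B" H "eta_lower B"
    by (intro xtensor_pair.intro up(1) kb_eta_lower)
  let ?g = "tmap U (\<lambda>p. \<one>\<^bsub>A\<^esub> \<boxtimes>\<^bsub>H\<^esub> p) \<eta>"
  note tm = xtensor_semilinear[where h = \<eta> and h' = \<eta> and hh = "eta_eta B",
      OF P kb_Le up(1) kb_eta_lower up(2) eta_lower_map, folded X_def U]
  note si = up(3,4) eta_smult eta_mult eta_eta_pure alg_homD(6)[OF eta_eta_hom]
  have ga: "?g \<in> add_map X U" by (rule tm(1)) (simp_all add: si)
  have gp: "\<And>p e. \<lbrakk>p \<in> carrier P; e \<in> carrier (Le B)\<rbrakk> \<Longrightarrow> ?g (p \<boxtimes>\<^bsub>X\<^esub> e) = (\<one>\<^bsub>A\<^esub> \<boxtimes>\<^bsub>H\<^esub> p) \<boxtimes>\<^bsub>U\<^esub> \<eta> e"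
    by (rule tm(2)) (simp_all add: si)
  have lin: "?g (lact X w z) = lact U (eta_eta B w) (?g z)"
    if "w \<in> carrier (alg_tensor K (Le B) (Le B))" "z \<in> carrier X" for w z
    by (rule tm(3)) (simp_all add: si that)
  have *: "tensor_map (sigma_res B \<xi>) X (carrier (LexLe B)) (ract (sigma_res B \<xi>)) (lact X) (hcomp (sigma_res B \<xi>) (LexLe B) X)
    (sigma B \<xi>) U (carrier (AxA B)) (ract (sigma B \<xi>)) (lact U) (hcomp (sigma B \<xi>) (AxA B) U) (\<lambda>x. x) ?g"
    unfolding LexLe_def AxA_def
    by (rule whisker_map[where K = K and h = "eta_eta B", OF hcomp_pair.intro[OF kb_sigma_res X.kb[folded X_def]]
          hcomp_pair.intro[OF Sg.kb_sig U.kb[folded U]]])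
      (simp_all add: add_map_def ga[unfolded add_map_def, simplified] alg_homD(1)[OF eta_eta_hom] lin)
  have d: "coh_left B \<xi> P = tmap (hcomp (sigma B \<xi>) (AxA B) U) (\<lambda>x. x) ?g"
    by (simp add: coh_left_def Let_def U_def H_def)
  show "coh_left B \<xi> P \<in> add_map (hcomp (sigma_res B \<xi>) (LexLe B) X) (hcomp (sigma B \<xi>) (AxA B) U)"
    unfolding d by (rule tensor_map.add_map[OF *])
  show "coh_left B \<xi> P (x \<boxtimes>\<^bsub>hcomp (sigma_res B \<xi>) (LexLe B) X\<^esub> (p \<boxtimes>\<^bsub>X\<^esub> e))
        = x \<boxtimes>\<^bsub>hcomp (sigma B \<xi>) (AxA B) U\<^esub> ((\<one>\<^bsub>A\<^esub> \<boxtimes>\<^bsub>H\<^esub> p) \<boxtimes>\<^bsub>U\<^esub> \<eta> e)"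
    if "x \<in> carrier A" "p \<in> carrier P" "e \<in> carrier (Le B)" for x p e
    unfolding d using that tensor_map.pure[OF *, of x "p \<boxtimes>\<^bsub>X\<^esub> e"]
    by (simp add: gp X.pure_closed[folded X_def])
qed

lemma coh_right:
  assumes P: "kbimod K (Le B) C P"
  defines "X \<equiv> xtensor K (id_cell (Le B)) P" and "H \<equiv> hcomp (eta_lower B) (Le B) P"
    and "U \<equiv> xtensor K (eta_lower B) (hcomp (eta_lower B) (Le B) P)"
  shows coh_right_add: "coh_right B \<xi> P \<in> add_map (hcomp (sigma_res B \<xi>) (LexLe B) X) (hcomp (sigma B \<xi>) (AxA B) U)"
    and coh_right_pure: "\<And>x p e. \<lbrakk>x \<in> carrier A; p \<in> carrier P; e \<in> carrier (Le B)\<rbrakk> \<Longrightarrow>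
      coh_right B \<xi> P (x \<boxtimes>\<^bsub>hcomp (sigma_res B \<xi>) (LexLe B) X\<^esub> (e \<boxtimes>\<^bsub>X\<^esub> p))
        = x \<boxtimes>\<^bsub>hcomp (sigma B \<xi>) (AxA B) U\<^esub> (\<eta> e \<boxtimes>\<^bsub>U\<^esub> (\<one>\<^bsub>A\<^esub> \<boxtimes>\<^bsub>H\<^esub> p))"
proof -
  note up = unit_pure[OF P, folded H_def]
  have U: "U = xtensor K (eta_lower B) H" by (simp add: U_def H_def)
  interpret X: xtensor_pair K "Le B" "Le B" "Le B" C "id_cell (Le B)" P
    by (intro xtensor_pair.intro P kb_Le)
  interpret U: xtensor_pair K A "Le B" A C "eta_lower B" H
    by (intro xtensor_pair.intro up(1) kb_eta_lower)
  let ?g = "tmap U \<eta> (\<lambda>p. \<one>\<^bsub>A\<^esub> \<boxtimes>\<^bsub>H\<^esub> p)"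
  note tm = xtensor_semilinear[where h = \<eta> and h' = \<eta> and hh = "eta_eta B",
      OF kb_Le P kb_eta_lower up(1) eta_lower_map up(2), folded X_def U]
  note si = up(3,4) eta_smult eta_mult eta_eta_pure alg_homD(6)[OF eta_eta_hom]
  have ga: "?g \<in> add_map X U" by (rule tm(1)) (simp_all add: si)
  have gp: "\<And>p e. \<lbrakk>p \<in> carrier P; e \<in> carrier (Le B)\<rbrakk> \<Longrightarrow> ?g (e \<boxtimes>\<^bsub>X\<^esub> p) = \<eta> e \<boxtimes>\<^bsub>U\<^esub> (\<one>\<^bsub>A\<^esub> \<boxtimes>\<^bsub>H\<^esub> p)"
    by (rule tm(2)) (simp_all add: si)
  have lin: "?g (lact X w z) = lact U (eta_eta B w) (?g z)"
    if "w \<in> carrier (alg_tensor K (Le B) (Le B))" "z \<in> carrier X" for w z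
    by (rule tm(3)) (simp_all add: si that)
  have *: "tensor_map (sigma_res B \<xi>) X (carrier (LexLe B)) (ract (sigma_res B \<xi>)) (lact X) (hcomp (sigma_res B \<xi>) (LexLe B) X)
    (sigma B \<xi>) U (carrier (AxA B)) (ract (sigma B \<xi>)) (lact U) (hcomp (sigma B \<xi>) (AxA B) U) (\<lambda>x. x) ?g"
    unfolding LexLe_def AxA_def
    by (rule whisker_map[where K = K and h = "eta_eta B", OF hcomp_pair.intro[OF kb_sigma_res X.kb[folded X_def]]
          hcomp_pair.intro[OF Sg.kb_sig U.kb[folded U]]])
      (simp_all add: add_map_def ga[unfolded add_map_def, simplified] alg_homD(1)[OF eta_eta_hom] lin)
  have d: "coh_right B \<xi> P = tmap (hcomp (sigma B \<xi>) (AxA B) U) (\<lambda>x. x) ?g"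
    by (simp add: coh_right_def Let_def U_def H_def)
  show "coh_right B \<xi> P \<in> add_map (hcomp (sigma_res B \<xi>) (LexLe B) X) (hcomp (sigma B \<xi>) (AxA B) U)"
    unfolding d by (rule tensor_map.add_map[OF *])
  show "coh_right B \<xi> P (x \<boxtimes>\<^bsub>hcomp (sigma_res B \<xi>) (LexLe B) X\<^esub> (e \<boxtimes>\<^bsub>X\<^esub> p))
        = x \<boxtimes>\<^bsub>hcomp (sigma B \<xi>) (AxA B) U\<^esub> (\<eta> e \<boxtimes>\<^bsub>U\<^esub> (\<one>\<^bsub>A\<^esub> \<boxtimes>\<^bsub>H\<^esub> p))"
    if "x \<in> carrier A" "p \<in> carrier P" "e \<in> carrier (Le B)" for x p e
    unfolding d using that tensor_map.pure[OF *, of x "e \<boxtimes>\<^bsub>X\<^esub> p"]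
    by (simp add: gp X.pure_closed[folded X_def])
qed

lemma sigma_whisker:
  assumes P: "kbimod K (alg_tensor K A A) C P" and Q: "kbimod K (alg_tensor K A A) C' Q"
    and f: "f \<in> add_map P Q"
    and lin: "\<And>w p. \<lbrakk>w \<in> carrier (alg_tensor K A A); p \<in> carrier P\<rbrakk> \<Longrightarrow> f (lact P w p) = lact Q w (f p)"
  shows sigma_whisker_add: "sigma_whisker B \<xi> Q f \<in> add_map (hcomp (sigma B \<xi>) (AxA B) P) (hcomp (sigma B \<xi>) (AxA B) Q)"
    and sigma_whisker_pure: "\<And>x p. \<lbrakk>x \<in> carrier A; p \<in> carrier P\<rbrakk> \<Longrightarrow>
      sigma_whisker B \<xi> Q f (x \<boxtimes>\<^bsub>hcomp (sigma B \<xi>) (AxA B) P\<^esub> p) = x \<boxtimes>\<^bsub>hcomp (sigma B \<xi>) (AxA B) Q\<^esub> f p"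
proof -
  have *: "tensor_map (sigma B \<xi>) P (carrier (AxA B)) (ract (sigma B \<xi>)) (lact P) (hcomp (sigma B \<xi>) (AxA B) P)
    (sigma B \<xi>) Q (carrier (AxA B)) (ract (sigma B \<xi>)) (lact Q) (hcomp (sigma B \<xi>) (AxA B) Q) (\<lambda>x. x) f"
    unfolding AxA_def
    by (rule whisker_map[where K = K and h = "\<lambda>d. d", OF hcomp_pair.intro[OF Sg.kb_sig P]
          hcomp_pair.intro[OF Sg.kb_sig Q]])
      (simp_all add: add_map_ident f lin)
  show "sigma_whisker B \<xi> Q f \<in> add_map (hcomp (sigma B \<xi>) (AxA B) P) (hcomp (sigma B \<xi>) (AxA B) Q)"
    unfolding sigma_whisker_def by (rule tensor_map.add_map[OF *])
  show "sigma_whisker B \<xi> Q f (x \<boxtimes>\<^bsub>hcomp (sigma B \<xi>) (AxA B) P\<^esub> p) = x \<boxtimes>\<^bsub>hcomp (sigma B \<xi>) (AxA B) Q\<^esub> f p"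
    if "x \<in> carrier A" "p \<in> carrier P" for x p
    unfolding sigma_whisker_def by (rule tensor_map.pure[OF *]) (use that in simp_all)
qed

end

section \<open>The compatibility condition and \<open>tau_l\<close> in coordinates\<close>

context tau_data
begin

abbreviation "MA \<equiv> xtensor K (M_res B) (eta_lower B)"
abbreviation "AM \<equiv> xtensor K (eta_lower B) (M_res B)"
abbreviation "AE \<equiv> xtensor K (id_cell A) (eta_lower B)"

lemma kb_MA: "kbimod K (alg_tensor K A A) (alg_tensor K (alg_tensor K (Le B) (Le B)) (Le B)) MA"
  and kb_AM: "kbimod K (alg_tensor K A A) (alg_tensor K (Le B) (alg_tensor K (Le B) (Le B))) AM"
  by (intro xtensor_pair.kb xtensor_pair.intro kb_M_res kb_eta_lower)+

lemma psi_lin: "psi B \<in> add_map Hm (M_res B)" "\<lbrakk>a \<in> carrier A; h \<in> carrier Hm\<rbrakk> \<Longrightarrow>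
    psi B (lact Hm a h) = lact (M_res B) a (psi B h)"
  using psi_add_map psi_lact by (simp_all add: add_map_def)

lemma eps_lin: "eps B \<in> add_map Hu (id_cell A)" "\<lbrakk>a \<in> carrier A; h \<in> carrier Hu\<rbrakk> \<Longrightarrow>
    eps B (lact Hu a h) = lact (id_cell A) a (eps B h)"
  using eps_add_map eps_lact by (simp_all add: add_map_def)

lemmas psi_id = xtensor_linear[OF Hm.kb kb_M_res kb_eta_lower kb_eta_lower psi_lin(1) add_map_ident psi_lin(2) refl]
lemmas id_psi = xtensor_linear[OF kb_eta_lower kb_eta_lower Hm.kb kb_M_res add_map_ident psi_lin(1) refl psi_lin(2)]
lemmas eps_id = xtensor_linear[OF Hu.kb kb_A kb_eta_lower kb_eta_lower eps_lin(1) add_map_ident eps_lin(2) refl]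

lemma kb_HmA: "kbimod K (alg_tensor K A A) (alg_tensor K (alg_tensor K (Le B) (Le B)) (Le B)) (xtensor K Hm (eta_lower B))"
  and kb_AHm: "kbimod K (alg_tensor K A A) (alg_tensor K (Le B) (alg_tensor K (Le B) (Le B))) (xtensor K (eta_lower B) Hm)"
  and kb_HuA: "kbimod K (alg_tensor K A A) (alg_tensor K A (Le B)) (xtensor K Hu (eta_lower B))"
  and kb_AE: "kbimod K (alg_tensor K A A) (alg_tensor K A (Le B)) AE"
  by (intro xtensor_pair.kb xtensor_pair.intro Hm.kb Hu.kb kb_eta_lower kb_A)+

text \<open>The two composites of the compatibility condition with \<open>\<Gamma>\<close> and
  \<open>\<Gamma>\<^sub>0\<close> removed. The condition becomes
  \<open>Gam D (comp_left z) = comp_right (Gamma0 B \<theta> z)\<close>.\<close>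

definition "comp_left z = sigma_whisker B \<xi> MA (tmap MA (psi B) (\<lambda>a. a))
   (coh_left B \<xi> (m_cell B) (tau_whisker B D (xtensor K (m_cell B) (id_cell (Le B))) z))"

definition "comp_right z = sigma_whisker B \<xi> AM (tmap AM (\<lambda>a. a) (psi B))
   (coh_right B \<xi> (m_cell B) (tau_whisker B D (xtensor K (id_cell (Le B)) (m_cell B)) z))"

text \<open>The whiskered \<open>psi\<close> ends in a composite built from \<open>M_res\<close> and
  \<open>eta_lower\<close>, while \<open>\<Gamma>\<close> starts at the one built from
  \<open>M_cell\<close> and \<open>id_cell\<close>. Only right actions differ, so elements, sums and
  pure tensors coincide.\<close>

lemma MA_cong:
  "carrier (hcomp (sigma B \<xi>) (AxA B) MA) = carrier sMA"
  "(\<oplus>\<^bsub>hcomp (sigma B \<xi>) (AxA B) MA\<^esub>) = (\<oplus>\<^bsub>sMA\<^esub>)"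
  "pure_tensor (hcomp (sigma B \<xi>) (AxA B) MA) = pure_tensor sMA"
  "pure_tensor MA = pure_tensor (xtensor K (M_cell B) (id_cell A))"
proof -
  note x = xtensor_cong[of "M_res B" "M_cell B" "eta_lower B" "id_cell A" K]
  show "pure_tensor MA = pure_tensor (xtensor K (M_cell B) (id_cell A))"
    by (rule x) (simp_all add: fun_eq_iff)
  show "carrier (hcomp (sigma B \<xi>) (AxA B) MA) = carrier sMA"
    "(\<oplus>\<^bsub>hcomp (sigma B \<xi>) (AxA B) MA\<^esub>) = (\<oplus>\<^bsub>sMA\<^esub>)"
    "pure_tensor (hcomp (sigma B \<xi>) (AxA B) MA) = pure_tensor sMA"
    unfolding sigma_MA_def
    by (rule hcomp_group_cong; rule x; simp add: fun_eq_iff)+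
qed

lemma AM_cong:
  "carrier (hcomp (sigma B \<xi>) (AxA B) AM) = carrier sAM"
  "(\<oplus>\<^bsub>hcomp (sigma B \<xi>) (AxA B) AM\<^esub>) = (\<oplus>\<^bsub>sAM\<^esub>)"
  "pure_tensor (hcomp (sigma B \<xi>) (AxA B) AM) = pure_tensor sAM"
  "pure_tensor AM = pure_tensor (xtensor K (id_cell A) (M_cell B))"
proof -
  note x = xtensor_cong[of "eta_lower B" "id_cell A" "M_res B" "M_cell B" K]
  show "pure_tensor AM = pure_tensor (xtensor K (id_cell A) (M_cell B))"
    by (rule x) (simp_all add: fun_eq_iff)
  show "carrier (hcomp (sigma B \<xi>) (AxA B) AM) = carrier sAM"
    "(\<oplus>\<^bsub>hcomp (sigma B \<xi>) (AxA B) AM\<^esub>) = (\<oplus>\<^bsub>sAM\<^esub>)"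
    "pure_tensor (hcomp (sigma B \<xi>) (AxA B) AM) = pure_tensor sAM"
    unfolding sAM_simps AxA_def[symmetric]
    by (rule hcomp_group_cong; rule x; simp add: fun_eq_iff)+
qed

lemma comp_left_add_map: "comp_left \<in> add_map (sigma0_mL B \<theta>) sMA"
proof -
  have "comp_left \<in> add_map (sigma0_mL B \<theta>) (hcomp (sigma B \<xi>) (AxA B) MA)"
    unfolding comp_left_def[abs_def] sigma0_mL_def
    by (rule add_map_comp[OF add_map_comp[OF tau_whisker_add[OF mL.kb] coh_left_add[OF kb_m]]
          sigma_whisker_add[OF kb_HmA kb_MA psi_id(1) psi_id(3)]])
  then show ?thesis by (simp add: add_map_def MA_cong)
qed

lemma comp_right_add_map: "comp_right \<in> add_map (sigma0_Lm B \<theta>) sAM"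
proof -
  have "comp_right \<in> add_map (sigma0_Lm B \<theta>) (hcomp (sigma B \<xi>) (AxA B) AM)"
    unfolding comp_right_def[abs_def] sigma0_Lm_def
    by (rule add_map_comp[OF add_map_comp[OF tau_whisker_add[OF Lm.kb] coh_right_add[OF kb_m]]
          sigma_whisker_add[OF kb_AHm kb_AM id_psi(1) id_psi(3)]])
  then show ?thesis by (simp add: add_map_def AM_cong)
qed

text \<open>\<open>coh_left\<close> has inserted \<open>1\<close> in front of \<open>n\<close>, so
  \<open>psi\<close> acts there by \<open>dact\<close> of \<open>1\<close> and contributes just
  \<open>etam n\<close>.\<close>

lemma comp_left_pure:
  assumes "z \<in> carrier (Le B)" "n \<in> carrier (m_tensor B)" "e \<in> carrier (Le B)"
  shows "comp_left (z \<boxtimes>\<^bsub>sigma0_mL B \<theta>\<^esub> (n \<boxtimes>\<^bsub>xtensor K (m_cell B) (id_cell (Le B))\<^esub> e))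
    = \<tau> z \<boxtimes>\<^bsub>sMA\<^esub> (etam n \<boxtimes>\<^bsub>xtensor K (M_cell B) (id_cell A)\<^esub> \<eta> e)"
proof -
  interpret U: xtensor_pair K A "alg_tensor K (Le B) (Le B)" A "Le B" Hm "eta_lower B"
    by (intro xtensor_pair.intro Hm.kb kb_eta_lower)
  have h: "\<one>\<^bsub>A\<^esub> \<boxtimes>\<^bsub>Hm\<^esub> n \<in> carrier Hm" using assms by (intro Hm.pure_closed) simp_all
  have x: "n \<boxtimes>\<^bsub>xtensor K (m_cell B) (id_cell (Le B))\<^esub> e \<in> carrier (xtensor K (m_cell B) (id_cell (Le B)))"
    using assms by (intro mL.pure_closed) simp_all
  have u: "(\<one>\<^bsub>A\<^esub> \<boxtimes>\<^bsub>Hm\<^esub> n) \<boxtimes>\<^bsub>xtensor K Hm (eta_lower B)\<^esub> \<eta> e \<in> carrier (xtensor K Hm (eta_lower B))"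
    using assms h by (intro U.pure_closed) simp_all
  show ?thesis
    using assms h x u
    by (simp add: comp_left_def sigma0_mL_def tau_whisker_pure[OF mL.kb] coh_left_pure[OF kb_m]
        sigma_whisker_pure[OF kb_HmA kb_MA psi_id(1) psi_id(3)] psi_id(2) psi_pure dact_one MA_cong)
qed

lemma comp_right_pure:
  assumes "z \<in> carrier (Le B)" "n \<in> carrier (m_tensor B)" "e \<in> carrier (Le B)"
  shows "comp_right (z \<boxtimes>\<^bsub>sigma0_Lm B \<theta>\<^esub> (e \<boxtimes>\<^bsub>xtensor K (id_cell (Le B)) (m_cell B)\<^esub> n))
    = \<tau> z \<boxtimes>\<^bsub>sAM\<^esub> (\<eta> e \<boxtimes>\<^bsub>xtensor K (id_cell A) (M_cell B)\<^esub> etam n)"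
proof -
  interpret U: xtensor_pair K A "Le B" A "alg_tensor K (Le B) (Le B)" "eta_lower B" Hm
    by (intro xtensor_pair.intro Hm.kb kb_eta_lower)
  have h: "\<one>\<^bsub>A\<^esub> \<boxtimes>\<^bsub>Hm\<^esub> n \<in> carrier Hm" using assms by (intro Hm.pure_closed) simp_all
  have x: "e \<boxtimes>\<^bsub>xtensor K (id_cell (Le B)) (m_cell B)\<^esub> n \<in> carrier (xtensor K (id_cell (Le B)) (m_cell B))"
    using assms by (intro Lm.pure_closed) simp_all
  have u: "\<eta> e \<boxtimes>\<^bsub>xtensor K (eta_lower B) Hm\<^esub> (\<one>\<^bsub>A\<^esub> \<boxtimes>\<^bsub>Hm\<^esub> n) \<in> carrier (xtensor K (eta_lower B) Hm)"
    using assms h by (intro U.pure_closed) simp_all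
  show ?thesis
    using assms h x u
    by (simp add: comp_right_def sigma0_Lm_def tau_whisker_pure[OF Lm.kb] coh_right_pure[OF kb_m]
        sigma_whisker_pure[OF kb_AHm kb_AM id_psi(1) id_psi(3)] id_psi(2) psi_pure dact_one AM_cong)
qed

abbreviation "s0 \<equiv> hcomp (sigma0 B \<theta>) (LexLe B) (xtensor K (eta_upper B) (id_cell (Le B)))"
abbreviation "sAE \<equiv> hcomp (sigma B \<xi>) (AxA B) AE"

lemma tau_l_add_map: "tau_l B D \<in> add_map s0 sAE"
  unfolding tau_l_def Let_def o_def
  by (rule add_map_comp[OF add_map_comp[OF tau_whisker_add[OF C0.X.kb] coh_left_add[OF kb_eta_upper]]
        sigma_whisker_add[OF kb_HuA kb_AE eps_id(1) eps_id(3)]])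

lemma tau_l_pure:
  assumes "z \<in> carrier (Le B)" "a \<in> carrier A" "e \<in> carrier (Le B)"
  shows "tau_l B D (z \<boxtimes>\<^bsub>s0\<^esub> (a \<boxtimes>\<^bsub>xtensor K (eta_upper B) (id_cell (Le B))\<^esub> e)) = \<tau> z \<boxtimes>\<^bsub>sAE\<^esub> (a \<boxtimes>\<^bsub>AE\<^esub> \<eta> e)"
proof -
  interpret U: xtensor_pair K A A A "Le B" Hu "eta_lower B"
    by (intro xtensor_pair.intro Hu.kb kb_eta_lower)
  have h: "\<one>\<^bsub>A\<^esub> \<boxtimes>\<^bsub>Hu\<^esub> a \<in> carrier Hu" using assms by (intro Hu.pure_closed) simp_all
  have x: "a \<boxtimes>\<^bsub>xtensor K (eta_upper B) (id_cell (Le B))\<^esub> e \<in> carrier (xtensor K (eta_upper B) (id_cell (Le B)))"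
    using assms by (intro C0.X.pure_closed) simp_all
  have u: "(\<one>\<^bsub>A\<^esub> \<boxtimes>\<^bsub>Hu\<^esub> a) \<boxtimes>\<^bsub>xtensor K Hu (eta_lower B)\<^esub> \<eta> e \<in> carrier (xtensor K Hu (eta_lower B))"
    using assms h by (intro U.pure_closed) simp_all
  show ?thesis
    using assms h x u
    by (simp add: tau_l_def Let_def tau_whisker_pure[OF C0.X.kb] coh_left_pure[OF kb_eta_upper]
        sigma_whisker_pure[OF kb_HuA kb_AE eps_id(1) eps_id(3)] eps_id(2) eps_pure)
qed

lemma s0_eq: "s0 = hcomp (sigma0 B \<theta>) (alg_tensor K (Le B) (Le B)) (xtensor K (eta_upper B) (id_cell (Le B)))"
  and sAE_eq: "sAE = hcomp (sigma B \<xi>) (alg_tensor K A A) AE"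
  by (simp_all add: LexLe_def AxA_def)

lemma s0_induct [consumes 1, case_names pure add]:
  assumes "z \<in> carrier s0"
    and p: "\<And>z a e. \<lbrakk>z \<in> carrier (Le B); a \<in> carrier A; e \<in> carrier (Le B)\<rbrakk> \<Longrightarrow>
      Q (z \<boxtimes>\<^bsub>s0\<^esub> (a \<boxtimes>\<^bsub>xtensor K (eta_upper B) (id_cell (Le B))\<^esub> e))"
    and a: "\<And>X Y. \<lbrakk>X \<in> carrier s0; Y \<in> carrier s0; Q X; Q Y\<rbrakk> \<Longrightarrow> Q (X \<oplus>\<^bsub>s0\<^esub> Y)"
  shows "Q z"
  using assms(1) unfolding s0_eq
proof (induction rule: C0.H.tensor_induct)
  case (pure x y)
  note x = pure(1)
  show ?case
    using pure(2)
  proof (induction rule: C0.X.tensor_induct)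
    case (pure a e)
    then show ?case using p[of x a e] x by (simp add: s0_eq)
  next
    case (add v w)
    then show ?case
      using a[unfolded s0_eq] x by (simp add: C0.H.pure_add_right C0.H.pure_closed)
  qed
qed (use a[unfolded s0_eq] in simp)

text \<open>On pure tensors the target coordinate is \<open>\<phi>(\<eta>(e)) \<tau>(z) a =
  \<tau>(Th(e) z) a = j \<eta>(Th(e) z) a\<close>, and \<open>\<eta>(Th(e) z) a\<close> is the
  source coordinate.\<close>

lemma tau_l_eq:
  assumes "z \<in> carrier s0"
  shows "tau_l B D z = CT.expand (j \<otimes>\<^bsub>A\<^esub> C0.coll z)"
  using assms
proof (induction rule: s0_induct)
  case (pure z a e)
  then show ?case
    using CT.pure_expand[of "\<tau> z" a "\<eta> e"] C0.coll_pure[of z a e] tau_twist[of z "\<one>\<^bsub>Le B\<^esub>" e]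
      tau_eta[of "Th e \<otimes>\<^bsub>Le B\<^esub> z"]
    by (simp add: tau_l_pure) (simp add: s0_eq sAE_eq A.m_assoc[symmetric])
next
  case (add X Y)
  then show ?case
    using add_map_closed[OF C0.coll_add, of X] add_map_closed[OF C0.coll_add, of Y]
      add_map_add[OF CT.expand_add, of "j \<otimes>\<^bsub>A\<^esub> C0.coll X" "j \<otimes>\<^bsub>A\<^esub> C0.coll Y"]
    by (simp add: add_map_add[OF tau_l_add_map])
      (simp add: s0_eq sAE_eq add_map_add[OF C0.coll_add] A.r_distr)
qed

lemma tau_l_bij_iff:
  "bij_betw (tau_l B D) (carrier s0) (carrier sAE) \<longleftrightarrow> bij_betw (\<lambda>a. j \<otimes>\<^bsub>A\<^esub> a) (carrier A) (carrier A)"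
proof -
  have e0: "bij_betw C0.expand (carrier A) (carrier s0)"
    unfolding s0_eq by (rule bij_betw_byWitness[where f' = C0.coll])
      (use add_map_closed[OF C0.coll_add] add_map_closed[OF C0.expand_add] in \<open>auto simp: C0.coll_expand C0.expand_coll\<close>)
  have eT: "bij_betw CT.expand (carrier A) (carrier sAE)"
    unfolding sAE_eq by (rule bij_betw_byWitness[where f' = CT.coll])
      (use add_map_closed[OF CT.coll_add] add_map_closed[OF CT.expand_add] in \<open>auto simp: CT.coll_expand CT.expand_coll\<close>)
  have c0: "bij_betw C0.coll (carrier s0) (carrier A)" and cT: "bij_betw CT.coll (carrier sAE) (carrier A)"
    using C0.coll_bij CT.coll_bij by (simp_all add: s0_eq sAE_eq)
  show ?thesis
  proof
    assume b: "bij_betw (tau_l B D) (carrier s0) (carrier sAE)"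
    have "bij_betw (CT.coll \<circ> (tau_l B D \<circ> C0.expand)) (carrier A) (carrier A)"
      by (rule bij_betw_trans[OF bij_betw_trans[OF e0 b] cT])
    moreover have "(CT.coll \<circ> (tau_l B D \<circ> C0.expand)) a = j \<otimes>\<^bsub>A\<^esub> a" if "a \<in> carrier A" for a
      using that bij_betwE[OF e0] by (simp add: tau_l_eq C0.coll_expand CT.coll_expand)
    ultimately show "bij_betw (\<lambda>a. j \<otimes>\<^bsub>A\<^esub> a) (carrier A) (carrier A)"
      by (simp cong: bij_betw_cong)
  next
    assume b: "bij_betw (\<lambda>a. j \<otimes>\<^bsub>A\<^esub> a) (carrier A) (carrier A)"
    have "bij_betw (CT.expand \<circ> ((\<lambda>a. j \<otimes>\<^bsub>A\<^esub> a) \<circ> C0.coll)) (carrier s0) (carrier sAE)"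
      by (rule bij_betw_trans[OF bij_betw_trans[OF c0 b] eT])
    then show "bij_betw (tau_l B D) (carrier s0) (carrier sAE)"
      by (simp add: tau_l_eq cong: bij_betw_cong)
  qed
qed

lemma left_mult_bij_iff:
  "bij_betw (\<lambda>a. j \<otimes>\<^bsub>A\<^esub> a) (carrier A) (carrier A) \<longleftrightarrow> j \<in> Units A"
proof
  assume b: "bij_betw (\<lambda>a. j \<otimes>\<^bsub>A\<^esub> a) (carrier A) (carrier A)"
  then obtain k where k: "k \<in> carrier A" "j \<otimes>\<^bsub>A\<^esub> k = \<one>\<^bsub>A\<^esub>"
    by (auto simp: bij_betw_def image_iff set_eq_iff) (metis A.one_closed)
  \<comment> \<open>Surjectivity supplies a right inverse \<open>k\<close>. Injectivity makes it
    two-sided, because \<open>kj\<close> and \<open>1\<close> have the same image under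
    multiplication by \<open>j\<close>.\<close>
  have "j \<otimes>\<^bsub>A\<^esub> (k \<otimes>\<^bsub>A\<^esub> j) = j \<otimes>\<^bsub>A\<^esub> \<one>\<^bsub>A\<^esub>"
    using k by (simp add: A.m_assoc[symmetric])
  then have "k \<otimes>\<^bsub>A\<^esub> j = \<one>\<^bsub>A\<^esub>"
    using b k inj_onD[of "\<lambda>a. j \<otimes>\<^bsub>A\<^esub> a" "carrier A" "k \<otimes>\<^bsub>A\<^esub> j" "\<one>\<^bsub>A\<^esub>"]
    by (simp add: bij_betw_def)
  then show "j \<in> Units A" using k by (auto simp: Units_def)
next
  assume j: "j \<in> Units A"
  show "bij_betw (\<lambda>a. j \<otimes>\<^bsub>A\<^esub> a) (carrier A) (carrier A)"
    by (rule bij_betw_byWitness[where f' = "\<lambda>a. inv\<^bsub>A\<^esub> j \<otimes>\<^bsub>A\<^esub> a"])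
      (use j in \<open>auto simp: A.m_assoc[symmetric] A.Units_l_inv A.Units_r_inv\<close>)
qed

lemma tau_l_two_cell: "tau_l B D \<in> two_cell (ground_alg K) (alg_tensor K A (Le B)) s0 sAE"
proof (rule two_cell_groundI)
  show k1: "kbimod K (ground_alg K) (alg_tensor K A (Le B)) s0" unfolding s0_eq by (rule C0.H.kb)
  show k2: "kbimod K (ground_alg K) (alg_tensor K A (Le B)) sAE" unfolding sAE_eq by (rule CT.H.kb)
  show "tau_l B D \<in> add_map s0 sAE" by (rule tau_l_add_map)
  interpret k1: kbimod K "ground_alg K" "alg_tensor K A (Le B)" s0 by (rule k1)
  interpret k2: kbimod K "ground_alg K" "alg_tensor K A (Le B)" sAE by (rule k2)
  note a = add_map_closed[OF tau_l_add_map] add_map_add[OF tau_l_add_map]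
  fix z c assume z: "z \<in> carrier s0" and c: "c \<in> carrier (alg_tensor K A (Le B))"
  show "tau_l B D (ract s0 z c) = ract sAE (tau_l B D z) c"
    using c
  proof (induction rule: CT.X.C.tensor_induct)
    case (pure x y)
    note xy = pure
    show ?case
      using z
    proof (induction rule: s0_induct)
      case (pure z a e)
      have X: "a \<boxtimes>\<^bsub>xtensor K (eta_upper B) (id_cell (Le B))\<^esub> e \<in> carrier (xtensor K (eta_upper B) (id_cell (Le B)))"
        "a \<boxtimes>\<^bsub>AE\<^esub> \<eta> e \<in> carrier AE"
        using pure by (auto intro!: C0.X.pure_closed CT.X.pure_closed)
      have "ract s0 (z \<boxtimes>\<^bsub>s0\<^esub> (a \<boxtimes>\<^bsub>xtensor K (eta_upper B) (id_cell (Le B))\<^esub> e)) (x \<boxtimes>\<^bsub>alg_tensor K A (Le B)\<^esub> y)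
          = z \<boxtimes>\<^bsub>s0\<^esub> ((a \<otimes>\<^bsub>A\<^esub> x) \<boxtimes>\<^bsub>xtensor K (eta_upper B) (id_cell (Le B))\<^esub> (e \<otimes>\<^bsub>Le B\<^esub> y))"
        using pure xy X by (simp add: s0_eq C0.H.ract_pure C0.X.ract_pure)
      moreover have "ract sAE (\<tau> z \<boxtimes>\<^bsub>sAE\<^esub> (a \<boxtimes>\<^bsub>AE\<^esub> \<eta> e)) (x \<boxtimes>\<^bsub>alg_tensor K A (Le B)\<^esub> y)
          = \<tau> z \<boxtimes>\<^bsub>sAE\<^esub> ((a \<otimes>\<^bsub>A\<^esub> x) \<boxtimes>\<^bsub>AE\<^esub> (\<eta> e \<otimes>\<^bsub>A\<^esub> \<eta> y))"
        using pure xy X by (simp add: sAE_eq CT.H.ract_pure CT.X.ract_pure)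
      ultimately show ?case
        using pure xy by (simp add: tau_l_pure eta_mult)
    qed (use xy in \<open>simp add: a k1.ract_add k2.ract_add k1.ract_closed\<close>)
  qed (use z in \<open>simp add: a k1.ract_add_right k2.ract_add_right k1.ract_closed\<close>)
qed

end

section \<open>The antipode and its Galois map when \<open>j\<close> is invertible\<close>

locale tau_unit = tau_data B D for B :: "('k, 'a, 'l) bialgebroid" and D :: "('a, 'l) star_structure" +
  assumes j_unit: "j \<in> Units A"
begin

abbreviation "S \<equiv> antipode_of B D"
abbreviation "i \<equiv> inv\<^bsub>A\<^esub> j"
abbreviation "q \<equiv> \<xi> j"
abbreviation "q' \<equiv> \<xi> i"

lemma i_closed [simp]: "i \<in> carrier A"
  using j_unit by (rule A.Units_inv_closed)

lemma ij [simp]: "i \<otimes>\<^bsub>A\<^esub> j = \<one>\<^bsub>A\<^esub>" "j \<otimes>\<^bsub>A\<^esub> i = \<one>\<^bsub>A\<^esub>"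
  using j_unit by (simp_all add: A.Units_l_inv A.Units_r_inv)

lemma ij_cancel [simp]:
  "a \<in> carrier A \<Longrightarrow> i \<otimes>\<^bsub>A\<^esub> (j \<otimes>\<^bsub>A\<^esub> a) = a" "a \<in> carrier A \<Longrightarrow> j \<otimes>\<^bsub>A\<^esub> (i \<otimes>\<^bsub>A\<^esub> a) = a"
  by (simp_all add: A.m_assoc[symmetric])

lemma qq' [simp]: "q \<otimes>\<^bsub>A\<^esub> q' = \<one>\<^bsub>A\<^esub>" "q' \<otimes>\<^bsub>A\<^esub> q = \<one>\<^bsub>A\<^esub>"
  by (simp_all add: xi_mult[symmetric])

lemma qq'_cancel [simp]:
  "a \<in> carrier A \<Longrightarrow> q \<otimes>\<^bsub>A\<^esub> (q' \<otimes>\<^bsub>A\<^esub> a) = a" "a \<in> carrier A \<Longrightarrow> q' \<otimes>\<^bsub>A\<^esub> (q \<otimes>\<^bsub>A\<^esub> a) = a"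
  by (simp_all add: A.m_assoc[symmetric])

lemma S_eq: "S a = \<xi> (j \<otimes>\<^bsub>A\<^esub> a \<otimes>\<^bsub>A\<^esub> i)"
  by (simp add: antipode_of_def Let_def j_def)

lemma S_eq': "a \<in> carrier A \<Longrightarrow> S a = q' \<otimes>\<^bsub>A\<^esub> (\<xi> a \<otimes>\<^bsub>A\<^esub> q)"
  by (simp add: S_eq xi_mult)

lemma S_phi: "b \<in> carrier A \<Longrightarrow> S (i \<otimes>\<^bsub>A\<^esub> \<phi> b \<otimes>\<^bsub>A\<^esub> j) = b"
  by (simp add: S_eq A.m_assoc)

lemma S_hom: "S \<in> alg_hom K A (alg_op A)"
  by (rule alg_homI)
    (auto intro!: add_mapI simp: S_eq' xi_add xi_mult xi_smult A.l_distr A.r_distr A.m_assoc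
      A.smult_mult_left A.smult_mult_right)

lemma S_bij: "bij_betw S (carrier A) (carrier A)"
  by (rule bij_betw_byWitness[where f' = "\<lambda>b. i \<otimes>\<^bsub>A\<^esub> \<phi> b \<otimes>\<^bsub>A\<^esub> j"])
    (auto simp: S_phi, auto simp: S_eq A.m_assoc)

text \<open>By \<open>phi_eta_j\<close>, conjugation by \<open>j\<close> carries
  \<open>\<eta>(Th(v))\<close> to \<open>\<phi>(\<eta>(v))\<close>, and \<open>\<xi>\<close> then
  cancels \<open>\<phi>\<close>. This is the purpose of conjugating in
  \<open>antipode_of\<close>.\<close>

lemma S_Th: "v \<in> carrier (Le B) \<Longrightarrow> S (\<eta> (Th v)) = \<eta> v"
proof -
  assume v: "v \<in> carrier (Le B)"
  then have "j \<otimes>\<^bsub>A\<^esub> \<eta> (Th v) \<otimes>\<^bsub>A\<^esub> i = \<phi> (\<eta> v)"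
    by (simp add: phi_eta_j[symmetric] A.m_assoc)
  then show ?thesis using v by (simp add: S_eq)
qed

text \<open>\<open>Th\<close> sends \<open>l \<otimes> 1\<close> to \<open>1 \<otimes> l\<close> and
  \<open>1 \<otimes> \<theta>(l)\<close> to \<open>l \<otimes> 1\<close>; these two choices of
  \<open>v\<close> in \<open>S_Th\<close> give the formulas.\<close>

lemma S_tgt: "l \<in> carrier L \<Longrightarrow> S (t l) = s l"
  and S_src: "l \<in> carrier L \<Longrightarrow> S (s l) = t (\<theta> l)"
  using S_Th[of "inl l"] S_Th[of "inr (\<theta> l)"] by (simp_all add: Th_pure eta_inl eta_inr eta_pure)

sublocale AS: antipode_like B S
  by (intro antipode_like.intro anti_auto.intro anti_auto_axioms.intro antipode_like_axioms.intro
      left_bialgebroid_loc_axioms S_hom S_bij S_tgt)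

abbreviation "gal \<equiv> AS.gal"

lemma xi_j: "u \<in> carrier A \<Longrightarrow> \<xi> (j \<otimes>\<^bsub>A\<^esub> u) = q \<otimes>\<^bsub>A\<^esub> S u"
  by (simp add: S_eq' xi_mult)

text \<open>The second Hopf axiom on the image of \<open>eta\<close>, where it follows from
  \<open>S_tgt\<close> and \<open>S_src\<close>: for
  \<open>\<gamma>(s(l) t(l')) = s(l) \<otimes> t(l')\<close> the map gives \<open>t(l') \<otimes>
  t(\<theta>(l)) = 1 \<otimes> s(l') t(\<theta>(l))\<close>.\<close>

lemma gal_eta:
  assumes "e \<in> carrier (Le B)"
  shows "gal (\<gamma> (\<eta> e)) = \<one>\<^bsub>A\<^esub> \<boxtimes>\<^bsub>M\<^esub> S (\<eta> e)"
  using assms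
proof (induction rule: E.tensor_induct)
  case (pure l l')
  then have [simp]: "l \<in> carrier L" "l' \<in> carrier L" by simp_all
  have "\<gamma> (s l \<otimes>\<^bsub>A\<^esub> t l') = s l \<boxtimes>\<^bsub>M\<^esub> t l'"
    by (simp add: cop_mult cop_t dact_s)
  then show ?case
    using M.pure_balanced[of "\<one>\<^bsub>A\<^esub>" l' "t (\<theta> l)"]
    by (simp add: eta_pure AS.gal_pure S_src cop_t rmult_pure AS.xi_mult S_tgt s_t[symmetric])
qed (simp_all add: eta_add cop_add AS.gal_add AS.xi_add M.pure_add_right)

text \<open>The coordinate form that compatibility prescribes for \<open>\<Gamma>\<close>. With
  \<open>i\<close> inside \<open>gal\<close>, compatibility can be computed from
  \<open>gal_eta\<close> alone; \<open>G_hopf\<close> gives the form with \<open>q'\<close> on the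
  right.\<close>

definition "G m = dact q (gal (dact i m))"

lemma G_add_map: "G \<in> add_map M M"
  unfolding G_def[abs_def]
  using add_map_comp[OF add_map_comp[OF dact_add_map AS.gal_add_map] dact_add_map] by simp

text \<open>Collapsing brings \<open>\<phi>(\<eta>(e))\<close> in front of \<open>j\<close>; moved
  past it, it becomes \<open>\<eta>(Th(e))\<close>. There \<open>gal_eta\<close> applies and turns
  it into right multiplication by \<open>1 \<otimes> \<eta>(e)\<close>.\<close>

lemma conj_G:
  assumes "x \<in> carrier A" "n \<in> carrier M" "e \<in> carrier (Le B)"
  shows "conj_coll G ((j \<otimes>\<^bsub>A\<^esub> x) \<boxtimes>\<^bsub>sMA\<^esub> (n \<boxtimes>\<^bsub>xtensor K (M_cell B) (id_cell A)\<^esub> \<eta> e))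
    = CR.expand (dact q (rmult (gal (dact x n)) \<one>\<^bsub>A\<^esub> (\<eta> e)))"
proof -
  have "i \<otimes>\<^bsub>A\<^esub> (\<phi> (\<eta> e) \<otimes>\<^bsub>A\<^esub> (j \<otimes>\<^bsub>A\<^esub> x)) = \<eta> (Th e) \<otimes>\<^bsub>A\<^esub> x"
    using assms phi_eta_j[of e] by (simp add: A.m_assoc[symmetric])
  then have "G (dact (\<phi> (\<eta> e) \<otimes>\<^bsub>A\<^esub> (j \<otimes>\<^bsub>A\<^esub> x)) n) = dact q (gal (dact (\<eta> (Th e)) (dact x n)))"
    using assms by (simp add: G_def dact_mult[symmetric])
  also have "\<dots> = dact q (rmult (gal (dact x n)) \<one>\<^bsub>A\<^esub> (\<eta> e))"
    using assms by (simp add: AS.gal_dact gal_eta S_Th)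
  finally show ?thesis
    using assms by (simp add: conj_coll_def sMA_eq CL.coll_pure)
qed

text \<open>
  Both sides of the compatibility condition are computed on pure tensors; \<open>\<Gamma>\<^sub>0\<close> enters only through
  the expansions of its arguments, so that its well-definedness is not needed.
\<close>

lemma comp_right_Gamma0:
  assumes "z \<in> carrier (sigma0_mL B \<theta>)"
  shows "comp_right (Gamma0 B \<theta> z) = conj_coll G (comp_left z)"
proof -
  let ?T = "sigma0_Lm B \<theta>" and ?U = "xtensor K (id_cell (Le B)) (m_cell B)"
    and ?S = "sigma0_mL B \<theta>" and ?X = "xtensor K (m_cell B) (id_cell (Le B))"
    and ?m = "m_tensor B"
  interpret T: hcomp_pair K "ground_alg K" "LexLe B" "alg_tensor K (Le B) (alg_tensor K (Le B) (Le B))"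
      "sigma0 B \<theta>" ?U
    unfolding LexLe_def by (intro hcomp_pair.intro S0.kb_sig Lm.kb)
  interpret Sm: hcomp_pair K "ground_alg K" "LexLe B" "alg_tensor K (alg_tensor K (Le B) (Le B)) (Le B)"
      "sigma0 B \<theta>" ?X
    unfolding LexLe_def by (intro hcomp_pair.intro S0.kb_sig mL.kb)
  note abT = T.ab[folded sigma0_Lm_def]
  note abA = kbimod.ab[OF kb_sAM]
  note cr = comp_right_add_map
  let ?F = "\<lambda>z. conj_coll G (comp_left z)"
  have F: "?F \<in> add_map ?S sAM"
    by (rule add_map_comp[OF comp_left_add_map conj_coll_add_map[OF G_add_map]])
  \<comment> \<open>\<open>?b1\<close> to \<open>?b4\<close> are the nested integrands of
    \<open>Gamma0\<close> from the inside out. Each layer is removed by one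
    \<open>tlift_fuse\<close>, since \<open>comp_right\<close> and the right side are
    additive.\<close>
  let ?b1 = "\<lambda>e1 e2 e3 x x'. \<one>\<^bsub>Le B\<^esub> \<boxtimes>\<^bsub>?T\<^esub> ((inl x \<otimes>\<^bsub>Le B\<^esub> e1) \<boxtimes>\<^bsub>?U\<^esub> ((inr x' \<otimes>\<^bsub>Le B\<^esub> e2) \<boxtimes>\<^bsub>m_cell B\<^esub> e3))"
  let ?b2 = "\<lambda>z e3 e1 e2. tlift ?T (?b1 e1 e2 e3) z"
  let ?b3 = "\<lambda>z n e3. tlift ?T (?b2 z e3) n"
  let ?b4 = "\<lambda>z w. tlift ?T (?b3 z) w"
  have c1: "?b1 e1 e2 e3 x x' \<in> carrier ?T"
    if "e1 \<in> carrier (Le B)" "e2 \<in> carrier (Le B)" "e3 \<in> carrier (Le B)" "x \<in> carrier L" "x' \<in> carrier L"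
    for e1 e2 e3 x x'
    using that by (auto intro!: T.pure_closed[folded sigma0_Lm_def] Lm.pure_closed m.pure_closed)
  have c2: "?b2 z e3 e1 e2 \<in> carrier ?T"
    if "z \<in> carrier (Le B)" "e1 \<in> carrier (Le B)" "e2 \<in> carrier (Le B)" "e3 \<in> carrier (Le B)" for z e1 e2 e3
    using that c1 by (intro E.tlift_closed[OF abT]) simp_all
  have c3: "?b3 z n e3 \<in> carrier ?T"
    if "z \<in> carrier (Le B)" "n \<in> carrier ?m" "e3 \<in> carrier (Le B)" for z n e3
    using that c2 by (intro m.tlift_closed[OF abT]) simp_all
  have c4: "?b4 z w \<in> carrier ?T" if "z \<in> carrier (Le B)" "w \<in> carrier ?X" for z w
    using that c3 by (intro mL.tlift_closed[OF abT]) simp_all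
  have pX: "n \<boxtimes>\<^bsub>?X\<^esub> e3 \<in> carrier ?X" if "n \<in> carrier ?m" "e3 \<in> carrier (Le B)" for n e3
    using that by (intro mL.pure_closed) simp_all
  have e1: "comp_right (?b1 e1 e2 e3 x x') = ?F ((x \<boxtimes>\<^bsub>Le B\<^esub> x') \<boxtimes>\<^bsub>?S\<^esub> ((e1 \<boxtimes>\<^bsub>?m\<^esub> e2) \<boxtimes>\<^bsub>?X\<^esub> e3))"
    if h: "e1 \<in> carrier (Le B)" "e2 \<in> carrier (Le B)" "e3 \<in> carrier (Le B)" "x \<in> carrier L" "x' \<in> carrier L"
    for e1 e2 e3 x x'
  proof -
    have "comp_right (?b1 e1 e2 e3 x x')
        = j \<boxtimes>\<^bsub>sAM\<^esub> ((s x \<otimes>\<^bsub>A\<^esub> \<eta> e1) \<boxtimes>\<^bsub>xtensor K (id_cell A) (M_cell B)\<^esub> ((t x' \<otimes>\<^bsub>A\<^esub> \<eta> e2) \<boxtimes>\<^bsub>M\<^esub> \<eta> e3))"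
      using h by (simp add: comp_right_pure m.pure_closed etam_pure eta_mult eta_inl eta_inr j_def)
    also have "\<dots> = CR.expand (dact (q \<otimes>\<^bsub>A\<^esub> S (s x \<otimes>\<^bsub>A\<^esub> \<eta> e1)) ((t x' \<otimes>\<^bsub>A\<^esub> \<eta> e2) \<boxtimes>\<^bsub>M\<^esub> \<eta> e3))"
      using h by (simp add: sAM_simps CR.pure_expand xi_j)
    also have "dact (q \<otimes>\<^bsub>A\<^esub> S (s x \<otimes>\<^bsub>A\<^esub> \<eta> e1)) ((t x' \<otimes>\<^bsub>A\<^esub> \<eta> e2) \<boxtimes>\<^bsub>M\<^esub> \<eta> e3)
        = dact q (rmult (gal ((s x \<otimes>\<^bsub>A\<^esub> \<eta> e1) \<boxtimes>\<^bsub>M\<^esub> (t x' \<otimes>\<^bsub>A\<^esub> \<eta> e2))) \<one>\<^bsub>A\<^esub> (\<eta> e3))"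
      using h by (simp add: AS.gal_pure rmult_rmult dact_pure dact_rmult cop_mult)
    also have "(s x \<otimes>\<^bsub>A\<^esub> \<eta> e1) \<boxtimes>\<^bsub>M\<^esub> (t x' \<otimes>\<^bsub>A\<^esub> \<eta> e2) = dact (\<eta> (x \<boxtimes>\<^bsub>Le B\<^esub> x')) (\<eta> e1 \<boxtimes>\<^bsub>M\<^esub> \<eta> e2)"
      using h by (simp add: eta_pure dact_mult dact_s dact_t)
    also have "CR.expand (dact q (rmult (gal (dact (\<eta> (x \<boxtimes>\<^bsub>Le B\<^esub> x')) (\<eta> e1 \<boxtimes>\<^bsub>M\<^esub> \<eta> e2))) \<one>\<^bsub>A\<^esub> (\<eta> e3)))
        = ?F ((x \<boxtimes>\<^bsub>Le B\<^esub> x') \<boxtimes>\<^bsub>?S\<^esub> ((e1 \<boxtimes>\<^bsub>?m\<^esub> e2) \<boxtimes>\<^bsub>?X\<^esub> e3))"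
      using h by (simp add: comp_left_pure m.pure_closed etam_pure tau_eta conj_G)
    finally show ?thesis .
  qed
  have e2: "comp_right (?b2 z e3 e1 e2) = ?F (z \<boxtimes>\<^bsub>?S\<^esub> ((e1 \<boxtimes>\<^bsub>?m\<^esub> e2) \<boxtimes>\<^bsub>?X\<^esub> e3))"
    if h: "z \<in> carrier (Le B)" "e1 \<in> carrier (Le B)" "e2 \<in> carrier (Le B)" "e3 \<in> carrier (Le B)" for z e1 e2 e3
  proof (rule E.tlift_fuse[OF abT abA cr])
    have "(e1 \<boxtimes>\<^bsub>?m\<^esub> e2) \<boxtimes>\<^bsub>?X\<^esub> e3 \<in> carrier ?X" using h by (intro pX m.pure_closed)
    from Sm.pure_left[OF this, folded sigma0_mL_def]
    have "(\<lambda>z. z \<boxtimes>\<^bsub>?S\<^esub> ((e1 \<boxtimes>\<^bsub>?m\<^esub> e2) \<boxtimes>\<^bsub>?X\<^esub> e3)) \<in> add_map (Le B) ?S"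
      by (simp add: add_map_def)
    from add_map_comp[OF this F] show "(\<lambda>z. ?F (z \<boxtimes>\<^bsub>?S\<^esub> ((e1 \<boxtimes>\<^bsub>?m\<^esub> e2) \<boxtimes>\<^bsub>?X\<^esub> e3))) \<in> add_map (Le B) sAM" .
  qed (use h c1 e1 in simp_all)
  have e3: "comp_right (?b3 z n e3) = ?F (z \<boxtimes>\<^bsub>?S\<^esub> (n \<boxtimes>\<^bsub>?X\<^esub> e3))"
    if h: "z \<in> carrier (Le B)" "n \<in> carrier ?m" "e3 \<in> carrier (Le B)" for z n e3
  proof (rule m.tlift_fuse[OF abT abA cr])
    have "(\<lambda>n. n \<boxtimes>\<^bsub>?X\<^esub> e3) \<in> add_map (m_cell B) ?X" using h by (intro mL.pure_left) simp
    moreover have "(\<lambda>w. z \<boxtimes>\<^bsub>?S\<^esub> w) \<in> add_map ?X ?S"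
      using h unfolding sigma0_mL_def by (intro Sm.pure_right) simp
    ultimately have "(\<lambda>n. z \<boxtimes>\<^bsub>?S\<^esub> (n \<boxtimes>\<^bsub>?X\<^esub> e3)) \<in> add_map (m_cell B) ?S" by (rule add_map_comp)
    from add_map_comp[OF this F] show "(\<lambda>n. ?F (z \<boxtimes>\<^bsub>?S\<^esub> (n \<boxtimes>\<^bsub>?X\<^esub> e3))) \<in> add_map ?m sAM"
      by (simp add: add_map_def)
  qed (use h c2 e2 in simp_all)
  have e4: "comp_right (?b4 z w) = ?F (z \<boxtimes>\<^bsub>?S\<^esub> w)" if h: "z \<in> carrier (Le B)" "w \<in> carrier ?X" for z w
  proof (rule mL.tlift_fuse[OF abT abA cr])
    have "(\<lambda>w. z \<boxtimes>\<^bsub>?S\<^esub> w) \<in> add_map ?X ?S"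
      using h unfolding sigma0_mL_def by (intro Sm.pure_right) simp
    from add_map_comp[OF this F] show "(\<lambda>w. ?F (z \<boxtimes>\<^bsub>?S\<^esub> w)) \<in> add_map ?X sAM" .
  qed (use h c3 e3 in simp_all)
  have "comp_right (tlift ?T ?b4 z) = ?F z"
    by (rule Sm.tlift_fuse[folded sigma0_mL_def, OF abT abA cr F])
      (use assms c4 e4 in simp_all)
  then show ?thesis by (simp add: Gamma0_def Let_def)
qed

text \<open>The second Hopf axiom at \<open>i\<close> turns the left action of \<open>i\<close> into
  right multiplication by \<open>1 \<otimes> S(i)\<close>, and
  \<open>S(i) = q' q' q = q'\<close>.\<close>

lemma G_hopf:
  assumes "hopf_algebroid B S" "m \<in> carrier M"
  shows "G m = dact q (rmult (gal m) \<one>\<^bsub>A\<^esub> q')"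
proof -
  have "S i = q'" by (simp add: S_eq' xi_mult[symmetric])
  then show ?thesis
    using assms AS.hopf_algebroid_iff by (simp add: G_def AS.gal_dact)
qed

text \<open>The second axiom at \<open>\<phi>(v)\<close> reads
  \<open>gal(\<gamma>(\<phi>(v))) = 1 \<otimes> v\<close>, and the factor
  \<open>1 \<otimes> u\<close> comes out of \<open>gal\<close> as \<open>u \<otimes> 1\<close>. So
  the image of \<open>gal'(u \<otimes> v)\<close> is \<open>u \<otimes> v\<close>.\<close>

lemma gal_inverse:
  assumes hopf2: "\<forall>a\<in>carrier A. gal (\<gamma> a) = \<one>\<^bsub>A\<^esub> \<boxtimes>\<^bsub>M\<^esub> S a" and "m \<in> carrier M"
  shows "gal (AS.gal' m) = m"
  using assms(2) by (induction rule: M.tensor_induct)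
    (use hopf2 in \<open>simp_all add: AS.gal'_pure AS.gal_rmult AS.gal_add rmult_pure dact_one\<close>)

lemma dact_unit_bij:
  assumes "a \<in> carrier A" "b \<in> carrier A" "a \<otimes>\<^bsub>A\<^esub> b = \<one>\<^bsub>A\<^esub>" "b \<otimes>\<^bsub>A\<^esub> a = \<one>\<^bsub>A\<^esub>"
  shows "bij_betw (dact a) (carrier M) (carrier M)"
  by (rule bij_betw_byWitness[where f' = "dact b"])
    (use assms in \<open>auto simp: dact_mult[symmetric] dact_one\<close>)

lemma gal_bij:
  assumes "hopf_algebroid B S"
  shows "bij_betw gal (carrier M) (carrier M)"
proof (rule bij_betw_byWitness[where f' = AS.gal'])
  have h: "\<forall>a\<in>carrier A. AS.gal' (\<gamma> a) = AS.\<phi> a \<boxtimes>\<^bsub>M\<^esub> \<one>\<^bsub>A\<^esub>"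
    "\<forall>a\<in>carrier A. gal (\<gamma> a) = \<one>\<^bsub>A\<^esub> \<boxtimes>\<^bsub>M\<^esub> S a"
    using assms AS.hopf_algebroid_iff by auto
  show "\<forall>m\<in>carrier M. gal (AS.gal' m) = m" using gal_inverse[OF h(2)] by blast
  \<comment> \<open>Dually, the first axiom at \<open>S(u)\<close> gives
    \<open>gal'(\<gamma>(S(u))) = u \<otimes> 1\<close>, and the factor \<open>v \<otimes> 1\<close>
    comes out as \<open>1 \<otimes> v\<close>.\<close>
  show "\<forall>m\<in>carrier M. AS.gal' (gal m) = m"
  proof
    fix m assume "m \<in> carrier M"
    then show "AS.gal' (gal m) = m"
      by (induction rule: M.tensor_induct)
        (use h in \<open>simp_all add: AS.gal_pure AS.gal'_rmult AS.gal_add rmult_pure dact_one\<close>)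
  qed
qed auto

text \<open>Equivariance is computed with \<open>G_hopf\<close>. The action of
  \<open>\<phi>(c)\<close> leaves \<open>gal\<close> as \<open>1 \<otimes> q' c q\<close>, whose
  \<open>q\<close> cancels against the final \<open>q'\<close>; on the left,
  \<open>q S(a) = \<xi>(a) q\<close>. Bijectivity is that of \<open>gal\<close> and of the actions
  of the units \<open>i\<close> and \<open>q\<close>.\<close>

lemma conj_G_iso:
  assumes hopf: "hopf_algebroid B S"
  shows "conj_coll G \<in> two_cell_iso (ground_alg K) (AAA B) sMA sAM"
proof (rule conj_coll_two_cell_iso[OF G_add_map])
  have "bij_betw (dact q \<circ> (gal \<circ> dact i)) (carrier M) (carrier M)"
    by (intro bij_betw_trans[OF bij_betw_trans[OF dact_unit_bij[of i j] gal_bij[OF hopf]] dact_unit_bij[of q q']])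
      simp_all
  then show "bij_betw G (carrier M) (carrier M)" by (simp add: G_def[abs_def] o_def)
  fix n a b c assume h: "n \<in> carrier M" "a \<in> carrier A" "b \<in> carrier A" "c \<in> carrier A"
  have gc: "gal (\<gamma> x) = \<one>\<^bsub>A\<^esub> \<boxtimes>\<^bsub>M\<^esub> S x" if "x \<in> carrier A" for x
    using hopf that AS.hopf_algebroid_iff by auto
  have Sc: "S (\<phi> c) = q' \<otimes>\<^bsub>A\<^esub> (c \<otimes>\<^bsub>A\<^esub> q)" using h by (simp add: S_eq')
  have "G (dact (\<phi> c) (rmult n a b)) = dact q (rmult (gal (dact (\<phi> c) (rmult n a b))) \<one>\<^bsub>A\<^esub> q')"
    using h by (simp add: G_hopf[OF hopf])
  also have "\<dots> = dact q (dact (S a) (rmult (gal n) b (q' \<otimes>\<^bsub>A\<^esub> c)))"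
    using h by (simp add: AS.gal_dact gc AS.gal_rmult dact_rmult rmult_rmult Sc A.m_assoc)
  also have "\<dots> = dact (\<xi> a) (dact q (rmult (gal n) b (q' \<otimes>\<^bsub>A\<^esub> c)))"
    using h by (simp add: dact_mult[symmetric] S_eq')
  also have "\<dots> = dact (\<xi> a) (rmult (G n) b c)"
    using h by (simp add: G_hopf[OF hopf] dact_rmult rmult_rmult)
  finally show "G (dact (\<phi> c) (rmult n a b)) = dact (\<xi> a) (rmult (G n) b c)" .
qed

text \<open>Besides giving the Hopf axioms, the argument shows that \<open>\<Gamma>\<close> is no
  free datum: it is determined by \<open>\<xi>\<close> and \<open>\<tau>\<close>. Isomorphic
  structures can therefore be recognised by the antipode.\<close>

lemma hopf_algebroid_antipode:
  assumes Gam: "Gam D \<in> two_cell_iso (ground_alg K) (AAA B) sMA sAM"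
    and comp: "\<And>z. z \<in> carrier (sigma0_mL B \<theta>) \<Longrightarrow> Gam D (comp_left z) = comp_right (Gamma0 B \<theta> z)"
  shows hopf_of_star: "hopf_algebroid B S"
    and Gam_eq: "\<And>z. z \<in> carrier sMA \<Longrightarrow> Gam D z = conj_coll G z"
proof -
  define h where "h n = CR.coll (Gam D (CL.expand n))" for n
  have Gb: "bij_betw (Gam D) (carrier sMA) (carrier sAM)"
    and Ga: "Gam D \<in> add_map sMA sAM"
    and Gr: "\<And>z w. \<lbrakk>z \<in> carrier sMA; w \<in> carrier (AAA B)\<rbrakk> \<Longrightarrow> Gam D (ract sMA z w) = ract sAM (Gam D z) w"
    using Gam by (simp_all add: two_cell_iso_def two_cell_def add_map_def)
  have ex: "CL.expand n \<in> carrier sMA" if "n \<in> carrier M" for n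
    using add_map_closed[OF CL.expand_add, of n] that by (simp add: sMA_eq)
  have co: "CR.coll y \<in> carrier M" "CR.expand (CR.coll y) = y" if "y \<in> carrier sAM" for y
    using add_map_closed[OF CR.coll_add, of y] CR.expand_coll[of y] that by (simp_all add: sAM_simps)
  have hc: "h n \<in> carrier M" if "n \<in> carrier M" for n
    using ex[OF that] add_map_closed[OF Ga] co by (simp add: h_def)
  have Geq: "Gam D (CL.expand n) = CR.expand (h n)" if "n \<in> carrier M" for n
    using ex[OF that] add_map_closed[OF Ga] co by (simp add: h_def)
  interpret T: algebra_pair K "AxA B" A by (simp add: algebra_pair_def AxA_def AA.alg alg_A)
  have wc: "(a \<boxtimes>\<^bsub>AxA B\<^esub> b) \<boxtimes>\<^bsub>AAA B\<^esub> c \<in> carrier (AAA B)"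
    if "a \<in> carrier A" "b \<in> carrier A" "c \<in> carrier A" for a b c
    using that T.pure_closed[folded AAA_def] AA.pure_closed[folded AxA_def] by simp
  have equiv: "h (dact (\<phi> c) (rmult n a b)) = dact (\<xi> a) (rmult (h n) b c)"
    if H: "n \<in> carrier M" "a \<in> carrier A" "b \<in> carrier A" "c \<in> carrier A" for n a b c
  proof -
    have "CR.expand (h (dact (\<phi> c) (rmult n a b))) = CR.expand (dact (\<xi> a) (rmult (h n) b c))"
      using H Gr[OF ex wc, of n a b c] hc by (simp add: ract_sMA Geq ract_sAM)
    then have "CR.coll (CR.expand (h (dact (\<phi> c) (rmult n a b)))) = CR.coll (CR.expand (dact (\<xi> a) (rmult (h n) b c)))"
      by simp
    then show ?thesis using H hc by (simp add: CR.coll_expand)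
  qed
  have h_j: "h (\<gamma> j) = \<gamma> q"
  proof -
    let ?one = "\<one>\<^bsub>Le B\<^esub> \<boxtimes>\<^bsub>sigma0_mL B \<theta>\<^esub> ((\<one>\<^bsub>Le B\<^esub> \<boxtimes>\<^bsub>m_tensor B\<^esub> \<one>\<^bsub>Le B\<^esub>)
      \<boxtimes>\<^bsub>xtensor K (m_cell B) (id_cell (Le B))\<^esub> \<one>\<^bsub>Le B\<^esub>)"
    interpret Sm: hcomp_pair K "ground_alg K" "LexLe B" "alg_tensor K (alg_tensor K (Le B) (Le B)) (Le B)"
        "sigma0 B \<theta>" "xtensor K (m_cell B) (id_cell (Le B))"
      unfolding LexLe_def by (intro hcomp_pair.intro S0.kb_sig mL.kb)
    have m1: "\<one>\<^bsub>Le B\<^esub> \<boxtimes>\<^bsub>m_tensor B\<^esub> \<one>\<^bsub>Le B\<^esub> \<in> carrier (m_tensor B)"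
      by (intro m.pure_closed) simp_all
    have one: "?one \<in> carrier (sigma0_mL B \<theta>)"
      unfolding sigma0_mL_def using m1 by (intro Sm.pure_closed mL.pure_closed) simp_all
    have "comp_left ?one = j \<boxtimes>\<^bsub>sMA\<^esub> ((\<one>\<^bsub>A\<^esub> \<boxtimes>\<^bsub>M\<^esub> \<one>\<^bsub>A\<^esub>) \<boxtimes>\<^bsub>xtensor K (M_cell B) (id_cell A)\<^esub> \<one>\<^bsub>A\<^esub>)"
      using m1 by (simp add: comp_left_pure etam_pure j_def)
    also have "\<dots> = CL.expand (\<gamma> j)" by (simp add: sMA_eq CL.pure_expand dact_cop)
    finally have "Gam D (CL.expand (\<gamma> j)) = conj_coll G (CL.expand (\<gamma> j))"
      using comp[OF one] comp_right_Gamma0[OF one] by simp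
    then have "CR.coll (CR.expand (h (\<gamma> j))) = CR.coll (CR.expand (G (\<gamma> j)))"
      by (simp add: Geq conj_coll_def CL.coll_expand)
    then have "h (\<gamma> j) = G (\<gamma> j)"
      using hc add_map_closed[OF G_add_map] by (simp add: CR.coll_expand)
    \<comment> \<open>Here \<open>i\<close> acting on \<open>\<gamma>(j)\<close> gives
      \<open>1 \<otimes> 1\<close>, which \<open>gal\<close> fixes; the action of \<open>q\<close>
      then produces \<open>\<gamma>(q)\<close>.\<close>
    also have "G (\<gamma> j) = \<gamma> q"
      by (simp add: G_def cop_mult[symmetric] cop_one)
        (simp add: AS.gal_pure cop_one rmult_pure dact_cop)
    finally show ?thesis .
  qed
  have h_gal: "h m = dact q (rmult (gal m) \<one>\<^bsub>A\<^esub> q')" if "m \<in> carrier M" for m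
    using that
  proof (induction rule: M.tensor_induct)
    case (pure u v)
    \<comment> \<open>Since \<open>\<phi>(q') = i\<close>, every pure tensor has the form
      \<open>\<phi>(c) \<cdot> \<gamma>(j) \<cdot> (u \<otimes> v)\<close> with
      \<open>c = q'\<close>. Equivariance thus determines \<open>h\<close> from its value at
      \<open>\<gamma>(j)\<close>.\<close>
    have "dact (\<phi> q') (rmult (\<gamma> j) u v) = u \<boxtimes>\<^bsub>M\<^esub> v"
      using pure by (simp add: dact_rmult cop_mult[symmetric] cop_one rmult_pure)
    then have "h (u \<boxtimes>\<^bsub>M\<^esub> v) = dact (\<xi> u) (rmult (\<gamma> q) v q')"
      using equiv[of "\<gamma> j" u v q'] pure h_j by simp
    also have "\<dots> = rmult (\<gamma> (q \<otimes>\<^bsub>A\<^esub> S u)) v q'"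
      using pure by (simp add: dact_rmult cop_mult[symmetric] S_eq')
    finally show ?case using pure by (simp add: AS.gal_pure rmult_rmult dact_rmult cop_mult)
  next
    case (add X Y)
    have "h (X \<oplus>\<^bsub>M\<^esub> Y) = h X \<oplus>\<^bsub>M\<^esub> h Y"
      using add ex add_map_closed[OF Ga] add_map_add[OF CL.expand_add, of X Y] add_map_add[OF Ga]
        add_map_add[OF CR.coll_add] by (simp add: h_def sMA_eq sAM_simps)
    then show ?case using add by (simp add: AS.gal_add rmult_add dact_add)
  qed
  have gal_h: "gal m = dact q' (rmult (h m) \<one>\<^bsub>A\<^esub> q)" if "m \<in> carrier M" for m
    using that by (simp add: h_gal dact_rmult[symmetric] rmult_rmult rmult_one dact_mult[symmetric] dact_one)
  have hopf2: "gal (\<gamma> a) = \<one>\<^bsub>A\<^esub> \<boxtimes>\<^bsub>M\<^esub> S a" if a: "a \<in> carrier A" for a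
  proof -
    \<comment> \<open>Chosen so that \<open>\<phi>(?c) = a i\<close>, whose action takes
      \<open>\<gamma>(j)\<close> to \<open>\<gamma>(a)\<close>. After stripping \<open>q\<close> and
      \<open>q'\<close> from \<open>h\<close>, the remaining factor is
      \<open>\<xi>(a i) \<xi>(j) = \<xi>(j a i) = S(a)\<close>.\<close>
    let ?c = "\<xi> (a \<otimes>\<^bsub>A\<^esub> i)"
    have "h (\<gamma> a) = h (dact (\<phi> ?c) (rmult (\<gamma> j) \<one>\<^bsub>A\<^esub> \<one>\<^bsub>A\<^esub>))"
      using a by (simp add: rmult_one cop_mult[symmetric] A.m_assoc)
    also have "\<dots> = rmult (\<gamma> q) \<one>\<^bsub>A\<^esub> ?c"
      using a by (subst equiv) (simp_all add: h_j dact_one)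
    finally have "gal (\<gamma> a) = \<one>\<^bsub>A\<^esub> \<boxtimes>\<^bsub>M\<^esub> (?c \<otimes>\<^bsub>A\<^esub> q)"
      using a by (simp add: gal_h rmult_rmult dact_rmult cop_mult[symmetric] cop_one rmult_pure)
    moreover have "?c \<otimes>\<^bsub>A\<^esub> q = S a" using a by (simp add: S_eq xi_mult A.m_assoc)
    ultimately show ?thesis by simp
  qed
  have h_inj: "m = m'" if "m \<in> carrier M" "m' \<in> carrier M" "h m = h m'" for m m'
  proof -
    have "CL.expand m = CL.expand m'"
      using that Gb ex by (auto simp: Geq bij_betw_def dest!: inj_onD[of "Gam D" _ "CL.expand m" "CL.expand m'"])
    then have "CL.coll (CL.expand m) = CL.coll (CL.expand m')" by simp
    then show ?thesis using that by (simp add: CL.coll_expand)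
  qed
  have gal_inj: "m = m'" if "m \<in> carrier M" "m' \<in> carrier M" "gal m = gal m'" for m m'
    using that h_inj by (simp add: h_gal)
  \<comment> \<open>Both sides have image \<open>\<gamma>(a)\<close> under the injective map
    \<open>gal\<close>: the left one because \<open>gal'\<close> is a right inverse, the right one
    because \<open>S\<close> inverts the \<open>\<phi>\<close> applied to \<open>a\<close>.\<close>
  have hopf1: "AS.gal' (\<gamma> a) = AS.\<phi> a \<boxtimes>\<^bsub>M\<^esub> \<one>\<^bsub>A\<^esub>" if a: "a \<in> carrier A" for a
  proof (rule gal_inj)
    have "gal (AS.gal' (\<gamma> a)) = \<gamma> a" using a hopf2 by (intro gal_inverse) auto
    moreover have "gal (AS.\<phi> a \<boxtimes>\<^bsub>M\<^esub> \<one>\<^bsub>A\<^esub>) = \<gamma> a" using a by (simp add: AS.gal_pure rmult_one)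
    ultimately show "gal (AS.gal' (\<gamma> a)) = gal (AS.\<phi> a \<boxtimes>\<^bsub>M\<^esub> \<one>\<^bsub>A\<^esub>)" by simp
  qed (use a in auto)
  show hopf: "hopf_algebroid B S" using hopf1 hopf2 AS.hopf_algebroid_iff by blast
  show "Gam D z = conj_coll G z" if "z \<in> carrier sMA" for z
  proof -
    have m: "CL.coll z \<in> carrier M" "CL.expand (CL.coll z) = z"
      using add_map_closed[OF CL.coll_add, of z] CL.expand_coll[of z] that by (simp_all add: sMA_eq)
    then have "Gam D z = CR.expand (h (CL.coll z))" using Geq[OF m(1)] by simp
    then show ?thesis using m by (simp add: conj_coll_def G_hopf[OF hopf] h_gal)
  qed
qed

end

lemma two_cell_iso_cong:
  assumes f: "f \<in> two_cell_iso D C P Q"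
    and P: "kbimod K D C P"
    and g: "\<And>x. x \<in> carrier P \<Longrightarrow> g x = f x"
  shows "g \<in> two_cell_iso D C P Q"
proof -
  interpret kbimod K D C P by fact
  have "x \<oplus>\<^bsub>P\<^esub> y \<in> carrier P" if "x \<in> carrier P" "y \<in> carrier P" for x y
    using that abelian_groupE(1)[OF ab] by blast
  moreover have "bij_betw g (carrier P) (carrier Q) \<longleftrightarrow> bij_betw f (carrier P) (carrier Q)"
    by (rule bij_betw_cong) (rule g)
  ultimately show ?thesis
    using f by (auto simp: two_cell_iso_def two_cell_def g lact_closed ract_closed Pi_iff)
qed

text \<open>Restriction along \<open>tassoc\<close> alters only the right action, so
  \<open>sigma_AM\<close> is still a tensor product and \<open>tmap\<close> into it can be
  evaluated.\<close>

lemma (in anti_auto) tensor_product_sAM: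
  "tensor_product (sigma B \<xi>) (xtensor K (id_cell A) (M_cell B)) (carrier (alg_tensor K A A))
    (ract (sigma B \<xi>)) (lact (xtensor K (id_cell A) (M_cell B))) sAM"
  by (intro tensor_product.intro CR.H.abM CR.H.abN CR.H.rho_closed CR.H.mu_closed)
    (simp_all add: sigma_AM_def restrict_right_def AxA_def CR.H.carrier_T CR.H.add_T CR.H.zero_T)

section \<open>The passages between strong star-autonomous and Hopf structures\<close>

context left_bialgebroid_loc
begin

text \<open>The clauses are regrouped so that those about \<open>\<xi>\<close>,
  \<open>\<theta>\<close> and \<open>\<tau>\<close> form a locale. If that locale fails both sides
  are false, so the composites have to be unfolded only inside it.\<close>

lemma strong_star_autonomous_iff:
  "strong_star_autonomous B D \<longleftrightarrow> tau_data B D \<and>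
    Gam D \<in> two_cell_iso (ground_alg K) (AAA B) (sigma_MA B (xi D)) (sigma_AM B (xi D)) \<and>
    (\<forall>z\<in>carrier (sigma0_mL B (theta D)).
      Gam D (tau_data.comp_left B D z) = tau_data.comp_right B D (Gamma0 B (theta D) z)) \<and>
    tau_l B D \<in> two_cell_iso (ground_alg K) (alg_tensor K A (Le B))
      (hcomp (sigma0 B (theta D)) (LexLe B) (xtensor K (eta_upper B) (id_cell (Le B))))
      (hcomp (sigma B (xi D)) (AxA B) (xtensor K (id_cell A) (eta_lower B)))"
proof (cases "tau_data B D")
  case True
  then interpret tau_data B D .
  show ?thesis
    unfolding strong_star_autonomous_def Let_def comp_left_def comp_right_def o_def
    using True xi_D theta_D tau_cell by blast
next
  case False
  then show ?thesis
    using left_bialgebroid_loc_axioms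
    by (auto simp: strong_star_autonomous_def Let_def tau_data_def tau_data_axioms_def)
qed

lemma strong_tau_unit:
  assumes "strong_star_autonomous B D"
  shows "tau_unit B D"
proof -
  interpret tau_data B D using assms strong_star_autonomous_iff by blast
  have "bij_betw (tau_l B D) (carrier s0) (carrier sAE)"
    using assms by (simp add: strong_star_autonomous_iff two_cell_iso_def)
  then have "j \<in> Units A" using tau_l_bij_iff left_mult_bij_iff by blast
  then show ?thesis by unfold_locales
qed

lemma
  assumes "strong_star_autonomous B D"
  shows strong_hopf: "hopf_algebroid B (antipode_of B D)"
    and strong_Gam: "\<And>z. z \<in> carrier (sigma_MA B (xi D)) \<Longrightarrow>
      Gam D z = anti_auto.conj_coll B (xi D) (tau_unit.G B D) z"
proof -
  interpret tau_unit B D by (rule strong_tau_unit[OF assms])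
  have G: "Gam D \<in> two_cell_iso (ground_alg K) (AAA B) sMA sAM"
    and c: "\<And>z. z \<in> carrier (sigma0_mL B \<theta>) \<Longrightarrow> Gam D (comp_left z) = comp_right (Gamma0 B \<theta> z)"
    using assms strong_star_autonomous_iff by blast+
  show "hopf_algebroid B S" by (rule hopf_of_star[OF G c])
  show "Gam D z = conj_coll G z" if "z \<in> carrier sMA" for z
    by (rule Gam_eq[OF G c that])
qed

text \<open>Antipodes are compared on the carrier of \<open>A\<close> only; as HOL functions they
  may differ elsewhere. Hence inverses, Galois maps and Hopf axioms have to be transferred
  explicitly.\<close>

lemma
  assumes S: "antipode_like B S" and S': "antipode_like B S'" and eq: "\<And>a. a \<in> carrier A \<Longrightarrow> S' a = S a"
  shows gal_cong: "\<And>m. m \<in> carrier M \<Longrightarrow> antipode_like.gal B S' m = antipode_like.gal B S m"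
    and hopf_algebroid_cong: "hopf_algebroid B S \<Longrightarrow> hopf_algebroid B S'"
proof -
  interpret X: antipode_like B S by fact
  interpret Y: antipode_like B S' by fact
  have phi: "Y.\<phi> a = X.\<phi> a" if "a \<in> carrier A" for a
    using that Y.xi_phi(2)[of "X.\<phi> a"] by (simp add: eq)
  show g: "Y.gal m = X.gal m" if "m \<in> carrier M" for m
    unfolding X.gal_def Y.gal_def by (rule M.tlift_cong[OF M.ab that]) (simp_all add: eq)
  have g': "Y.gal' m = X.gal' m" if "m \<in> carrier M" for m
    unfolding X.gal'_def Y.gal'_def by (rule M.tlift_cong[OF M.ab that]) (simp_all add: phi)
  show "hopf_algebroid B S'" if "hopf_algebroid B S"
    using that unfolding X.hopf_algebroid_iff Y.hopf_algebroid_iff by (simp add: g g' phi eq)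
qed

lemma hopf_antipode_like:
  assumes "hopf_algebroid B S"
  shows "antipode_like B S"
  using assms left_bialgebroid_loc_axioms
  by (auto simp: hopf_algebroid_def Let_def antipode_like_def anti_auto_def anti_auto_axioms_def
      antipode_like_axioms_def)

lemma star_of_simps [simp]:
  "xi (star_of B S) = S" "theta (star_of B S) = (\<lambda>l. \<pi> (S (s l)))" "tau (star_of B S) = \<eta>"
  by (simp_all add: star_of_def Let_def)

lemma
  assumes hopf: "hopf_algebroid B S"
  shows strong_star_of: "strong_star_autonomous B (star_of B S)"
    and antipode_of_star_of: "\<And>a. a \<in> carrier A \<Longrightarrow> antipode_of B (star_of B S) a = S a"
proof -
  interpret H: antipode_like B S by (rule hopf_antipode_like[OF hopf])
  define D where "D = star_of B S"
  define \<theta> where "\<theta> = (\<lambda>l. \<pi> (S (s l)))"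
  have h1: "H.gal' (\<gamma> a) = H.\<phi> a \<boxtimes>\<^bsub>M\<^esub> \<one>\<^bsub>A\<^esub>" and h2: "H.gal (\<gamma> a) = \<one>\<^bsub>A\<^esub> \<boxtimes>\<^bsub>M\<^esub> S a"
    if "a \<in> carrier A" for a
    using hopf that H.hopf_algebroid_iff by auto
  \<comment> \<open>From \<open>\<gamma>(s(l)) = s(l) \<otimes> 1\<close> the second axiom gives
    \<open>\<gamma>(S(s(l))) = 1 \<otimes> S(s(l))\<close>, and the counit places
    \<open>S(s(l))\<close> in the image of \<open>t\<close>. This is the origin of
    \<open>\<theta> = \<pi> \<circ> S \<circ> s\<close>.\<close>
  have Ss: "S (s l) = t (\<theta> l)" if l: "l \<in> carrier L" for l
  proof -
    have "\<gamma> (S (s l)) = \<one>\<^bsub>A\<^esub> \<boxtimes>\<^bsub>M\<^esub> S (s l)"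
      using l h2[of "s l"] by (simp add: cop_s H.gal_pure rmult_one)
    from counit_right_eq[OF _ _ _ this] l show ?thesis by (simp add: \<theta>_def)
  qed
  \<comment> \<open>Dually, the first axiom at \<open>t(l)\<close> places
    \<open>\<phi>(t(l))\<close> in the image of \<open>s\<close>; its preimage is what
    \<open>\<theta>\<^sup>-\<^sup>1(l)\<close> has to be.\<close>
  have pt: "s (\<pi> (H.\<phi> (t l))) = H.\<phi> (t l)" if l: "l \<in> carrier L" for l
  proof -
    have "\<gamma> (H.\<phi> (t l)) = H.\<phi> (t l) \<boxtimes>\<^bsub>M\<^esub> \<one>\<^bsub>A\<^esub>"
      using l h1[of "t l"] by (simp add: cop_t H.gal'_pure rmult_one)
    from counit_left_eq[OF _ _ _ this] l show ?thesis by simp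
  qed
  have tc [simp]: "\<theta> l \<in> carrier L" if "l \<in> carrier L" for l using that by (simp add: \<theta>_def)
  \<comment> \<open>Since \<open>\<pi>\<close> retracts \<open>t\<close>, the relation
    \<open>S \<circ> s = t \<circ> \<theta>\<close> characterises \<open>\<theta>\<close>. Its
    algebraic properties are read off from those of \<open>S\<close>, \<open>s\<close> and
    \<open>t\<close>.\<close>
  have tI: "\<theta> l = l'" if "l \<in> carrier L" "l' \<in> carrier L" "S (s l) = t l'" for l l'
    using that by (simp add: \<theta>_def cou_t)
  have th: "\<theta> \<in> alg_hom K L L"
    by (intro alg_homI add_mapI tI)
      (simp_all add: s_add s_mult s_smult H.xi_add H.xi_mult H.xi_smult Ss t_add t_mult t_smult)
  have tb: "bij_betw \<theta> (carrier L) (carrier L)"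
    by (rule bij_betw_byWitness[where f' = "\<lambda>l. \<pi> (H.\<phi> (t l))"])
      (auto simp: Ss[symmetric] cou_s intro!: tI, simp add: pt)
  interpret BA: base_auto B \<theta> by unfold_locales (fact th tb)+
  \<comment> \<open>The relation \<open>phi_eta_j\<close> for \<open>j = 1\<close>. It makes
    \<open>\<eta>\<close> linear from \<open>sigma0\<close> to \<open>sigma_res\<close>, so that
    \<open>\<tau> = \<eta>\<close> is admissible.\<close>
  have pe: "H.\<phi> (\<eta> v) = \<eta> (BA.Th v)" if "v \<in> carrier (Le B)" for v
    using that
  proof (induction rule: E.tensor_induct)
    case (pure l l')
    then have [simp]: "l \<in> carrier L" "l' \<in> carrier L" by simp_all
    have "H.\<phi> (t l') = s (BA.th' l')" using Ss[of "BA.th' l'"] H.xi_phi(2)[of "s (BA.th' l')"] by simp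
    then show ?case by (simp add: eta_pure BA.Th_pure H.phi_mult H.phi_s)
  qed (use add_map_closed[OF BA.Th_add_map] in \<open>simp add: eta_add H.phi_add add_map_add[OF BA.Th_add_map]\<close>)
  have tau: "\<eta> \<in> two_cell (ground_alg K) (LexLe B) (sigma0 B \<theta>) (sigma_res B S)"
  proof (rule two_cell_groundI)
    show k0: "kbimod K (ground_alg K) (LexLe B) (sigma0 B \<theta>)" unfolding LexLe_def by (rule BA.S0.kb_sig)
    show k1: "kbimod K (ground_alg K) (LexLe B) (sigma_res B S)"
      unfolding LexLe_def sigma_res_def by (rule kbimod_restrict_right[OF H.Sg.kb_sig EE.alg eta_eta_hom])
    show "\<eta> \<in> add_map (sigma0 B \<theta>) (sigma_res B S)"
      using eta_add_map by (simp add: add_map_def sigma_res_def restrict_right_def)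
    fix z w assume z: "z \<in> carrier (sigma0 B \<theta>)" and w: "w \<in> carrier (LexLe B)"
    show "\<eta> (ract (sigma0 B \<theta>) z w) = ract (sigma_res B S) (\<eta> z) w"
      using w unfolding LexLe_def
    proof (induction rule: EE.tensor_induct)
      case (pure u v)
      then show ?case
        using z by (simp add: BA.ract_sigma0 eta_mult sigma_res_def restrict_right_def eta_eta_pure
            H.ract_sigma pe)
    next
      case (add v w)
      then show ?case
        using z kbimod.ract_add_right[OF k0, unfolded LexLe_def, of z v w]
          kbimod.ract_add_right[OF k1, unfolded LexLe_def, of "\<eta> z" v w]
          kbimod.ract_closed[OF k0, unfolded LexLe_def, of z]
        by (simp add: eta_add sigma_res_def restrict_right_def)
    qed
  qed
  interpret T: tau_data B D
    by unfold_locales (use H.xi_hom H.xi_bij th tb tau in \<open>simp_all add: D_def \<theta>_def\<close>)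
  have j1: "T.j = \<one>\<^bsub>A\<^esub>" unfolding T.j_def by (simp add: D_def)
  interpret T: tau_unit B D by unfold_locales (simp add: j1)
  have xD: "xi D = S" by (simp add: D_def)
  have ant: "antipode_of B D a = S a" if "a \<in> carrier A" for a
    using that by (simp add: T.S_eq j1 xD)
  then show "\<And>a. a \<in> carrier A \<Longrightarrow> antipode_of B (star_of B S) a = S a" by (simp add: D_def)
  have hopf': "hopf_algebroid B (antipode_of B D)"
    by (rule hopf_algebroid_cong[OF H.antipode_like_axioms T.AS.antipode_like_axioms ant hopf])
  have g2: "T.gal (\<gamma> a) = \<one>\<^bsub>A\<^esub> \<boxtimes>\<^bsub>M\<^esub> antipode_of B D a" if "a \<in> carrier A" for a
    using hopf' that T.AS.hopf_algebroid_iff by auto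
  \<comment> \<open>The nested lifts in \<open>star_of\<close> are identified with
    \<open>conj_coll\<close> of \<open>G\<close> from the inside out. Here \<open>j = 1\<close>, and
    the second Hopf axiom gives
    \<open>G(\<phi>(c) \<cdot> m) = gal(m)(1 \<otimes> c)\<close>.\<close>
  have Gam: "Gam D z = T.conj_coll T.G z" if z: "z \<in> carrier T.sMA" for z
  proof -
    let ?T = "sigma_AM B S" and ?U = "xtensor K (id_cell A) (M_cell B)" and ?X = "xtensor K (M_cell B) (id_cell A)"
    let ?b1 = "\<lambda>c u v. \<one>\<^bsub>A\<^esub> \<boxtimes>\<^bsub>?T\<^esub> (u \<boxtimes>\<^bsub>?U\<^esub> (v \<boxtimes>\<^bsub>M_cell B\<^esub> c))"
    let ?b2 = "\<lambda>x n c. tlift ?T (?b1 c) (dact x n)"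
    let ?b3 = "\<lambda>x w. tlift ?T (?b2 x) w"
    let ?F = "T.conj_coll T.G"
    note F = T.conj_coll_add_map[OF T.G_add_map]
    have abT: "abelian_group ?T" using kbimod.ab[OF T.kb_sAM] by (simp add: xD)
    have F': "?F \<in> add_map (hcomp (sigma B S) (alg_tensor K A A) ?X) ?T"
      using F unfolding T.sMA_eq by (simp add: xD)
    \<comment> \<open>In the coordinate \<open>CR\<close> the innermost value is
      \<open>S(u) \<cdot> (v \<otimes> c) = \<gamma>(S(u))(v \<otimes> c)\<close>, and the factor
      \<open>1 \<otimes> c\<close> splits off to leave \<open>gal(u \<otimes> v)\<close>.\<close>
    have b1: "?b1 c u v = T.CR.expand (rmult (T.gal (u \<boxtimes>\<^bsub>M\<^esub> v)) \<one>\<^bsub>A\<^esub> c)"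
      if "c \<in> carrier A" "u \<in> carrier A" "v \<in> carrier A" for c u v
      using that T.CR.pure_expand[of "\<one>\<^bsub>A\<^esub>" "v \<boxtimes>\<^bsub>M\<^esub> c" u]
      by (simp add: T.sAM_simps[unfolded xD] xD T.AS.gal_pure ant rmult_rmult dact_pure)
    have t1: "tlift ?T (?b1 c) m = T.CR.expand (rmult (T.gal m) \<one>\<^bsub>A\<^esub> c)"
      if "c \<in> carrier A" "m \<in> carrier M" for c m
    proof (rule M.tlift_eqI[OF abT])
      show "(\<lambda>m. T.CR.expand (rmult (T.gal m) \<one>\<^bsub>A\<^esub> c)) \<in> add_map M ?T"
        using add_map_comp[OF add_map_comp[OF T.AS.gal_add_map rmult_add_map[of "\<one>\<^bsub>A\<^esub>" c]], of "T.CR.expand"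
            "hcomp (sigma B S) (alg_tensor K A A) ?U"] T.CR.expand_add that
        by (simp add: add_map_def T.sAM_simps[unfolded xD] xD)
    qed (use that b1 in auto)
    have t2: "?b2 x n c = ?F (x \<boxtimes>\<^bsub>T.sMA\<^esub> (n \<boxtimes>\<^bsub>?X\<^esub> c))"
      if "x \<in> carrier A" "n \<in> carrier M" "c \<in> carrier A" for x n c
    proof -
      have "T.CL.coll (x \<boxtimes>\<^bsub>T.sMA\<^esub> (n \<boxtimes>\<^bsub>?X\<^esub> c)) = dact (T.\<phi> c) (dact x n)"
        using that by (simp add: T.sMA_eq T.CL.coll_pure dact_mult)
      moreover have "T.G (dact (T.\<phi> c) (dact x n)) = rmult (T.gal (dact x n)) \<one>\<^bsub>A\<^esub> c"
        using that by (simp add: T.G_def j1 dact_one T.AS.gal_dact g2) (simp add: ant xD[symmetric])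
      ultimately show ?thesis using that t1[of c "dact x n"] by (simp add: T.conj_coll_def)
    qed
    have t3: "?b3 x w = ?F (x \<boxtimes>\<^bsub>T.sMA\<^esub> w)" if "x \<in> carrier A" "w \<in> carrier ?X" for x w
    proof (rule H.CL.X.tlift_eqI[OF abT])
      show "(\<lambda>w. ?F (x \<boxtimes>\<^bsub>T.sMA\<^esub> w)) \<in> add_map ?X ?T"
        unfolding T.sMA_eq by (rule add_map_comp[OF T.CL.H.pure_right]) (use that F' in \<open>simp_all add: xD\<close>)
    qed (use that t2 in simp_all)
    have "tlift ?T ?b3 z = ?F z"
    proof (rule T.CL.H.tlift_eqI[OF abT])
      show "?F \<in> add_map (hcomp (sigma B T.\<xi>) (alg_tensor K A A) ?X) ?T" using F' by (simp add: xD)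
      show "z \<in> carrier (hcomp (sigma B T.\<xi>) (alg_tensor K A A) ?X)" using z by (simp add: T.sMA_eq)
    qed (use t3 in \<open>simp add: T.sMA_eq\<close>)
    then show ?thesis by (simp add: D_def star_of_def Let_def)
  qed
  have iso: "Gam D \<in> two_cell_iso (ground_alg K) (AAA B) T.sMA T.sAM"
    by (rule two_cell_iso_cong[OF T.conj_G_iso[OF hopf'] T.kb_sMA Gam])
  have "strong_star_autonomous B D"
    unfolding strong_star_autonomous_iff
  proof (intro conjI iso ballI)
    show "tau_data B D" ..
    show "Gam D (T.comp_left z) = T.comp_right (Gamma0 B T.\<theta> z)" if "z \<in> carrier (sigma0_mL B T.\<theta>)" for z
      using that add_map_closed[OF T.comp_left_add_map that] by (simp add: Gam T.comp_right_Gamma0)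
    show "tau_l B D \<in> two_cell_iso (ground_alg K) (alg_tensor K A (Le B)) T.s0 T.sAE"
      using T.tau_l_two_cell T.tau_l_bij_iff T.left_mult_bij_iff T.j_unit by (simp add: two_cell_iso_def)
  qed
  then show "strong_star_autonomous B (star_of B S)" by (simp add: D_def)
qed

section \<open>Isomorphic structures and equal antipodes\<close>

text \<open>The candidate is forced. A map of right \<open>A\<close>-modules is left multiplication
  by an element \<open>k\<close>, and transport of \<open>\<tau>\<close> at \<open>1\<close>
  requires \<open>k j = j'\<close>; hence \<open>k = j' j\<^sup>-\<^sup>1\<close>.\<close>

lemma star_isomorphicI:
  assumes D: "strong_star_autonomous B D" and D': "strong_star_autonomous B D'"
    and eq: "\<And>a. a \<in> carrier A \<Longrightarrow> antipode_of B D a = antipode_of B D' a"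
  shows "star_isomorphic B D D'"
proof -
  interpret X: tau_unit B D by (rule strong_tau_unit[OF D])
  interpret Y: tau_unit B D' by (rule strong_tau_unit[OF D'])
  note hX = strong_hopf[OF D] and hY = strong_hopf[OF D']
  let ?k = "Y.j \<otimes>\<^bsub>A\<^esub> X.i"
  \<comment> \<open>\<open>i \<phi>(b) j\<close> is the inverse antipode at \<open>b\<close>, hence
    the same for both structures. Conjugating this equality shows that \<open>k\<close> intertwines
    the two maps \<open>\<phi>\<close>, which is linearity of \<open>f\<close> in the second
    factor.\<close>
  have kX: "?k \<otimes>\<^bsub>A\<^esub> X.\<phi> b = Y.\<phi> b \<otimes>\<^bsub>A\<^esub> ?k" if b: "b \<in> carrier A" for b
  proof -
    have "X.S (X.i \<otimes>\<^bsub>A\<^esub> X.\<phi> b \<otimes>\<^bsub>A\<^esub> X.j) = X.S (Y.i \<otimes>\<^bsub>A\<^esub> Y.\<phi> b \<otimes>\<^bsub>A\<^esub> Y.j)"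
      using b X.S_phi[OF b] Y.S_phi[OF b] by (simp add: eq)
    then have e: "X.i \<otimes>\<^bsub>A\<^esub> X.\<phi> b \<otimes>\<^bsub>A\<^esub> X.j = Y.i \<otimes>\<^bsub>A\<^esub> Y.\<phi> b \<otimes>\<^bsub>A\<^esub> Y.j"
      using b X.AS.xi_phi(2) by (metis A.m_closed X.i_closed X.j_closed X.phi_simps'(1) Y.i_closed Y.j_closed Y.phi_simps'(1))
    have "?k \<otimes>\<^bsub>A\<^esub> X.\<phi> b = Y.j \<otimes>\<^bsub>A\<^esub> (X.i \<otimes>\<^bsub>A\<^esub> X.\<phi> b \<otimes>\<^bsub>A\<^esub> X.j) \<otimes>\<^bsub>A\<^esub> X.i"
      using b by (simp add: A.m_assoc)
    also have "\<dots> = Y.\<phi> b \<otimes>\<^bsub>A\<^esub> ?k" unfolding e using b by (simp add: A.m_assoc)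
    finally show ?thesis .
  qed
  have kxi: "Y.\<xi> ?k = Y.q \<otimes>\<^bsub>A\<^esub> X.q'"
  proof -
    have "X.S X.i = X.q'" by (simp add: X.S_eq)
    then show ?thesis by (simp add: Y.xi_j eq[symmetric])
  qed
  define f where "f = (\<lambda>x. ?k \<otimes>\<^bsub>A\<^esub> x)"
  have f_add: "f \<in> add_map A A" by (auto intro!: add_mapI simp: f_def A.r_distr)
  have f_ract: "f (ract (sigma B X.\<xi>) x w) = ract (sigma B Y.\<xi>) (f x) w"
    if x: "x \<in> carrier A" and w: "w \<in> carrier (alg_tensor K A A)" for x w
    using w
  proof (induction rule: AA.tensor_induct)
    case (pure a b)
    have "?k \<otimes>\<^bsub>A\<^esub> (X.\<phi> b \<otimes>\<^bsub>A\<^esub> x \<otimes>\<^bsub>A\<^esub> a) = (?k \<otimes>\<^bsub>A\<^esub> X.\<phi> b) \<otimes>\<^bsub>A\<^esub> x \<otimes>\<^bsub>A\<^esub> a"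
      using pure x by (simp add: A.m_assoc)
    also have "\<dots> = Y.\<phi> b \<otimes>\<^bsub>A\<^esub> (?k \<otimes>\<^bsub>A\<^esub> x) \<otimes>\<^bsub>A\<^esub> a"
      unfolding kX[OF pure(2)] using pure x by (simp add: A.m_assoc)
    finally show ?case using pure x by (simp add: f_def X.ract_sigma Y.ract_sigma)
  next
    case (add v w)
    have fx: "f x \<in> carrier A" using x by (simp add: f_def)
    show ?case
      using add add_map_closed[OF X.ract_sigma(1)[OF x]] add_map_closed[OF Y.ract_sigma(1)[OF fx]]
      by (simp add: add_map_add[OF X.ract_sigma(1)[OF x]] add_map_add[OF Y.ract_sigma(1)[OF fx]] add_map_add[OF f_add])
  qed
  have fc: "f \<in> two_cell_iso (ground_alg K) (AxA B) (sigma B X.\<xi>) (sigma B Y.\<xi>)"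
  proof -
    have "f \<in> two_cell (ground_alg K) (AxA B) (sigma B X.\<xi>) (sigma B Y.\<xi>)"
      unfolding AxA_def
      by (rule two_cell_groundI[OF X.Sg.kb_sig Y.Sg.kb_sig])
        (use f_add f_ract in \<open>simp_all add: add_map_def\<close>)
    moreover have "bij_betw f (carrier A) (carrier A)"
      by (rule bij_betw_byWitness[where f' = "\<lambda>x. X.j \<otimes>\<^bsub>A\<^esub> Y.i \<otimes>\<^bsub>A\<^esub> x"])
        (auto simp: f_def A.m_assoc)
    ultimately show ?thesis by (simp add: two_cell_iso_def)
  qed
  have tm_MA: "tensor_map (sigma B X.\<xi>) (xtensor K (M_cell B) (id_cell A)) (carrier (alg_tensor K A A))
      (ract (sigma B X.\<xi>)) (lact (xtensor K (M_cell B) (id_cell A))) X.sMA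
      (sigma B Y.\<xi>) (xtensor K (M_cell B) (id_cell A)) (carrier (alg_tensor K A A))
      (ract (sigma B Y.\<xi>)) (lact (xtensor K (M_cell B) (id_cell A))) Y.sMA f (\<lambda>n. n)"
    unfolding X.sMA_eq Y.sMA_eq
    by (rule whisker_map[where h = "\<lambda>d. d", OF X.CL.H.hcomp_pair_axioms Y.CL.H.hcomp_pair_axioms])
      (use f_add f_ract in \<open>simp_all add: add_map_def\<close>)
  have tm_AM: "tensor_map (sigma B X.\<xi>) (xtensor K (id_cell A) (M_cell B)) (carrier (alg_tensor K A A))
      (ract (sigma B X.\<xi>)) (lact (xtensor K (id_cell A) (M_cell B))) X.sAM
      (sigma B Y.\<xi>) (xtensor K (id_cell A) (M_cell B)) (carrier (alg_tensor K A A))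
      (ract (sigma B Y.\<xi>)) (lact (xtensor K (id_cell A) (M_cell B))) Y.sAM f (\<lambda>n. n)"
  proof (intro tensor_map.intro X.tensor_product_sAM Y.tensor_product_sAM tensor_map_axioms.intro add_map_ident)
    show "f \<in> add_map (sigma B X.\<xi>) (sigma B Y.\<xi>)" using f_add by (simp add: add_map_def)
    interpret T: tensor_product "sigma B Y.\<xi>" "xtensor K (id_cell A) (M_cell B)" "carrier (alg_tensor K A A)"
      "ract (sigma B Y.\<xi>)" "lact (xtensor K (id_cell A) (M_cell B))" Y.sAM by (rule Y.tensor_product_sAM)
    show "f (ract (sigma B X.\<xi>) x r) \<boxtimes>\<^bsub>Y.sAM\<^esub> y = f x \<boxtimes>\<^bsub>Y.sAM\<^esub> lact (xtensor K (id_cell A) (M_cell B)) r y"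
      if "x \<in> carrier (sigma B X.\<xi>)" "r \<in> carrier (alg_tensor K A A)" "y \<in> carrier (xtensor K (id_cell A) (M_cell B))" for x r y
      using that add_map_closed[OF f_add] by (simp add: f_ract T.pure_balanced)
  qed
  have f1: "f \<one>\<^bsub>A\<^esub> = ?k" by (simp add: f_def)
  have mapMA: "tmap Y.sMA f (\<lambda>n. n) (X.CL.expand m) = ?k \<boxtimes>\<^bsub>Y.sMA\<^esub> (m \<boxtimes>\<^bsub>xtensor K (M_cell B) (id_cell A)\<^esub> \<one>\<^bsub>A\<^esub>)"
    if "m \<in> carrier M" for m
    using tensor_map.pure[OF tm_MA, of "\<one>\<^bsub>A\<^esub>" "m \<boxtimes>\<^bsub>xtensor K (M_cell B) (id_cell A)\<^esub> \<one>\<^bsub>A\<^esub>"]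
      X.CL.X.pure_closed[of m "\<one>\<^bsub>A\<^esub>"] that
    by (simp add: X.CL.expand_def X.sMA_eq f1)
  have mapAM: "tmap Y.sAM f (\<lambda>n. n) (X.CR.expand m) = Y.CR.expand (dact (Y.q \<otimes>\<^bsub>A\<^esub> X.q') m)"
    if "m \<in> carrier M" for m
    using tensor_map.pure[OF tm_AM, of "\<one>\<^bsub>A\<^esub>" "\<one>\<^bsub>A\<^esub> \<boxtimes>\<^bsub>xtensor K (id_cell A) (M_cell B)\<^esub> m"]
      X.CR.X.pure_closed[of "\<one>\<^bsub>A\<^esub>" m] Y.CR.pure_expand[of ?k m "\<one>\<^bsub>A\<^esub>"] that
    by (simp add: X.CR.expand_def X.sAM_simps Y.sAM_simps f1 kxi)
  have gal: "Y.gal m = X.gal m" if "m \<in> carrier M" for m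
    by (rule gal_cong[OF X.AS.antipode_like_axioms Y.AS.antipode_like_axioms _ that]) (simp add: eq)
  have gY: "Y.gal (\<gamma> a) = \<one>\<^bsub>A\<^esub> \<boxtimes>\<^bsub>M\<^esub> Y.S a" if "a \<in> carrier A" for a
    using hY that Y.AS.hopf_algebroid_iff by auto
  have "Y.S ?k = X.q' \<otimes>\<^bsub>A\<^esub> Y.q"
  proof -
    have "Y.S X.i = X.q'" by (simp add: eq[symmetric] X.S_eq)
    moreover have "Y.S Y.j = Y.q" by (simp add: Y.S_eq A.m_assoc)
    ultimately show ?thesis by (simp add: Y.AS.xi_mult)
  qed
  then have galk: "Y.gal (dact ?k m) = rmult (X.gal m) \<one>\<^bsub>A\<^esub> (X.q' \<otimes>\<^bsub>A\<^esub> Y.q)" if "m \<in> carrier M" for m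
    using Y.AS.gal_dact[OF that _ gY, of ?k] that by (simp add: gal[OF that])
  \<comment> \<open>In coordinates \<open>f\<close> acts by \<open>k\<close> on the source of
    \<open>\<Gamma>\<close> and by \<open>Y.\<xi>(k) = Y.q X.q'\<close> on the target. The right
    factors agree, as \<open>X.q' Y.q Y.q' = X.q'\<close>; the left factors agree, as
    \<open>Y.q = Y.q X.q' X.q\<close>.\<close>
  have key: "Y.G (dact ?k m) = dact (Y.q \<otimes>\<^bsub>A\<^esub> X.q') (X.G m)" if "m \<in> carrier M" for m
    using that Y.G_hopf[OF hY, of "dact ?k m"]
    by (simp add: X.G_hopf[OF hX] galk rmult_rmult A.m_assoc dact_mult[symmetric])
  have Gam: "Gam D' (tmap (sigma_MA B Y.\<xi>) f (\<lambda>n. n) z) = tmap (sigma_AM B Y.\<xi>) f (\<lambda>n. n) (Gam D z)"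
    if z: "z \<in> carrier X.sMA" for z
  proof -
    define m where "m = X.CL.coll z"
    have m: "m \<in> carrier M" "z = X.CL.expand m"
      using z add_map_closed[OF X.CL.coll_add, of z] X.CL.expand_coll by (simp_all add: m_def X.sMA_eq)
    have "Gam D' (tmap Y.sMA f (\<lambda>n. n) z) = Y.conj_coll Y.G (tmap Y.sMA f (\<lambda>n. n) z)"
      by (rule strong_Gam[OF D' add_map_closed[OF tensor_map.add_map[OF tm_MA] z]])
    also have "\<dots> = Y.CR.expand (Y.G (dact ?k m))"
      using m(1) unfolding m(2) mapMA[OF m(1)] Y.conj_coll_def by (simp add: Y.sMA_eq Y.CL.coll_pure)
    also have "\<dots> = tmap Y.sAM f (\<lambda>n. n) (X.conj_coll X.G z)"
      using m(1) add_map_closed[OF X.G_add_map m(1)] unfolding m(2)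
      by (simp add: X.conj_coll_def X.CL.coll_expand key mapAM)
    also have "X.conj_coll X.G z = Gam D z" by (rule strong_Gam[OF D z, symmetric])
    finally show ?thesis .
  qed
  \<comment> \<open>\<open>S(s(l)) = t(\<theta>(l))\<close> recovers \<open>\<theta>\<close> from
    the antipode, because \<open>\<pi>\<close> retracts \<open>t\<close>.\<close>
  have th: "X.\<theta> l = Y.\<theta> l" if "l \<in> carrier L" for l
    using that X.S_src[OF that] Y.S_src[OF that] cou_t[of "X.\<theta> l"] cou_t[of "Y.\<theta> l"] by (simp add: eq)
  have tau: "tau D' e = f (tau D e)" if "e \<in> carrier (Le B)" for e
    using that by (simp add: X.tau_eta Y.tau_eta f_def A.m_assoc)
  show ?thesis
    unfolding star_isomorphic_def using th fc tau Gam by blast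
qed

text \<open>\<open>S(a)\<close> is the element \<open>b\<close> with
  \<open>\<phi>(b) j = j a\<close>. An isomorphism is linear and carries \<open>j\<close> to
  \<open>j'\<close>, so it transports this equation to the second structure with the same
  \<open>a\<close> and \<open>b\<close>.\<close>

lemma antipode_of_isomorphic:
  assumes D: "tau_unit B D" and D': "tau_unit B D'" and iso: "star_isomorphic B D D'" and a: "a \<in> carrier A"
  shows "antipode_of B D a = antipode_of B D' a"
proof -
  interpret X: tau_unit B D by (rule D)
  interpret Y: tau_unit B D' by (rule D')
  obtain f where f: "f \<in> two_cell_iso (ground_alg K) (AxA B) (sigma B X.\<xi>) (sigma B Y.\<xi>)"
    and ft: "\<And>e. e \<in> carrier (Le B) \<Longrightarrow> tau D' e = f (tau D e)"
    using iso unfolding star_isomorphic_def by blast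
  have fc: "f x \<in> carrier A" if "x \<in> carrier A" for x
    using f that by (auto simp: two_cell_iso_def two_cell_def)
  have fr: "f (X.\<phi> b \<otimes>\<^bsub>A\<^esub> x \<otimes>\<^bsub>A\<^esub> c) = Y.\<phi> b \<otimes>\<^bsub>A\<^esub> f x \<otimes>\<^bsub>A\<^esub> c"
    if "b \<in> carrier A" "x \<in> carrier A" "c \<in> carrier A" for b x c
  proof -
    have "f (ract (sigma B X.\<xi>) x (c \<boxtimes>\<^bsub>alg_tensor K A A\<^esub> b)) = ract (sigma B Y.\<xi>) (f x) (c \<boxtimes>\<^bsub>alg_tensor K A A\<^esub> b)"
      using f that AA.pure_closed[of c b] by (simp add: two_cell_iso_def two_cell_def AxA_def)
    then show ?thesis using that fc by (simp add: X.ract_sigma Y.ract_sigma)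
  qed
  let ?b = "X.S a"
  have "Y.\<phi> ?b \<otimes>\<^bsub>A\<^esub> Y.j = Y.\<phi> ?b \<otimes>\<^bsub>A\<^esub> f X.j \<otimes>\<^bsub>A\<^esub> \<one>\<^bsub>A\<^esub>"
    using ft[of "\<one>\<^bsub>Le B\<^esub>"] a fc by (simp add: X.j_def Y.j_def)
  also have "\<dots> = f (X.\<phi> ?b \<otimes>\<^bsub>A\<^esub> X.j \<otimes>\<^bsub>A\<^esub> \<one>\<^bsub>A\<^esub>)" by (rule fr[symmetric]) (use a in simp_all)
  also have "X.\<phi> ?b \<otimes>\<^bsub>A\<^esub> X.j \<otimes>\<^bsub>A\<^esub> \<one>\<^bsub>A\<^esub> = X.\<phi> \<one>\<^bsub>A\<^esub> \<otimes>\<^bsub>A\<^esub> X.j \<otimes>\<^bsub>A\<^esub> a"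
    using a by (simp add: X.S_eq A.m_assoc)
  also have "f (X.\<phi> \<one>\<^bsub>A\<^esub> \<otimes>\<^bsub>A\<^esub> X.j \<otimes>\<^bsub>A\<^esub> a) = Y.j \<otimes>\<^bsub>A\<^esub> a"
    using ft[of "\<one>\<^bsub>Le B\<^esub>"] a fc by (simp add: fr del: X.phi_simps'(2)) (simp add: X.j_def Y.j_def)
  finally have "Y.\<phi> ?b \<otimes>\<^bsub>A\<^esub> Y.j \<otimes>\<^bsub>A\<^esub> Y.i = Y.j \<otimes>\<^bsub>A\<^esub> a \<otimes>\<^bsub>A\<^esub> Y.i" by simp
  then have "Y.\<phi> ?b = Y.j \<otimes>\<^bsub>A\<^esub> a \<otimes>\<^bsub>A\<^esub> Y.i" using a by (simp add: A.m_assoc)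
  then have "Y.\<xi> (Y.\<phi> ?b) = Y.S a" by (simp add: Y.S_eq)
  then show ?thesis using a by simp
qed

end

text \<open>\<open>star_of\<close> always takes \<open>\<tau> = \<eta>\<close>, hence
  \<open>j = 1\<close>. A structure with a different \<open>j\<close> is therefore recovered only up
  to isomorphism, whereas the antipode is recovered exactly on the carrier.\<close>

theorem theorem4p7:
  fixes B :: "('k, 'a, 'l) bialgebroid"
  assumes "left_bialgebroid B"
  shows
    "(\<forall>D. strong_star_autonomous B D \<longrightarrow> hopf_algebroid B (antipode_of B D)) \<and>
     (\<forall>S. hopf_algebroid B S \<longrightarrow> strong_star_autonomous B (star_of B S)) \<and>
     (\<forall>S. hopf_algebroid B S \<longrightarrow>
        (\<forall>a\<in>carrier (total B). antipode_of B (star_of B S) a = S a)) \<and>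
     (\<forall>D. strong_star_autonomous B D \<longrightarrow>
        star_isomorphic B D (star_of B (antipode_of B D))) \<and>
     (\<forall>D D'. strong_star_autonomous B D \<longrightarrow> strong_star_autonomous B D' \<longrightarrow>
        (star_isomorphic B D D' \<longleftrightarrow>
          (\<forall>a\<in>carrier (total B). antipode_of B D a = antipode_of B D' a)))"
proof -
  interpret left_bialgebroid_loc B by unfold_locales (rule assms)
  show ?thesis
  proof (intro conjI allI impI ballI iffI)
    fix D assume D: "strong_star_autonomous B D"
    show hopf: "hopf_algebroid B (antipode_of B D)" by (rule strong_hopf[OF D])
    show "star_isomorphic B D (star_of B (antipode_of B D))"
      by (rule star_isomorphicI[OF D strong_star_of[OF hopf]])
        (simp add: antipode_of_star_of[OF hopf])
  next
    fix D D' assume D: "strong_star_autonomous B D" and D': "strong_star_autonomous B D'"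
    show "star_isomorphic B D D'" if "\<forall>a\<in>carrier A. antipode_of B D a = antipode_of B D' a"
      by (rule star_isomorphicI[OF D D']) (use that in blast)
    show "antipode_of B D a = antipode_of B D' a" if "star_isomorphic B D D'" "a \<in> carrier A" for a
      by (rule antipode_of_isomorphic[OF strong_tau_unit[OF D] strong_tau_unit[OF D'] that])
  qed (rule strong_star_of antipode_of_star_of; assumption)+
qed

end
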